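(* Let $\mathcal V=(V,\eta,\xi)$ be a right cyclic polarized arrangement of $n$ hyperplanes in $k$-space. The maps $\Phi:\mathcal B_r(n,k)\to\tilde B(\mathcal V)$ and $\Psi:\tilde B(\mathcal V)\to\mathcal B_r(n,k)$ defined in the context are well defined and are mutually inverse isomorphisms of multi-graded $\mathbb Z$-algebras (gradings by $\mathbb Z\langle e_1,\dots,e_n\rangle$), and they intertwine the anti-involution $\psi_{OSz}$ of $\mathcal B_r(n,k)$ with the anti-involution $\psi^{\mathcal V}$ of $\tilde B(\mathcal V)$.
   Context: **Arrangements.** An arrangement of $n$ hyperplanes in $k$-space is a pair $(V,\eta)$ with $V\subset\mathbb R^n$ a linear subspace of dimension $k$ and $\eta\in\mathbb R^n/V$ such that every representative of $\eta$ has at least $n-k$ nonzero entries. View $V+\eta$ as an affine subspace of $\mathbb R^n$; $H_i=\{x\in V+\eta: x_i=0\}$, $H_S=\bigcap_{i\in S}H_i$, and for $\alpha\in\{+,-\}^n$, $\Delta_\alpha=\{x\in V+\eta:\alpha(i)x_i\ge0\ \forall i\}$. A polarized arrangement is $(V,\eta,\xi)$ with also $\xi\in V^*=(\mathbb R^n)^*/V^\perp$, every representative of $\xi$ having at least $k$ nonzero entries. $\alpha$ is feasible if $\Delta_\alpha\ne\emptyset$, bounded if an affine function on $V+\eta$ with linear part $\xi$ is bounded above on $\Delta_\alpha$; $\mathcal P$ is the set of bounded feasible $\alpha$. **Right cyclic.** $\mathrm{Gr}^{>0}_{k,n}$: $k$-dimensional subspaces of $\mathbb R^n$ with all Plücker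 coordinates nonzero and of the same sign. $(V,\eta,\xi)$ is right cyclic if $V+\langle\eta\rangle\in\mathrm{Gr}^{>0}_{k+1,n}$, $\{(v,(-1)^k\xi(v)):v\in V\}\in\mathrm{Gr}^{>0}_{k,n+1}$, and the first coordinate of the orthogonal projection of a representative of $\eta$ onto $V^\perp$ is positive. **$\tilde B(\mathcal V)$.** For $\alpha,\beta\in\mathcal P$, $\tilde R_{\alpha\beta}=\mathbb Z[u_1,\dots,u_n]/(u_S:\Delta_\alpha\cap\Delta_\beta\cap H_S=\emptyset)$, $u_S=\prod_{i\in S}u_i$, and $f_{\alpha,\beta}$ is the class of $1$. $\tilde B(\mathcal V)=\bigoplus_{\alpha,\beta\in\mathcal P}\tilde R_{\alpha\beta}$ with $\mathbb Z[u_1,\dots,u_n]$-bilinear product $f_{\alpha,\beta}f_{\beta,\gamma}=u_{S(\alpha\beta\gamma)}f_{\alpha,\gamma}$, $S(\alpha\beta\gamma)=\{i:\alpha(i)=\gamma(i)\ne\beta(i)\}$ (other products $0$). Multi-degree: $\deg u_i=2e_i$, $\deg f_{\alpha,\beta}=\sum_{i:\alpha(i)\ne\beta(i)}e_i$. $\psi^{\mathcal V}$ is the anti-automorphism given by the identity maps $\tilde R_{\alpha\beta}\to\tilde R_{\beta\alpha}$. **Quiver description of $\tilde B(\mathcal V)$ for right cyclic $\mathcal V$.** Put $\mathrm{var}_r(\alpha)=$ number of sign changes in the sequence $\alpha(-1)^k$ (the sign $(-1)^k$ appended to $\alpha$); $\mathcal P=\{\alpha:\mathrm{var}_r(\alpha)=k\}$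 and $\alpha$ is bounded iff $\mathrm{var}_r(\alpha)\ge k$. Write $\alpha\leftrightarrow\beta$ if $\alpha,\beta$ differ in exactly one entry, and $\beta=\alpha^i$ if they differ only in entry $i$. Let $Q$ be the quiver with vertices all $\alpha$ with $\mathrm{var}_r(\alpha)\ge k$ and arrows $p(\alpha,\beta)$ from $\alpha$ to $\beta$ when $\alpha\leftrightarrow\beta$. Then $\tilde B(\mathcal V)$ is $P(Q)\otimes_{\mathbb Z}\mathbb Z[u_1,\dots,u_n]$ modulo: $e_\alpha=0$ if $\mathrm{var}_r(\alpha)>k$; $p(\alpha,\beta)p(\beta,\gamma)=p(\alpha,\delta)p(\delta,\gamma)$ for distinct vertices $\alpha\leftrightarrow\beta\leftrightarrow\gamma\leftrightarrow\delta\leftrightarrow\alpha$; $p(\alpha,\beta)p(\beta,\alpha)=u_ie_\alpha$ if $\beta=\alpha^i$. For $\alpha,\beta\in\mathcal P$, $e_\alpha$ corresponds to $f_{\alpha,\alpha}$ and $p(\alpha,\beta)$ to $f_{\alpha,\beta}$. **Ozsváth–Szabó algebra.** $V(n,k)$ is the set of $k$-element subsets of $\{0,\dots,n\}$. $\mathcal B(n,k)$ is the path algebra over $\mathbb Z$ (paths composed left to right) of the quiver with vertex set $V(n,k)$ and arrows: for $1\le i\le n$, $R_i:\mathbf x\to\mathbf y$ and $L_i:\mathbf y\to\mathbf x$ whenever $\mathbf x\cap\{i-1,i\}=\{i-1\}$ and $\mathbf y=(\mathbf x\setminus\{i-1\})\cup\{i\}$; $U_i:\mathbf x\to\mathbf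 x$ for all $\mathbf x$; modulo (whenever the paths make sense) $R_iU_j=U_jR_i$, $L_iU_j=U_jL_i$, $U_iU_j=U_jU_i$; $R_iL_i=U_i$, $L_iR_i=U_i$; $R_iR_j=R_jR_i$, $L_iL_j=L_jL_i$, $L_iR_j=R_jL_i$ for $|i-j|>1$; $R_{i-1}R_i=0$, $L_iL_{i-1}=0$; $U_i\mathbf I_{\mathbf x}=0$ if $\mathbf x\cap\{i-1,i\}=\emptyset$ ($\mathbf I_{\mathbf x}$ = trivial path). Multi-degree: $\deg R_i=\deg L_i=e_i$, $\deg U_i=2e_i$. With $V_r(n,k)$ the set of $k$-element subsets of $\{1,\dots,n\}$, $\mathcal B_r(n,k)=\bigoplus_{\mathbf x,\mathbf x'\in V_r(n,k)}\mathbf I_{\mathbf x}\mathcal B(n,k)\mathbf I_{\mathbf x'}$; it is generated by the $\mathbf I_{\mathbf x}$ and the arrows $R_i,L_i,U_i$ between vertices in $V_r(n,k)$. $\psi_{OSz}$ is the anti-automorphism fixing each $\mathbf I_{\mathbf x}$ with $R_i\mapsto L_i$, $L_i\mapsto R_i$, $U_i\mapsto U_i$. **Bijection.** $\mathcal P\to V_r(n,k)$, $\alpha\mapsto\mathbf x_\alpha=\{i\in\{1,\dots,n\}:\alpha(i)\ne\alpha(i+1)\}$ with the convention $\alpha(n+1)=(-1)^k$; the inverse is written $\mathbf x\mapsto\alpha_{\mathbf x}$. **Maps.** $\Phi$ sends $\mathbf I_{\mathbf x}\mapsto e_{\alpha_{\mathbf x}}$; each arrow $R_i$ or $L_i$ from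 $\mathbf x$ to $\mathbf y$ to $p(\alpha_{\mathbf x},\alpha_{\mathbf y})$; each arrow $U_i:\mathbf x\to\mathbf x$ to $u_ie_{\alpha_{\mathbf x}}$. $\Psi$ sends $e_\alpha\mapsto\mathbf I_{\mathbf x_\alpha}$ if $\mathrm{var}_r(\alpha)=k$ and $e_\alpha\mapsto0$ (hence arrows at $\alpha$ to $0$) if $\mathrm{var}_r(\alpha)>k$; for $\alpha,\beta\in\mathcal P$ with $\beta=\alpha^i$, $p(\alpha,\beta)\mapsto(R_i:\mathbf x_\alpha\to\mathbf x_\beta)$ if $\mathbf x_\beta=(\mathbf x_\alpha\setminus\{i-1\})\cup\{i\}$, and $p(\alpha,\beta)\mapsto(L_i:\mathbf x_\alpha\to\mathbf x_\beta)$ if $\mathbf x_\beta=(\mathbf x_\alpha\setminus\{i\})\cup\{i-1\}$; $u_i\mapsto\sum_{\mathbf x\in V_r(n,k)}U_i\mathbf I_{\mathbf x}$. *)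

theory Defs
  imports
    "Jordan_Normal_Form.VS_Connect"
    "Jordan_Normal_Form.DL_Submatrix"
    "Graph_Theory.Arc_Walk"
    "HOL-Library.Poly_Mapping"
    "HOL-Algebra.QuotRing"
begin

section \<open>Polarized arrangements\<close>

text \<open>Hyperplanes are numbered \<open>1, \<dots>, n\<close>, whereas library vectors are indexed from 0.\<close>

definition coord :: "real vec \<Rightarrow> nat \<Rightarrow> real" where
  "coord x i = x $ (i - 1)"

definition linear_subspace :: "nat \<Rightarrow> nat \<Rightarrow> real vec set \<Rightarrow> bool" where
  "linear_subspace n k V \<longleftrightarrow>
     VectorSpace.subspace class_ring V (module_vec TYPE(real) n) \<and>
     vectorspace.dim class_ring ((module_vec TYPE(real) n)\<lparr>carrier := V\<rparr>) = k"

text \<open>Cosets are represented as sets of vectors, so the coset \<open>\<eta>\<close> of \<open>V\<close> is itself the affine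
  space \<open>V + \<eta>\<close>, and its elements are the representatives of \<open>\<eta>\<close>. Linear forms on \<open>\<real>\<^sup>n\<close> are
  identified with vectors through the standard scalar product, so that the annihilator of \<open>V\<close> is
  its orthogonal complement and an element of \<open>V\<^sup>*\<close> is a coset \<open>\<xi>\<close> of that complement.\<close>

definition is_coset :: "nat \<Rightarrow> real vec set \<Rightarrow> real vec set \<Rightarrow> bool" where
  "is_coset n W C \<longleftrightarrow> (\<exists>h \<in> carrier_vec n. C = (\<lambda>w. h + w) ` W)"

abbreviation perp :: "nat \<Rightarrow> real vec set \<Rightarrow> real vec set" where
  "perp n V \<equiv> vec_module.orthogonal_complement n V"

definition num_nonzero :: "nat \<Rightarrow> real vec \<Rightarrow> nat" where
  "num_nonzero n x = card {i \<in> {1..n}. coord x i \<noteq> 0}"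

definition polarized_arrangement ::
    "nat \<Rightarrow> nat \<Rightarrow> real vec set \<Rightarrow> real vec set \<Rightarrow> real vec set \<Rightarrow> bool" where
  "polarized_arrangement n k V \<eta> \<xi> \<longleftrightarrow>
     linear_subspace n k V \<and>
     is_coset n V \<eta> \<and> (\<forall>h \<in> \<eta>. n - k \<le> num_nonzero n h) \<and>
     is_coset n (perp n V) \<xi> \<and> (\<forall>c \<in> \<xi>. k \<le> num_nonzero n c)"

definition hyperplane_int :: "real vec set \<Rightarrow> nat set \<Rightarrow> real vec set" where
  "hyperplane_int \<eta> S = {x \<in> \<eta>. \<forall>i \<in> S. coord x i = 0}"

definition sign_vectors :: "nat \<Rightarrow> (nat \<Rightarrow> int) set" where
  "sign_vectors n = {1..n} \<rightarrow>\<^sub>E {-1, 1}"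

definition chamber :: "nat \<Rightarrow> real vec set \<Rightarrow> (nat \<Rightarrow> int) \<Rightarrow> real vec set" where
  "chamber n \<eta> \<alpha> = {x \<in> \<eta>. \<forall>i \<in> {1..n}. real_of_int (\<alpha> i) * coord x i \<ge> 0}"

definition feasible :: "nat \<Rightarrow> real vec set \<Rightarrow> (nat \<Rightarrow> int) \<Rightarrow> bool" where
  "feasible n \<eta> \<alpha> \<longleftrightarrow> chamber n \<eta> \<alpha> \<noteq> {}"

text \<open>Affine functions on \<open>V + \<eta>\<close> with linear part \<open>\<xi>\<close> differ by constants, so it does not matter
  which one is tested.\<close>

definition bounded_sign ::
    "nat \<Rightarrow> real vec set \<Rightarrow> real vec set \<Rightarrow> (nat \<Rightarrow> int) \<Rightarrow> bool" where
  "bounded_sign n \<eta> \<xi> \<alpha> \<longleftrightarrow> (\<exists>c \<in> \<xi>. bdd_above ((\<lambda>x. c \<bullet> x) ` chamber n \<eta> \<alpha>))"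

definition bounded_feasible :: "nat \<Rightarrow> real vec set \<Rightarrow> real vec set \<Rightarrow> (nat \<Rightarrow> int) set" where
  "bounded_feasible n \<eta> \<xi> = {\<alpha> \<in> sign_vectors n. feasible n \<eta> \<alpha> \<and> bounded_sign n \<eta> \<xi> \<alpha>}"


section \<open>Right cyclic arrangements\<close>

definition gr_pos :: "nat \<Rightarrow> nat \<Rightarrow> real vec set \<Rightarrow> bool" where
  "gr_pos k n V \<longleftrightarrow> linear_subspace n k V \<and>
     (\<exists>M \<in> carrier_mat k n. vec_space.row_space n M = V \<and>
        ((\<forall>J \<subseteq> {0..<n}. card J = k \<longrightarrow> det (submatrix M UNIV J) > 0) \<or>
         (\<forall>J \<subseteq> {0..<n}. card J = k \<longrightarrow> det (submatrix M UNIV J) < 0)))"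

definition right_cyclic ::
    "nat \<Rightarrow> nat \<Rightarrow> real vec set \<Rightarrow> real vec set \<Rightarrow> real vec set \<Rightarrow> bool" where
  "right_cyclic n k V \<eta> \<xi> \<longleftrightarrow>
     polarized_arrangement n k V \<eta> \<xi> \<and>
     gr_pos (k + 1) n {v + t \<cdot>\<^sub>v h | v t h. v \<in> V \<and> h \<in> \<eta>} \<and>
     gr_pos k (n + 1) {v @\<^sub>v vec 1 (\<lambda>_. (-1) ^ k * (c \<bullet> v)) | v c. v \<in> V \<and> c \<in> \<xi>} \<and>
     (\<exists>h \<in> \<eta>. \<exists>w \<in> perp n V. h - w \<in> V \<and> coord w 1 > 0)"


section \<open>The convolution algebra of a polarized arrangement\<close>

text \<open>The ring \<open>\<int>[u\<^sub>1, \<dots>, u\<^sub>n]\<close>, with monomials encoded by their exponents.\<close>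

type_synonym upoly = "(nat \<Rightarrow>\<^sub>0 nat) \<Rightarrow>\<^sub>0 int"

definition upoly_ring :: "nat \<Rightarrow> upoly ring" where
  "upoly_ring n = \<lparr>carrier = {p. \<forall>m \<in> Poly_Mapping.keys p. Poly_Mapping.keys m \<subseteq> {1..n}},
     monoid.mult = (*), one = 1, zero = 0, add = (+)\<rparr>"

definition uvar :: "nat \<Rightarrow> upoly" where
  "uvar i = Poly_Mapping.single (Poly_Mapping.single i 1) 1"

definition umon :: "nat set \<Rightarrow> upoly" where
  "umon S = (\<Prod>i\<in>S. uvar i)"

definition R_ideal :: "nat \<Rightarrow> real vec set \<Rightarrow> (nat \<Rightarrow> int) \<Rightarrow> (nat \<Rightarrow> int) \<Rightarrow> upoly set" where
  "R_ideal n \<eta> \<alpha> \<beta> = genideal (upoly_ring n)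
     {umon S | S. S \<subseteq> {1..n} \<and> chamber n \<eta> \<alpha> \<inter> chamber n \<eta> \<beta> \<inter> hyperplane_int \<eta> S = {}}"

definition R_ring :: "nat \<Rightarrow> real vec set \<Rightarrow> (nat \<Rightarrow> int) \<Rightarrow> (nat \<Rightarrow> int) \<Rightarrow> upoly set ring" where
  "R_ring n \<eta> \<alpha> \<beta> = upoly_ring n Quot R_ideal n \<eta> \<alpha> \<beta>"

definition R_class ::
    "nat \<Rightarrow> real vec set \<Rightarrow> (nat \<Rightarrow> int) \<Rightarrow> (nat \<Rightarrow> int) \<Rightarrow> upoly \<Rightarrow> upoly set" where
  "R_class n \<eta> \<alpha> \<beta> p = R_ideal n \<eta> \<alpha> \<beta> +>\<^bsub>upoly_ring n\<^esub> p"

definition S_set :: "nat \<Rightarrow> (nat \<Rightarrow> int) \<Rightarrow> (nat \<Rightarrow> int) \<Rightarrow> (nat \<Rightarrow> int) \<Rightarrow> nat set" where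
  "S_set n \<alpha> \<beta> \<gamma> = {i \<in> {1..n}. \<alpha> i = \<gamma> i \<and> \<gamma> i \<noteq> \<beta> i}"

text \<open>The product of classes in the summands at \<open>(\<alpha>, \<beta>)\<close> and \<open>(\<beta>, \<gamma>)\<close>, a class in the summand
  at \<open>(\<alpha>, \<gamma>)\<close>; compare the library's product of cosets \<^const>\<open>rcoset_mult\<close>.\<close>

definition R_conv :: "nat \<Rightarrow> real vec set \<Rightarrow> (nat \<Rightarrow> int) \<Rightarrow> (nat \<Rightarrow> int) \<Rightarrow> (nat \<Rightarrow> int) \<Rightarrow>
    upoly set \<Rightarrow> upoly set \<Rightarrow> upoly set" where
  "R_conv n \<eta> \<alpha> \<beta> \<gamma> A B =
     (\<Union>p\<in>A. \<Union>q\<in>B. R_class n \<eta> \<alpha> \<gamma> (p * q * umon (S_set n \<alpha> \<beta> \<gamma>)))"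

type_synonym bt_elem = "(nat \<Rightarrow> int) \<times> (nat \<Rightarrow> int) \<Rightarrow> upoly set"

text \<open>There are finitely many pairs \<open>(\<alpha>, \<beta>)\<close>, so the direct sum of the \<open>R_ring n \<eta> \<alpha> \<beta>\<close> is their
  product.\<close>

definition B_tilde :: "nat \<Rightarrow> real vec set \<Rightarrow> real vec set \<Rightarrow> bt_elem ring" where
  "B_tilde n \<eta> \<xi> = (let P = bounded_feasible n \<eta> \<xi> in
     \<lparr>carrier = (\<Pi>\<^sub>E (\<alpha>, \<beta>) \<in> P \<times> P. carrier (R_ring n \<eta> \<alpha> \<beta>)),
      monoid.mult = (\<lambda>F G. \<lambda>(\<alpha>, \<gamma>) \<in> P \<times> P.
         \<Oplus>\<^bsub>R_ring n \<eta> \<alpha> \<gamma>\<^esub> \<beta> \<in> P. R_conv n \<eta> \<alpha> \<beta> \<gamma> (F (\<alpha>, \<beta>)) (G (\<beta>, \<gamma>))),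
      one = (\<lambda>(\<alpha>, \<beta>) \<in> P \<times> P. R_class n \<eta> \<alpha> \<beta> (if \<alpha> = \<beta> then 1 else 0)),
      zero = (\<lambda>(\<alpha>, \<beta>) \<in> P \<times> P. R_class n \<eta> \<alpha> \<beta> 0),
      add = (\<lambda>F G. \<lambda>(\<alpha>, \<beta>) \<in> P \<times> P. F (\<alpha>, \<beta>) \<oplus>\<^bsub>R_ring n \<eta> \<alpha> \<beta>\<^esub> G (\<alpha>, \<beta>))\<rparr>)"

definition bt_f :: "nat \<Rightarrow> real vec set \<Rightarrow> real vec set \<Rightarrow> (nat \<Rightarrow> int) \<Rightarrow> (nat \<Rightarrow> int) \<Rightarrow> bt_elem" where
  "bt_f n \<eta> \<xi> \<alpha> \<beta> = (\<lambda>(\<gamma>, \<delta>) \<in> bounded_feasible n \<eta> \<xi> \<times> bounded_feasible n \<eta> \<xi>.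
     R_class n \<eta> \<gamma> \<delta> (if \<gamma> = \<alpha> \<and> \<delta> = \<beta> then 1 else 0))"

text \<open>The element \<open>u\<^sub>i \<cdot> 1\<close>.\<close>

definition bt_u :: "nat \<Rightarrow> real vec set \<Rightarrow> real vec set \<Rightarrow> nat \<Rightarrow> bt_elem" where
  "bt_u n \<eta> \<xi> i = (\<lambda>(\<gamma>, \<delta>) \<in> bounded_feasible n \<eta> \<xi> \<times> bounded_feasible n \<eta> \<xi>.
     R_class n \<eta> \<gamma> \<delta> (if \<gamma> = \<delta> then uvar i else 0))"

text \<open>The images of the quiver generators: the vertices of the quiver include sign vectors outside
  \<open>bounded_feasible n \<eta> \<xi>\<close>, whose idempotents (and the arrows at them) are zero.\<close>

definition bt_e :: "nat \<Rightarrow> real vec set \<Rightarrow> real vec set \<Rightarrow> (nat \<Rightarrow> int) \<Rightarrow> bt_elem" where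
  "bt_e n \<eta> \<xi> \<alpha> =
     (if \<alpha> \<in> bounded_feasible n \<eta> \<xi> then bt_f n \<eta> \<xi> \<alpha> \<alpha> else \<zero>\<^bsub>B_tilde n \<eta> \<xi>\<^esub>)"

definition bt_p :: "nat \<Rightarrow> real vec set \<Rightarrow> real vec set \<Rightarrow> (nat \<Rightarrow> int) \<Rightarrow> (nat \<Rightarrow> int) \<Rightarrow> bt_elem" where
  "bt_p n \<eta> \<xi> \<alpha> \<beta> =
     (if \<alpha> \<in> bounded_feasible n \<eta> \<xi> \<and> \<beta> \<in> bounded_feasible n \<eta> \<xi>
      then bt_f n \<eta> \<xi> \<alpha> \<beta> else \<zero>\<^bsub>B_tilde n \<eta> \<xi>\<^esub>)"

text \<open>Multi-degrees are functions \<open>nat \<Rightarrow> int\<close>, with \<open>e\<^sub>i\<close> the indicator function of \<open>i\<close>; only those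
  supported in \<open>{1..n}\<close> carry nonzero elements.\<close>

definition bt_degree :: "(nat \<Rightarrow> int) \<Rightarrow> (nat \<Rightarrow> int) \<Rightarrow> (nat \<Rightarrow>\<^sub>0 nat) \<Rightarrow> nat \<Rightarrow> int" where
  "bt_degree \<alpha> \<beta> m = (\<lambda>i. 2 * int (Poly_Mapping.lookup m i) + of_bool (\<alpha> i \<noteq> \<beta> i))"

definition bt_homogeneous ::
    "nat \<Rightarrow> real vec set \<Rightarrow> real vec set \<Rightarrow> (nat \<Rightarrow> int) \<Rightarrow> bt_elem set" where
  "bt_homogeneous n \<eta> \<xi> d = {F \<in> carrier (B_tilde n \<eta> \<xi>).
     \<forall>\<alpha> \<in> bounded_feasible n \<eta> \<xi>. \<forall>\<beta> \<in> bounded_feasible n \<eta> \<xi>.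
       \<exists>p \<in> carrier (upoly_ring n). F (\<alpha>, \<beta>) = R_class n \<eta> \<alpha> \<beta> p \<and>
         (\<forall>m \<in> Poly_Mapping.keys p. bt_degree \<alpha> \<beta> m = d)}"

definition bt_psi :: "nat \<Rightarrow> real vec set \<Rightarrow> real vec set \<Rightarrow> bt_elem \<Rightarrow> bt_elem" where
  "bt_psi n \<eta> \<xi> F =
     (\<lambda>(\<alpha>, \<beta>) \<in> bounded_feasible n \<eta> \<xi> \<times> bounded_feasible n \<eta> \<xi>. F (\<beta>, \<alpha>))"


section \<open>Path algebras over the integers\<close>

text \<open>A path is a triple (source, list of arrows, target); paths are composed left to right.
  Elements are finitely supported integer functions on the paths.\<close>

type_synonym ('v, 'a) qpath = "'v \<times> 'a list \<times> 'v"

definition path_algebra :: "('v, 'a) pre_digraph \<Rightarrow> (('v, 'a) qpath \<Rightarrow> int) ring" where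
  "path_algebra Q =
     \<lparr>carrier = {f. finite {r. f r \<noteq> 0} \<and> (\<forall>u p v. f (u, p, v) \<noteq> 0 \<longrightarrow> pre_digraph.awalk Q u p v)},
      monoid.mult = (\<lambda>f g (u, p, w). \<Sum>j \<le> length p.
         let v = last (pre_digraph.awalk_verts Q u (take j p))
         in f (u, take j p, v) * g (v, drop j p, w)),
      one = (\<lambda>(u, p, v). of_bool (u \<in> verts Q \<and> p = [] \<and> v = u)),
      zero = (\<lambda>_. 0),
      add = (\<lambda>f g r. f r + g r)\<rparr>"

definition path_elem :: "('v, 'a) qpath \<Rightarrow> ('v, 'a) qpath \<Rightarrow> int" where
  "path_elem r = (\<lambda>s. of_bool (s = r))"


section \<open>The algebras of Ozsvath and Szabo\<close>

datatype osz_label = OR nat | OL nat | OU nat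

text \<open>An arrow is a triple (label, source, target).\<close>

type_synonym osz_arrow = "osz_label \<times> nat set \<times> nat set"

definition osz_V :: "nat \<Rightarrow> nat \<Rightarrow> nat set set" where
  "osz_V n k = {x. x \<subseteq> {0..n} \<and> card x = k}"

definition osz_Vr :: "nat \<Rightarrow> nat \<Rightarrow> nat set set" where
  "osz_Vr n k = {x. x \<subseteq> {1..n} \<and> card x = k}"

definition osz_quiver :: "nat \<Rightarrow> nat \<Rightarrow> (nat set, osz_arrow) pre_digraph" where
  "osz_quiver n k =
     \<lparr>verts = osz_V n k,
      arcs =
        {(OR i, x, y) | i x y. i \<in> {1..n} \<and> x \<in> osz_V n k \<and> y \<in> osz_V n k \<and>
           x \<inter> {i - 1, i} = {i - 1} \<and> y = insert i (x - {i - 1})} \<union>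
        {(OL i, y, x) | i x y. i \<in> {1..n} \<and> x \<in> osz_V n k \<and> y \<in> osz_V n k \<and>
           x \<inter> {i - 1, i} = {i - 1} \<and> y = insert i (x - {i - 1})} \<union>
        {(OU i, x, x) | i x. i \<in> {1..n} \<and> x \<in> osz_V n k},
      tail = (\<lambda>(l, x, y). x),
      head = (\<lambda>(l, x, y). y)\<rparr>"

text \<open>Labels of pairs of parallel paths that are identified, and of paths that are set to zero.
  Labels out of range do no harm: only honest paths of the quiver enter \<open>osz_relators\<close>.\<close>

definition osz_equal_words :: "(osz_label list \<times> osz_label list) set" where
  "osz_equal_words =
     {([OR i, OU j], [OU j, OR i]) | i j. True} \<union>
     {([OL i, OU j], [OU j, OL i]) | i j. True} \<union>
     {([OU i, OU j], [OU j, OU i]) | i j. True} \<union>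
     {([OR i, OL i], [OU i]) | i. True} \<union>
     {([OL i, OR i], [OU i]) | i. True} \<union>
     {([OR i, OR j], [OR j, OR i]) | i j. \<bar>int i - int j\<bar> > 1} \<union>
     {([OL i, OL j], [OL j, OL i]) | i j. \<bar>int i - int j\<bar> > 1} \<union>
     {([OL i, OR j], [OR j, OL i]) | i j. \<bar>int i - int j\<bar> > 1}"

definition osz_zero_words :: "osz_label list set" where
  "osz_zero_words =
     {[OR i, OR (Suc i)] | i. True} \<union> {[OL (Suc i), OL i] | i. True}"

definition osz_relators :: "nat \<Rightarrow> nat \<Rightarrow> ((nat set, osz_arrow) qpath \<Rightarrow> int) set" where
  "osz_relators n k = (let Q = osz_quiver n k in
     {path_elem (x, p, y) \<ominus>\<^bsub>path_algebra Q\<^esub> path_elem (x, q, y) | x p q y.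
        pre_digraph.awalk Q x p y \<and> pre_digraph.awalk Q x q y \<and>
        (map fst p, map fst q) \<in> osz_equal_words} \<union>
     {path_elem (x, p, y) | x p y. pre_digraph.awalk Q x p y \<and> map fst p \<in> osz_zero_words} \<union>
     {path_elem (x, [(OU i, x, x)], x) | i x.
        i \<in> {1..n} \<and> x \<in> osz_V n k \<and> x \<inter> {i - 1, i} = {}})"

definition osz_ideal :: "nat \<Rightarrow> nat \<Rightarrow> ((nat set, osz_arrow) qpath \<Rightarrow> int) set" where
  "osz_ideal n k = genideal (path_algebra (osz_quiver n k)) (osz_relators n k)"

type_synonym osz_elem = "((nat set, osz_arrow) qpath \<Rightarrow> int) set"

definition osz_B :: "nat \<Rightarrow> nat \<Rightarrow> osz_elem ring" where
  "osz_B n k = path_algebra (osz_quiver n k) Quot osz_ideal n k"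

definition osz_class :: "nat \<Rightarrow> nat \<Rightarrow> ((nat set, osz_arrow) qpath \<Rightarrow> int) \<Rightarrow> osz_elem" where
  "osz_class n k f = osz_ideal n k +>\<^bsub>path_algebra (osz_quiver n k)\<^esub> f"

definition osz_I :: "nat \<Rightarrow> nat \<Rightarrow> nat set \<Rightarrow> osz_elem" where
  "osz_I n k x = osz_class n k (path_elem (x, [], x))"

definition osz_arr :: "nat \<Rightarrow> nat \<Rightarrow> osz_label \<Rightarrow> nat set \<Rightarrow> nat set \<Rightarrow> osz_elem" where
  "osz_arr n k l x y = osz_class n k (path_elem (x, [(l, x, y)], y))"

definition osz_Br :: "nat \<Rightarrow> nat \<Rightarrow> osz_elem ring" where
  "osz_Br n k = (osz_B n k)
     \<lparr>carrier := {\<Oplus>\<^bsub>osz_B n k\<^esub> x \<in> osz_Vr n k. \<Oplus>\<^bsub>osz_B n k\<^esub> y \<in> osz_Vr n k.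
          osz_I n k x \<otimes>\<^bsub>osz_B n k\<^esub> b x y \<otimes>\<^bsub>osz_B n k\<^esub> osz_I n k y
        | b. \<forall>x \<in> osz_Vr n k. \<forall>y \<in> osz_Vr n k. b x y \<in> carrier (osz_B n k)},
      one := \<Oplus>\<^bsub>osz_B n k\<^esub> x \<in> osz_Vr n k. osz_I n k x\<rparr>"

fun osz_label_degree :: "osz_label \<Rightarrow> nat \<Rightarrow> int" where
  "osz_label_degree (OR i) j = of_bool (j = i)"
| "osz_label_degree (OL i) j = of_bool (j = i)"
| "osz_label_degree (OU i) j = 2 * of_bool (j = i)"

definition osz_degree :: "osz_arrow list \<Rightarrow> nat \<Rightarrow> int" where
  "osz_degree p = (\<lambda>j. \<Sum>a\<leftarrow>p. osz_label_degree (fst a) j)"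

definition osz_homogeneous :: "nat \<Rightarrow> nat \<Rightarrow> (nat \<Rightarrow> int) \<Rightarrow> osz_elem set" where
  "osz_homogeneous n k d = {b \<in> carrier (osz_Br n k).
     \<exists>f \<in> carrier (path_algebra (osz_quiver n k)). b = osz_class n k f \<and>
       (\<forall>x p y. f (x, p, y) \<noteq> 0 \<longrightarrow> osz_degree p = d)}"

text \<open>The anti-automorphism acts on the path algebra by reversing paths and exchanging \<open>R\<^sub>i\<close> and
  \<open>L\<^sub>i\<close>; on the quotient it acts by taking images of cosets. As path reversal is an involution,
  precomposing with it sends each path to its reverse.\<close>

fun osz_swap :: "osz_label \<Rightarrow> osz_label" where
  "osz_swap (OR i) = OL i"
| "osz_swap (OL i) = OR i"
| "osz_swap (OU i) = OU i"

fun osz_rev_path :: "(nat set, osz_arrow) qpath \<Rightarrow> (nat set, osz_arrow) qpath" where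
  "osz_rev_path (x, p, y) = (y, rev (map (\<lambda>(l, s, t). (osz_swap l, t, s)) p), x)"

definition osz_psi :: "osz_elem \<Rightarrow> osz_elem" where
  "osz_psi b = (\<lambda>f. f \<circ> osz_rev_path) ` b"


section \<open>The maps\<close>

text \<open>The sequence \<open>\<alpha>\<close> with the sign \<open>(-1)\<^sup>k\<close> appended.\<close>

definition extend_sign :: "nat \<Rightarrow> nat \<Rightarrow> (nat \<Rightarrow> int) \<Rightarrow> nat \<Rightarrow> int" where
  "extend_sign n k \<alpha> = \<alpha>(Suc n := (-1) ^ k)"

definition sign_subset :: "nat \<Rightarrow> nat \<Rightarrow> (nat \<Rightarrow> int) \<Rightarrow> nat set" where
  "sign_subset n k \<alpha> = {i \<in> {1..n}. extend_sign n k \<alpha> i \<noteq> extend_sign n k \<alpha> (Suc i)}"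

definition var_r :: "nat \<Rightarrow> nat \<Rightarrow> (nat \<Rightarrow> int) \<Rightarrow> nat" where
  "var_r n k \<alpha> = card {i \<in> {1..n}. extend_sign n k \<alpha> i \<noteq> extend_sign n k \<alpha> (Suc i)}"

definition flip_sign :: "(nat \<Rightarrow> int) \<Rightarrow> nat \<Rightarrow> nat \<Rightarrow> int" where
  "flip_sign \<alpha> i = \<alpha>(i := - \<alpha> i)"

definition quiver_verts :: "nat \<Rightarrow> nat \<Rightarrow> (nat \<Rightarrow> int) set" where
  "quiver_verts n k = {\<alpha> \<in> sign_vectors n. var_r n k \<alpha> \<ge> k}"

definition sign_of_subset ::
    "nat \<Rightarrow> nat \<Rightarrow> real vec set \<Rightarrow> real vec set \<Rightarrow> nat set \<Rightarrow> nat \<Rightarrow> int" where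
  "sign_of_subset n k \<eta> \<xi> = inv_into (bounded_feasible n \<eta> \<xi>) (sign_subset n k)"

text \<open>A map prescribed on generators is a ring homomorphism with the prescribed values; it is well
  defined iff there is exactly one such homomorphism. Requiring the value \<open>undefined\<close> off the
  carrier makes uniqueness meaningful. Compatibility with the \<open>\<int>\<close>-action is automatic.\<close>

definition is_Phi ::
    "nat \<Rightarrow> nat \<Rightarrow> real vec set \<Rightarrow> real vec set \<Rightarrow> (osz_elem \<Rightarrow> bt_elem) \<Rightarrow> bool" where
  "is_Phi n k \<eta> \<xi> \<Phi> \<longleftrightarrow>
     \<Phi> \<in> extensional (carrier (osz_Br n k)) \<and>
     \<Phi> \<in> Ring.ring_hom (osz_Br n k) (B_tilde n \<eta> \<xi>) \<and>
     (\<forall>x \<in> osz_Vr n k. \<Phi> (osz_I n k x) = bt_e n \<eta> \<xi> (sign_of_subset n k \<eta> \<xi> x)) \<and>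
     (\<forall>i. \<forall>x \<in> osz_Vr n k. \<forall>y \<in> osz_Vr n k. \<forall>l \<in> {OR i, OL i}.
        (l, x, y) \<in> arcs (osz_quiver n k) \<longrightarrow>
        \<Phi> (osz_arr n k l x y) =
          bt_p n \<eta> \<xi> (sign_of_subset n k \<eta> \<xi> x) (sign_of_subset n k \<eta> \<xi> y)) \<and>
     (\<forall>i \<in> {1..n}. \<forall>x \<in> osz_Vr n k.
        \<Phi> (osz_arr n k (OU i) x x) =
          bt_u n \<eta> \<xi> i \<otimes>\<^bsub>B_tilde n \<eta> \<xi>\<^esub> bt_e n \<eta> \<xi> (sign_of_subset n k \<eta> \<xi> x))"

definition is_Psi ::
    "nat \<Rightarrow> nat \<Rightarrow> real vec set \<Rightarrow> real vec set \<Rightarrow> (bt_elem \<Rightarrow> osz_elem) \<Rightarrow> bool" where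
  "is_Psi n k \<eta> \<xi> \<Psi> \<longleftrightarrow>
     \<Psi> \<in> extensional (carrier (B_tilde n \<eta> \<xi>)) \<and>
     \<Psi> \<in> Ring.ring_hom (B_tilde n \<eta> \<xi>) (osz_Br n k) \<and>
     (\<forall>\<alpha> \<in> quiver_verts n k. \<Psi> (bt_e n \<eta> \<xi> \<alpha>) =
        (if var_r n k \<alpha> = k then osz_I n k (sign_subset n k \<alpha>) else \<zero>\<^bsub>osz_Br n k\<^esub>)) \<and>
     (\<forall>\<alpha> \<in> quiver_verts n k. \<forall>\<beta> \<in> quiver_verts n k. \<forall>i \<in> {1..n}.
        \<beta> = flip_sign \<alpha> i \<longrightarrow>
        (let x = sign_subset n k \<alpha>; y = sign_subset n k \<beta> in
           (var_r n k \<alpha> > k \<or> var_r n k \<beta> > k \<longrightarrow>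
              \<Psi> (bt_p n \<eta> \<xi> \<alpha> \<beta>) = \<zero>\<^bsub>osz_Br n k\<^esub>) \<and>
           (var_r n k \<alpha> = k \<and> var_r n k \<beta> = k \<and> y = insert i (x - {i - 1}) \<longrightarrow>
              \<Psi> (bt_p n \<eta> \<xi> \<alpha> \<beta>) = osz_arr n k (OR i) x y) \<and>
           (var_r n k \<alpha> = k \<and> var_r n k \<beta> = k \<and> y = insert (i - 1) (x - {i}) \<longrightarrow>
              \<Psi> (bt_p n \<eta> \<xi> \<alpha> \<beta>) = osz_arr n k (OL i) x y))) \<and>
     (\<forall>i \<in> {1..n}. \<Psi> (bt_u n \<eta> \<xi> i) =
        (\<Oplus>\<^bsub>osz_Br n k\<^esub> x \<in> osz_Vr n k.
           osz_arr n k (OU i) x x \<otimes>\<^bsub>osz_Br n k\<^esub> osz_I n k x))"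

text \<open>Isomorphisms of multi-graded rings, the grading being given by the homogeneous parts.\<close>

definition graded_ring_iso :: "('a, 'c) ring_scheme \<Rightarrow> ((nat \<Rightarrow> int) \<Rightarrow> 'a set) \<Rightarrow>
    ('b, 'd) ring_scheme \<Rightarrow> ((nat \<Rightarrow> int) \<Rightarrow> 'b set) \<Rightarrow> ('a \<Rightarrow> 'b) \<Rightarrow> bool" where
  "graded_ring_iso A GA B GB h \<longleftrightarrow>
     ring A \<and> ring B \<and> h \<in> ring_iso A B \<and> (\<forall>d. h ` GA d = GB d)"

end

theory Submission
  imports Defs
begin

text \<open>Both algebras have a basis of homogeneous elements of multiplicity at most one, and the bases
  match. On the quiver side, the relations identify any two paths with the same end points and the
  same degree, unless they vanish: a path reduces to a product of some \<open>U\<^sub>i\<close> and of crossings of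
  distinct edges, and it vanishes iff the edges of positive degree contain all edges between two
  holes of its source. Thus the ideal of relations is the set of combinations whose coefficients sum
  to zero over each surviving triple (source, target, degree).

  On the arrangement side, the summand at \<open>(\<alpha>, \<beta>)\<close> has as a basis the monomials \<open>u\<^sup>m\<close> for which the
  face of \<open>\<Delta>\<^sub>\<alpha> \<inter> \<Delta>\<^sub>\<beta>\<close> cut out by the variables of \<open>m\<close> is nonempty. The Pluecker relations of a
  positive subspace show that a point of \<open>V + \<eta>\<close> alternates at most \<open>k\<close> times, and the vertices of
  the arrangement realize all remaining possibilities; hence this face is nonempty iff the variables
  of \<open>m\<close>, together with the indices where \<open>\<alpha>\<close> and \<open>\<beta>\<close> differ, do not contain all edges between two
  holes of \<open>x\<^sub>\<alpha>\<close>. Since crossing the edge \<open>i\<close> flips the sign \<open>\<alpha> i\<close>, the degrees agree as well, and the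
  factor \<open>u\<close> to the power \<open>S(\<alpha>\<beta>\<gamma>)\<close> counts the edges crossed by both factors of a product.\<close>

section \<open>Finitely supported functions on paths: linear functionals and convolution\<close>

section \<open>The path algebra of a quiver\<close>

text \<open>The obstacle is to show that the relations kill no more than the evident paths. The
  ideal is not computed from its generators: integer functionals, one for each surviving triple, are
  shown to cut out a two-sided ideal that contains the relators, and rewriting gives the reverse
  inclusion. Once vanishing is understood on both sides, \<open>Phi\<close> can be defined on all
  paths at once instead of generator by generator. Then no relation has to be checked against it,
  the ring axioms of the convolution algebra are transported instead of proved, and
  \<open>Psi\<close> is simply the inverse. Only the uniqueness of the two maps uses generators, and
  only those of the truncated algebra.

  On the geometric side the two positivity conditions concern different spaces. They are linked
  because the maximal minors of the span of V and \<eta> are one common multiple of sums formed from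
  a point of \<eta> and the minors of the signed graph of \<xi>. Positivity leaves the sign of this
  multiple open; it is fixed by the condition on the first coordinate of the projection of
  \<eta>.\<close>

definition supp :: "('s \<Rightarrow> int) \<Rightarrow> 's set" where
  "supp f = {s. f s \<noteq> 0}"

text \<open>Values may lie in any commutative ring: integer functionals test equality in the path
  algebra, and polynomial values give the map from paths to monomials.\<close>

definition lin :: "('s \<Rightarrow> 'b::comm_ring_1) \<Rightarrow> ('s \<Rightarrow> int) \<Rightarrow> 'b" where
  "lin \<Theta> f = (\<Sum>s\<in>supp f. of_int (f s) * \<Theta> s)"

lemma lin_superset:
  assumes "finite A" "supp f \<subseteq> A"
  shows "lin \<Theta> f = (\<Sum>s\<in>A. of_int (f s) * \<Theta> s)"
  unfolding lin_def by (rule sum.mono_neutral_left) (use assms in \<open>auto simp: supp_def\<close>)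

lemma lin_add:
  assumes "finite (supp f)" "finite (supp g)"
  shows "lin \<Theta> (\<lambda>s. f s + g s) = lin \<Theta> f + lin \<Theta> g"
proof -
  let ?A = "supp f \<union> supp g"
  have fin: "finite ?A" using assms by simp
  have "lin \<Theta> (\<lambda>s. f s + g s) = (\<Sum>s\<in>?A. of_int (f s + g s) * \<Theta> s)"
    by (rule lin_superset[OF fin]) (auto simp: supp_def)
  also have "\<dots> = (\<Sum>s\<in>?A. of_int (f s) * \<Theta> s) + (\<Sum>s\<in>?A. of_int (g s) * \<Theta> s)"
    by (simp add: sum.distrib algebra_simps)
  finally show ?thesis using lin_superset[OF fin, of f \<Theta>] lin_superset[OF fin, of g \<Theta>] by simp
qed

lemma lin_uminus: "lin \<Theta> (\<lambda>s. - f s) = - lin \<Theta> f"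
  by (simp add: lin_def supp_def sum_negf)

lemma lin_diff:
  assumes "finite (supp f)" "finite (supp g)"
  shows "lin \<Theta> (\<lambda>s. f s - g s) = lin \<Theta> f - lin \<Theta> g"
  using lin_add[of f "\<lambda>s. - g s" \<Theta>] assms lin_uminus[of \<Theta> g] by (simp add: supp_def)

lemma lin_zero [simp]: "lin \<Theta> (\<lambda>_. 0) = 0"
  by (simp add: lin_def supp_def)

lemma lin_delta:
  assumes "finite (supp f)"
  shows "lin (\<lambda>r. of_bool (r = s)) f = f s"
proof -
  have "lin (\<lambda>r. of_bool (r = s)) f = (\<Sum>r\<in>supp f. if r = s then f r else 0)"
    unfolding lin_def by (rule sum.cong) auto
  also have "\<dots> = f s" using assms by (simp add: sum.delta') (simp add: supp_def)
  finally show ?thesis .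
qed

fun composable :: "('v, 'a) qpath \<Rightarrow> ('v, 'a) qpath \<Rightarrow> bool" where
  "composable (u, p, v) (v', q, w) \<longleftrightarrow> v = v'"

fun pcomp :: "('v, 'a) qpath \<Rightarrow> ('v, 'a) qpath \<Rightarrow> ('v, 'a) qpath" where
  "pcomp (u, p, v) (v', q, w) = (u, p @ q, w)"

lemma lin_path_elem [simp]: "lin \<Theta> (path_elem r) = \<Theta> r"
  by (simp add: lin_def supp_def path_elem_def)

lemma supp_path_elem [simp]: "supp (path_elem r) = {r}"
  by (auto simp: supp_def path_elem_def)

lemma carrier_path_algebra:
  "carrier (path_algebra Q) =
     {f. finite (supp f) \<and> (\<forall>u p v. (u, p, v) \<in> supp f \<longrightarrow> pre_digraph.awalk Q u p v)}"
  by (simp add: path_algebra_def supp_def)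

lemma path_algebra_add [simp]: "f \<oplus>\<^bsub>path_algebra Q\<^esub> g = (\<lambda>r. f r + g r)"
  by (simp add: path_algebra_def)

lemma path_algebra_zero [simp]: "\<zero>\<^bsub>path_algebra Q\<^esub> = (\<lambda>_. 0)"
  by (simp add: path_algebra_def)

context wf_digraph
begin

abbreviation PA :: "(('a, 'b) qpath \<Rightarrow> int) ring" where
  "PA \<equiv> path_algebra G"

text \<open>The product is defined by cutting a path at each position j and reading the vertex of
  the cut off the walk. Reindexed by pairs of factors, j is the length of the first factor, and the
  vertex is forced because elements are supported on walks.\<close>

lemma PA_mult_eq_sum:
  assumes f: "f \<in> carrier PA" and g: "g \<in> carrier PA"
  shows "(f \<otimes>\<^bsub>PA\<^esub> g) s =
    (\<Sum>(r1, r2) \<in> supp f \<times> supp g. if composable r1 r2 \<and> pcomp r1 r2 = s then f r1 * g r2 else 0)"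
proof -
  obtain u p w where s: "s = (u, p, w)" by (cases s) auto
  let ?h = "\<lambda>j. awlast u (take j p)"
  let ?T = "{j. j \<le> length p \<and> f (u, take j p, ?h j) * g (?h j, drop j p, w) \<noteq> 0}"
  let ?P = "{(r1, r2) \<in> supp f \<times> supp g. composable r1 r2 \<and> pcomp r1 r2 = s}"
  have fin: "finite (supp f \<times> supp g)" using f g by (simp add: carrier_path_algebra)
  have "(f \<otimes>\<^bsub>PA\<^esub> g) s = (\<Sum>j\<le>length p. f (u, take j p, ?h j) * g (?h j, drop j p, w))"
    by (simp add: path_algebra_def s Let_def)
  also have "\<dots> = (\<Sum>j\<in>?T. f (u, take j p, ?h j) * g (?h j, drop j p, w))"
    by (rule sum.mono_neutral_right) auto
  also have "\<dots> = (\<Sum>(r1, r2)\<in>?P. f r1 * g r2)"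
  proof (rule sum.reindex_bij_witness[where i = "\<lambda>(r1, r2). length (fst (snd r1))"
        and j = "\<lambda>j. ((u, take j p, ?h j), (?h j, drop j p, w))"])
    fix r assume "r \<in> ?P"
    then obtain p1 p2 v where r: "r = ((u, p1, v), (v, p2, w))" "p = p1 @ p2"
      "(u, p1, v) \<in> supp f" "(v, p2, w) \<in> supp g"
      unfolding s by auto
    have "awalk u p1 v" using r(3) f by (auto simp: carrier_path_algebra)
    then have "awlast u p1 = v" by simp
    then show "((u, take (case r of (r1, r2) \<Rightarrow> length (fst (snd r1))) p,
               awlast u (take (case r of (r1, r2) \<Rightarrow> length (fst (snd r1))) p)),
              awlast u (take (case r of (r1, r2) \<Rightarrow> length (fst (snd r1))) p),
              drop (case r of (r1, r2) \<Rightarrow> length (fst (snd r1))) p, w) = r"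
      and "(case r of (r1, r2) \<Rightarrow> length (fst (snd r1))) \<in> ?T"
      using r by (auto simp: supp_def)
  qed (auto simp: s supp_def)
  also have "\<dots> = (\<Sum>r \<in> supp f \<times> supp g.
      if composable (fst r) (snd r) \<and> pcomp (fst r) (snd r) = s then f (fst r) * g (snd r) else 0)"
    using fin by (simp add: sum.inter_filter[symmetric] case_prod_unfold mem_Times_iff conj_assoc)
  finally show ?thesis by (simp add: case_prod_unfold)
qed

lemma PA_mult_closed:
  assumes f: "f \<in> carrier PA" and g: "g \<in> carrier PA"
  shows "f \<otimes>\<^bsub>PA\<^esub> g \<in> carrier PA"
    and supp_PA_mult: "supp (f \<otimes>\<^bsub>PA\<^esub> g) \<subseteq>
      {pcomp r1 r2 | r1 r2. r1 \<in> supp f \<and> r2 \<in> supp g \<and> composable r1 r2}"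
proof -
  have fin: "finite (supp f \<times> supp g)" using f g by (simp add: carrier_path_algebra)
  have *: "\<exists>r1 r2. r1 \<in> supp f \<and> r2 \<in> supp g \<and> composable r1 r2 \<and> pcomp r1 r2 = s"
    if "s \<in> supp (f \<otimes>\<^bsub>PA\<^esub> g)" for s
  proof (rule ccontr)
    assume no: "\<not> ?thesis"
    have "(f \<otimes>\<^bsub>PA\<^esub> g) s = 0"
      unfolding PA_mult_eq_sum[OF f g]
    proof (intro sum.neutral ballI)
      fix r assume "r \<in> supp f \<times> supp g"
      then obtain r1 r2 where "r = (r1, r2)" "r1 \<in> supp f" "r2 \<in> supp g" by blast
      moreover from this no have "\<not> (composable r1 r2 \<and> pcomp r1 r2 = s)" by blast
      ultimately show "(case r of (r1, r2) \<Rightarrow>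
          if composable r1 r2 \<and> pcomp r1 r2 = s then f r1 * g r2 else 0) = 0"
        by (simp only: split if_False)
    qed
    then show False using that by (simp add: supp_def)
  qed
  show S: "supp (f \<otimes>\<^bsub>PA\<^esub> g) \<subseteq>
      {pcomp r1 r2 | r1 r2. r1 \<in> supp f \<and> r2 \<in> supp g \<and> composable r1 r2}"
    using * by blast
  have "supp (f \<otimes>\<^bsub>PA\<^esub> g) \<subseteq> (\<lambda>(r1, r2). pcomp r1 r2) ` (supp f \<times> supp g)"
  proof
    fix s assume "s \<in> supp (f \<otimes>\<^bsub>PA\<^esub> g)"
    then obtain r1 r2 where "r1 \<in> supp f" "r2 \<in> supp g" "s = pcomp r1 r2" using * by metis
    then show "s \<in> (\<lambda>(r1, r2). pcomp r1 r2) ` (supp f \<times> supp g)"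
      by (intro image_eqI[of _ _ "(r1, r2)"]) simp_all
  qed
  then have 1: "finite (supp (f \<otimes>\<^bsub>PA\<^esub> g))" using fin finite_surj by blast
  have 2: "awalk u p v" if uv: "(u, p, v) \<in> supp (f \<otimes>\<^bsub>PA\<^esub> g)" for u p v
  proof -
    obtain r1 r2 where r: "r1 \<in> supp f" "r2 \<in> supp g" "composable r1 r2" "pcomp r1 r2 = (u, p, v)"
      using *[OF uv] by blast
    then obtain p1 p2 z where z: "r1 = (u, p1, z)" "r2 = (z, p2, v)" "p = p1 @ p2"
      by (cases r1; cases r2) auto
    have "awalk u p1 z" "awalk z p2 v" using r f g unfolding z by (auto simp: carrier_path_algebra)
    then show ?thesis using z by auto
  qed
  show "f \<otimes>\<^bsub>PA\<^esub> g \<in> carrier PA" using 1 2 by (simp add: carrier_path_algebra)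
qed

lemma lin_PA_mult:
  assumes f: "f \<in> carrier PA" and g: "g \<in> carrier PA"
  shows "lin \<Theta> (f \<otimes>\<^bsub>PA\<^esub> g) = (\<Sum>r1\<in>supp f. \<Sum>r2\<in>supp g.
     if composable r1 r2 then of_int (f r1 * g r2) * \<Theta> (pcomp r1 r2) else 0)"
proof -
  let ?X = "supp f \<times> supp g"
  let ?A = "(\<lambda>r. pcomp (fst r) (snd r)) ` ?X"
  let ?c = "\<lambda>r. composable (fst r) (snd r)" and ?m = "\<lambda>r. pcomp (fst r) (snd r)"
  have fin: "finite (supp f)" "finite (supp g)" "finite ?X"
    using f g by (simp_all add: carrier_path_algebra)
  have "lin \<Theta> (f \<otimes>\<^bsub>PA\<^esub> g) = (\<Sum>s\<in>?A. of_int ((f \<otimes>\<^bsub>PA\<^esub> g) s) * \<Theta> s)"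
    by (rule lin_superset) (use fin supp_PA_mult[OF f g] in \<open>force+\<close>)
  also have "\<dots> = (\<Sum>s\<in>?A. \<Sum>r\<in>?X. if ?m r = s then
      (if ?c r then of_int (f (fst r) * g (snd r)) * \<Theta> s else 0) else 0)"
    unfolding PA_mult_eq_sum[OF f g]
    by (intro sum.cong refl) (auto simp: of_int_sum sum_distrib_right case_prod_unfold intro!: sum.cong)
  also have "\<dots> = (\<Sum>r\<in>?X. \<Sum>s\<in>?A. if ?m r = s then
      (if ?c r then of_int (f (fst r) * g (snd r)) * \<Theta> s else 0) else 0)"
    by (rule sum.swap)
  also have "\<dots> = (\<Sum>r\<in>?X. if ?c r then of_int (f (fst r) * g (snd r)) * \<Theta> (?m r) else 0)"
    using fin by (intro sum.cong refl) (simp add: sum.delta')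
  finally show ?thesis by (simp add: sum.cartesian_product case_prod_unfold)
qed

text \<open>One factor is expanded path by path, while the other is only seen through a functional
  that depends on the path. In this shape a property stated for all functionals of a factor passes
  to the product.\<close>

lemma lin_PA_mult_left:
  assumes "f \<in> carrier PA" "g \<in> carrier PA"
  shows "lin \<Theta> (f \<otimes>\<^bsub>PA\<^esub> g) = lin (\<lambda>r1. lin (\<lambda>r2. if composable r1 r2 then \<Theta> (pcomp r1 r2) else 0) g) f"
  unfolding lin_PA_mult[OF assms] lin_def[of _ f] lin_def[of _ g] sum_distrib_left
  by (intro sum.cong refl) (auto simp: mult.assoc)

lemma lin_PA_mult_right:
  assumes "f \<in> carrier PA" "g \<in> carrier PA"
  shows "lin \<Theta> (f \<otimes>\<^bsub>PA\<^esub> g) = lin (\<lambda>r2. lin (\<lambda>r1. if composable r1 r2 then \<Theta> (pcomp r1 r2) else 0) f) g"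
  unfolding lin_PA_mult[OF assms] lin_def[of _ f] lin_def[of _ g] sum_distrib_left
  by (subst sum.swap, intro sum.cong refl) (auto simp: algebra_simps)

text \<open>Indicator functions of single paths recover the coefficients, so identities between
  products can be checked through functionals.\<close>

lemma PA_eqI:
  assumes "f \<in> carrier PA" "g \<in> carrier PA"
    and "\<And>\<Theta> :: ('a, 'b) qpath \<Rightarrow> int. lin \<Theta> f = lin \<Theta> g"
  shows "f = g"
proof
  fix s show "f s = g s"
    using assms(3)[of "\<lambda>r. of_bool (r = s)"] lin_delta[of f s] lin_delta[of g s] assms(1,2)
    by (simp add: carrier_path_algebra)
qed

text \<open>Both sides expand to the same sum over composable triples of paths.\<close>

lemma PA_mult_assoc:
  assumes f: "f \<in> carrier PA" and g: "g \<in> carrier PA" and h: "h \<in> carrier PA"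
  shows "f \<otimes>\<^bsub>PA\<^esub> g \<otimes>\<^bsub>PA\<^esub> h = f \<otimes>\<^bsub>PA\<^esub> (g \<otimes>\<^bsub>PA\<^esub> h)"
proof (rule PA_eqI)
  fix \<Theta> :: "('a, 'b) qpath \<Rightarrow> int"
  have fgc: "f \<otimes>\<^bsub>PA\<^esub> g \<in> carrier PA" and ghc: "g \<otimes>\<^bsub>PA\<^esub> h \<in> carrier PA"
    using f g h by (auto intro: PA_mult_closed)
  have "lin \<Theta> (f \<otimes>\<^bsub>PA\<^esub> g \<otimes>\<^bsub>PA\<^esub> h) =
      lin (\<lambda>r. \<Sum>r3\<in>supp h. if composable r r3 then h r3 * \<Theta> (pcomp r r3) else 0) (f \<otimes>\<^bsub>PA\<^esub> g)"
    unfolding lin_PA_mult[OF fgc h]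
    by (simp add: lin_def sum_distrib_left if_distrib cong: if_cong sum.cong) (simp add: mult.assoc cong: if_cong)
  also have "\<dots> = (\<Sum>r1\<in>supp f. \<Sum>r2\<in>supp g. \<Sum>r3\<in>supp h.
      if composable r1 r2 \<and> composable (pcomp r1 r2) r3
      then f r1 * g r2 * h r3 * \<Theta> (pcomp (pcomp r1 r2) r3) else 0)"
    unfolding lin_PA_mult[OF f g]
    by (intro sum.cong refl) (auto simp: sum_distrib_left intro!: sum.cong)
  also have "\<dots> = (\<Sum>r1\<in>supp f. \<Sum>r2\<in>supp g. \<Sum>r3\<in>supp h.
      if composable r2 r3 \<and> composable r1 (pcomp r2 r3)
      then f r1 * g r2 * h r3 * \<Theta> (pcomp r1 (pcomp r2 r3)) else 0)"
    by (intro sum.cong refl) auto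
  also have "\<dots> = (\<Sum>r1\<in>supp f. f r1 * (\<Sum>r2\<in>supp g. \<Sum>r3\<in>supp h. if composable r2 r3 then
      g r2 * h r3 * (if composable r1 (pcomp r2 r3) then \<Theta> (pcomp r1 (pcomp r2 r3)) else 0) else 0))"
    unfolding sum_distrib_left by (intro sum.cong refl) auto
  also have "\<dots> = (\<Sum>r1\<in>supp f. f r1 *
      lin (\<lambda>r. if composable r1 r then \<Theta> (pcomp r1 r) else 0) (g \<otimes>\<^bsub>PA\<^esub> h))"
    unfolding lin_PA_mult[OF g h] by (simp only: of_int_eq_id id_apply)
  also have "\<dots> = lin \<Theta> (f \<otimes>\<^bsub>PA\<^esub> (g \<otimes>\<^bsub>PA\<^esub> h))"
    unfolding lin_PA_mult_left[OF f ghc] by (simp add: lin_def[of _ f])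
  finally show "lin \<Theta> (f \<otimes>\<^bsub>PA\<^esub> g \<otimes>\<^bsub>PA\<^esub> h) = lin \<Theta> (f \<otimes>\<^bsub>PA\<^esub> (g \<otimes>\<^bsub>PA\<^esub> h))" .
qed (use f g h in \<open>auto intro: PA_mult_closed\<close>)

lemma supp_PA_one: "supp \<one>\<^bsub>PA\<^esub> = (\<lambda>u. (u, [], u)) ` verts G"
  by (auto simp: path_algebra_def supp_def)

lemma PA_one_apply: "u \<in> verts G \<Longrightarrow> \<one>\<^bsub>PA\<^esub> (u, [], u) = 1"
  by (simp add: path_algebra_def)

lemma PA_one_closed:
  assumes "finite (verts G)"
  shows "\<one>\<^bsub>PA\<^esub> \<in> carrier PA"
  using assms by (auto simp: carrier_path_algebra supp_PA_one awalk_Nil_iff)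

lemma PA_add_closed:
  assumes "f \<in> carrier PA" "g \<in> carrier PA"
  shows "(\<lambda>r. f r + g r) \<in> carrier PA"
proof -
  have "supp (\<lambda>r. f r + g r) \<subseteq> supp f \<union> supp g" by (auto simp: supp_def)
  then show ?thesis using assms unfolding carrier_path_algebra
    by (auto intro: finite_subset)
qed

lemma PA_uminus_closed:
  assumes "f \<in> carrier PA" shows "(\<lambda>r. - f r) \<in> carrier PA"
  using assms by (simp add: carrier_path_algebra supp_def)

lemma PA_zero_closed: "(\<lambda>_. 0) \<in> carrier PA"
  by (simp add: carrier_path_algebra supp_def)

lemma lin_PA_one_composable:
  assumes "finite (verts G)" "awalk u p v"
  shows "lin (\<lambda>r. if composable (u, p, v) r then \<Theta> (pcomp (u, p, v) r) else 0) \<one>\<^bsub>PA\<^esub> = \<Theta> (u, p, v)"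
    and "lin (\<lambda>r. if composable r (u, p, v) then \<Theta> (pcomp r (u, p, v)) else 0) \<one>\<^bsub>PA\<^esub> = \<Theta> (u, p, v)"
proof -
  have uv: "u \<in> verts G" "v \<in> verts G" using assms(2) by auto
  have inj: "inj_on (\<lambda>u. (u, [], u)) (verts G)" by (auto simp: inj_on_def)
  have e: "lin \<Xi> \<one>\<^bsub>PA\<^esub> = (\<Sum>x\<in>verts G. \<Xi> (x, [], x))" for \<Xi> :: "('a, 'b) qpath \<Rightarrow> 'c"
    unfolding lin_def supp_PA_one sum.reindex[OF inj] by (simp add: PA_one_apply)
  show "lin (\<lambda>r. if composable (u, p, v) r then \<Theta> (pcomp (u, p, v) r) else 0) \<one>\<^bsub>PA\<^esub> = \<Theta> (u, p, v)"
    unfolding e using assms(1) uv by (simp add: if_distrib sum.delta sum.delta' cong: if_cong)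
  show "lin (\<lambda>r. if composable r (u, p, v) then \<Theta> (pcomp r (u, p, v)) else 0) \<one>\<^bsub>PA\<^esub> = \<Theta> (u, p, v)"
    unfolding e using assms(1) uv by (simp add: if_distrib sum.delta sum.delta' cong: if_cong)
qed

text \<open>Finiteness of the vertex set makes the unit, the sum of all trivial paths, finitely
  supported.\<close>

lemma PA_ring:
  assumes fin: "finite (verts G)"
  shows "ring PA"
proof (rule ringI)
  have fs: "finite (supp f)" if "f \<in> carrier PA" for f using that by (simp add: carrier_path_algebra)
  have linc: "lin \<Theta> f = lin \<Xi> f" if "f \<in> carrier PA" "\<And>u p v. awalk u p v \<Longrightarrow> \<Theta> (u, p, v) = \<Xi> (u, p, v)"
    for f and \<Theta> \<Xi> :: "('a, 'b) qpath \<Rightarrow> int"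
    unfolding lin_def by (rule sum.cong) (use that in \<open>auto simp: carrier_path_algebra\<close>)
  note oc = PA_one_closed[OF fin]
  show "abelian_group PA"
  proof (rule abelian_groupI)
    show "\<exists>y\<in>carrier PA. y \<oplus>\<^bsub>PA\<^esub> x = \<zero>\<^bsub>PA\<^esub>" if "x \<in> carrier PA" for x
      using PA_uminus_closed[OF that] by (intro bexI[of _ "\<lambda>r. - x r"]) auto
  qed (auto simp: PA_add_closed PA_zero_closed ac_simps)
  show "monoid PA"
  proof (rule monoidI)
    fix f assume f: "f \<in> carrier PA"
    show "\<one>\<^bsub>PA\<^esub> \<otimes>\<^bsub>PA\<^esub> f = f"
      by (rule PA_eqI[OF PA_mult_closed(1)[OF oc f] f], unfold lin_PA_mult_right[OF oc f], rule linc[OF f])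
        (rule lin_PA_one_composable(2)[OF fin])
    show "f \<otimes>\<^bsub>PA\<^esub> \<one>\<^bsub>PA\<^esub> = f"
      by (rule PA_eqI[OF PA_mult_closed(1)[OF f oc] f], unfold lin_PA_mult_left[OF f oc], rule linc[OF f])
        (rule lin_PA_one_composable(1)[OF fin])
  qed (auto intro: PA_mult_closed PA_mult_assoc oc)
  fix f g h assume f: "f \<in> carrier PA" and g: "g \<in> carrier PA" and h: "h \<in> carrier PA"
  have a: "(\<lambda>r. f r + g r) \<in> carrier PA" using PA_add_closed f g by auto
  show "(f \<oplus>\<^bsub>PA\<^esub> g) \<otimes>\<^bsub>PA\<^esub> h = f \<otimes>\<^bsub>PA\<^esub> h \<oplus>\<^bsub>PA\<^esub> g \<otimes>\<^bsub>PA\<^esub> h"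
  proof (rule PA_eqI)
    fix \<Theta> :: "('a, 'b) qpath \<Rightarrow> int"
    have "lin \<Theta> ((\<lambda>r. f r + g r) \<otimes>\<^bsub>PA\<^esub> h) = lin \<Theta> (f \<otimes>\<^bsub>PA\<^esub> h) + lin \<Theta> (g \<otimes>\<^bsub>PA\<^esub> h)"
      unfolding lin_PA_mult_left[OF a h] lin_PA_mult_left[OF f h] lin_PA_mult_left[OF g h]
      by (rule lin_add) (auto intro: fs f g)
    then show "lin \<Theta> ((f \<oplus>\<^bsub>PA\<^esub> g) \<otimes>\<^bsub>PA\<^esub> h) = lin \<Theta> (f \<otimes>\<^bsub>PA\<^esub> h \<oplus>\<^bsub>PA\<^esub> g \<otimes>\<^bsub>PA\<^esub> h)"
      using lin_add[of "f \<otimes>\<^bsub>PA\<^esub> h" "g \<otimes>\<^bsub>PA\<^esub> h" \<Theta>] by (simp add: fs PA_mult_closed f g h)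
  qed (simp_all add: PA_add_closed PA_mult_closed a f g h)
  show "h \<otimes>\<^bsub>PA\<^esub> (f \<oplus>\<^bsub>PA\<^esub> g) = h \<otimes>\<^bsub>PA\<^esub> f \<oplus>\<^bsub>PA\<^esub> h \<otimes>\<^bsub>PA\<^esub> g"
  proof (rule PA_eqI)
    fix \<Theta> :: "('a, 'b) qpath \<Rightarrow> int"
    have "lin \<Theta> (h \<otimes>\<^bsub>PA\<^esub> (\<lambda>r. f r + g r)) = lin \<Theta> (h \<otimes>\<^bsub>PA\<^esub> f) + lin \<Theta> (h \<otimes>\<^bsub>PA\<^esub> g)"
      unfolding lin_PA_mult_right[OF h a] lin_PA_mult_right[OF h f] lin_PA_mult_right[OF h g]
      by (rule lin_add) (auto intro: fs f g)
    then show "lin \<Theta> (h \<otimes>\<^bsub>PA\<^esub> (f \<oplus>\<^bsub>PA\<^esub> g)) = lin \<Theta> (h \<otimes>\<^bsub>PA\<^esub> f \<oplus>\<^bsub>PA\<^esub> h \<otimes>\<^bsub>PA\<^esub> g)"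
      using lin_add[of "h \<otimes>\<^bsub>PA\<^esub> f" "h \<otimes>\<^bsub>PA\<^esub> g" \<Theta>] by (simp add: fs PA_mult_closed f g h)
  qed (simp_all add: PA_add_closed PA_mult_closed a f g h)
qed

lemma path_elem_mult:
  assumes "awalk u p v" "awalk v q w"
  shows "path_elem (u, p, v) \<otimes>\<^bsub>PA\<^esub> path_elem (v, q, w) = path_elem (u, p @ q, w)"
proof (rule PA_eqI)
  have c: "path_elem (u, p, v) \<in> carrier PA" "path_elem (v, q, w) \<in> carrier PA"
    using assms by (simp_all add: carrier_path_algebra)
  show "path_elem (u, p, v) \<otimes>\<^bsub>PA\<^esub> path_elem (v, q, w) \<in> carrier PA" by (rule PA_mult_closed[OF c])
  show "path_elem (u, p @ q, w) \<in> carrier PA" using assms by (auto simp: carrier_path_algebra)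
  show "lin \<Theta> (path_elem (u, p, v) \<otimes>\<^bsub>PA\<^esub> path_elem (v, q, w)) = lin \<Theta> (path_elem (u, p @ q, w))"
    for \<Theta> :: "('a, 'b) qpath \<Rightarrow> int"
    by (simp add: lin_PA_mult_left[OF c])
qed

lemma PA_minus:
  assumes "finite (verts G)" "f \<in> carrier PA" "g \<in> carrier PA"
  shows "f \<ominus>\<^bsub>PA\<^esub> g = (\<lambda>r. f r - g r)"
proof -
  interpret ring PA by (rule PA_ring[OF assms(1)])
  have "(\<lambda>r. - g r) = \<ominus>\<^bsub>PA\<^esub> g"
    by (rule minus_equality[symmetric]) (use assms PA_uminus_closed in auto)
  then show ?thesis unfolding a_minus_def by (metis (no_types) path_algebra_add diff_conv_add_uminus)
qed

end

section \<open>Walks of the quiver as words in crossings and loops\<close>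

section \<open>States and words\<close>

definition toggle :: "nat \<Rightarrow> nat set \<Rightarrow> nat set" where
  "toggle i x = (x - {i - 1, i}) \<union> ({i - 1, i} - x)"

text \<open>A letter \<open>(True, i)\<close> crosses the edge \<open>i\<close> between \<open>i - 1\<close> and \<open>i\<close>, in the direction that
  the current state allows, and \<open>(False, i)\<close> stands for \<open>U\<^sub>i\<close>.\<close>

type_synonym letter = "bool \<times> nat"

fun step :: "nat set \<Rightarrow> letter \<Rightarrow> nat set" where
  "step x (c, i) = (if c then toggle i x else x)"

abbreviation run :: "nat set \<Rightarrow> letter list \<Rightarrow> nat set" where
  "run \<equiv> foldl step"

fun letter_ok :: "nat \<Rightarrow> nat set \<Rightarrow> letter \<Rightarrow> bool" where
  "letter_ok n x (c, i) \<longleftrightarrow> 1 \<le> i \<and> i \<le> n \<and> (c \<longrightarrow> (i - 1 \<in> x) \<noteq> (i \<in> x))"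

fun word_ok :: "nat \<Rightarrow> nat set \<Rightarrow> letter list \<Rightarrow> bool" where
  "word_ok n x [] \<longleftrightarrow> True"
| "word_ok n x (l # w) \<longleftrightarrow> letter_ok n x l \<and> word_ok n (step x l) w"

fun arrow :: "nat set \<Rightarrow> letter \<Rightarrow> osz_arrow" where
  "arrow x (c, i) = (if c then (if i - 1 \<in> x then OR i else OL i, x, toggle i x) else (OU i, x, x))"

fun arrows :: "nat set \<Rightarrow> letter list \<Rightarrow> osz_arrow list" where
  "arrows x [] = []"
| "arrows x (l # w) = arrow x l # arrows (step x l) w"

definition wpath :: "nat set \<Rightarrow> letter list \<Rightarrow> (nat set, osz_arrow) qpath" where
  "wpath x w = (x, arrows x w, run x w)"

abbreviation Cs :: "nat list \<Rightarrow> letter list" where "Cs \<equiv> map (Pair True)"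
abbreviation Us :: "nat list \<Rightarrow> letter list" where "Us \<equiv> map (Pair False)"

lemma in_toggle_iff: "j \<in> toggle i x \<longleftrightarrow> (j \<in> x) \<noteq> (j = i \<or> j = i - 1)"
  by (auto simp: toggle_def)

lemma toggle_toggle [simp]: "toggle i (toggle i x) = x"
  by (auto simp: in_toggle_iff)

lemma toggle_commute: "toggle i (toggle j x) = toggle j (toggle i x)"
  by (auto simp: in_toggle_iff)

lemma word_ok_append [simp]: "word_ok n x (u @ w) \<longleftrightarrow> word_ok n x u \<and> word_ok n (run x u) w"
  by (induction u arbitrary: x) auto

lemma arrows_append [simp]: "arrows x (u @ w) = arrows x u @ arrows (run x u) w"
  by (induction u arbitrary: x) auto

lemma run_Us [simp]: "run x (Us w) = x"
  by (induction w) auto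

lemma word_ok_Us [simp]: "word_ok n x (Us w) \<longleftrightarrow> set w \<subseteq> {1..n}"
  by (induction w) auto

lemma word_ok_Cs_range: "word_ok n x (Cs r) \<Longrightarrow> set r \<subseteq> {1..n}"
  by (induction r arbitrary: x) auto

text \<open>The position j is an end of the edges j and j + 1 only, and each edge is crossed at most
  once.\<close>

lemma in_run_Cs_iff:
  assumes "distinct r" "0 \<notin> set r"
  shows "j \<in> run x (Cs r) \<longleftrightarrow> (j \<in> x) \<noteq> ((j \<in> set r) \<noteq> (Suc j \<in> set r))"
  using assms
proof (induction r arbitrary: x)
  case (Cons i r)
  have "0 < i" using Cons.prems by auto
  then show ?case using Cons.prems by (auto simp: Cons.IH in_toggle_iff)
qed simp

lemma toggle_osz_V:
  assumes "x \<in> osz_V n k" "1 \<le> i" "i \<le> n" "(i - 1 \<in> x) \<noteq> (i \<in> x)"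
  shows "toggle i x \<in> osz_V n k"
proof -
  have fin: "finite x" using assms(1) finite_subset by (auto simp: osz_V_def)
  have "card (toggle i x) = card x"
  proof (cases "i \<in> x")
    case True
    then have "toggle i x = insert (i - 1) (x - {i})" using assms by (auto simp: in_toggle_iff)
    also have "card \<dots> = Suc (card (x - {i}))"
      using True assms fin by (subst card_insert_disjoint) auto
    also have "\<dots> = card x" using True by (rule card_Suc_Diff1[OF fin])
    finally show ?thesis .
  next
    case False
    then have "toggle i x = insert i (x - {i - 1})" using assms by (auto simp: in_toggle_iff)
    also have "card \<dots> = Suc (card (x - {i - 1}))"
      using False assms fin by (subst card_insert_disjoint) auto
    also have "\<dots> = card x" using False assms(4) by (intro card_Suc_Diff1[OF fin]) auto
    finally show ?thesis .
  qed
  moreover have "\<forall>j\<in>x. j \<le> n" using assms(1) by (auto simp: osz_V_def)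
  then have "toggle i x \<subseteq> {0..n}" using assms(2,3) by (auto simp: in_toggle_iff)
  ultimately show ?thesis using assms by (simp add: osz_V_def)
qed

lemma step_osz_V: "x \<in> osz_V n k \<Longrightarrow> letter_ok n x l \<Longrightarrow> step x l \<in> osz_V n k"
  by (cases l) (auto simp: toggle_osz_V)

lemma run_osz_V: "x \<in> osz_V n k \<Longrightarrow> word_ok n x w \<Longrightarrow> run x w \<in> osz_V n k"
  by (induction w arbitrary: x) (auto simp: step_osz_V)

lemma arrow_in_arcs:
  assumes "x \<in> osz_V n k" "letter_ok n x l"
  shows "arrow x l \<in> arcs (osz_quiver n k)"
proof -
  obtain c i where l: "l = (c, i)" by fastforce
  show ?thesis
  proof (cases c)
    case False
    then show ?thesis using assms by (auto simp: osz_quiver_def l)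
  next
    case True
    have i: "1 \<le> i" "i \<le> n" "(i - 1 \<in> x) \<noteq> (i \<in> x)" using assms True by (auto simp: l)
    then have V: "toggle i x \<in> osz_V n k" by (intro toggle_osz_V assms(1))
    show ?thesis
    proof (cases "i - 1 \<in> x")
      case R: True
      then have "x \<inter> {i - 1, i} = {i - 1}" "toggle i x = insert i (x - {i - 1})"
        using i by (auto simp: in_toggle_iff)
      then show ?thesis using True R V assms(1) i by (auto simp: osz_quiver_def l)
    next
      case L: False
      then have "toggle i x \<inter> {i - 1, i} = {i - 1}" "x = insert i (toggle i x - {i - 1})"
        using i by (auto simp: in_toggle_iff)
      then show ?thesis using True L V assms(1) i by (auto simp: osz_quiver_def l)
    qed
  qed
qed

lemma inter_pair:
  assumes "x \<inter> {i - 1, i} = {i - 1}" "1 \<le> (i :: nat)"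
  shows "i - 1 \<in> x" "i \<notin> x"
proof -
  have "i - 1 \<in> x \<inter> {i - 1, i}" unfolding assms(1) by simp
  then show "i - 1 \<in> x" by simp
  show "i \<notin> x"
  proof
    assume "i \<in> x"
    then have "i \<in> x \<inter> {i - 1, i}" by simp
    then have "i = i - 1" unfolding assms(1) by simp
    then show False using assms(2) by simp
  qed
qed

lemma arc_is_arrow:
  assumes "a \<in> arcs (osz_quiver n k)"
  obtains x l where "x \<in> osz_V n k" "letter_ok n x l" "a = arrow x l"
proof -
  consider (R) i x where "a = (OR i, x, insert i (x - {i - 1}))" "i \<in> {1..n}" "x \<in> osz_V n k"
      "x \<inter> {i - 1, i} = {i - 1}"
    | (L) i x where "a = (OL i, insert i (x - {i - 1}), x)" "i \<in> {1..n}"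
      "insert i (x - {i - 1}) \<in> osz_V n k" "x \<inter> {i - 1, i} = {i - 1}"
    | (U) i x where "a = (OU i, x, x)" "i \<in> {1..n}" "x \<in> osz_V n k"
    using assms unfolding osz_quiver_def by auto
  then show thesis
  proof cases
    case R
    have x: "i - 1 \<in> x" "i \<notin> x"
      by (rule inter_pair[OF R(4)], use R(2) in simp)+
    have "toggle i x = insert i (x - {i - 1})" unfolding set_eq_iff in_toggle_iff using x by auto
    then show ?thesis using R(1-3) x by (intro that[of x "(True, i)"]) simp_all
  next
    case L
    have x: "i - 1 \<in> x" "i \<notin> x"
      by (rule inter_pair[OF L(4)], use L(2) in simp)+
    let ?y = "insert i (x - {i - 1})"
    have "toggle i ?y = x" unfolding set_eq_iff in_toggle_iff using x by auto
    moreover have "i - 1 \<noteq> i" using L(2) by auto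
    ultimately show ?thesis using L(1-3) x by (intro that[of ?y "(True, i)"]) simp_all
  next
    case U
    then show ?thesis by (intro that[of x "(False, i)"]) auto
  qed
qed

lemma verts_osz_quiver [simp]: "verts (osz_quiver n k) = osz_V n k"
  by (simp add: osz_quiver_def)

lemma tail_arrow [simp]: "tail (osz_quiver n k) (arrow x l) = x"
  and head_arrow [simp]: "head (osz_quiver n k) (arrow x l) = step x l"
  by (cases l; simp add: osz_quiver_def)+

lemma finite_osz_V [simp]: "finite (osz_V n k)"
  by (rule finite_subset[of _ "Pow {0..n}"]) (auto simp: osz_V_def)

interpretation osz: wf_digraph "osz_quiver n k" for n k
proof
  fix a assume "a \<in> arcs (osz_quiver n k)"
  then obtain x l where "x \<in> osz_V n k" "letter_ok n x l" "a = arrow x l" by (rule arc_is_arrow)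
  then show "tail (osz_quiver n k) a \<in> verts (osz_quiver n k)"
    and "head (osz_quiver n k) a \<in> verts (osz_quiver n k)"
    by (auto simp: step_osz_V simp del: step.simps)
qed

lemma awalk_wpath:
  assumes "x \<in> osz_V n k" "word_ok n x w"
  shows "osz.awalk n k x (arrows x w) (run x w)"
  using assms
proof (induction w arbitrary: x)
  case (Cons l w)
  then show ?case
    by (simp add: osz.awalk_Cons_iff arrow_in_arcs step_osz_V)
qed (simp add: osz.awalk_Nil_iff)

text \<open>At a given state the edge and the kind of a letter determine the arrow, since at most
  one direction of crossing is possible. Hence all questions about walks become questions about
  lists of letters with a starting state.\<close>

lemma awalk_is_wpath:
  assumes "osz.awalk n k x p y"
  obtains w where "x \<in> osz_V n k" "word_ok n x w" "(x, p, y) = wpath x w"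
proof -
  have "\<exists>w. x \<in> osz_V n k \<and> word_ok n x w \<and> p = arrows x w \<and> y = run x w"
    using assms
  proof (induction p arbitrary: x)
    case Nil
    then show ?case by (intro exI[of _ "[]"]) (auto simp: osz.awalk_Nil_iff)
  next
    case (Cons a p)
    then have a: "a \<in> arcs (osz_quiver n k)" "tail (osz_quiver n k) a = x"
      "osz.awalk n k (head (osz_quiver n k) a) p y"
      by (auto simp: osz.awalk_Cons_iff)
    from a(1) obtain x' l where l: "x' \<in> osz_V n k" "letter_ok n x' l" "a = arrow x' l"
      by (rule arc_is_arrow)
    then have x': "x' = x" using a(2) by simp
    obtain w where "word_ok n (step x l) w" "p = arrows (step x l) w" "y = run (step x l) w"
      using Cons.IH[of "step x l"] a(3) l x' by auto
    then show ?case using l x' by (intro exI[of _ "l # w"]) auto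
  qed
  then show thesis using that by (auto simp: wpath_def)
qed

fun letter_degree :: "letter \<Rightarrow> nat \<Rightarrow> int" where
  "letter_degree (c, i) j = (if c then 1 else 2) * of_bool (j = i)"

definition word_degree :: "letter list \<Rightarrow> nat \<Rightarrow> int" where
  "word_degree w j = (\<Sum>l\<leftarrow>w. letter_degree l j)"

lemma word_degree_simps [simp]:
  "word_degree [] j = 0"
  "word_degree (l # w) j = letter_degree l j + word_degree w j"
  "word_degree (u @ w) j = word_degree u j + word_degree w j"
  by (auto simp: word_degree_def)

lemma osz_degree_arrows [simp]: "osz_degree (arrows x w) = word_degree w"
proof
  fix j
  have "osz_label_degree (fst (arrow x l)) j = letter_degree l j" for x l
    by (cases l) auto
  then show "osz_degree (arrows x w) j = word_degree w j"
    by (induction w arbitrary: x) (auto simp: osz_degree_def)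
qed

lemma word_degree_nonneg: "0 \<le> word_degree w j"
  by (induction w) auto

lemma word_degree_pos_iff: "0 < word_degree w j \<longleftrightarrow> j \<in> snd ` set w"
proof (induction w)
  case (Cons l w)
  obtain c i where "l = (c, i)" by fastforce
  then show ?case using Cons word_degree_nonneg[of w j] by auto
qed simp

lemma word_degree_Us: "word_degree (Us us) j = 2 * int (count (mset us) j)"
  by (induction us) auto

lemma word_degree_Cs: "distinct r \<Longrightarrow> word_degree (Cs r) j = of_bool (j \<in> set r)"
  by (induction r) auto


section \<open>Congruence of words modulo the ideal of relations\<close>

section \<open>Relations between words\<close>

abbreviation osz_PA :: "nat \<Rightarrow> nat \<Rightarrow> ((nat set, osz_arrow) qpath \<Rightarrow> int) ring" where
  "osz_PA n k \<equiv> path_algebra (osz_quiver n k)"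

lemma ring_osz_PA: "ring (osz_PA n k)"
  by (rule osz.PA_ring) simp

lemma osz_PA_minus:
  "f \<in> carrier (osz_PA n k) \<Longrightarrow> g \<in> carrier (osz_PA n k) \<Longrightarrow> f \<ominus>\<^bsub>osz_PA n k\<^esub> g = (\<lambda>r. f r - g r)"
  by (rule osz.PA_minus) simp_all

lemma path_elem_closed: "osz.awalk n k x p y \<Longrightarrow> path_elem (x, p, y) \<in> carrier (osz_PA n k)"
  by (simp add: carrier_path_algebra)

lemma osz_relators_closed: "osz_relators n k \<subseteq> carrier (osz_PA n k)"
proof -
  interpret ring "osz_PA n k" by (rule ring_osz_PA)
  have "osz.awalk n k x [(OU i, x, x)] x" if "i \<in> {1..n}" "x \<in> osz_V n k" for i x
    using awalk_wpath[of x n k "[(False, i)]"] that by simp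
  then show ?thesis
    by (auto simp: osz_relators_def Let_def intro!: minus_closed path_elem_closed)
qed

lemma ideal_osz: "ideal (osz_ideal n k) (osz_PA n k)"
  unfolding osz_ideal_def by (rule ring.genideal_ideal[OF ring_osz_PA osz_relators_closed])

lemma relators_in_osz_ideal: "osz_relators n k \<subseteq> osz_ideal n k"
  unfolding osz_ideal_def by (rule ring.genideal_self[OF ring_osz_PA osz_relators_closed])

definition word :: "nat \<Rightarrow> nat \<Rightarrow> nat set \<Rightarrow> letter list \<Rightarrow> bool" where
  "word n k x w \<longleftrightarrow> x \<in> osz_V n k \<and> word_ok n x w"

definition elem :: "nat set \<Rightarrow> letter list \<Rightarrow> (nat set, osz_arrow) qpath \<Rightarrow> int" where
  "elem x w = path_elem (wpath x w)"

text \<open>Validity of both words and equality of their end states are part of the congruence, so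
  that each rewriting step also shows that its result is a path and can be continued by the same
  words.\<close>

definition weq :: "nat \<Rightarrow> nat \<Rightarrow> nat set \<Rightarrow> letter list \<Rightarrow> letter list \<Rightarrow> bool" where
  "weq n k x w w' \<longleftrightarrow> word n k x w \<and> word n k x w' \<and> run x w = run x w' \<and>
     elem x w \<ominus>\<^bsub>osz_PA n k\<^esub> elem x w' \<in> osz_ideal n k"

definition wnul :: "nat \<Rightarrow> nat \<Rightarrow> nat set \<Rightarrow> letter list \<Rightarrow> bool" where
  "wnul n k x w \<longleftrightarrow> word n k x w \<and> elem x w \<in> osz_ideal n k"

context
  fixes n k :: nat
begin

interpretation PA: ring "osz_PA n k" by (rule ring_osz_PA)
interpretation I: ideal "osz_ideal n k" "osz_PA n k" by (rule ideal_osz)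

lemma elem_closed: "word n k x w \<Longrightarrow> elem x w \<in> carrier (osz_PA n k)"
  unfolding elem_def wpath_def word_def by (intro path_elem_closed awalk_wpath) auto

lemma elem_append:
  assumes "word n k x (u @ w)"
  shows "elem x (u @ w) = elem x u \<otimes>\<^bsub>osz_PA n k\<^esub> elem (run x u) w"
proof -
  have "osz.awalk n k x (arrows x u) (run x u)"
    "osz.awalk n k (run x u) (arrows (run x u) w) (run (run x u) w)"
    using assms by (auto simp: word_def intro!: awalk_wpath run_osz_V)
  from osz.path_elem_mult[OF this] show ?thesis by (simp add: elem_def wpath_def)
qed

lemma word_append: "word n k x (u @ w) \<longleftrightarrow> word n k x u \<and> word n k (run x u) w"
  by (auto simp: word_def run_osz_V)

lemma weq_refl: "word n k x w \<Longrightarrow> weq n k x w w"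
  unfolding weq_def using elem_closed[of x w] I.zero_closed
  by (simp add: PA.r_neg a_minus_def del: path_algebra_zero path_algebra_add)

lemma weq_sym: "weq n k x w w' \<Longrightarrow> weq n k x w' w"
proof -
  assume a: "weq n k x w w'"
  have "elem x w' \<ominus>\<^bsub>osz_PA n k\<^esub> elem x w = \<ominus>\<^bsub>osz_PA n k\<^esub> (elem x w \<ominus>\<^bsub>osz_PA n k\<^esub> elem x w')"
    using a by (simp add: weq_def elem_closed PA.minus_add PA.minus_minus a_minus_def PA.a_comm
        del: path_algebra_zero path_algebra_add)
  then show ?thesis using a I.a_inv_closed by (auto simp: weq_def)
qed

lemma weq_trans [trans]: 
  assumes "weq n k x u v" "weq n k x v w" shows "weq n k x u w"
proof -
  have "elem x u \<ominus>\<^bsub>osz_PA n k\<^esub> elem x w =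
      (elem x u \<ominus>\<^bsub>osz_PA n k\<^esub> elem x v) \<oplus>\<^bsub>osz_PA n k\<^esub> (elem x v \<ominus>\<^bsub>osz_PA n k\<^esub> elem x w)"
    using assms by (simp add: weq_def elem_closed osz_PA_minus)
  then show ?thesis using assms I.a_closed unfolding weq_def by metis
qed

text \<open>The ideal is two-sided, and since both words end at the same state, the suffix
  \<open>v\<close> fits after either.\<close>

lemma weq_ctx:
  assumes "word n k x u" "weq n k (run x u) w w'" "word n k (run (run x u) w) v"
  shows "weq n k x (u @ w @ v) (u @ w' @ v)"
proof -
  let ?y = "run x u" and ?R = "osz_PA n k"
  have w: "word n k ?y w" "word n k ?y w'" "run ?y w = run ?y w'" using assms by (auto simp: weq_def)
  have 1: "word n k x (u @ w @ v)" "word n k x (u @ w' @ v)"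
    using assms w by (simp_all add: word_append)
  have e: "elem x (u @ w @ v) = elem x u \<otimes>\<^bsub>?R\<^esub> (elem ?y w \<otimes>\<^bsub>?R\<^esub> elem (run ?y w) v)"
    "elem x (u @ w' @ v) = elem x u \<otimes>\<^bsub>?R\<^esub> (elem ?y w' \<otimes>\<^bsub>?R\<^esub> elem (run ?y w) v)"
    using 1 w by (simp_all add: elem_append word_append)
  have c: "elem x u \<in> carrier ?R" "elem ?y w \<in> carrier ?R" "elem ?y w' \<in> carrier ?R"
    "elem (run ?y w) v \<in> carrier ?R"
    using assms w by (simp_all add: elem_closed)
  have "elem x (u @ w @ v) \<ominus>\<^bsub>?R\<^esub> elem x (u @ w' @ v) =
      elem x u \<otimes>\<^bsub>?R\<^esub> ((elem ?y w \<ominus>\<^bsub>?R\<^esub> elem ?y w') \<otimes>\<^bsub>?R\<^esub> elem (run ?y w) v)"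
    using c unfolding e a_minus_def
    by (simp add: PA.l_distr PA.r_distr PA.l_minus PA.r_minus del: path_algebra_zero path_algebra_add)
  also have "\<dots> \<in> osz_ideal n k"
    using assms(2) c by (intro I.I_l_closed I.I_r_closed) (auto simp: weq_def)
  finally show ?thesis using 1 w by (simp add: weq_def)
qed

lemma wnul_ctx:
  assumes "word n k x u" "wnul n k (run x u) w" "word n k (run (run x u) w) v"
  shows "wnul n k x (u @ w @ v)"
proof -
  have 1: "word n k x (u @ w @ v)" using assms by (simp add: word_append wnul_def)
  then have "elem x (u @ w @ v) = elem x u \<otimes>\<^bsub>osz_PA n k\<^esub>
      (elem (run x u) w \<otimes>\<^bsub>osz_PA n k\<^esub> elem (run (run x u) w) v)"
    by (simp add: elem_append word_append)
  also have "\<dots> \<in> osz_ideal n k"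
    using assms by (intro I.I_l_closed I.I_r_closed) (auto simp: wnul_def elem_closed)
  finally show ?thesis using 1 by (simp add: wnul_def)
qed

lemma wnul_weq:
  assumes "weq n k x w w'" "wnul n k x w'"
  shows "wnul n k x w"
proof -
  have "elem x w = (elem x w \<ominus>\<^bsub>osz_PA n k\<^esub> elem x w') \<oplus>\<^bsub>osz_PA n k\<^esub> elem x w'"
    using assms by (simp add: weq_def elem_closed osz_PA_minus)
  then show ?thesis using assms I.a_closed unfolding weq_def wnul_def by metis
qed

lemma weq_word: "weq n k x w w' \<Longrightarrow> word n k x w" "weq n k x w w' \<Longrightarrow> word n k x w'"
  "weq n k x w w' \<Longrightarrow> run x w = run x w'"
  by (auto simp: weq_def)

lemma osz_equal_wordsI:
  "([OR i, OU j], [OU j, OR i]) \<in> osz_equal_words"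
  "([OL i, OU j], [OU j, OL i]) \<in> osz_equal_words"
  "([OU i, OU j], [OU j, OU i]) \<in> osz_equal_words"
  "([OR i, OL i], [OU i]) \<in> osz_equal_words"
  "([OL i, OR i], [OU i]) \<in> osz_equal_words"
  "\<bar>int i - int j\<bar> > 1 \<Longrightarrow> ([OR i, OR j], [OR j, OR i]) \<in> osz_equal_words"
  "\<bar>int i - int j\<bar> > 1 \<Longrightarrow> ([OL i, OL j], [OL j, OL i]) \<in> osz_equal_words"
  "\<bar>int i - int j\<bar> > 1 \<Longrightarrow> ([OL i, OR j], [OR j, OL i]) \<in> osz_equal_words"
  unfolding osz_equal_words_def Un_iff mem_Collect_eq by blast+

lemma osz_zero_wordsI:
  "[OR i, OR (Suc i)] \<in> osz_zero_words" "[OL (Suc i), OL i] \<in> osz_zero_words"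
  unfolding osz_zero_words_def by blast+

lemma weq_relator:
  assumes "word n k x w" "word n k x w'" "run x w = run x w'"
    "(map fst (arrows x w), map fst (arrows x w')) \<in> osz_equal_words"
  shows "weq n k x w w'"
proof -
  have "elem x w \<ominus>\<^bsub>osz_PA n k\<^esub> elem x w' \<in> osz_relators n k"
    unfolding osz_relators_def Let_def elem_def wpath_def assms(3)[symmetric]
    by (rule UnI1, rule UnI1, rule CollectI, intro exI conjI, rule refl)
      (use assms awalk_wpath[of x n k w] awalk_wpath[of x n k w'] in \<open>simp_all add: word_def\<close>)
  then show ?thesis using relators_in_osz_ideal assms by (auto simp: weq_def)
qed

lemma wnul_relator:
  assumes "word n k x w" "map fst (arrows x w) \<in> osz_zero_words"
  shows "wnul n k x w"
proof -
  have "elem x w \<in> osz_relators n k"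
    unfolding osz_relators_def Let_def elem_def wpath_def
    by (rule UnI1, rule UnI2, rule CollectI, intro exI conjI, rule refl)
      (use assms awalk_wpath[of x n k w] in \<open>simp_all add: word_def\<close>)
  then show ?thesis using relators_in_osz_ideal assms by (auto simp: wnul_def)
qed

lemma weq_UU:
  assumes "word n k x [(False, i), (False, j)]"
  shows "weq n k x [(False, i), (False, j)] [(False, j), (False, i)]"
  by (rule weq_relator) (use assms in \<open>simp_all add: word_def osz_equal_wordsI\<close>)

lemma weq_CU:
  assumes "word n k x [(True, i), (False, j)]"
  shows "weq n k x [(True, i), (False, j)] [(False, j), (True, i)]"
  by (rule weq_relator) (use assms in \<open>simp_all add: word_def osz_equal_wordsI\<close>)

text \<open>Edges at distance greater than 1 have no end in common, so crossing one changes neither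
  the legality nor the direction of crossing the other.\<close>

lemma word_commute:
  assumes "word n k x [(True, i), (True, j)]" "\<bar>int i - int j\<bar> > 1"
  shows "word n k x [(True, j), (True, i)]"
    and "run x [(True, i), (True, j)] = run x [(True, j), (True, i)]"
    and "j - 1 \<in> toggle i x \<longleftrightarrow> j - 1 \<in> x" "i - 1 \<in> toggle j x \<longleftrightarrow> i - 1 \<in> x"
proof -
  have ij: "1 \<le> i" "1 \<le> j" "i \<le> n" "j \<le> n" using assms(1) by (simp_all add: word_def)
  then have d: "j \<noteq> i" "i \<noteq> j" "j \<noteq> i - 1" "j - 1 \<noteq> i" "j - 1 \<noteq> i - 1" "i \<noteq> j - 1" "i - 1 \<noteq> j"
      "i - 1 \<noteq> j - 1"
    using assms(2) by linarith+
  show m: "j - 1 \<in> toggle i x \<longleftrightarrow> j - 1 \<in> x" "i - 1 \<in> toggle j x \<longleftrightarrow> i - 1 \<in> x"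
    by (simp_all only: in_toggle_iff d simp_thms)
  have m': "j \<in> toggle i x \<longleftrightarrow> j \<in> x" "i \<in> toggle j x \<longleftrightarrow> i \<in> x"
    by (simp_all only: in_toggle_iff d simp_thms)
  show "word n k x [(True, j), (True, i)]"
    using assms(1) ij by (simp only: word_def word_ok.simps letter_ok.simps step.simps if_True m m' simp_thms)
  show "run x [(True, i), (True, j)] = run x [(True, j), (True, i)]"
    by (simp add: toggle_commute[of i j])
qed

lemma weq_CC_commute:
  assumes "word n k x [(True, i), (True, j)]" "\<bar>int i - int j\<bar> > 1"
  shows "weq n k x [(True, i), (True, j)] [(True, j), (True, i)]"
proof -
  note w' = word_commute(1,2)[OF assms]
  have m: "j - 1 \<in> toggle i x \<longleftrightarrow> j - 1 \<in> x" "i - 1 \<in> toggle j x \<longleftrightarrow> i - 1 \<in> x"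
    by (rule word_commute[OF assms])+
  have l: "map fst (arrows x [(True, i), (True, j)]) =
      [if i - 1 \<in> x then OR i else OL i, if j - 1 \<in> x then OR j else OL j]"
    "map fst (arrows x [(True, j), (True, i)]) =
      [if j - 1 \<in> x then OR j else OL j, if i - 1 \<in> x then OR i else OL i]"
    by (simp_all only: arrows.simps arrow.simps step.simps m if_True list.map fst_conv)
  have d: "\<bar>int j - int i\<bar> > 1" using assms by simp
  show ?thesis
  \<comment> \<open>The commutation of L with R is listed with L first only; when the word starts
    with R and continues with L, the relation is read backwards.\<close>
  proof (cases "i - 1 \<notin> x \<or> j - 1 \<in> x")
    case True
    show ?thesis
    proof (rule weq_relator[OF assms(1) w'])
      show "(map fst (arrows x [(True, i), (True, j)]), map fst (arrows x [(True, j), (True, i)]))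
          \<in> osz_equal_words"
        unfolding l using True by (cases "i - 1 \<in> x"; cases "j - 1 \<in> x")
          (simp_all only: if_True if_False osz_equal_wordsI(6-8)[OF assms(2)] simp_thms)
    qed
  next
    case False
    show ?thesis
    proof (rule weq_sym, rule weq_relator[OF w'(1) assms(1) w'(2)[symmetric]])
      show "(map fst (arrows x [(True, j), (True, i)]), map fst (arrows x [(True, i), (True, j)]))
          \<in> osz_equal_words"
        unfolding l using False osz_equal_wordsI(8)[OF d] by simp
    qed
  qed
qed

lemma weq_CC_U:
  assumes "word n k x [(True, i)]"
  shows "weq n k x [(True, i), (True, i)] [(False, i)]"
  by (rule weq_relator)
    (use assms in \<open>auto simp: word_def osz_equal_wordsI in_toggle_iff\<close>)

lemma wnul_right:
  assumes "word n k x [(True, i), (True, Suc i)]" "i - 1 \<in> x" "i \<notin> x"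
  shows "wnul n k x [(True, i), (True, Suc i)]"
  by (rule wnul_relator)
    (use assms in \<open>auto simp: word_def osz_zero_wordsI in_toggle_iff\<close>)

lemma wnul_left:
  assumes "word n k x [(True, Suc i), (True, i)]" "Suc i \<in> x" "i \<notin> x"
  shows "wnul n k x [(True, Suc i), (True, i)]"
  by (rule wnul_relator)
    (use assms in \<open>auto simp: word_def osz_zero_wordsI in_toggle_iff\<close>)

lemma wnul_U:
  assumes "x \<in> osz_V n k" "1 \<le> i" "i \<le> n" "i - 1 \<notin> x" "i \<notin> x"
  shows "wnul n k x [(False, i)]"
proof -
  have "elem x [(False, i)] \<in> osz_relators n k"
    unfolding osz_relators_def Let_def elem_def wpath_def
    by (rule UnI2, rule CollectI, rule exI[of _ i], rule exI[of _ x]) (use assms in auto)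
  then show ?thesis using relators_in_osz_ideal assms by (auto simp: wnul_def word_def)
qed

end

section \<open>Rewriting words: normal forms, uniqueness in each degree, vanishing\<close>

section \<open>Normal forms of words\<close>

lemma in_run_Cs_unaffected:
  "j \<notin> set t \<Longrightarrow> Suc j \<notin> set t \<Longrightarrow> j \<in> run x (Cs t) \<longleftrightarrow> j \<in> x"
proof (induction t arbitrary: x)
  case (Cons a t)
  then have "j \<noteq> a \<and> j \<noteq> a - 1" by (cases a) auto
  then show ?case using Cons by (simp add: in_toggle_iff)
qed simp

context
  fixes n k :: nat
begin

lemma weq_pre: "word n k x u \<Longrightarrow> weq n k (run x u) w w' \<Longrightarrow> weq n k x (u @ w) (u @ w')"
  using weq_ctx[of n k x u w w' "[]"] weq_word[of n k "run x u" w w']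
  by (simp add: word_def run_osz_V)

lemma weq_post: "weq n k x w w' \<Longrightarrow> word n k (run x w) v \<Longrightarrow> weq n k x (w @ v) (w' @ v)"
  using weq_ctx[of n k x "[]" w w' v] weq_word[of n k x w w'] by (simp add: word_def)

lemma weq_Cons: "word n k x [l] \<Longrightarrow> weq n k (step x l) w w' \<Longrightarrow> weq n k x (l # w) (l # w')"
  using weq_pre[of x "[l]"] by simp

lemma wnul_pre: "word n k x u \<Longrightarrow> wnul n k (run x u) w \<Longrightarrow> wnul n k x (u @ w)"
  using wnul_ctx[of n k x u w "[]"] by (simp add: word_def wnul_def run_osz_V)

lemma wnul_post: "wnul n k x w \<Longrightarrow> word n k (run x w) v \<Longrightarrow> wnul n k x (w @ v)"
  using wnul_ctx[of n k x "[]" w v] by (simp add: word_def wnul_def)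

lemma word_Cons: "word n k x (l # w) \<longleftrightarrow> word n k x [l] \<and> word n k (step x l) w"
  using word_append[of n k x "[l]" w] by simp

lemma weq_letter_U:
  assumes "word n k x [l, (False, j)]" shows "weq n k x [l, (False, j)] [(False, j), l]"
  using assms weq_CU[of n k x "snd l" j] weq_UU[of n k x "snd l" j]
  by (cases l; cases "fst l") auto

text \<open>Commutation with \<open>m\<close> is asked at every state, because the state at which
  \<open>m\<close> meets a letter changes while \<open>m\<close> moves to the front.\<close>

lemma weq_snoc_commute:
  assumes "word n k x (w @ [m])"
    and "\<And>y l. l \<in> set w \<Longrightarrow> word n k y [l, m] \<Longrightarrow> weq n k y [l, m] [m, l]"
  shows "weq n k x (w @ [m]) (m # w)"
  using assms
proof (induction w arbitrary: x)
  case Nil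
  then show ?case by (simp add: weq_refl)
next
  case (Cons l w)
  have w: "word n k x [l]" "word n k (step x l) (w @ [m])"
    using Cons.prems(1) word_Cons[of x l "w @ [m]"] by (simp_all only: append_Cons)
  have 1: "weq n k (step x l) (w @ [m]) (m # w)" using Cons.IH[OF w(2)] Cons.prems(2) by simp
  then have 2: "weq n k x (l # w @ [m]) (l # m # w)" by (intro weq_Cons w)
  have 3: "word n k x ([l, m] @ w)" using weq_word(2)[OF 2] by simp
  then have "weq n k x ([l, m] @ w) ([m, l] @ w)"
    by (intro weq_post Cons.prems(2)) (simp_all only: word_append list.set_intros)
  then show ?case using weq_trans[OF 2] by simp
qed

lemma weq_Cons_commute:
  assumes "word n k x (m # w)"
    and "\<And>y l. l \<in> set w \<Longrightarrow> word n k y [m, l] \<Longrightarrow> weq n k y [m, l] [l, m]"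
  shows "weq n k x (m # w) (w @ [m])"
  using assms
proof (induction w arbitrary: x)
  case Nil
  then show ?case by (simp add: weq_refl)
next
  case (Cons l w)
  have w: "word n k x ([m, l] @ w)" using Cons.prems(1) by simp
  then have 1: "weq n k x ([m, l] @ w) ([l, m] @ w)"
    by (intro weq_post Cons.prems(2)) (simp_all only: word_append list.set_intros)
  then have "word n k x (l # m # w)" using weq_word(2) by fastforce
  then have "word n k x [l]" "word n k (step x l) (m # w)"
      using word_Cons[of x l "m # w"] by simp_all
  then have "weq n k x (l # m # w) (l # w @ [m])"
    using Cons by (intro weq_Cons Cons.IH) auto
  then show ?case using weq_trans[OF 1] by simp
qed

lemma weq_U_front:
  assumes "word n k x (u @ (False, j) # v)"
  shows "weq n k x (u @ (False, j) # v) ((False, j) # u @ v)"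
proof -
  have w: "word n k x (u @ [(False, j)])" "word n k (run x (u @ [(False, j)])) v"
    using assms word_append[of n k x "u @ [(False, j)]" v] by simp_all
  have "weq n k x (u @ [(False, j)]) ((False, j) # u)"
    by (rule weq_snoc_commute[OF w(1)]) (rule weq_letter_U)
  from weq_post[OF this w(2)] show ?thesis by simp
qed

lemma weq_C_front:
  assumes "word n k x (Cs t @ (True, i) # v)" "\<And>j. j \<in> set t \<Longrightarrow> \<bar>int i - int j\<bar> > 1"
  shows "weq n k x (Cs t @ (True, i) # v) ((True, i) # Cs t @ v)"
proof -
  have w: "word n k x (Cs t @ [(True, i)])" "word n k (run x (Cs t @ [(True, i)])) v"
    using assms word_append[of n k x "Cs t @ [(True, i)]" v] by simp_all
  have "weq n k x (Cs t @ [(True, i)]) ((True, i) # Cs t)"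
    using assms(2) by (intro weq_snoc_commute[OF w(1)]) (force intro!: weq_CC_commute)
  from weq_post[OF this w(2)] show ?thesis by simp
qed

lemma weq_C_back:
  assumes "word n k x ((True, i) # Cs t @ v)" "\<And>j. j \<in> set t \<Longrightarrow> \<bar>int i - int j\<bar> > 1"
  shows "weq n k x ((True, i) # Cs t @ v) (Cs t @ (True, i) # v)"
proof -
  have w: "word n k x ((True, i) # Cs t)" "word n k (run x ((True, i) # Cs t)) v"
    using assms word_append[of n k x "(True, i) # Cs t" v] by simp_all
  have "weq n k x ((True, i) # Cs t) (Cs t @ [(True, i)])"
    using assms(2) by (intro weq_Cons_commute[OF w(1)]) (force intro!: weq_CC_commute)
  from weq_post[OF this w(2)] show ?thesis by simp
qed

lemma weq_Us_C:
  assumes "word n k x (Us us @ [(True, i)])"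
  shows "weq n k x (Us us @ [(True, i)]) ((True, i) # Us us)"
proof (rule weq_snoc_commute[OF assms])
  fix y l assume l: "l \<in> set (Us us)" and w: "word n k y [l, (True, i)]"
  then obtain j where j: "l = (False, j)" by auto
  have "word n k y [(True, i), (False, j)]" using w by (auto simp: j word_def)
  then show "weq n k y [l, (True, i)] [(True, i), l]" unfolding j by (rule weq_sym[OF weq_CU])
qed

text \<open>Only letters on different sides of \<open>P\<close> have to commute; the order within
  each side is kept.\<close>

lemma weq_filter:
  assumes "word n k x (Cs t)" "\<And>a b. a \<in> set t \<Longrightarrow> b \<in> set t \<Longrightarrow> P a \<Longrightarrow> \<not> P b \<Longrightarrow> \<bar>int b - int a\<bar> > 1"
  shows "weq n k x (Cs t) (Cs (filter P t) @ Cs (filter (\<lambda>a. \<not> P a) t))"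
  using assms
proof (induction t arbitrary: x)
  case Nil
  then show ?case by (simp add: weq_refl)
next
  case (Cons a t)
  let ?F = "filter P t" and ?N = "filter (\<lambda>a. \<not> P a) t"
  have w: "word n k x [(True, a)]" "word n k (step x (True, a)) (Cs t)"
    using Cons.prems(1) word_Cons[of x "(True, a)" "Cs t"] by simp_all
  have 1: "weq n k x ((True, a) # Cs t) ((True, a) # Cs ?F @ Cs ?N)"
    using Cons.prems(2) by (intro weq_Cons w Cons.IH) auto
  show ?case
  proof (cases "P a")
    case True
    then show ?thesis using 1 by simp
  next
    case False
    have "weq n k x ((True, a) # Cs ?F @ Cs ?N) (Cs ?F @ (True, a) # Cs ?N)"
      using False Cons.prems(2) weq_word(2)[OF 1] by (intro weq_C_back) auto
    then show ?thesis using False weq_trans[OF 1] by simp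
  qed
qed

text \<open>The crossing of i is moved right until it meets j. None of the passed letters touches
  the position i, so i is still crossed in the direction it had at \<open>x\<close>; this is what
  the condition on z records.\<close>

lemma wnul_slide:
  assumes "word n k x ((True, i) # Cs t @ (True, j) # v)" "\<And>a. a \<in> set t \<Longrightarrow> \<bar>int i - int a\<bar> > 1"
    and nul: "\<And>z. word n k z [(True, i), (True, j)] \<Longrightarrow> i \<in> z \<longleftrightarrow> i \<in> x \<Longrightarrow> wnul n k z [(True, i), (True, j)]"
  shows "wnul n k x ((True, i) # Cs t @ (True, j) # v)"
proof -
  have 1: "weq n k x ((True, i) # Cs t @ (True, j) # v) (Cs t @ [(True, i), (True, j)] @ v)"
    using weq_C_back[OF assms(1,2)] by simp
  then have w: "word n k x (Cs t)" "word n k (run x (Cs t)) [(True, i), (True, j)]"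
    "word n k (run (run x (Cs t)) [(True, i), (True, j)]) v"
    using weq_word(2)[OF 1] by (simp_all only: word_append)
  have "i \<notin> set t" "Suc i \<notin> set t" using assms(2)[of i] assms(2)[of "Suc i"] by auto
  then have "wnul n k (run x (Cs t)) [(True, i), (True, j)]"
    by (intro nul w in_run_Cs_unaffected)
  then show ?thesis by (intro wnul_weq[OF 1] wnul_ctx w)
qed

text \<open>If both neighbours of \<open>i\<close> are crossed after \<open>i\<close>, then one of them follows \<open>i\<close> in a forbidden
  way: sorting the remaining crossings into those above and those below \<open>i\<close> brings the two together.\<close>

lemma wnul_both_neighbours:
  assumes w: "word n k x ((True, i) # Cs t)" and d: "distinct t" "i \<notin> set t"
    and t: "i - 1 \<in> set t" "Suc i \<in> set t"
  shows "wnul n k x ((True, i) # Cs t)"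
proof -
  have ok: "word n k x [(True, i)]" "word n k (step x (True, i)) (Cs t)"
    using w word_Cons[of x "(True, i)" "Cs t"] by simp_all
  have i: "1 \<le> i" "(i - 1 \<in> x) \<noteq> (i \<in> x)" using ok(1) by (auto simp: word_def)
  \<comment> \<open>The direction decides which neighbour is forbidden next: if i is occupied, the
    crossing goes left and L_i L_(i-1) vanishes; otherwise it goes right and R_i R_(i+1) vanishes.
    \<open>P\<close> selects the side of this neighbour \<open>j\<close>, where nothing other than
    \<open>j\<close> is adjacent to i.\<close>
  define P where "P a \<longleftrightarrow> (if i \<in> x then a < i else i < a)" for a
  define j where "j = (if i \<in> x then i - 1 else Suc i)"
  have PN: "\<bar>int b - int a\<bar> > 1" if "a \<in> set t" "b \<in> set t" "P a" "\<not> P b" for a b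
  proof -
    have "b \<noteq> i" "a \<noteq> i" using that d by auto
    then show ?thesis using that(3,4) by (auto simp: P_def split: if_splits)
  qed
  have i1: "i - 1 < i" using i(1) by simp
  have "j \<in> set (filter P t)" using t i1 by (simp add: j_def P_def)
  then obtain t1 t2 where F: "filter P t = t1 @ j # t2" by (meson split_list)
  have dF: "distinct (filter P t)" using d by simp
  have t1: "\<bar>int i - int a\<bar> > 1" if "a \<in> set t1" for a
  proof -
    have "a \<in> set (filter P t)" "a \<noteq> j" using that dF unfolding F by auto
    then show ?thesis using i1 by (auto simp: P_def j_def split: if_splits)
  qed
  have 1: "weq n k x ((True, i) # Cs t)
      ((True, i) # Cs t1 @ (True, j) # Cs t2 @ Cs (filter (\<lambda>a. \<not> P a) t))"
    using weq_Cons[OF ok(1) weq_filter[of _ _ P, OF ok(2) PN]] unfolding F by simp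
  have "wnul n k x ((True, i) # Cs t1 @ (True, j) # Cs t2 @ Cs (filter (\<lambda>a. \<not> P a) t))"
  proof (rule wnul_slide[OF weq_word(2)[OF 1] t1])
    fix z assume z: "word n k z [(True, i), (True, j)]" "i \<in> z \<longleftrightarrow> i \<in> x"
    have iz: "(i - 1 \<in> z) \<noteq> (i \<in> z)" using z(1) by (simp add: word_def)
    show "wnul n k z [(True, i), (True, j)]"
    proof (cases "i \<in> x")
      case True
      have "Suc (i - 1) = i" using i(1) by simp
      then show ?thesis using wnul_left[of n k z "i - 1"] z iz True by (simp add: j_def)
    next
      case False
      then show ?thesis using wnul_right[of n k z i] z iz by (simp add: j_def)
    qed
  qed auto
  then show ?thesis by (rule wnul_weq[OF 1])
qed

lemma word_Cs_nz: "word n k x (Cs t) \<Longrightarrow> 0 \<notin> set t"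
  using word_ok_Cs_range[of n x t] by (auto simp: word_def)

text \<open>The edge i has exactly one occupied end both before and after the word, so its two ends
  have been changed equally often modulo 2. Besides i itself, the only edges at these ends are i - 1
  and i + 1.\<close>

lemma neighbours_iff:
  assumes w: "word n k x ((True, i) # Cs t)" and d: "distinct t" "i \<notin> set t"
    and e: "(i - 1 \<in> run x ((True, i) # Cs t)) \<noteq> (i \<in> run x ((True, i) # Cs t))"
  shows "i - 1 \<in> set t \<longleftrightarrow> Suc i \<in> set t"
proof -
  have ok: "word n k x [(True, i)]" "word n k (toggle i x) (Cs t)"
    using w word_Cons[of x "(True, i)" "Cs t"] by simp_all
  have i: "1 \<le> i" "(i - 1 \<in> x) \<noteq> (i \<in> x)" using ok(1) by (auto simp: word_def)
  have "Suc (i - 1) = i" using i by simp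
  then have "i - 1 \<in> run (toggle i x) (Cs t) \<longleftrightarrow> (i - 1 \<in> toggle i x) \<noteq> (i - 1 \<in> set t)"
    "i \<in> run (toggle i x) (Cs t) \<longleftrightarrow> (i \<in> toggle i x) \<noteq> (Suc i \<in> set t)"
    using in_run_Cs_iff[OF d(1) word_Cs_nz[OF ok(2)]] d(2) by auto
  then show ?thesis using e i(2) by (auto simp: in_toggle_iff)
qed

text \<open>The word is built up from the left. A new crossing i passes the letters U; if i occurs
  already, then by \<open>neighbours_iff\<close> either both neighbours were crossed in between and
  the word vanishes, or neither was, the two crossings of i meet, and they become U_i, which has the
  same degree.\<close>

lemma normal_form:
  assumes "word n k x w"
  shows "wnul n k x w \<or> (\<exists>r us. distinct r \<and> weq n k x w (Cs r @ Us us) \<and>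
    word_degree w = word_degree (Cs r @ Us us))"
  using assms
proof (induction w rule: rev_induct)
  case Nil
  have "weq n k x [] (Cs [] @ Us [])" using weq_refl[OF Nil] by simp
  then show ?case by (intro disjI2 exI[of _ "[]"]) simp
next
  case (snoc l w)
  obtain c i where l: "l = (c, i)" by fastforce
  have w: "word n k x w" "word n k (run x w) [l]" using snoc.prems by (simp_all only: word_append)
  from snoc.IH[OF w(1)] show ?case
  proof (elim disjE exE conjE)
    assume "wnul n k x w"
    then show ?thesis using wnul_post w by blast
  next
    fix r us assume r: "distinct r" "weq n k x w (Cs r @ Us us)"
      "word_degree w = word_degree (Cs r @ Us us)"
    have 1: "weq n k x (w @ [l]) (Cs r @ Us us @ [l])" using weq_post[OF r(2) w(2)] by simp
    have deg: "word_degree (w @ [l]) = word_degree (Cs r @ Us us @ [l])"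
      using r(3) by (auto simp: fun_eq_iff)
    show ?thesis
    proof (cases c)
      case False
      then show ?thesis using 1 r(1) deg l by (intro disjI2 exI[of _ r] exI[of _ "us @ [i]"]) simp
    next
      case c: True
      let ?y = "run x (Cs r)"
      have ww: "word n k x (Cs r)" "word n k ?y (Us us @ [(True, i)])"
        using weq_word(2)[OF 1] c l by (simp_all only: word_append)
      have 2: "weq n k x (w @ [l]) (Cs r @ (True, i) # Us us)"
        using weq_trans[OF 1] weq_pre[OF ww(1) weq_Us_C[OF ww(2)]] c l by simp
      show ?thesis
      proof (cases "i \<in> set r")
        case False
        then show ?thesis using 2 r(1) deg l c
          by (intro disjI2 exI[of _ "r @ [i]"] exI[of _ us]) (auto simp: fun_eq_iff)
      next
        case True
        then obtain r1 r2 where r12: "r = r1 @ i # r2" by (meson split_list)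
        let ?z = "run x (Cs r1)"
        have d: "distinct r2" "i \<notin> set r2" "distinct (r1 @ r2)" using r(1) r12 by auto
        have wz: "word n k x (Cs r1)" "word n k ?z ((True, i) # Cs r2)"
          "word n k (run ?z ((True, i) # Cs r2)) [(True, i)]"
          "word n k (run ?z ((True, i) # Cs r2 @ [(True, i)])) (Us us)"
          using weq_word(2)[OF 2]
            word_append[of n k x "Cs r1" "(True, i) # Cs r2 @ [(True, i)] @ Us us"]
            word_append[of n k ?z "(True, i) # Cs r2" "[(True, i)] @ Us us"]
            word_append[of n k ?z "(True, i) # Cs r2 @ [(True, i)]" "Us us"]
            word_append[of n k "run ?z ((True, i) # Cs r2)" "[(True, i)]" "Us us"]
          by (simp_all add: r12)
        have wz5: "word n k (run ?z ((True, i) # Cs r2)) ([(True, i)] @ Us us)"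
          using wz(3,4) unfolding word_append by simp
        have nb: "i - 1 \<in> set r2 \<longleftrightarrow> Suc i \<in> set r2"
          using neighbours_iff[OF wz(2) d(1,2)] wz(3) by (auto simp: word_def)
        show ?thesis
        proof (cases "Suc i \<in> set r2")
          case True
          have "wnul n k ?z ((True, i) # Cs r2)"
            using True nb by (intro wnul_both_neighbours wz d) auto
          then have "wnul n k x (Cs r1 @ ((True, i) # Cs r2) @ ([(True, i)] @ Us us))"
            by (intro wnul_ctx wz wz5)
          then show ?thesis using wnul_weq[OF 2] r12 by simp
        next
          case False
          have far: "\<bar>int i - int j\<bar> > 1" if "j \<in> set r2" for j
          proof -
            have "j \<noteq> i" "j \<noteq> i - 1" "j \<noteq> Suc i" using that False nb d by auto
            then show ?thesis by linarith
          qed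
          have w3: "word n k ?z ((True, i) # Cs r2 @ [(True, i)])"
            using wz word_append[of n k ?z "(True, i) # Cs r2" "[(True, i)]"] by simp
          have 3: "weq n k ?z ((True, i) # Cs r2 @ [(True, i)]) (Cs r2 @ [(True, i), (True, i)])"
            using weq_C_back[OF w3 far] by simp
          have w4: "word n k ?z (Cs r2)" "word n k (run ?z (Cs r2)) [(True, i)]"
            using weq_word(2)[OF 3] word_append[of n k ?z "Cs r2" "[(True, i), (True, i)]"]
              word_append[of n k "run ?z (Cs r2)" "[(True, i)]" "[(True, i)]"] by simp_all
          have 4: "weq n k ?z ((True, i) # Cs r2 @ [(True, i)]) (Cs r2 @ [(False, i)])"
            using weq_trans[OF 3] weq_pre[OF w4(1) weq_CC_U[OF w4(2)]] by simp
          have 5: "weq n k x (w @ [l]) (Cs (r1 @ r2) @ Us (i # us))"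
            using weq_trans[OF 2] weq_ctx[OF wz(1) 4 wz(4)] r12 by simp
          have "word_degree (w @ [l]) = word_degree (Cs (r1 @ r2) @ Us (i # us))"
            using deg r12 l c by (auto simp: fun_eq_iff)
          then show ?thesis using 5 d(3) by blast
        qed
      qed
    qed
  qed
qed

text \<open>The last crossing a of \<open>r\<close> is pulled to the end of \<open>r'\<close>. If
  both neighbours of a stand in its way, \<open>r'\<close> vanishes; if neither does, a commutes
  with all letters after it and the remaining words are compared by induction.\<close>

lemma weq_simple_words:
  assumes "word n k x (Cs r)" "word n k x (Cs r')" "distinct r" "distinct r'" "set r = set r'"
  shows "weq n k x (Cs r) (Cs r') \<or> wnul n k x (Cs r')"
  using assms
proof (induction r arbitrary: r' rule: rev_induct)
  case Nil
  then show ?case by (simp add: weq_refl)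
next
  case (snoc a r)
  have "a \<in> set r'" using snoc.prems(5) by auto
  then obtain r1 r2 where r12: "r' = r1 @ a # r2" by (meson split_list)
  let ?z = "run x (Cs r1)"
  have d: "distinct r2" "a \<notin> set r2" "distinct (r1 @ r2)" "a \<notin> set (r1 @ r2)" using snoc.prems r12 by auto
  have w: "word n k x (Cs r)" "word n k (run x (Cs r)) [(True, a)]"
    using snoc.prems(1) word_append[of n k x "Cs r" "[(True, a)]"] by simp_all
  have wz: "word n k x (Cs r1)" "word n k ?z ((True, a) # Cs r2)"
    using snoc.prems(2) word_append[of n k x "Cs r1" "(True, a) # Cs r2"] by (simp_all add: r12)
  have "run x (Cs (r @ [a])) = run x (Cs r')"
  proof -
    have r': "j \<in> set r' \<longleftrightarrow> j \<in> set (r @ [a])" for j using snoc.prems(5) by simp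
    have "j \<in> run x (Cs (r @ [a])) \<longleftrightarrow> j \<in> run x (Cs r')" for j
      using in_run_Cs_iff[OF snoc.prems(3) word_Cs_nz[OF snoc.prems(1)]]
        in_run_Cs_iff[OF snoc.prems(4) word_Cs_nz[OF snoc.prems(2)]]
      by (simp only: r')
    then show ?thesis by blast
  qed
  then have e: "run ?z ((True, a) # Cs r2) = toggle a (run x (Cs r))" by (simp add: r12)
  \<comment> \<open>Both words end at the same state, and from there a can be crossed back; so the
    criterion on the neighbours applies to the letters that follow a in \<open>r'\<close>.\<close>
  have "(a - 1 \<in> toggle a (run x (Cs r))) \<noteq> (a \<in> toggle a (run x (Cs r)))"
    using w(2) by (auto simp: word_def in_toggle_iff)
  then have nb: "a - 1 \<in> set r2 \<longleftrightarrow> Suc a \<in> set r2"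
    using neighbours_iff[OF wz(2) d(1,2)] unfolding e by blast
  show ?case
  proof (cases "Suc a \<in> set r2")
    case True
    have "wnul n k ?z ((True, a) # Cs r2)"
      using True nb by (intro wnul_both_neighbours wz d) auto
    then show ?thesis using wnul_pre[OF wz(1)] r12 by simp
  next
    case False
    have far: "\<bar>int a - int j\<bar> > 1" if "j \<in> set r2" for j
    proof -
      have "j \<noteq> a" "j \<noteq> a - 1" "j \<noteq> Suc a" using that False nb d by auto
      then show ?thesis by linarith
    qed
    have "weq n k ?z ((True, a) # Cs r2) (Cs r2 @ [(True, a)])"
      using weq_C_back[of ?z a r2 "[]", OF _ far] wz(2) by simp
    from weq_pre[OF wz(1) this] have 1: "weq n k x (Cs r') (Cs (r1 @ r2) @ [(True, a)])"
      by (simp add: r12)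
    then have w1: "word n k x (Cs (r1 @ r2))" "word n k (run x (Cs (r1 @ r2))) [(True, a)]"
      using weq_word(2)[OF 1] by (simp_all only: word_append)
    have "set r = set (r1 @ r2)" using snoc.prems(3,5) d r12 by auto
    from snoc.IH[OF w(1) w1(1) _ d(3) this] snoc.prems(3)
    consider "weq n k x (Cs r) (Cs (r1 @ r2))" | "wnul n k x (Cs (r1 @ r2))" by auto
    then show ?thesis
    proof cases
      case 1
      then show ?thesis using weq_trans[OF weq_post[OF 1 w(2)] weq_sym] \<open>weq n k x (Cs r') _\<close> by simp
    next
      case 2
      then show ?thesis using wnul_weq[OF \<open>weq n k x (Cs r') _\<close>] wnul_post[OF 2 w1(2)] by simp
    qed
  qed
qed

lemma weq_Us_perm:
  assumes "word n k x (Us us)" "mset us = mset us'"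
  shows "weq n k x (Us us) (Us us')"
  using assms
proof (induction us arbitrary: us')
  case Nil
  then show ?case by (simp add: weq_refl)
next
  case (Cons i us)
  have "i \<in> set us'" using Cons.prems(2) by (metis list.set_intros(1) set_mset_mset)
  then obtain p q where pq: "us' = p @ i # q" by (meson split_list)
  have w: "word n k x [(False, i)]" "word n k x (Us us)" using Cons.prems(1) by (simp_all add: word_def)
  have "weq n k x (Us us) (Us (p @ q))" using Cons.prems(2) pq by (intro Cons.IH w) simp
  then have 1: "weq n k x (Us (i # us)) ((False, i) # Us p @ Us q)" using weq_Cons[OF w(1)] by simp
  have "set us' = set (i # us)" using Cons.prems(2) by (metis set_mset_mset)
  then have "word n k x (Us us')" using Cons.prems(1) by (simp only: word_def word_ok_Us)
  then have "word n k x (Us p @ (False, i) # Us q)" using pq by simp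
  from weq_trans[OF 1 weq_sym[OF weq_U_front[OF this]]] show ?case by (simp add: pq)
qed

text \<open>Normal forms are determined by the degree up to order: the odd degrees are the distinct
  crossings, and what remains is twice the number of letters U at each edge.\<close>

lemma weq_same_degree:
  assumes w: "word n k x w" "word n k x w'" and deg: "word_degree w = word_degree w'"
    and nz: "\<not> wnul n k x w" "\<not> wnul n k x w'"
  shows "weq n k x w w'"
proof -
  obtain r us where r: "distinct r" "weq n k x w (Cs r @ Us us)" "word_degree w = word_degree (Cs r @ Us us)"
    using normal_form[OF w(1)] nz by blast
  obtain r' us' where r': "distinct r'" "weq n k x w' (Cs r' @ Us us')"
    "word_degree w' = word_degree (Cs r' @ Us us')"
    using normal_form[OF w(2)] nz by blast
  have e: "of_bool (j \<in> set r) + 2 * int (count (mset us) j) =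
      of_bool (j \<in> set r') + 2 * int (count (mset us') j)" for j
    using r(3) r'(3) deg r(1) r'(1) by (auto simp: fun_eq_iff word_degree_Us word_degree_Cs)
  have rr: "(j \<in> set r \<longleftrightarrow> j \<in> set r') \<and> count (mset us) j = count (mset us') j" for j
    using e[of j] by (cases "j \<in> set r"; cases "j \<in> set r'") (auto, presburger+)
  have s: "set r = set r'" "mset us = mset us'" using rr by (auto simp: multiset_eq_iff)
  have ww: "word n k x (Cs r)" "word n k (run x (Cs r)) (Us us)"
    "word n k x (Cs r')" "word n k (run x (Cs r')) (Us us')"
    using weq_word(2)[OF r(2)] weq_word(2)[OF r'(2)] by (simp_all only: word_append)
  have "\<not> wnul n k x (Cs r')" using nz(2) wnul_weq[OF r'(2)] wnul_post ww(4) by blast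
  then have 1: "weq n k x (Cs r) (Cs r')" using weq_simple_words ww r r' s by blast
  have "weq n k x (Cs r @ Us us) (Cs r' @ Us us)" by (rule weq_post[OF 1 ww(2)])
  also have "weq n k x (Cs r' @ Us us) (Cs r' @ Us us')"
    using ww weq_word(3)[OF 1] s(2) by (intro weq_pre weq_Us_perm) auto
  finally show ?thesis using weq_trans[OF r(2)] weq_trans[OF _ weq_sym[OF r'(2)]] by blast
qed

text \<open>Induction on the length of the gap between the holes a and b; a further hole in between
  gives a shorter gap at once. Otherwise the word is rewritten to start with a crossing of an end
  edge of the gap, which moves one hole inwards; if only letters U cover the gap, one of them is
  split into two crossings. In a gap of length one the word contains either a U at two empty
  positions or a forbidden pair of crossings.\<close>

lemma zero_word:
  assumes "word n k x (Cs r @ Us us)" "distinct r" "a < b" "a \<notin> x" "b \<notin> x"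
    "{a<..b} \<subseteq> set r \<union> set us"
  shows "wnul n k x (Cs r @ Us us)"
  using assms
proof (induction "b - a" arbitrary: a b x r us rule: less_induct)
  case less
  note w = less.prems(1) and d = less.prems(2) and ab = less.prems(3-5) and cover = less.prems(6)
  have wr: "word n k x (Cs r)" using w by (simp only: word_append)
  have xV: "x \<in> osz_V n k" using w by (simp add: word_def)
  show ?case
  proof (cases "\<exists>c. a < c \<and> c < b \<and> c \<notin> x")
    case True
    then obtain c where c: "a < c" "c < b" "c \<notin> x" by blast
    have "{a<..c} \<subseteq> {a<..b}" using c by auto
    then show ?thesis using c ab cover w d by (intro less.hyps[of c a]) auto
  next
    case False
    then have full: "c \<in> x" if "a < c" "c < b" for c using that by blast
    show ?thesis
    proof (cases "{a<..b} \<inter> set r = {}")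
      case True
      then have cov: "{a<..b} \<subseteq> set us" using cover by blast
      have "Suc a \<in> set us" using cov ab by auto
      then obtain p q where pq: "us = p @ Suc a # q" by (meson split_list)
      define w' where "w' = Cs r @ Us (p @ q)"
      have 1: "weq n k x (Cs r @ Us us) ((False, Suc a) # w')"
        using weq_U_front[of x "Cs r @ Us p" "Suc a" "Us q"] w by (simp add: pq w'_def)
      have w1: "word n k x [(False, Suc a)]" "word n k x w'"
        using weq_word(2)[OF 1] word_Cons[of x "(False, Suc a)" w'] by simp_all
      show ?thesis
      proof (cases "b = Suc a")
        case True
        have "wnul n k x [(False, Suc a)]"
          using w1(1) ab True by (intro wnul_U) (auto simp: word_def)
        then show ?thesis using wnul_weq[OF 1] wnul_post[of x "[(False, Suc a)]" w'] w1 by simp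
      next
        case False
        then have b: "Suc a < b" using ab by simp
        have w2: "word n k x [(True, Suc a)]" using w1(1) ab full[of "Suc a"] b by (auto simp: word_def)
        \<comment> \<open>The position a + 1 is occupied and a is not, so U at this edge is a double
          crossing. Its first half moves the hole from a to a + 1, its second half joins the
          crossings of \<open>r\<close>.\<close>
        have 2: "weq n k x ((False, Suc a) # w') ((True, Suc a) # (True, Suc a) # w')"
          using weq_post[OF weq_sym[OF weq_CC_U[OF w2]], of w'] w1(2) by simp
        let ?x = "toggle (Suc a) x"
        have w3: "word n k ?x (Cs (Suc a # r) @ Us (p @ q))"
          using weq_word(2)[OF 2] word_Cons[of x "(True, Suc a)" "(True, Suc a) # w'"]
          by (simp add: w'_def)
        have "wnul n k ?x (Cs (Suc a # r) @ Us (p @ q))"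
        proof (rule less.hyps[OF _ w3])
          show "b - Suc a < b - a" using b by simp
          have "Suc a \<in> {a<..b}" using ab by simp
          then show "distinct (Suc a # r)" using d True by auto
          show "Suc a \<notin> ?x" "b \<notin> ?x" using ab b full[of "Suc a"] by (auto simp: in_toggle_iff)
          have "{Suc a<..b} \<subseteq> {a<..b} - {Suc a}" by auto
          then show "{Suc a<..b} \<subseteq> set (Suc a # r) \<union> set (p @ q)" using cov pq by auto
        qed (rule b)
        then have "wnul n k x ((True, Suc a) # (True, Suc a) # w')"
          using wnul_pre[OF w2] by (simp add: w'_def)
        then show ?thesis using wnul_weq[OF 1] wnul_weq[OF 2] by blast
      qed
    next
      case False
      then have "\<exists>i\<in>set r. i \<in> {a<..b}" by blast
      then obtain r1 i r2 where r: "r = r1 @ i # r2" "i \<in> {a<..b}" "\<forall>j\<in>set r1. j \<notin> {a<..b}"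
        using split_list_first_prop[of r "\<lambda>i. i \<in> {a<..b}"] by blast
      let ?z = "run x (Cs r1)"
      have dr: "distinct r1" "i \<notin> set r1" "i \<notin> set r2" "distinct (r1 @ r2)" using d r by auto
      have w1: "word n k x (Cs r1)" "word n k ?z [(True, i)]" "word n k (run x (Cs r1 @ [(True, i)])) (Cs r2 @ Us us)"
        using w word_append[of n k x "Cs r1" "(True, i) # Cs r2 @ Us us"]
          word_Cons[of ?z "(True, i)" "Cs r2 @ Us us"] by (simp_all add: r)
      have iz: "1 \<le> i" "i \<le> n" "(i - 1 \<in> ?z) \<noteq> (i \<in> ?z)" using w1(2) by (auto simp: word_def)
      note mem = in_run_Cs_iff[OF dr(1) word_Cs_nz[OF w1(1)]]
      \<comment> \<open>If i commutes with everything crossed before it, it can be brought to the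
        front; the state after it has a shorter covered gap, from a' to b', which no longer needs
        the edge i.\<close>
      have front: "wnul n k x (Cs r @ Us us)"
        if far: "\<And>j. j \<in> set r1 \<Longrightarrow> \<bar>int i - int j\<bar> > 1"
          and ab': "b' - a' < b - a" "a' < b'" "a' \<notin> toggle i x" "b' \<notin> toggle i x"
            "{a'<..b'} \<subseteq> {a<..b} - {i}" for a' b'
      proof -
        have 1: "weq n k x (Cs r @ Us us) ((True, i) # Cs (r1 @ r2) @ Us us)"
          using weq_C_front[of x r1 i "Cs r2 @ Us us"] w far by (simp add: r)
        have w2: "word n k x [(True, i)]" "word n k (toggle i x) (Cs (r1 @ r2) @ Us us)"
          using weq_word(2)[OF 1] word_Cons[of x "(True, i)" "Cs (r1 @ r2) @ Us us"] by simp_all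
        have "{a'<..b'} \<subseteq> set (r1 @ r2) \<union> set us" using ab'(5) cover r by auto
        then have "wnul n k (toggle i x) (Cs (r1 @ r2) @ Us us)"
          using ab' w2 dr by (intro less.hyps[of b' a'])
        then show ?thesis using wnul_weq[OF 1] wnul_pre[OF w2(1)] by simp
      qed
      consider (eq) "i = b" "b = Suc a" | (R) "i = b" "Suc a < b" | (L) "i = Suc a" "Suc a < b"
        | (M) "Suc a < i" "i < b"
        using r(2) by force
      then show ?thesis
      proof cases
        case R
        have "b - 1 \<in> x" using R by (intro full) auto
        moreover have "b - 1 \<in> {a<..b}" "b \<in> {a<..b}" "Suc (b - 1) = b" using R by auto
        ultimately have "b - 1 \<in> ?z" using in_run_Cs_unaffected[of "b - 1" r1 x] r(3) by metis
        then have "b \<notin> ?z" using iz R by simp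
        \<comment> \<open>The position b is empty both at \<open>x\<close> and before the crossing
          of i = b; its only other edge is b + 1, so that edge has not been crossed so far.\<close>
        then have "Suc b \<notin> set r1" using mem[of b] ab dr R by auto
        then have far: "\<bar>int i - int j\<bar> > 1" if "j \<in> set r1" for j
        proof -
          have "j \<noteq> Suc b" using that \<open>Suc b \<notin> set r1\<close> by auto
          moreover have "j \<le> a \<or> b < j" using r(3) that by auto
          ultimately show ?thesis using R by linarith
        qed
        have "a \<notin> toggle i x" "b - 1 \<notin> toggle i x"
          using ab R \<open>b - 1 \<in> x\<close> by (auto simp: in_toggle_iff)
        then show ?thesis using R by (intro front[of "b - 1" a] far) auto
      next
        case L
        have "Suc a \<in> x" using L by (intro full) auto
        moreover have "Suc a \<in> {a<..b}" "Suc (Suc a) \<in> {a<..b}" using L by auto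
        ultimately have "Suc a \<in> ?z" using in_run_Cs_unaffected[of "Suc a" r1 x] r(3) by metis
        then have "a \<notin> ?z" using iz L by simp
        then have "a \<notin> set r1" using mem[of a] ab dr L by auto
        then have far: "\<bar>int i - int j\<bar> > 1" if "j \<in> set r1" for j
        proof -
          have "j \<noteq> a" using that \<open>a \<notin> set r1\<close> by auto
          moreover have "j \<le> a \<or> b < j" using r(3) that by auto
          ultimately show ?thesis using L by linarith
        qed
        have "Suc a \<notin> toggle i x" "b \<notin> toggle i x"
          using ab L \<open>Suc a \<in> x\<close> by (auto simp: in_toggle_iff)
        then show ?thesis using L by (intro front[of b "Suc a"] far) auto
      next
        case M
        \<comment> \<open>Both ends of an inner edge stay occupied until some edge of the gap is
          crossed, so an inner edge cannot be the first one crossed.\<close>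
        have "i \<in> x" "i - 1 \<in> x" using M by (auto intro: full)
        moreover have "i \<in> {a<..b}" "Suc i \<in> {a<..b}" "i - 1 \<in> {a<..b}" "Suc (i - 1) = i"
          using M by auto
        ultimately have "i \<in> ?z" "i - 1 \<in> ?z"
          using in_run_Cs_unaffected[of i r1 x] in_run_Cs_unaffected[of "i - 1" r1 x] r(3) by metis+
        then show ?thesis using iz by simp
      next
        case eq
        have "a \<in> ?z \<longleftrightarrow> a \<in> set r1" "b \<in> ?z \<longleftrightarrow> Suc b \<in> set r1"
          using mem[of a] mem[of b] ab dr eq by auto
        then have one: "(a \<in> set r1) \<noteq> (Suc b \<in> set r1)" using iz eq by auto
        \<comment> \<open>Both ends of the single edge i are empty at first. An element must
          therefore have arrived, at a over the edge a or at b over the edge b + 1; crossing i then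
          continues in the same direction, which is a zero relation once the two letters are
          adjacent.\<close>
        define c where "c = (if a \<in> set r1 then a else Suc b)"
        have "c \<in> set r1" using one by (auto simp: c_def)
        then obtain t1 t2 where t: "r1 = t1 @ c # t2" by (meson split_list)
        have far: "\<bar>int i - int j\<bar> > 1" if "j \<in> set t2" for j
        proof -
          have "j \<in> set r1" "j \<noteq> c" using that dr t by auto
          then have "j \<noteq> a" "j \<noteq> b" "j \<noteq> Suc b" using one dr eq by (auto simp: c_def split: if_splits)
          then show ?thesis using eq by linarith
        qed
        let ?y = "run x (Cs t1)"
        have wy: "word n k x (Cs t1)" "word n k ?y [(True, c)]"
          "word n k (step ?y (True, c)) (Cs t2 @ (True, i) # Cs r2 @ Us us)"
          using w word_append[of n k x "Cs t1" "(True, c) # Cs t2 @ (True, i) # Cs r2 @ Us us"]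
            word_Cons[of ?y "(True, c)" "Cs t2 @ (True, i) # Cs r2 @ Us us"] by (simp_all add: r t)
        have 1: "weq n k ?y ((True, c) # Cs t2 @ (True, i) # Cs r2 @ Us us)
            ((True, c) # (True, i) # Cs t2 @ Cs r2 @ Us us)"
          by (intro weq_Cons wy(2) weq_C_front wy(3) far)
        have w2: "word n k ?y [(True, c), (True, i)]"
          "word n k (run ?y [(True, c), (True, i)]) (Cs t2 @ Cs r2 @ Us us)"
          using weq_word(2)[OF 1] word_append[of n k ?y "[(True, c), (True, i)]" "Cs t2 @ Cs r2 @ Us us"]
          by simp_all
        have cy: "(c - 1 \<in> ?y) \<noteq> (c \<in> ?y)" using wy(2) by (simp add: word_def)
        have "b \<notin> set t1" "c \<notin> set t1" using dr eq t by auto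
        have "wnul n k ?y [(True, c), (True, i)]"
        proof (cases "a \<in> set r1")
          case True
          then have c: "c = a" by (simp add: c_def)
          have "a \<notin> ?y"
            using in_run_Cs_unaffected[of a t1 x] \<open>b \<notin> set t1\<close> \<open>c \<notin> set t1\<close> c eq ab by auto
          then show ?thesis using wnul_right[of n k ?y a] w2(1) cy eq c by simp
        next
          case False
          then have c: "c = Suc b" by (simp add: c_def)
          have "b \<notin> ?y"
            using in_run_Cs_unaffected[of b t1 x] \<open>b \<notin> set t1\<close> \<open>c \<notin> set t1\<close> c ab by auto
          then show ?thesis using wnul_left[of n k ?y b] w2(1) cy eq c by simp
        qed
        then have "wnul n k ?y ([(True, c), (True, i)] @ Cs t2 @ Cs r2 @ Us us)"
          by (rule wnul_post[OF _ w2(2)])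
        then have "wnul n k ?y ((True, c) # Cs t2 @ (True, i) # Cs r2 @ Us us)"
          using wnul_weq[OF 1] by simp
        from wnul_pre[OF wy(1) this] show ?thesis by (simp add: r t)
      qed
    qed
  qed
qed

end

text \<open>The condition for a path from \<open>x\<close> using exactly the edges in \<open>T\<close> to be nonzero.\<close>

definition live :: "nat \<Rightarrow> nat set \<Rightarrow> nat set \<Rightarrow> bool" where
  "live n x T \<longleftrightarrow> (\<forall>a b. a < b \<and> b \<le> n \<and> a \<notin> x \<and> b \<notin> x \<longrightarrow> \<not> {a<..b} \<subseteq> T)"

lemma live_antimono: "live n x T \<Longrightarrow> S \<subseteq> T \<Longrightarrow> live n x S"
  unfolding live_def by blast

text \<open>The normal form uses the same set of edges as the word, since this set is the support of
  the degree.\<close>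

lemma wnul_if_not_live:
  assumes w: "word n k x w" and "\<not> live n x (snd ` set w)"
  shows "wnul n k x w"
  using normal_form[OF w]
proof (elim disjE exE conjE)
  fix r us assume r: "distinct r" "weq n k x w (Cs r @ Us us)" "word_degree w = word_degree (Cs r @ Us us)"
  have "snd ` set w = {j. word_degree w j > 0}" by (simp only: word_degree_pos_iff Collect_mem_eq)
  also have "\<dots> = snd ` set (Cs r @ Us us)" unfolding r(3) by (simp only: word_degree_pos_iff Collect_mem_eq)
  also have "\<dots> = set r \<union> set us" by (simp add: image_Un image_image)
  finally obtain a b where "a < b" "a \<notin> x" "b \<notin> x" "{a<..b} \<subseteq> set r \<union> set us"
    using assms(2) unfolding live_def by blast
  then have "wnul n k x (Cs r @ Us us)" using weq_word(2)[OF r(2)] r(1) by (intro zero_word) auto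
  then show ?thesis by (rule wnul_weq[OF r(2)])
qed

text \<open>Crossing i moves one hole along an edge of \<open>T\<close>. An interval that ends at
  the moved hole gains or loses only the edge i, so a covered gap after the move yields one before
  it.\<close>

lemma live_toggle:
  assumes "live n x T" "1 \<le> i" "i \<in> T" "(i - 1 \<in> x) \<noteq> (i \<in> x)" "i \<le> n"
  shows "live n (toggle i x) T"
  unfolding live_def
proof (intro allI impI notI, elim conjE)
  fix a b assume ab: "a < b" "b \<le> n" "a \<notin> toggle i x" "b \<notin> toggle i x" "{a<..b} \<subseteq> T"
  have no: False if "a' < b'" "b' \<le> n" "a' \<notin> x" "b' \<notin> x" "{a'<..b'} \<subseteq> T" for a' b'
    using assms(1) that unfolding live_def by blast
  have i: "i - 1 < i" using assms(2) by simp
  consider "i - 1 \<in> x" "i \<notin> x" | "i - 1 \<notin> x" "i \<in> x" using assms(4) by blast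
  then show False
  proof cases
    case 1
    have t: "c \<notin> x \<or> c = i - 1" "c \<noteq> i" if "c \<notin> toggle i x" for c
      using that 1 i by (auto simp: in_toggle_iff)
    consider "a = i - 1" | "b = i - 1" | "a \<notin> x" "b \<notin> x" using t ab by blast
    then show ?thesis
    proof cases
      assume a: "a = i - 1"
      then have "i < b" using ab t(2)[OF ab(4)] by simp
      moreover have "{i<..b} \<subseteq> T" using ab(5) a i by auto
      moreover have "b \<notin> x" using t(1)[OF ab(4)] a ab by auto
      ultimately show False using no[of i b] ab 1 by simp
    next
      assume b: "b = i - 1"
      have "{a<..i} \<subseteq> insert i {a<..b}" using b by auto
      then have "{a<..i} \<subseteq> T" using ab(5) assms(3) by blast
      moreover have "a \<notin> x" using t(1)[OF ab(3)] b ab by auto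
      ultimately show False using no[of a i] ab 1 b i assms(5) by simp
    next
      assume "a \<notin> x" "b \<notin> x"
      then show False using no ab by blast
    qed
  next
    case 2
    have t: "c \<notin> x \<or> c = i" "c \<noteq> i - 1" if "c \<notin> toggle i x" for c
      using that 2 i by (auto simp: in_toggle_iff)
    consider "a = i" | "b = i" | "a \<notin> x" "b \<notin> x" using t ab by blast
    then show ?thesis
    proof cases
      assume a: "a = i"
      have "{i - 1<..b} \<subseteq> insert i {a<..b}" using a i by auto
      then have "{i - 1<..b} \<subseteq> T" using ab(5) assms(3) by blast
      moreover have "b \<notin> x" using t(1)[OF ab(4)] a ab by auto
      ultimately show False using no[of "i - 1" b] ab 2 a i by simp
    next
      assume b: "b = i"
      then have "a < i - 1" using ab t(2)[OF ab(3)] by simp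
      moreover have "{a<..i - 1} \<subseteq> T" using ab(5) b i by auto
      moreover have "a \<notin> x" using t(1)[OF ab(3)] b ab by auto
      moreover have "i - 1 \<le> n" using assms(5) by simp
      ultimately show False using no[of a "i - 1"] ab 2 by simp
    next
      assume "a \<notin> x" "b \<notin> x"
      then show False using no ab by blast
    qed
  qed
qed

text \<open>Once \<open>T\<close> contains the edges used by a path, liveness may be read at either
  end of it. This makes the vanishing condition stable under multiplication from the left.\<close>

lemma live_run:
  assumes "word_ok n x w" "snd ` set w \<subseteq> T"
  shows "live n (run x w) T \<longleftrightarrow> live n x T"
  using assms
proof (induction w arbitrary: x)
  case (Cons l w)
  obtain c i where l: "l = (c, i)" by fastforce
  have "live n (step x l) T \<longleftrightarrow> live n x T"
  proof (cases c)
    case True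
    have i: "1 \<le> i" "i \<le> n" "i \<in> T" "(i - 1 \<in> x) \<noteq> (i \<in> x)" using Cons.prems True by (auto simp: l)
    then have "(i - 1 \<in> toggle i x) \<noteq> (i \<in> toggle i x)" by (simp add: in_toggle_iff)
    then show ?thesis using live_toggle[of n x T i] live_toggle[of n "toggle i x" T i] i True l by auto
  qed (simp add: l)
  then show ?case using Cons by simp
qed simp

text \<open>If no edge of \<open>D\<close> can be crossed at \<open>x\<close>, then near \<open>D\<close> the state \<open>x\<close> has no holes, hence the
  endpoint, which differs from \<open>x\<close> exactly at the ends of the runs of \<open>D\<close>, is a proper subset of \<open>x\<close>.\<close>

lemma simple_path_exists:
  assumes "x \<in> osz_V n k" "y \<in> osz_V n k" "D \<subseteq> {1..n}" "live n x D"
    and "\<And>j. j \<in> y \<longleftrightarrow> (j \<in> x) \<noteq> ((j \<in> D) \<noteq> (Suc j \<in> D))"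
  shows "\<exists>r. distinct r \<and> set r = D \<and> word n k x (Cs r) \<and> run x (Cs r) = y"
proof -
  have "finite D" using assms(3) finite_subset by blast
  then show ?thesis using assms
  proof (induction "card D" arbitrary: x D)
    case 0
    then have "y = x" by auto
    then show ?case using 0 by (intro exI[of _ "[]"]) (simp add: word_def)
  next
    case (Suc m)
    note D = Suc.prems(4) and live = Suc.prems(5) and y = Suc.prems(6)
    have ne: "D \<noteq> {}" using Suc.hyps(2) by auto
    have "\<exists>i\<in>D. (i - 1 \<in> x) \<noteq> (i \<in> x)"
    proof (rule ccontr)
      assume "\<not> ?thesis"
      then have same: "i - 1 \<in> x \<longleftrightarrow> i \<in> x" if "i \<in> D" for i using that by blast
      have full: "i \<in> x" "i - 1 \<in> x" if "i \<in> D" for i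
      proof -
        have i: "1 \<le> i" "i \<le> n" using that D by auto
        show "i \<in> x"
        proof (rule ccontr)
          assume "i \<notin> x"
          moreover have "{i - 1<..i} \<subseteq> D" using that i by (subgoal_tac "{i - 1<..i} = {i}") auto
          ultimately show False
            using live[unfolded live_def, rule_format, of "i - 1" i] same[OF that] i by auto
        qed
        then show "i - 1 \<in> x" using same[OF that] by simp
      qed
      have "y \<subseteq> x"
      proof
        fix j assume "j \<in> y"
        then show "j \<in> x" using y[of j] full[of j] full(2)[of "Suc j"] by auto
      qed
      moreover have "\<exists>p. p \<notin> y \<and> p \<in> x"
      proof -
        have m: "Min D \<in> D" using ne Suc.prems(1) by simp
        then have "1 \<le> Min D" using D by (metis atLeastAtMost_iff subsetD)
        then obtain p where p: "Min D = Suc p" by (metis Suc_pred' less_eq_Suc_le One_nat_def)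
        have "p \<notin> D" using Min_le[OF Suc.prems(1), of p] p by linarith
        moreover have "Suc p \<in> D" using m p by simp
        moreover have "p \<in> x" using full(2)[OF m] p by simp
        ultimately show ?thesis using y[of p] by blast
      qed
      ultimately have "y \<subset> x" by blast
      moreover have "finite x" "card x = card y"
        using Suc.prems(2,3) finite_subset[of x "{0..n}"] by (simp_all add: osz_V_def)
      ultimately show False using psubset_card_mono[of x y] by simp
    qed
    then obtain i where i: "i \<in> D" "(i - 1 \<in> x) \<noteq> (i \<in> x)" by blast
    have i': "1 \<le> i" "i \<le> n" using i D by auto
    let ?x = "toggle i x"
    have "\<exists>r. distinct r \<and> set r = D - {i} \<and> word n k ?x (Cs r) \<and> run ?x (Cs r) = y"
    proof (rule Suc.hyps)
      show "m = card (D - {i})" using Suc.hyps(2) i Suc.prems(1) by simp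
      show "?x \<in> osz_V n k" by (rule toggle_osz_V[OF Suc.prems(2) i' i(2)])
      show "live n ?x (D - {i})" using live_toggle[OF live i'(1) i i'(2)] live_antimono by blast
      fix j
      have "j = i - 1 \<longleftrightarrow> Suc j = i" using i' by auto
      then show "j \<in> y \<longleftrightarrow> (j \<in> ?x) \<noteq> ((j \<in> D - {i}) \<noteq> (Suc j \<in> D - {i}))"
        unfolding y[of j] in_toggle_iff using i(1) by auto
    qed (use Suc.prems D in auto)
    then obtain r where r: "distinct r" "set r = D - {i}" "word n k ?x (Cs r)" "run ?x (Cs r) = y" by blast
    have "word n k x (Cs (i # r))" using r(3) i' i(2) Suc.prems(2) by (simp add: word_def)
    then show ?case using r i by (intro exI[of _ "i # r"]) auto
  qed
qed

section \<open>The ideal of relations as the common kernel of functionals\<close>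

section \<open>A basis of the algebra of Ozsvath and Szabo\<close>

text \<open>For live d these functionals become the coordinates of the quotient with respect to its
  basis of path classes.\<close>

definition class_sum ::
    "nat set \<Rightarrow> nat set \<Rightarrow> (nat \<Rightarrow> int) \<Rightarrow> ((nat set, osz_arrow) qpath \<Rightarrow> int) \<Rightarrow> int" where
  "class_sum x y d f = lin (\<lambda>(x', p, y'). of_bool (x' = x \<and> y' = y \<and> osz_degree p = d)) f"

definition live_degree :: "nat \<Rightarrow> nat set \<Rightarrow> (nat \<Rightarrow> int) \<Rightarrow> bool" where
  "live_degree n x d \<longleftrightarrow> live n x {i. d i > 0}"

definition kernel :: "nat \<Rightarrow> nat \<Rightarrow> ((nat set, osz_arrow) qpath \<Rightarrow> int) set" where
  "kernel n k = {f \<in> carrier (osz_PA n k). \<forall>x y d. live_degree n x d \<longrightarrow> class_sum x y d f = 0}"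

lemma osz_degree_append: "osz_degree (p @ q) j = osz_degree p j + osz_degree q j"
  by (simp add: osz_degree_def)

lemma osz_degree_nonneg: "0 \<le> osz_degree p j"
proof -
  have "0 \<le> osz_label_degree l j" for l by (cases l) auto
  then show ?thesis by (induction p) (auto simp: osz_degree_def)
qed

lemma live_walk:
  assumes "osz.awalk n k x p y" "\<And>i. osz_degree p i > 0 \<Longrightarrow> i \<in> T"
  shows "live n y T \<longleftrightarrow> live n x T"
proof -
  obtain w where w: "word_ok n x w" "(x, p, y) = wpath x w" using awalk_is_wpath[OF assms(1)] by metis
  have "snd ` set w \<subseteq> T"
  proof
    fix i assume "i \<in> snd ` set w"
    then have "osz_degree p i > 0" using w(2) by (simp add: word_degree_pos_iff wpath_def)
    then show "i \<in> T" by (rule assms(2))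
  qed
  then show ?thesis using live_run[OF w(1)] w(2) by (simp add: wpath_def)
qed

lemma supp_PA:
  assumes "f \<in> carrier (osz_PA n k)"
  shows "finite (supp f)" "(x, p, y) \<in> supp f \<Longrightarrow> osz.awalk n k x p y"
  using assms by (auto simp: carrier_path_algebra)

lemma lin_eq_0I: "(\<And>s. s \<in> supp f \<Longrightarrow> \<Theta> s = 0) \<Longrightarrow> lin \<Theta> f = 0"
  by (simp add: lin_def)

lemma lin_cong: "(\<And>s. s \<in> supp f \<Longrightarrow> \<Theta> s = \<Xi> s) \<Longrightarrow> lin \<Theta> f = lin \<Xi> f"
  by (simp add: lin_def)

text \<open>With a fixed left factor p1 ending at z, the functional of degree d becomes the
  functional at z whose degree is d minus that of p1. If any path contributes to it, it is live
  again, because p1 runs along edges of positive degree in d.\<close>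

lemma kernel_mult_left:
  assumes f: "f \<in> kernel n k" and g: "g \<in> carrier (osz_PA n k)"
  shows "g \<otimes>\<^bsub>osz_PA n k\<^esub> f \<in> kernel n k"
proof -
  have fc: "f \<in> carrier (osz_PA n k)" using f by (simp add: kernel_def)
  have "class_sum x y d (g \<otimes>\<^bsub>osz_PA n k\<^esub> f) = 0" if live: "live_degree n x d" for x y d
    unfolding class_sum_def osz.lin_PA_mult_left[OF g fc]
  proof (rule lin_eq_0I)
    fix r1 assume r1: "r1 \<in> supp g"
    obtain u p1 z where [simp]: "r1 = (u, p1, z)" by (cases r1) auto
    have walk: "osz.awalk n k u p1 z" using supp_PA(2)[OF g] r1 by simp
    let ?d = "\<lambda>i. d i - osz_degree p1 i"
    have deg: "osz_degree (p1 @ p2) = d \<longleftrightarrow> osz_degree p2 = ?d" for p2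
      by (auto simp: fun_eq_iff osz_degree_append algebra_simps)
    show "lin (\<lambda>r2. if composable r1 r2 then case pcomp r1 r2 of (x', p, y') \<Rightarrow>
        of_bool (x' = x \<and> y' = y \<and> osz_degree p = d) else 0) f = (0 :: int)" (is "lin ?\<Theta> f = 0")
    proof (cases "u = x \<and> live_degree n z ?d")
      case True
      have "lin ?\<Theta> f = class_sum z y ?d f"
        unfolding class_sum_def using True by (intro lin_cong) (auto simp: deg)
      then show ?thesis using f True by (simp add: kernel_def)
    next
      case False
      show ?thesis
      proof (rule lin_eq_0I, rule ccontr)
        fix r2 assume r2: "r2 \<in> supp f" and ne: "?\<Theta> r2 \<noteq> 0"
        obtain p2 w where r2': "r2 = (z, p2, w)" "u = x" "osz_degree p2 = ?d"
          using ne by (cases r2) (auto simp: deg split: if_splits)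
        \<comment> \<open>A contributing second factor has nonnegative degrees, so every edge of p1
          has positive degree in d and \<open>live_walk\<close> applies.\<close>
        have "0 \<le> d i - osz_degree p1 i" for i using r2'(3) osz_degree_nonneg[of p2 i] by simp
        then have pos: "i \<in> {i. d i > 0}" if "osz_degree p1 i > 0" for i
          using that by (smt (verit) mem_Collect_eq)
        have "live n z {i. d i > 0}"
          using live_walk[OF walk pos] live r2'(2) by (simp add: live_degree_def)
        moreover have "{i. ?d i > 0} \<subseteq> {i. d i > 0}"
          using osz_degree_nonneg[of p1] by (auto, smt (verit))
        ultimately have "live_degree n z ?d" unfolding live_degree_def by (rule live_antimono)
        then show False using False r2'(2) by simp
      qed
    qed
  qed
  then show ?thesis using osz.PA_mult_closed[OF g fc] by (simp add: kernel_def)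
qed

text \<open>Here the source does not change, so it suffices that a smaller degree has fewer edges to
  cover a gap.\<close>

lemma kernel_mult_right:
  assumes f: "f \<in> kernel n k" and g: "g \<in> carrier (osz_PA n k)"
  shows "f \<otimes>\<^bsub>osz_PA n k\<^esub> g \<in> kernel n k"
proof -
  have fc: "f \<in> carrier (osz_PA n k)" using f by (simp add: kernel_def)
  have "class_sum x y d (f \<otimes>\<^bsub>osz_PA n k\<^esub> g) = 0" if live: "live_degree n x d" for x y d
    unfolding class_sum_def osz.lin_PA_mult_right[OF fc g]
  proof (rule lin_eq_0I)
    fix r2 assume r2: "r2 \<in> supp g"
    obtain z p2 w where [simp]: "r2 = (z, p2, w)" by (cases r2) auto
    let ?d = "\<lambda>i. d i - osz_degree p2 i"
    have deg: "osz_degree (p1 @ p2) = d \<longleftrightarrow> osz_degree p1 = ?d" for p1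
      by (auto simp: fun_eq_iff osz_degree_append algebra_simps)
    have "{i. ?d i > 0} \<subseteq> {i. d i > 0}"
      using osz_degree_nonneg[of p2] by (auto, smt (verit))
    then have live': "live_degree n x ?d" using live live_antimono unfolding live_degree_def by blast
    have "lin (\<lambda>r1. if composable r1 r2 then case pcomp r1 r2 of (x', p, y') \<Rightarrow>
        of_bool (x' = x \<and> y' = y \<and> osz_degree p = d) else 0) f =
        (if w = y then class_sum x z ?d f else 0)"
    proof (cases "w = y")
      case True
      then show ?thesis unfolding class_sum_def by (auto simp: deg intro!: lin_cong split: if_splits)
    next
      case False
      then show ?thesis by (auto intro!: lin_eq_0I split: if_splits)
    qed
    then show "lin (\<lambda>r1. if composable r1 r2 then case pcomp r1 r2 of (x', p, y') \<Rightarrow>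
        of_bool (x' = x \<and> y' = y \<and> osz_degree p = d) else 0) f = (0 :: int)"
      using f live' by (simp add: kernel_def)
  qed
  then show ?thesis using osz.PA_mult_closed[OF fc g] by (simp add: kernel_def)
qed

lemma kernel_ideal: "ideal (kernel n k) (osz_PA n k)"
proof (rule idealI[OF ring_osz_PA])
  interpret ring "osz_PA n k" by (rule ring_osz_PA)
  have neg: "\<ominus>\<^bsub>osz_PA n k\<^esub> f = (\<lambda>r. - f r)" if "f \<in> carrier (osz_PA n k)" for f
    by (rule minus_equality) (use that osz.PA_uminus_closed in auto)
  show "subgroup (kernel n k) (add_monoid (osz_PA n k))"
  proof (rule add.subgroupI)
    show "kernel n k \<noteq> {}"
      using osz.PA_zero_closed by (auto simp: kernel_def class_sum_def intro!: exI[of _ "\<lambda>_. 0"])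
    show "\<ominus>\<^bsub>osz_PA n k\<^esub> f \<in> kernel n k" if "f \<in> kernel n k" for f
      using that osz.PA_uminus_closed by (auto simp: kernel_def neg class_sum_def lin_uminus)
    show "f \<oplus>\<^bsub>osz_PA n k\<^esub> g \<in> kernel n k" if "f \<in> kernel n k" "g \<in> kernel n k" for f g
      using that osz.PA_add_closed by (auto simp: kernel_def class_sum_def lin_add supp_PA)
  qed (auto simp: kernel_def)
qed (auto intro: kernel_mult_left kernel_mult_right)

lemma class_sum_path_elem [simp]:
  "class_sum x y d (path_elem (u, p, v)) = of_bool (u = x \<and> v = y \<and> osz_degree p = d)"
  by (simp add: class_sum_def)

lemma osz_degree_labels: "osz_degree p j = (\<Sum>l\<leftarrow>map fst p. osz_label_degree l j)"
  by (simp add: osz_degree_def comp_def)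

lemma equal_words_degree:
  assumes "(map fst p, map fst q) \<in> osz_equal_words"
  shows "osz_degree p = osz_degree q"
proof -
  have "(\<Sum>l\<leftarrow>ls. osz_label_degree l j) = (\<Sum>l\<leftarrow>ls'. osz_label_degree l j)"
    if "(ls, ls') \<in> osz_equal_words" for ls ls' j
    using that unfolding osz_equal_words_def Un_iff by (elim disjE) (clarsimp simp: add.commute)+
  from this[OF assms] have "osz_degree p j = osz_degree q j" for j unfolding osz_degree_labels .
  then show ?thesis by (rule ext)
qed

lemma fst_arrow_eq:
  "fst (arrow x l) = OR i \<longleftrightarrow> l = (True, i) \<and> i - 1 \<in> x"
  "fst (arrow x l) = OL i \<longleftrightarrow> l = (True, i) \<and> i - 1 \<notin> x"
  "fst (arrow x l) = OU i \<longleftrightarrow> l = (False, i)"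
  by (cases l; auto)+

text \<open>The second of the two crossings uses an edge both of whose ends are holes of the source,
  which is a covered gap of length one.\<close>

lemma zero_words_not_live:
  assumes "osz.awalk n k x p y" "map fst p \<in> osz_zero_words"
  shows "\<not> live_degree n x (osz_degree p)"
proof -
  obtain w where w: "word_ok n x w" "p = arrows x w"
    using awalk_is_wpath[OF assms(1)] by (metis wpath_def prod.inject)
  obtain i where "map fst p = [OR i, OR (Suc i)] \<or> map fst p = [OL (Suc i), OL i]"
    using assms(2) by (auto simp: osz_zero_words_def)
  then obtain l m where lm: "w = [l, m]"
    using w(2) by (cases w; cases "tl w"; cases "tl (tl w)") auto
  have no: ?thesis if "a < b" "b \<le> n" "a \<notin> x" "b \<notin> x" "\<And>c. a < c \<Longrightarrow> c \<le> b \<Longrightarrow> c \<in> snd ` set w" for a b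
  proof -
    have "{a<..b} \<subseteq> {i. word_degree w i > 0}" unfolding word_degree_pos_iff using that(5) by auto
    then show ?thesis using that(1-4) w(2) unfolding live_degree_def live_def by auto
  qed
  from \<open>_ \<or> _\<close> show ?thesis
  proof
    assume "map fst p = [OR i, OR (Suc i)]"
    then have l: "l = (True, i)" "m = (True, Suc i)" "i - 1 \<in> x" "i \<in> toggle i x"
      using w(2) lm by (auto simp: fst_arrow_eq)
    then show ?thesis using w(1) lm
      by (intro no[of i "Suc i"]) (auto simp: in_toggle_iff le_Suc_eq)
  next
    assume "map fst p = [OL (Suc i), OL i]"
    then have l: "l = (True, Suc i)" "m = (True, i)" "i \<notin> x" "i - 1 \<notin> toggle (Suc i) x"
      using w(2) lm by (auto simp: fst_arrow_eq)
    then have "1 \<le> i" "i \<le> n" using w(1) lm by auto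
    then show ?thesis using l lm
      by (intro no[of "i - 1" i]) (auto simp: in_toggle_iff)
  qed
qed

lemma relators_in_kernel: "osz_relators n k \<subseteq> kernel n k"
proof
  fix f assume f: "f \<in> osz_relators n k"
  then have fc: "f \<in> carrier (osz_PA n k)" using osz_relators_closed by blast
  have "class_sum x y d f = 0" if live: "live_degree n x d" for x y d
  proof -
    consider (E) u p q v where "f = path_elem (u, p, v) \<ominus>\<^bsub>osz_PA n k\<^esub> path_elem (u, q, v)"
        "osz.awalk n k u p v" "osz.awalk n k u q v" "(map fst p, map fst q) \<in> osz_equal_words"
      | (Z) u p v where "f = path_elem (u, p, v)" "osz.awalk n k u p v" "map fst p \<in> osz_zero_words"
      | (U) i u where "f = path_elem (u, [(OU i, u, u)], u)" "i \<in> {1..n}" "u \<inter> {i - 1, i} = {}"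
      using f unfolding osz_relators_def Let_def by blast
    then show ?thesis
    proof cases
      case E
      then show ?thesis using equal_words_degree[OF E(4)]
        by (simp add: osz_PA_minus path_elem_closed class_sum_def lin_diff)
    next
      case Z
      then show ?thesis using zero_words_not_live[OF Z(2,3)] live by auto
    next
      case U
      have "\<not> live_degree n u (osz_degree [(OU i, u, u)])"
      proof -
        have "i - 1 < i" "i \<le> n" "i - 1 \<notin> u" "i \<notin> u" using U(2,3) by auto
        moreover have "{i - 1<..i} \<subseteq> {j. osz_degree [(OU i, u, u)] j > 0}"
          by (auto simp: osz_degree_def)
        ultimately show ?thesis unfolding live_degree_def live_def by blast
      qed
      then show ?thesis using U live by auto
    qed
  qed
  then show "f \<in> kernel n k" using fc by (simp add: kernel_def)
qed

lemma osz_ideal_subset_kernel: "osz_ideal n k \<subseteq> kernel n k"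
  unfolding osz_ideal_def by (rule ring.genideal_minimal[OF ring_osz_PA kernel_ideal relators_in_kernel])

text \<open>The two estimates meet: rewriting shows that words of dead degree vanish, and a
  functional equal to 1 on a live word shows that it does not.\<close>

lemma wnul_iff_not_live:
  assumes "word n k x w"
  shows "wnul n k x w \<longleftrightarrow> \<not> live_degree n x (word_degree w)"
proof
  assume "wnul n k x w"
  then have "elem x w \<in> kernel n k" using osz_ideal_subset_kernel by (auto simp: wnul_def)
  then have "live_degree n x d \<longrightarrow> class_sum x y d (elem x w) = 0" for y d by (simp add: kernel_def)
  then show "\<not> live_degree n x (word_degree w)" by (auto simp: elem_def wpath_def)
next
  assume "\<not> live_degree n x (word_degree w)"
  then show "wnul n k x w"
    using wnul_if_not_live[OF assms] by (simp add: live_degree_def word_degree_pos_iff)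
qed

lemma walk_in_ideal:
  assumes "osz.awalk n k x p y" "\<not> live_degree n x (osz_degree p)"
  shows "path_elem (x, p, y) \<in> osz_ideal n k"
proof -
  obtain w where w: "x \<in> osz_V n k" "word_ok n x w" "(x, p, y) = wpath x w"
    using awalk_is_wpath[OF assms(1)] by metis
  then have "wnul n k x w" using assms(2) wnul_iff_not_live[of n k x w] by (auto simp: word_def wpath_def)
  then show ?thesis using w by (simp add: wnul_def elem_def)
qed

lemma walk_diff_in_ideal:
  assumes "osz.awalk n k x p y" "osz.awalk n k x q y" "osz_degree p = osz_degree q"
    "live_degree n x (osz_degree p)"
  shows "(\<lambda>s. path_elem (x, p, y) s - path_elem (x, q, y) s) \<in> osz_ideal n k"
proof -
  obtain w where w: "x \<in> osz_V n k" "word_ok n x w" "(x, p, y) = wpath x w"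
    using awalk_is_wpath[OF assms(1)] by metis
  obtain w' where w': "word_ok n x w'" "(x, q, y) = wpath x w'"
    using awalk_is_wpath[OF assms(2)] by metis
  have "weq n k x w w'"
    using assms(3,4) w w' wnul_iff_not_live[of n k x w] wnul_iff_not_live[of n k x w']
    by (intro weq_same_degree) (auto simp: word_def wpath_def)
  then have 1: "word n k x w" "word n k x w'"
    "elem x w \<ominus>\<^bsub>osz_PA n k\<^esub> elem x w' \<in> osz_ideal n k"
    unfolding weq_def by blast+
  then have "(\<lambda>s. elem x w s - elem x w' s) \<in> osz_ideal n k"
    unfolding osz_PA_minus[OF elem_closed[OF 1(1)] elem_closed[OF 1(2)]] by blast
  then show ?thesis using w(3) w'(2) by (simp add: elem_def)
qed

text \<open>Integer multiples are repeated sums and negatives. The statement is about sets of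
  functions in general, since it serves the ideal, the truncated path space and the set on which two
  homomorphisms agree.\<close>

lemma int_combination_closed:
  fixes Q :: "('s \<Rightarrow> int) set"
  assumes zero: "(\<lambda>_. 0) \<in> Q" and add: "\<And>f g. f \<in> Q \<Longrightarrow> g \<in> Q \<Longrightarrow> (\<lambda>s. f s + g s) \<in> Q"
    and neg: "\<And>f. f \<in> Q \<Longrightarrow> (\<lambda>s. - f s) \<in> Q"
    and A: "finite A" "\<And>a. a \<in> A \<Longrightarrow> g a \<in> Q"
  shows "(\<lambda>s. \<Sum>a\<in>A. c a * g a s) \<in> Q"
proof -
  have nat: "(\<lambda>s. int m * f s) \<in> Q" if "f \<in> Q" for f m
  proof (induction m)
    case 0
    then show ?case using zero by simp
  next
    case (Suc m)
    then show ?case using add[OF that Suc] by (simp add: algebra_simps)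
  qed
  have int: "(\<lambda>s. z * f s) \<in> Q" if "f \<in> Q" for f z
  proof (cases z)
    case (nonneg m)
    then show ?thesis using nat[OF that] by simp
  next
    case z: (neg m)
    have "(\<lambda>s. z * f s) = (\<lambda>s. - (int (Suc m) * f s))" unfolding z by (simp only: mult_minus_left)
    then show ?thesis using neg[OF nat[OF that, of "Suc m"]] by simp
  qed
  show ?thesis using A
  proof (induction A rule: finite_induct)
    case empty
    then show ?case using zero by simp
  next
    case (insert a A)
    then show ?case using add[OF int[of "g a" "c a"], of "\<lambda>s. \<Sum>a\<in>A. c a * g a s"] by simp
  qed
qed

lemma osz_ideal_sum:
  assumes "finite A" "\<And>a. a \<in> A \<Longrightarrow> g a \<in> osz_ideal n k"
  shows "(\<lambda>s. \<Sum>a\<in>A. c a * g a s) \<in> osz_ideal n k"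
proof (rule int_combination_closed)
  interpret ideal "osz_ideal n k" "osz_PA n k" by (rule ideal_osz)
  show "(\<lambda>_. 0) \<in> osz_ideal n k"
    using additive_subgroup.zero_closed[OF ideal.axioms(1)[OF ideal_osz]] by simp
  show "(\<lambda>s. f s + h s) \<in> osz_ideal n k" if "f \<in> osz_ideal n k" "h \<in> osz_ideal n k" for f h
    using additive_subgroup.a_closed[OF ideal.axioms(1)[OF ideal_osz] that] by simp
  show "(\<lambda>s. - f s) \<in> osz_ideal n k" if f: "f \<in> osz_ideal n k" for f
  proof -
    have "(\<lambda>s. - f s) = \<ominus>\<^bsub>osz_PA n k\<^esub> f"
      using minus_equality[of "\<lambda>s. - f s" f] Icarr[OF f] osz.PA_uminus_closed by auto
    then show ?thesis using additive_subgroup.a_inv_closed[OF ideal.axioms(1)[OF ideal_osz] f] by simp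
  qed
qed (use assms in auto)

text \<open>In every class of parallel paths of equal degree one representative is chosen. Each path
  in the support is replaced by its difference from the representative, or kept if it is dead; these
  lie in the ideal, and the representatives left over have the functionals of f as coefficients,
  which are zero.\<close>

lemma kernel_subset_osz_ideal: "kernel n k \<subseteq> osz_ideal n k"
proof
  fix f assume f: "f \<in> kernel n k"
  then have fc: "f \<in> carrier (osz_PA n k)" by (simp add: kernel_def)
  define same where "same r s \<longleftrightarrow> (case (r, s) of ((x, p, y), (x', p', y')) \<Rightarrow>
      x' = x \<and> y' = y \<and> osz_degree p' = osz_degree p \<and> osz.awalk n k x p' y)"
    for r s :: "(nat set, osz_arrow) qpath"
  define c where "c r = (SOME s. same r s)" for r
  define alive where "alive r = (case r of (x, p, y) \<Rightarrow> live_degree n x (osz_degree p))"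
    for r :: "(nat set, osz_arrow) qpath"
  define g where "g r = (\<lambda>s. path_elem r s - (if alive r then path_elem (c r) s else 0))" for r
  have same: "same r (c r)" if "r \<in> supp f" for r
  proof -
    obtain x p y where r: "r = (x, p, y)" by (cases r) auto
    have "same r r" using supp_PA(2)[OF fc] that by (simp add: r same_def)
    then show ?thesis unfolding c_def by (rule someI)
  qed
  have gI: "g r \<in> osz_ideal n k" if rs: "r \<in> supp f" for r
  proof -
    obtain x p y where r: "r = (x, p, y)" by (cases r) auto
    obtain q where c: "c r = (x, q, y)" "osz_degree q = osz_degree p" "osz.awalk n k x q y"
      using same[OF rs] by (cases "c r") (auto simp: same_def r)
    have w: "osz.awalk n k x p y" using supp_PA(2)[OF fc] rs by (simp add: r)
    show ?thesis
    proof (cases "alive r")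
      case True
      then show ?thesis using walk_diff_in_ideal[OF w c(3)] c unfolding g_def by (simp add: r alive_def)
    next
      case False
      then show ?thesis using walk_in_ideal[OF w] unfolding g_def by (simp add: r alive_def)
    qed
  qed
  have "f s = (\<Sum>r\<in>supp f. f r * g r s)" for s
  proof -
    have fin: "finite (supp f)" using supp_PA(1)[OF fc] .
    have 1: "(\<Sum>r\<in>supp f. f r * path_elem r s) = f s"
    proof -
      have "(\<Sum>r\<in>supp f. f r * path_elem r s) = (\<Sum>r\<in>supp f. if s = r then f r else 0)"
        by (rule sum.cong) (auto simp: path_elem_def)
      also have "\<dots> = f s" using fin by (simp add: supp_def)
      finally show ?thesis .
    qed
    \<comment> \<open>If s is the representative of some live class met by f, this sum collects the
      coefficients of that whole class; for any other s it has no nonzero term.\<close>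
    have 2: "(\<Sum>r\<in>supp f. f r * (if alive r then path_elem (c r) s else 0)) = 0"
    proof (cases "\<exists>r0\<in>supp f. alive r0 \<and> c r0 = s")
      case True
      then obtain r0 where r0: "r0 \<in> supp f" "alive r0" "c r0 = s" by blast
      obtain x p y where r: "r0 = (x, p, y)" by (cases r0) auto
      have iff: "alive r' \<and> s = c r' \<longleftrightarrow> (case r' of (x', p', y') \<Rightarrow>
          x' = x \<and> y' = y \<and> osz_degree p' = osz_degree p)" if r': "r' \<in> supp f" for r'
      proof
        assume "alive r' \<and> s = c r'"
        then show "case r' of (x', p', y') \<Rightarrow> x' = x \<and> y' = y \<and> osz_degree p' = osz_degree p"
          using same[OF r'] same[OF r0(1)] r0(3) by (auto simp: same_def r split: prod.splits)
      next
        assume "case r' of (x', p', y') \<Rightarrow> x' = x \<and> y' = y \<and> osz_degree p' = osz_degree p"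
        then obtain p' where r'': "r' = (x, p', y)" "osz_degree p' = osz_degree p" by (cases r') auto
        then have "same r' = same r0" by (simp add: same_def r fun_eq_iff)
        then have "c r' = c r0" by (simp add: c_def)
        then show "alive r' \<and> s = c r'" using r0 r'' by (simp add: alive_def r)
      qed
      have "(\<Sum>r\<in>supp f. f r * (if alive r then path_elem (c r) s else 0)) = class_sum x y (osz_degree p) f"
        unfolding class_sum_def lin_def
      proof (rule sum.cong[OF refl])
        fix r' assume r': "r' \<in> supp f"
        have "(if alive r' then path_elem (c r') s else 0) = of_bool (alive r' \<and> s = c r')"
          by (simp add: path_elem_def)
        also have "\<dots> = of_bool (case r' of (x', p', y') \<Rightarrow> x' = x \<and> y' = y \<and> osz_degree p' = osz_degree p)"
          unfolding iff[OF r'] ..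
        finally show "f r' * (if alive r' then path_elem (c r') s else 0) = of_int (f r') *
            (case r' of (x', p', y') \<Rightarrow> of_bool (x' = x \<and> y' = y \<and> osz_degree p' = osz_degree p))"
          by (cases r') simp
      qed
      also have "\<dots> = 0" using f r0(2) by (simp add: kernel_def alive_def r)
      finally show ?thesis .
    next
      case False
      then show ?thesis by (intro sum.neutral) (auto simp: path_elem_def)
    qed
    have "(\<Sum>r\<in>supp f. f r * g r s) = (\<Sum>r\<in>supp f. f r * path_elem r s) -
        (\<Sum>r\<in>supp f. f r * (if alive r then path_elem (c r) s else 0))"
      unfolding g_def right_diff_distrib by (rule sum_subtractf)
    then show ?thesis using 1 2 by simp
  qed
  then have "f = (\<lambda>s. \<Sum>r\<in>supp f. f r * g r s)" by (rule ext)
  also have "\<dots> \<in> osz_ideal n k" by (rule osz_ideal_sum[OF supp_PA(1)[OF fc] gI])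
  finally show "f \<in> osz_ideal n k" .
qed

lemma osz_ideal_eq_kernel: "osz_ideal n k = kernel n k"
  using osz_ideal_subset_kernel kernel_subset_osz_ideal by blast


section \<open>The quotient algebra: equality of classes read off functionals\<close>

section \<open>The idempotent-truncated algebra\<close>

lemma ring_osz_B: "ring (osz_B n k)"
  unfolding osz_B_def by (rule ideal.quotient_is_ring[OF ideal_osz])

lemma osz_class_hom: "osz_class n k \<in> Ring.ring_hom (osz_PA n k) (osz_B n k)"
proof -
  have "osz_class n k = (+>\<^bsub>osz_PA n k\<^esub>) (osz_ideal n k)" by (auto simp: osz_class_def)
  then show ?thesis unfolding osz_B_def using ideal.rcos_ring_hom[OF ideal_osz] by simp
qed

lemma osz_class_closed: "f \<in> carrier (osz_PA n k) \<Longrightarrow> osz_class n k f \<in> carrier (osz_B n k)"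
  using osz_class_hom by (rule ring_hom_closed)

lemma osz_class_mult:
  "f \<in> carrier (osz_PA n k) \<Longrightarrow> g \<in> carrier (osz_PA n k) \<Longrightarrow>
    osz_class n k f \<otimes>\<^bsub>osz_B n k\<^esub> osz_class n k g = osz_class n k (f \<otimes>\<^bsub>osz_PA n k\<^esub> g)"
  using ring_hom_mult[OF osz_class_hom] by simp

lemma osz_class_add:
  "f \<in> carrier (osz_PA n k) \<Longrightarrow> g \<in> carrier (osz_PA n k) \<Longrightarrow>
    osz_class n k f \<oplus>\<^bsub>osz_B n k\<^esub> osz_class n k g = osz_class n k (\<lambda>s. f s + g s)"
  using ring_hom_add[OF osz_class_hom] by simp

lemma osz_class_zero: "osz_class n k (\<lambda>_. 0) = \<zero>\<^bsub>osz_B n k\<^esub>"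
  using ring_hom_zero[OF osz_class_hom ring_osz_PA ring_osz_B] by simp

lemma osz_B_elem:
  assumes "b \<in> carrier (osz_B n k)" obtains f where "f \<in> carrier (osz_PA n k)" "b = osz_class n k f"
  using assms unfolding osz_B_def FactRing_def A_RCOSETS_def' osz_class_def by auto

lemma osz_class_eq_iff:
  assumes "f \<in> carrier (osz_PA n k)" "g \<in> carrier (osz_PA n k)"
  shows "osz_class n k f = osz_class n k g \<longleftrightarrow>
    (\<forall>x y d. live_degree n x d \<longrightarrow> class_sum x y d f = class_sum x y d g)"
proof -
  have "osz_class n k f = osz_class n k g \<longleftrightarrow> (\<lambda>s. f s - g s) \<in> kernel n k"
    using ring.quotient_eq_iff_same_a_r_cos[OF ring_osz_PA ideal_osz assms]
    by (simp add: osz_class_def osz_PA_minus assms osz_ideal_eq_kernel)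
  also have "\<dots> \<longleftrightarrow> (\<forall>x y d. live_degree n x d \<longrightarrow> class_sum x y d f = class_sum x y d g)"
    using assms osz.PA_add_closed[OF assms(1) osz.PA_uminus_closed[OF assms(2)]]
    by (auto simp: kernel_def class_sum_def lin_diff supp_PA)
  finally show ?thesis .
qed

section \<open>Sign vectors, alternation bounds and faces of chambers\<close>

section \<open>Chambers of cyclic arrangements\<close>

lemma card_less_insert:
  assumes "finite K" "j \<notin> K"
  shows "card {a \<in> insert j K. a < i} = card {a \<in> K. a < i} + of_bool (j < (i :: nat))"
proof (cases "j < i")
  case True
  then have "{a \<in> insert j K. a < i} = insert j {a \<in> K. a < i}" by auto
  then show ?thesis using True assms by simp
next
  case False
  then have "{a \<in> insert j K. a < i} = {a \<in> K. a < i}" by auto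
  then show ?thesis using False by simp
qed

lemma card_split_at:
  assumes "finite x"
  shows "card x = card {j \<in> x. j < i} + card {j \<in> x. i \<le> (j :: nat)}"
proof -
  have "x = {j \<in> x. j < i} \<union> {j \<in> x. i \<le> j}" by auto
  then have "card x = card ({j \<in> x. j < i} \<union> {j \<in> x. i \<le> j})" by simp
  also have "\<dots> = card {j \<in> x. j < i} + card {j \<in> x. i \<le> j}"
    using assms by (intro card_Un_disjoint) auto
  finally show ?thesis .
qed

lemma card_Un3:
  assumes "finite A" "finite B" "finite C"
    and "\<And>a b. a \<in> A \<Longrightarrow> b \<in> B \<Longrightarrow> a < b" "\<And>b c. b \<in> B \<Longrightarrow> c \<in> C \<Longrightarrow> b < c"
    "\<And>a c. a \<in> A \<Longrightarrow> c \<in> C \<Longrightarrow> a < (c :: nat)"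
  shows "card (A \<union> B \<union> C) = card A + card B + card C"
proof -
  have "A \<inter> B = {}" "(A \<union> B) \<inter> C = {}" using assms(4-6) by fastforce+
  then show ?thesis using assms(1-3) by (simp add: card_Un_disjoint)
qed

text \<open>The smallest elements are taken, so that the alternating signs, which count smaller
  elements of the index set, are unchanged.\<close>

lemma initial_segment:
  assumes "finite I" "m \<le> card (I :: nat set)"
  obtains J where "J \<subseteq> I" "card J = m" "\<And>i. i \<in> J \<Longrightarrow> {j \<in> J. j < i} = {j \<in> I. j < i}"
proof -
  have "\<exists>J\<subseteq>I. card J = m \<and> (\<forall>i\<in>J. {j \<in> J. j < i} = {j \<in> I. j < i})"
    using assms(2)
  proof (induction m)
    case 0
    then show ?case by (intro exI[of _ "{}"]) simp
  next
    case (Suc m)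
    then obtain J where J: "J \<subseteq> I" "card J = m" "\<And>i. i \<in> J \<Longrightarrow> {j \<in> J. j < i} = {j \<in> I. j < i}"
      by auto
    have fin: "finite J" "finite (I - J)" using J assms(1) finite_subset by auto
    have "I - J \<noteq> {}"
    proof
      assume "I - J = {}"
      then have "I = J" using J(1) by blast
      then show False using J(2) Suc.prems by simp
    qed
    define e where "e = Min (I - J)"
    have e: "e \<in> I" "e \<notin> J" using Min_in[OF fin(2) \<open>I - J \<noteq> {}\<close>] by (auto simp: e_def)
    have least: "e \<le> i" if "i \<in> I" "i \<notin> J" for i using Min_le[OF fin(2)] that by (auto simp: e_def)
    have less: "i < e" if "i \<in> J" for i
    proof (rule ccontr)
      assume "\<not> i < e"
      then have "e < i" using that e by (cases "e = i") auto
      then have "e \<in> {j \<in> I. j < i}" using e by simp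
      then show False using J(3)[OF that] e by blast
    qed
    have "{j \<in> insert e J. j < i} = {j \<in> I. j < i}" if "i \<in> insert e J" for i
    proof (cases "i = e")
      case True
      have "{j \<in> insert e J. j < e} = J" using less by auto
      also have "J = {j \<in> I. j < e}" using less least J(1) by (auto simp: not_less[symmetric])
      finally show ?thesis using True by simp
    next
      case False
      then have "i \<in> J" using that by simp
      have "{j \<in> insert e J. j < i} = {j \<in> J. j < i}" using less[OF \<open>i \<in> J\<close>] by auto
      then show ?thesis using J(3)[OF \<open>i \<in> J\<close>] by simp
    qed
    then show ?case using J e fin by (intro exI[of _ "insert e J"]) auto
  qed
  then show thesis using that by blast
qed

text \<open>The largest missing elements are added. Every index that stays outside lies below all of
  them, so its sign, which counts smaller elements, does not change.\<close>

lemma enlarge_high: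
  assumes "K \<subseteq> {a..n :: nat}" "card K \<le> q" "q \<le> Suc n - a"
  obtains K' where "K' \<subseteq> {a..n}" "card K' = q"
    "\<And>i. i \<le> n \<Longrightarrow> i \<notin> K' \<Longrightarrow> i \<notin> K \<and> {j \<in> K'. j < i} = {j \<in> K. j < i}"
proof -
  have "\<exists>K'\<subseteq>{a..n}. card K' = q \<and> (\<forall>i\<le>n. i \<notin> K' \<longrightarrow> i \<notin> K \<and> {j \<in> K'. j < i} = {j \<in> K. j < i})"
    using assms
  proof (induction "q - card K" arbitrary: K)
    case 0
    then show ?case by (intro exI[of _ K]) auto
  next
    case (Suc m)
    have fin: "finite K" "finite ({a..n} - K)" using Suc.prems(1) finite_subset by auto
    have "card K < card {a..n}" using Suc.hyps(2) Suc.prems by simp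
    then have ne: "{a..n} - K \<noteq> {}" using Suc.prems(1) fin by (metis Diff_eq_empty_iff card_mono not_less)
    define e where "e = Max ({a..n} - K)"
    have e: "e \<in> {a..n}" "e \<notin> K" using Max_in[OF fin(2) ne] by (auto simp: e_def)
    have greatest: "i \<le> e" if "i \<in> {a..n}" "i \<notin> K" for i using Max_ge[OF fin(2)] that by (auto simp: e_def)
    have "\<exists>K'\<subseteq>{a..n}. card K' = q \<and>
        (\<forall>i\<le>n. i \<notin> K' \<longrightarrow> i \<notin> insert e K \<and> {j \<in> K'. j < i} = {j \<in> insert e K. j < i})"
      using Suc.hyps(2) Suc.prems e fin by (intro Suc.hyps(1)) auto
    then obtain K' where K': "K' \<subseteq> {a..n}" "card K' = q"
      "\<And>i. i \<le> n \<Longrightarrow> i \<notin> K' \<Longrightarrow> i \<notin> insert e K \<and> {j \<in> K'. j < i} = {j \<in> insert e K. j < i}" by blast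
    have "i \<notin> K \<and> {j \<in> K'. j < i} = {j \<in> K. j < i}" if i: "i \<le> n" "i \<notin> K'" for i
    proof -
      have "i \<noteq> e" "i \<notin> K" using K'(3)[OF i] by auto
      then have "i < a \<or> i < e" using greatest[of i] i by (cases "a \<le> i") auto
      then have "i < e" using e by auto
      then have "{j \<in> insert e K. j < i} = {j \<in> K. j < i}" by auto
      then show ?thesis using K'(3)[OF i] by auto
    qed
    then show ?case using K' by blast
  qed
  then show thesis using that by blast
qed

text \<open>The mirror image of \<open>enlarge_high\<close>, for signs that count the elements from
  i on.\<close>

lemma enlarge_low:
  assumes "K \<subseteq> {1..n :: nat}" "card K \<le> q" "q \<le> n"
  obtains K' where "K' \<subseteq> {1..n}" "card K' = q"
    "\<And>i. 1 \<le> i \<Longrightarrow> i \<notin> K' \<Longrightarrow> i \<notin> K \<and> {j \<in> K'. i \<le> j} = {j \<in> K. i \<le> j}"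
proof -
  have "\<exists>K'\<subseteq>{1..n}. card K' = q \<and> (\<forall>i\<ge>1. i \<notin> K' \<longrightarrow> i \<notin> K \<and> {j \<in> K'. i \<le> j} = {j \<in> K. i \<le> j})"
    using assms
  proof (induction "q - card K" arbitrary: K)
    case 0
    then show ?case by (intro exI[of _ K]) auto
  next
    case (Suc m)
    have fin: "finite K" "finite ({1..n} - K)" using Suc.prems(1) finite_subset by auto
    have "card K < card {1..n}" using Suc.hyps(2) Suc.prems by simp
    then have ne: "{1..n} - K \<noteq> {}" using Suc.prems(1) fin by (metis Diff_eq_empty_iff card_mono not_less)
    define e where "e = Min ({1..n} - K)"
    have e: "e \<in> {1..n}" "e \<notin> K" using Min_in[OF fin(2) ne] by (auto simp: e_def)
    have least: "e \<le> i" if "i \<in> {1..n}" "i \<notin> K" for i using Min_le[OF fin(2)] that by (auto simp: e_def)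
    have "\<exists>K'\<subseteq>{1..n}. card K' = q \<and>
        (\<forall>i\<ge>1. i \<notin> K' \<longrightarrow> i \<notin> insert e K \<and> {j \<in> K'. i \<le> j} = {j \<in> insert e K. i \<le> j})"
      using Suc.hyps(2) Suc.prems e fin by (intro Suc.hyps(1)) auto
    then obtain K' where K': "K' \<subseteq> {1..n}" "card K' = q"
      "\<And>i. 1 \<le> i \<Longrightarrow> i \<notin> K' \<Longrightarrow> i \<notin> insert e K \<and> {j \<in> K'. i \<le> j} = {j \<in> insert e K. i \<le> j}" by blast
    have "i \<notin> K \<and> {j \<in> K'. i \<le> j} = {j \<in> K. i \<le> j}" if i: "1 \<le> i" "i \<notin> K'" for i
    proof -
      have "i \<noteq> e" "i \<notin> K" using K'(3)[OF i] by auto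
      then have "n < i \<or> e < i" using least[of i] i by (cases "i \<le> n") auto
      then have "e < i" using e by auto
      then have "{j \<in> insert e K. i \<le> j} = {j \<in> K. i \<le> j}" by auto
      then show ?thesis using K'(3)[OF i] by auto
    qed
    then show ?case using K' by blast
  qed
  then show thesis using that by blast
qed

lemma minus_one_power_eq: "(-1) ^ a = ((-1) ^ b :: 'a::ring_1) " if "even (a + b :: nat)"
  using that by (cases "even a") auto

lemma odd_sum: "k - 1 = a + b \<Longrightarrow> 1 \<le> k \<Longrightarrow> odd (a + (k + b))" for a b k :: nat
  by presburger

lemma even_sum: "k = a + b \<Longrightarrow> even (k + b + a)" for a b k :: nat
  by presburger

lemma sign_vector_cases: "\<alpha> \<in> sign_vectors n \<Longrightarrow> i \<in> {1..n} \<Longrightarrow> \<alpha> i = 1 \<or> \<alpha> i = -1"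
  by (auto simp: sign_vectors_def PiE_def Pi_def)

lemma sign_subset_subset: "sign_subset n k \<alpha> \<subseteq> {1..n}"
  by (auto simp: sign_subset_def)

lemma finite_sign_subset [simp]: "finite (sign_subset n k \<alpha>)"
  by (simp add: sign_subset_def)

lemma card_sign_subset: "card (sign_subset n k \<alpha>) = var_r n k \<alpha>"
  by (simp add: sign_subset_def var_r_def)

text \<open>Starting from the appended sign (-1)^k and going left, the sign changes at each element
  of the state.\<close>

lemma sign_from_right:
  assumes "\<alpha> \<in> sign_vectors n" "1 \<le> i" "i \<le> Suc n"
  shows "extend_sign n k \<alpha> i = (-1) ^ k * (-1) ^ card {j \<in> sign_subset n k \<alpha>. i \<le> j}"
  using assms(3,2)
proof (induction rule: inc_induct)
  case base
  have "{j \<in> sign_subset n k \<alpha>. Suc n \<le> j} = {}" using sign_subset_subset[of n k \<alpha>] by fastforce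
  then have "card {j \<in> sign_subset n k \<alpha>. Suc n \<le> j} = 0" by (simp only: card.empty)
  then show ?case by (simp only: extend_sign_def fun_upd_same power_0 mult_1_right)
next
  case (step i)
  let ?x = "sign_subset n k \<alpha>" and ?a = "extend_sign n k \<alpha>"
  have fin: "finite ?x" by simp
  have v: "?a j = 1 \<or> ?a j = -1" if "1 \<le> j" "j \<le> Suc n" for j
    using that sign_vector_cases[OF assms(1), of j]
    by (cases "even k") (auto simp: extend_sign_def)
  have i: "1 \<le> i" "i \<le> n" using step by auto
  show ?case
  proof (cases "i \<in> ?x")
    case True
    then have "{j \<in> ?x. i \<le> j} = insert i {j \<in> ?x. Suc i \<le> j}" by (auto simp: le_less Suc_le_eq)
    then have "card {j \<in> ?x. i \<le> j} = Suc (card {j \<in> ?x. Suc i \<le> j})" using fin by simp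
    moreover have "?a i = - ?a (Suc i)"
      using True v[of i] v[of "Suc i"] i by (auto simp: sign_subset_def)
    ultimately show ?thesis using step by simp
  next
    case False
    then have "{j \<in> ?x. i \<le> j} = {j \<in> ?x. Suc i \<le> j}" by (auto simp: le_less Suc_le_eq)
    moreover have "?a i = ?a (Suc i)" using False i by (auto simp: sign_subset_def)
    ultimately show ?thesis using step by simp
  qed
qed

lemma sign_formula_right:
  assumes "\<alpha> \<in> sign_vectors n" "i \<in> {1..n}"
  shows "\<alpha> i = (-1) ^ (k + card {j \<in> sign_subset n k \<alpha>. i \<le> j})"
  using sign_from_right[OF assms(1), of i k] assms(2) by (simp add: extend_sign_def power_add)

text \<open>With exactly k changes before the final sign (-1)^k, the sequence starts with a plus, so
  signs may be counted from the left instead.\<close>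

lemma sign_formula:
  assumes "\<alpha> \<in> sign_vectors n" "var_r n k \<alpha> = k" "i \<in> {1..n}"
  shows "\<alpha> i = (-1) ^ card {j \<in> sign_subset n k \<alpha>. j < i}"
proof -
  from card_split_at[OF finite_sign_subset, of n k \<alpha> i] have "k = card {j \<in> sign_subset n k \<alpha>. j < i} +
      card {j \<in> sign_subset n k \<alpha>. i \<le> j}" using assms(2) card_sign_subset by simp
  then show ?thesis unfolding sign_formula_right[OF assms(1,3), of k]
    by (intro minus_one_power_eq even_sum)
qed

text \<open>\<open>P\<close> stands for the maximal minors, made positive by a common sign, of the
  space of vectors v extended by the coordinate (-1)^k \<xi>(v) at index n + 1. \<open>rel_V\<close>
  says that a bordered determinant vanishes for a vector of this space, \<open>prescribe\<close>
  that any k coordinates can be chosen freely, since their minor is nonzero.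
  \<open>pos_\<eta>\<close> is the positivity of the minors of the span of V and \<eta>, expanded
  along the row of a point of \<eta>; the cofactors are the minors that avoid the index n +
  1.\<close>

locale cyclic_coords =
  fixes n k :: nat and V \<eta> \<xi> :: "real vec set" and c\<^sub>0 :: "real vec" and P :: "nat set \<Rightarrow> real"
  assumes k_less: "k < n"
    and V_carrier: "V \<subseteq> carrier_vec n"
    and \<eta>_carrier: "\<eta> \<subseteq> carrier_vec n"
    and \<eta>_nonempty: "\<eta> \<noteq> {}"
    and V_add: "v \<in> V \<Longrightarrow> w \<in> V \<Longrightarrow> v + w \<in> V"
    and V_smult: "v \<in> V \<Longrightarrow> t \<cdot>\<^sub>v v \<in> V"
    and \<eta>_add: "z \<in> \<eta> \<Longrightarrow> v \<in> V \<Longrightarrow> z + v \<in> \<eta>"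
    and \<eta>_diff: "z \<in> \<eta> \<Longrightarrow> z' \<in> \<eta> \<Longrightarrow> z - z' \<in> V"
    and \<xi>_carrier: "\<xi> \<subseteq> carrier_vec n"
    and c\<^sub>0_in: "c\<^sub>0 \<in> \<xi>"
    and \<xi>_eq: "c \<in> \<xi> \<Longrightarrow> v \<in> V \<Longrightarrow> c \<bullet> v = c\<^sub>0 \<bullet> v"
    and P_pos: "J \<subseteq> {1..Suc n} \<Longrightarrow> card J = k \<Longrightarrow> P J > 0"
    and rel_V: "v \<in> V \<Longrightarrow> I \<subseteq> {1..Suc n} \<Longrightarrow> card I = Suc k \<Longrightarrow>
      (\<Sum>i\<in>I. (-1) ^ card {j \<in> I. j < i} * (if i = Suc n then (-1) ^ k * (c\<^sub>0 \<bullet> v) else coord v i) * P (I - {i})) = 0"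
    and pos_\<eta>: "z \<in> \<eta> \<Longrightarrow> I \<subseteq> {1..n} \<Longrightarrow> card I = Suc k \<Longrightarrow>
      (\<Sum>i\<in>I. (-1) ^ card {j \<in> I. j < i} * coord z i * P (I - {i})) > 0"
    and prescribe: "K \<subseteq> {1..Suc n} \<Longrightarrow> card K = k \<Longrightarrow>
      \<exists>v\<in>V. \<forall>i\<in>K. (if i = Suc n then (-1) ^ k * (c\<^sub>0 \<bullet> v) else coord v i) = g i"
begin

abbreviation ext :: "real vec \<Rightarrow> nat \<Rightarrow> real" where
  "ext v i \<equiv> (if i = Suc n then (-1) ^ k * (c\<^sub>0 \<bullet> v) else coord v i)"

lemma coord_add: "v \<in> carrier_vec n \<Longrightarrow> w \<in> carrier_vec n \<Longrightarrow> i \<in> {1..n} \<Longrightarrow>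
    coord (v + w) i = coord v i + coord w i"
  by (auto simp: coord_def)

lemma coord_smult: "v \<in> carrier_vec n \<Longrightarrow> i \<in> {1..n} \<Longrightarrow> coord (t \<cdot>\<^sub>v v) i = t * coord v i"
  by (auto simp: coord_def)

text \<open>Otherwise every term of the positive sum over the first k + 1 of these positions would
  be nonpositive. This is the bound on the sign variation of points of \<eta>.\<close>

lemma not_alternating:
  assumes "z \<in> \<eta>" "I \<subseteq> {1..n}" "Suc k \<le> card I"
  shows "\<exists>i\<in>I. (-1) ^ card {j \<in> I. j < i} * coord z i > 0"
proof (rule ccontr)
  assume no: "\<not> ?thesis"
  have "finite I" using assms(2) finite_subset by blast
  then obtain J where J: "J \<subseteq> I" "card J = Suc k" "\<And>i. i \<in> J \<Longrightarrow> {j \<in> J. j < i} = {j \<in> I. j < i}"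
    using initial_segment assms(3) by metis
  have "(\<Sum>i\<in>J. (-1) ^ card {j \<in> J. j < i} * coord z i * P (J - {i})) \<le> 0"
  proof (rule sum_nonpos)
    fix i assume i: "i \<in> J"
    have "(-1) ^ card {j \<in> J. j < i} * coord z i \<le> 0" using no J(1) i unfolding J(3)[OF i] by force
    moreover have "P (J - {i}) > 0"
    proof (rule P_pos)
      show "J - {i} \<subseteq> {1..Suc n}" using J(1) assms(2) by fastforce
      show "card (J - {i}) = k" using J(2) i by (metis card_Suc_Diff1 card.infinite nat.distinct(1) old.nat.inject)
    qed
    ultimately show "(-1) ^ card {j \<in> J. j < i} * coord z i * P (J - {i}) \<le> 0"
      by (simp add: mult_nonpos_nonneg)
  qed
  moreover have "J \<subseteq> {1..n}" using J(1) assms(2) by blast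
  ultimately show False using pos_\<eta>[OF assms(1) _ J(2)] by force
qed

text \<open>The k coordinates in \<open>K\<close> are corrected to zero by a vector of V. For any
  further i, the positive sum over \<open>insert i K\<close> has the i-th term as its only nonzero
  one, which gives the sign of that coordinate.\<close>

lemma vertex:
  assumes K: "K \<subseteq> {1..n}" "card K = k"
  shows "\<exists>z\<in>\<eta>. (\<forall>i\<in>K. coord z i = 0) \<and> (\<forall>i\<in>{1..n} - K. (-1) ^ card {j \<in> K. j < i} * coord z i > 0)"
proof -
  have fin: "finite K" using K(1) finite_subset by blast
  have K': "K \<subseteq> {1..Suc n}" using K(1) by fastforce
  obtain z0 where z0: "z0 \<in> \<eta>" using \<eta>_nonempty by blast
  obtain v where v: "v \<in> V" "\<And>i. i \<in> K \<Longrightarrow> ext v i = - coord z0 i"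
    using prescribe[OF K' K(2), of "\<lambda>i. - coord z0 i"] by blast
  let ?z = "z0 + v"
  have z: "?z \<in> \<eta>" using \<eta>_add z0 v by blast
  have 0: "coord ?z i = 0" if "i \<in> K" for i
  proof -
    have i: "i \<in> {1..n}" using that K by auto
    then show ?thesis using v(2)[OF that] coord_add[of z0 v i] z0 v(1) V_carrier \<eta>_carrier by auto
  qed
  have "(-1) ^ card {j \<in> K. j < i} * coord ?z i > 0" if i: "i \<in> {1..n} - K" for i
  proof -
    let ?I = "insert i K"
    have "(\<Sum>j\<in>?I. (-1) ^ card {l \<in> ?I. l < j} * coord ?z j * P (?I - {j})) > 0"
      using K i fin by (intro pos_\<eta>[OF z]) auto
    also have "(\<Sum>j\<in>?I. (-1) ^ card {l \<in> ?I. l < j} * coord ?z j * P (?I - {j})) =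
        (-1) ^ card {l \<in> ?I. l < i} * coord ?z i * P (?I - {i})"
      using fin i 0 by (subst sum.insert) auto
    also have "?I - {i} = K" using i by auto
    also have "card {l \<in> ?I. l < i} = card {l \<in> K. l < i}" using card_less_insert[of K i i] fin i by simp
    finally show ?thesis using P_pos[OF K' K(2)] by (simp add: zero_less_mult_iff)
  qed
  then show ?thesis using z 0 by blast
qed

text \<open>The vertex cut out by \<open>K = \<phi> ` x\<close>, where \<open>\<phi>\<close> moves the elements of the state \<open>x\<close> to adjacent
  edges in such a way that \<open>K\<close> covers \<open>T\<close>, lies in all faces in question.\<close>

lemma chambers_meet:
  assumes \<alpha>: "\<alpha> \<in> sign_vectors n" "var_r n k \<alpha> = k" and \<beta>: "\<beta> \<in> sign_vectors n"
    and S: "S \<subseteq> {1..n}" and live: "live n (sign_subset n k \<alpha>) (S \<union> {i \<in> {1..n}. \<alpha> i \<noteq> \<beta> i})"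
  shows "chamber n \<eta> \<alpha> \<inter> chamber n \<eta> \<beta> \<inter> hyperplane_int \<eta> S \<noteq> {}"
proof -
  let ?x = "sign_subset n k \<alpha>"
  define T where "T = S \<union> {i \<in> {1..n}. \<alpha> i \<noteq> \<beta> i}"
  have T: "T \<subseteq> {1..n}" using S by (auto simp: T_def)
  have x: "?x \<subseteq> {1..n}" "card ?x = k" using sign_subset_subset card_sign_subset \<alpha>(2) by auto
  have finx: "finite ?x" by simp
  \<comment> \<open>An element t can be moved to either of its edges t and t + 1. It takes t + 1
    exactly when edges of \<open>T\<close> lead from t up to a hole. As no run of edges of
    \<open>T\<close> has holes at both ends, every edge of \<open>T\<close> then receives an
    element.\<close>
  define up where "up t \<longleftrightarrow> (\<exists>h. t < h \<and> h \<le> n \<and> h \<notin> ?x \<and> {t<..h} \<subseteq> T)" for t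
  define \<phi> where "\<phi> t = (if up t then Suc t else t)" for t
  have nogap: False if "a < b" "b \<le> n" "a \<notin> ?x" "b \<notin> ?x" "{a<..b} \<subseteq> T" for a b
    using live that unfolding live_def T_def by blast
  have \<phi>_inj: "inj_on \<phi> ?x"
  proof -
    have "t = s" if ts: "t \<in> ?x" "s \<in> ?x" "\<phi> t = \<phi> s" "t \<le> s" for t s
    proof (rule ccontr)
      assume "t \<noteq> s"
      then have s: "s = Suc t" "up t" "\<not> up s" using ts(3,4) by (auto simp: \<phi>_def split: if_splits)
      then obtain h where h: "t < h" "h \<le> n" "h \<notin> ?x" "{t<..h} \<subseteq> T" by (auto simp: up_def)
      have "h \<noteq> s" using h ts by auto
      then have "s < h" using h s by auto
      moreover have "{s<..h} \<subseteq> {t<..h}" using s by auto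
      ultimately show False using h s(3) unfolding up_def by blast
    qed
    then show ?thesis by (metis inj_onI linear)
  qed
  let ?K = "\<phi> ` ?x"
  have K: "?K \<subseteq> {1..n}" "card ?K = k"
  proof -
    show "?K \<subseteq> {1..n}"
    proof clarify
      fix t assume "t \<in> ?x"
      then show "\<phi> t \<in> {1..n}" using x(1) by (cases "up t") (auto simp: \<phi>_def up_def)
    qed
    show "card ?K = k" using card_image[OF \<phi>_inj] x by simp
  qed
  have TK: "T \<subseteq> ?K"
  proof
    fix e assume e: "e \<in> T"
    then have e1: "1 \<le> e" "e \<le> n" using T by auto
    have Se: "{e - 1<..e} = {e}" "Suc (e - 1) = e" using e1 by auto
    show "e \<in> ?K"
    proof (cases "e \<in> ?x \<and> \<not> up e")
      case True
      then show ?thesis by (intro image_eqI[of _ _ e]) (auto simp: \<phi>_def)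
    next
      case False
      have "\<exists>h. e \<le> h \<and> h \<le> n \<and> h \<notin> ?x \<and> {e - 1<..h} \<subseteq> T"
      proof (cases "e \<in> ?x")
        case True
        then obtain h where h: "e < h" "h \<le> n" "h \<notin> ?x" "{e<..h} \<subseteq> T" using False by (auto simp: up_def)
        have "{e - 1<..h} \<subseteq> insert e {e<..h}" using e1 by auto
        then show ?thesis using h e by (intro exI[of _ h]) auto
      next
        case False
        then show ?thesis using e e1 Se by (intro exI[of _ e]) auto
      qed
      then obtain h where h: "e \<le> h" "h \<le> n" "h \<notin> ?x" "{e - 1<..h} \<subseteq> T" by blast
      have "e - 1 \<in> ?x" using nogap[of "e - 1" h] h e1 by fastforce
      moreover have "up (e - 1)" unfolding up_def using h e1 by (intro exI[of _ h]) auto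
      ultimately show ?thesis using Se by (intro image_eqI[of _ _ "e - 1"]) (auto simp: \<phi>_def)
    qed
  qed
  \<comment> \<open>The map raises elements by at most one, so it could carry one from below i past
    i only by stopping at i itself. Hence outside K the signs of the vertex are those of
    \<alpha>.\<close>
  have count: "card {j \<in> ?K. j < i} = card {j \<in> ?x. j < i}" if "i \<notin> ?K" for i
  proof -
    have "{j \<in> ?K. j < i} = \<phi> ` {j \<in> ?x. j < i}"
    proof (intro equalityI subsetI)
      fix s assume "s \<in> {j \<in> ?K. j < i}"
      then obtain t where "t \<in> ?x" "s = \<phi> t" "\<phi> t < i" by auto
      moreover have "t \<le> \<phi> t" by (simp add: \<phi>_def)
      ultimately show "s \<in> \<phi> ` {j \<in> ?x. j < i}" by auto
    next
      fix s assume "s \<in> \<phi> ` {j \<in> ?x. j < i}"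
      then obtain t where t: "t \<in> ?x" "t < i" "s = \<phi> t" by auto
      then have "\<phi> t \<noteq> i" using that by blast
      then show "s \<in> {j \<in> ?K. j < i}" using t by (auto simp: \<phi>_def split: if_splits)
    qed
    moreover have "inj_on \<phi> {j \<in> ?x. j < i}" using \<phi>_inj by (rule inj_on_subset) auto
    ultimately show ?thesis by (simp add: card_image)
  qed
  obtain z where z: "z \<in> \<eta>" "\<And>i. i \<in> ?K \<Longrightarrow> coord z i = 0"
    "\<And>i. i \<in> {1..n} - ?K \<Longrightarrow> (-1) ^ card {j \<in> ?K. j < i} * coord z i > 0"
    using vertex[OF K] by blast
  have \<alpha>z: "real_of_int (\<alpha> i) * coord z i \<ge> 0" if i: "i \<in> {1..n}" for i
  proof (cases "i \<in> ?K")
    case True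
    then show ?thesis using z by simp
  next
    case False
    then have "(-1) ^ card {j \<in> ?K. j < i} * coord z i > 0" using z(3)[of i] i by simp
    then show ?thesis unfolding sign_formula[OF \<alpha> i] count[OF False] by simp
  qed
  have \<beta>z: "real_of_int (\<beta> i) * coord z i \<ge> 0" if i: "i \<in> {1..n}" for i
  proof (cases "i \<in> T")
    case True
    then show ?thesis using z TK by auto
  next
    case False
    then have "\<beta> i = \<alpha> i" using i by (auto simp: T_def)
    then show ?thesis using \<alpha>z[OF i] by simp
  qed
  have "z \<in> chamber n \<eta> \<alpha> \<inter> chamber n \<eta> \<beta> \<inter> hyperplane_int \<eta> S"
    using z TK \<alpha>z \<beta>z by (auto simp: chamber_def hyperplane_int_def T_def)
  then show ?thesis by blast
qed

text \<open>A point z of the face vanishes on \<open>T\<close>. For a shortest covered gap from a to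
  b, take the edges t + 1 for elements t below a, all edges of the gap, and the edges t for elements
  t above b: one more than the k elements of the state. In the outer blocks the numbers of smaller
  members of this set and of the state differ by one, so z has weakly the wrong signs there and is
  zero in the middle, against \<open>not_alternating\<close>.\<close>

lemma chambers_disjoint:
  assumes \<alpha>: "\<alpha> \<in> sign_vectors n" "var_r n k \<alpha> = k" and \<beta>: "\<beta> \<in> sign_vectors n"
    and S: "S \<subseteq> {1..n}" and live: "\<not> live n (sign_subset n k \<alpha>) (S \<union> {i \<in> {1..n}. \<alpha> i \<noteq> \<beta> i})"
  shows "chamber n \<eta> \<alpha> \<inter> chamber n \<eta> \<beta> \<inter> hyperplane_int \<eta> S = {}"
proof (rule ccontr)
  assume "\<not> ?thesis"
  then obtain z where zz: "z \<in> chamber n \<eta> \<alpha>" "z \<in> chamber n \<eta> \<beta>" "z \<in> hyperplane_int \<eta> S"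
    by blast
  have z: "z \<in> \<eta>" "\<And>i. i \<in> {1..n} \<Longrightarrow> real_of_int (\<alpha> i) * coord z i \<ge> 0"
    "\<And>i. i \<in> {1..n} \<Longrightarrow> real_of_int (\<beta> i) * coord z i \<ge> 0" "\<And>i. i \<in> S \<Longrightarrow> coord z i = 0"
    using zz by (simp_all add: chamber_def hyperplane_int_def)
  let ?x = "sign_subset n k \<alpha>"
  define T where "T = S \<union> {i \<in> {1..n}. \<alpha> i \<noteq> \<beta> i}"
  have x: "?x \<subseteq> {1..n}" "card ?x = k" using sign_subset_subset card_sign_subset \<alpha>(2) by auto
  have finx: "finite ?x" by simp
  \<comment> \<open>Where \<alpha> and \<beta> differ, membership in both chambers bounds the
    coordinate from both sides by zero.\<close>
  have zT: "coord z i = 0" if "i \<in> T" for i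
  proof (cases "i \<in> S")
    case False
    then have i: "i \<in> {1..n}" "\<alpha> i \<noteq> \<beta> i" using that by (auto simp: T_def)
    then show ?thesis
      using z(2,3)[OF i(1)] sign_vector_cases[OF \<alpha>(1) i(1)] sign_vector_cases[OF \<beta> i(1)] by auto
  qed (rule z(4))
  let ?Q = "\<lambda>m. \<exists>a b. b - a = m \<and> a < b \<and> b \<le> n \<and> a \<notin> ?x \<and> b \<notin> ?x \<and> {a<..b} \<subseteq> T"
  have "\<exists>m. ?Q m" using live unfolding live_def T_def by blast
  then have "?Q (LEAST m. ?Q m)" by (rule LeastI_ex)
  then obtain a b where ab: "b - a = (LEAST m. ?Q m)" "a < b" "b \<le> n" "a \<notin> ?x" "b \<notin> ?x" "{a<..b} \<subseteq> T"
    by blast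
  have full: "c \<in> ?x" if "a < c" "c < b" for c
  proof (rule ccontr)
    assume "c \<notin> ?x"
    moreover have "{a<..c} \<subseteq> T" using ab(6) that by auto
    ultimately have "?Q (c - a)"
      using that ab by (intro exI[of _ a] exI[of _ c]) auto
    then have "(LEAST m. ?Q m) \<le> c - a" by (rule Least_le)
    then show False using ab(1) that by linarith
  qed
  define lo hi where "lo = {j \<in> ?x. j < a}" and "hi = {j \<in> ?x. b < j}"
  define I where "I = Suc ` lo \<union> {a<..b} \<union> hi"
  have fin: "finite lo" "finite hi" using finx by (auto simp: lo_def hi_def)
  have lo_le: "j \<le> a" if "j \<in> Suc ` lo" for j using that by (auto simp: lo_def)
  have hi_gt: "b < j" if "j \<in> hi" for j using that by (auto simp: hi_def)
  have xs: "?x = lo \<union> {a<..<b} \<union> hi"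
  proof (intro equalityI subsetI)
    fix j assume j: "j \<in> ?x"
    then have "j \<noteq> a" "j \<noteq> b" using ab by auto
    then show "j \<in> lo \<union> {a<..<b} \<union> hi" using j by (auto simp: lo_def hi_def)
  qed (auto simp: lo_def hi_def full)
  have lt: "c < a" if "c \<in> lo" for c using that by (simp add: lo_def)
  have "card ?x = card lo + card {a<..<b} + card hi"
    unfolding xs using fin lt hi_gt ab(2) by (intro card_Un3) force+
  moreover have "card I = card (Suc ` lo) + card {a<..b} + card hi"
    unfolding I_def using fin lo_le hi_gt ab(2) by (intro card_Un3) force+
  ultimately have cI: "card I = Suc k" using x ab(2) by (simp add: card_image)
  have I: "I \<subseteq> {1..n}" using x ab by (auto simp: I_def lo_def hi_def)
  obtain i where i: "i \<in> I" "(-1) ^ card {j \<in> I. j < i} * coord z i > 0"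
    using not_alternating[OF z(1) I] cI by auto
  have i1: "i \<in> {1..n}" using i I by blast
  have contra: False if "odd (card {j \<in> I. j < i} + card {j \<in> ?x. j < i})"
  proof -
    have "(-1) ^ card {j \<in> ?x. j < i} = - ((-1) ^ card {j \<in> I. j < i} :: real)"
      using that by (cases "even (card {j \<in> I. j < i})") auto
    then have "real_of_int (\<alpha> i) * coord z i < 0" using i(2) sign_formula[OF \<alpha> i1] by simp
    then show False using z(2)[OF i1] by simp
  qed
  consider (lo) "i \<in> Suc ` lo" | (mid) "i \<in> {a<..b}" | (hi) "i \<in> hi" using i by (auto simp: I_def)
  then show False
  proof cases
    case lo
    then obtain j where j: "i = Suc j" "j \<in> ?x" "j < a" by (auto simp: lo_def)
    have "{l \<in> I. l < i} = Suc ` {l \<in> ?x. l < j}"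
      using j lo_le hi_gt ab(2) by (auto simp: I_def lo_def hi_def)
    then have "card {l \<in> I. l < i} = card {l \<in> ?x. l < j}" by (simp add: card_image)
    moreover have "{l \<in> ?x. l < i} = insert j {l \<in> ?x. l < j}" using j by (auto simp: less_Suc_eq)
    then have "card {l \<in> ?x. l < i} = Suc (card {l \<in> ?x. l < j})" using finx by simp
    ultimately show False by (intro contra) simp
  next
    case mid
    then have "coord z i = 0" using zT ab(6) by blast
    then show False using i(2) by simp
  next
    case hi
    then have b: "b < i" by (rule hi_gt)
    let ?h = "{l \<in> hi. l < i}"
    have "{l \<in> I. l < i} = Suc ` lo \<union> {a<..b} \<union> ?h" using b ab lo_le by (auto simp: I_def) force+
    moreover have "card (Suc ` lo \<union> {a<..b} \<union> ?h) = card (Suc ` lo) + card {a<..b} + card ?h"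
      using fin lo_le hi_gt ab(2) by (intro card_Un3) force+
    moreover have "{l \<in> ?x. l < i} = lo \<union> {a<..<b} \<union> ?h" unfolding xs using b ab by (auto simp: lo_def)
    moreover have "card (lo \<union> {a<..<b} \<union> ?h) = card lo + card {a<..<b} + card ?h"
      using fin lt hi_gt ab(2) by (intro card_Un3) force+
    ultimately have "card {l \<in> I. l < i} = Suc (card {l \<in> ?x. l < i})" using ab(2) by (simp add: card_image)
    then show False by (intro contra) simp
  qed
qed

text \<open>The positions just after a change of sign form an alternating set, so there are at most
  k of them. A change between n and n + 1 has no such position, which costs one; the parity of the
  number of changes, fixed by the two outer signs, recovers it.\<close>

lemma feasible_var_r_le:
  assumes \<alpha>: "\<alpha> \<in> sign_vectors n" and "feasible n \<eta> \<alpha>"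
  shows "var_r n k \<alpha> \<le> k"
proof -
  obtain z where z: "z \<in> \<eta>" "\<And>i. i \<in> {1..n} \<Longrightarrow> real_of_int (\<alpha> i) * coord z i \<ge> 0"
    using assms(2) by (auto simp: feasible_def chamber_def)
  \<comment> \<open>The plus put in front at index 0 makes the first position after a change
    negative, which is the pattern that \<open>not_alternating\<close> forbids for more than k
    positions.\<close>
  define a where "a i = (if i = 0 then 1 else extend_sign n k \<alpha> i)" for i
  define y where "y = {i \<in> {0..n}. a i \<noteq> a (Suc i)}"
  have fin: "finite y" by (simp add: y_def)
  have v: "a j = 1 \<or> a j = -1" if "j \<le> Suc n" for j
    using that sign_vector_cases[OF \<alpha>, of j]
    by (cases "even k") (auto simp: a_def extend_sign_def)
  have ai: "a i = (-1) ^ card {j \<in> y. j < i}" if "i \<le> Suc n" for i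
    using that
  proof (induction i)
    case (Suc i)
    show ?case
    proof (cases "i \<in> y")
      case True
      then have "{j \<in> y. j < Suc i} = insert i {j \<in> y. j < i}" by (auto simp: less_Suc_eq)
      then have "card {j \<in> y. j < Suc i} = Suc (card {j \<in> y. j < i})" using fin by simp
      moreover have "a (Suc i) = - a i" using True v[of i] v[of "Suc i"] Suc.prems by (auto simp: y_def)
      ultimately show ?thesis using Suc by simp
    next
      case False
      then have "{j \<in> y. j < Suc i} = {j \<in> y. j < i}" by (auto simp: less_Suc_eq)
      moreover have "a (Suc i) = a i" using False Suc.prems by (auto simp: y_def)
      ultimately show ?thesis using Suc by simp
    qed
  qed (simp add: a_def)
  have "{j \<in> y. j < Suc n} = y" by (auto simp: y_def)
  then have "(-1) ^ k = ((-1) ^ card y :: int)" using ai[of "Suc n"] by (simp add: a_def extend_sign_def)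
  then have parity: "even (card y) = even k" by (cases "even k"; cases "even (card y)") auto
  let ?I = "Suc ` (y - {n})"
  have I: "?I \<subseteq> {1..n}" by (auto simp: y_def)
  have "card ?I \<le> k"
  proof (rule ccontr)
    assume "\<not> card ?I \<le> k"
    then obtain i where i: "i \<in> ?I" "(-1) ^ card {j \<in> ?I. j < i} * coord z i > 0"
      using not_alternating[OF z(1) I] by auto
    then obtain j where j: "i = Suc j" "j \<in> y" "j \<noteq> n" by auto
    have "j < n" using j by (simp add: y_def)
    then have n: "n \<notin> {l \<in> y. l < j}" by simp
    have "{l \<in> Suc ` (y - {n}). l < Suc j} = Suc ` ({l \<in> y. l < j} - {n})" by blast
    then have "{l \<in> ?I. l < i} = Suc ` {l \<in> y. l < j}" using n j(1) by simp
    then have "card {l \<in> ?I. l < i} = card {l \<in> y. l < j}" by (simp add: card_image)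
    moreover have "{l \<in> y. l < i} = insert j {l \<in> y. l < j}" using j by (auto simp: less_Suc_eq)
    then have "card {l \<in> y. l < i} = Suc (card {l \<in> y. l < j})" using fin by simp
    moreover have i1: "i \<in> {1..n}" using i I by blast
    then have "\<alpha> i = a i" by (auto simp: a_def extend_sign_def)
    ultimately have "real_of_int (\<alpha> i) * coord z i < 0" using i(2) ai[of i] i1 by simp
    then show False using z(2)[OF i1] by simp
  qed
  then have "card (y - {n}) \<le> k" by (simp add: card_image)
  moreover have "card y \<le> card (insert n (y - {n}))" using fin by (intro card_mono) auto
  moreover have "card (insert n A) \<le> Suc (card A)" if "finite A" for A
    using that by (simp add: card_insert_if)
  then have "card (insert n (y - {n})) \<le> Suc (card (y - {n}))" using fin by (meson finite_Diff)
  ultimately have "card y \<le> Suc k" by linarith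
  then have "card y \<le> k" using parity by (cases "card y = Suc k") auto
  moreover have "sign_subset n k \<alpha> \<subseteq> y" by (auto simp: sign_subset_def y_def a_def)
  from card_mono[OF fin this] have "card (sign_subset n k \<alpha>) \<le> card y" .
  ultimately show ?thesis by (simp add: card_sign_subset)
qed

text \<open>With fewer than k changes there is a vector v in V with \<xi>(v) = 1 whose coordinates
  have weakly the signs of \<alpha>. Moving along v stays in the chamber and is unbounded for
  \<xi>.\<close>

lemma bounded_var_r_ge:
  assumes \<alpha>: "\<alpha> \<in> sign_vectors n" and f: "feasible n \<eta> \<alpha>" and b: "bounded_sign n \<eta> \<xi> \<alpha>"
  shows "k \<le> var_r n k \<alpha>"
proof (rule ccontr)
  let ?x = "sign_subset n k \<alpha>"
  assume "\<not> ?thesis"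
  then have less: "card ?x \<le> k - 1" "1 \<le> k" by (auto simp: card_sign_subset)
  \<comment> \<open>The vector is to vanish on k - 1 indices containing all sign changes. They are
    added from below because with fewer than k changes the signs of \<alpha> can only be counted
    from the fixed right end.\<close>
  obtain K where K: "K \<subseteq> {1..n}" "card K = k - 1"
    "\<And>i. 1 \<le> i \<Longrightarrow> i \<notin> K \<Longrightarrow> i \<notin> ?x \<and> {j \<in> K. i \<le> j} = {j \<in> ?x. i \<le> j}"
    by (rule enlarge_low[OF sign_subset_subset less(1)]) (use k_less in auto)
  have fin: "finite K" using K finite_subset by blast
  have nK: "Suc n \<notin> K" using K by auto
  have K': "insert (Suc n) K \<subseteq> {1..Suc n}" "card (insert (Suc n) K) = k"
    using K fin nK less by auto
  obtain v where v: "v \<in> V" "\<And>i. i \<in> insert (Suc n) K \<Longrightarrow> ext v i = (if i = Suc n then (-1) ^ k else 0)"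
    using prescribe[OF K', of "\<lambda>i. if i = Suc n then (-1) ^ k else 0"] by blast
  have c0: "c\<^sub>0 \<bullet> v = 1" using v(2)[of "Suc n"] by simp
  have v0: "coord v i = 0" if "i \<in> K" for i using v(2)[of i] that nK by (auto split: if_splits)
  have pos: "real_of_int (\<alpha> i) * coord v i \<ge> 0" if i: "i \<in> {1..n}" for i
  proof (cases "i \<in> K")
    case False
    let ?I = "insert i (insert (Suc n) K)"
    have iK: "i \<notin> insert (Suc n) K" using False i by auto
    have I: "?I \<subseteq> {1..Suc n}" "card ?I = Suc k" using K' iK i fin by auto
    let ?t = "\<lambda>j. (-1) ^ card {l \<in> ?I. l < j} * ext v j * P (?I - {j})"
    have "0 = (\<Sum>j\<in>?I. ?t j)" using rel_V[OF v(1) I] by simp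
    also have "\<dots> = ?t i + (?t (Suc n) + (\<Sum>j\<in>K. ?t j))"
      using iK nK fin by simp
    also have "(\<Sum>j\<in>K. ?t j) = 0" using v0 nK by (intro sum.neutral) auto
    finally have 0: "?t i + ?t (Suc n) = 0" by simp
    have "{l \<in> ?I. l < Suc n} = insert i K" using K(1) i by auto
    then have "card {l \<in> ?I. l < Suc n} = k" using fin False K(2) less by simp
    then have tn: "?t (Suc n) = P (?I - {Suc n})" by (simp add: c0 power_add[symmetric] mult_2[symmetric])
    have e: "?I - {Suc n} = insert i K" "?I - {i} = insert (Suc n) K" using nK iK i by auto
    have "P (insert i K) > 0"
      using K i False fin less(2) by (intro P_pos) auto
    then have "P (?I - {Suc n}) > 0" "P (?I - {i}) > 0" unfolding e using P_pos[OF K'] by simp_all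
    have "{l \<in> ?I. l < i} = {l \<in> K. l < i}" using i by auto
    then have ti: "?t i = (-1) ^ card {l \<in> K. l < i} * coord v i * P (?I - {i})" using i by simp
    have "(-1) ^ card {l \<in> K. l < i} * coord v i < 0"
      using 0 \<open>P (?I - {Suc n}) > 0\<close> \<open>P (?I - {i}) > 0\<close> unfolding tn ti
      by (smt (verit) mult_nonneg_nonneg)
    moreover have "k - 1 = card {l \<in> K. l < i} + card {l \<in> ?x. i \<le> l}"
      using card_split_at[OF fin, of i] K(2) K(3)[of i] False i by simp
    then have "odd (card {l \<in> K. l < i} + (k + card {l \<in> ?x. i \<le> l}))" using less(2) odd_sum by blast
    then have "(-1) ^ (k + card {l \<in> ?x. i \<le> l}) = - ((-1) ^ card {l \<in> K. l < i} :: real)"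
      by (cases "even (card {l \<in> K. l < i})") auto
    ultimately show ?thesis unfolding sign_formula_right[OF \<alpha> i, of k] by simp
  qed (simp add: v0)
  obtain z where z: "z \<in> chamber n \<eta> \<alpha>" using f by (auto simp: feasible_def)
  obtain c B where c: "c \<in> \<xi>" and B: "\<And>y. y \<in> chamber n \<eta> \<alpha> \<Longrightarrow> c \<bullet> y \<le> B"
    using b by (auto simp: bounded_sign_def bdd_above_def)
  have zc: "z \<in> \<eta>" "z \<in> carrier_vec n" "v \<in> carrier_vec n" "c \<in> carrier_vec n"
    using z v(1) V_carrier \<eta>_carrier \<xi>_carrier c by (auto simp: chamber_def)
  define t where "t = \<bar>B - c \<bullet> z\<bar> + 1"
  have "z + t \<cdot>\<^sub>v v \<in> chamber n \<eta> \<alpha>"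
    unfolding chamber_def
  proof (intro CollectI conjI ballI)
    show "z + t \<cdot>\<^sub>v v \<in> \<eta>" using zc v(1) V_smult \<eta>_add by blast
    fix i assume i: "i \<in> {1..n}"
    have "real_of_int (\<alpha> i) * coord (z + t \<cdot>\<^sub>v v) i =
        real_of_int (\<alpha> i) * coord z i + t * (real_of_int (\<alpha> i) * coord v i)"
      using i zc by (simp add: coord_add coord_smult algebra_simps)
    moreover have "real_of_int (\<alpha> i) * coord z i \<ge> 0" using z i by (auto simp: chamber_def)
    moreover have "t \<ge> 0" by (simp add: t_def)
    ultimately show "real_of_int (\<alpha> i) * coord (z + t \<cdot>\<^sub>v v) i \<ge> 0" using pos[OF i] by simp
  qed
  then have "c \<bullet> (z + t \<cdot>\<^sub>v v) \<le> B" by (rule B)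
  moreover have "c \<bullet> (z + t \<cdot>\<^sub>v v) = c \<bullet> z + t"
    using zc \<xi>_eq[OF c v(1)] c0 by (simp add: scalar_prod_add_distrib[of _ n])
  ultimately show False by (simp add: t_def)
qed

text \<open>The relation on the state together with the index n + 1 writes -\<xi>(v) as a
  combination of the numbers \<open>\<alpha> i * coord v i\<close>, i in the state, with positive
  coefficients. On the chamber these products are nonnegative, which bounds \<xi> from
  above.\<close>

lemma var_r_eq_bounded:
  assumes \<alpha>: "\<alpha> \<in> sign_vectors n" "var_r n k \<alpha> = k"
  shows "bounded_sign n \<eta> \<xi> \<alpha>"
proof -
  let ?x = "sign_subset n k \<alpha>"
  have x: "?x \<subseteq> {1..n}" "card ?x = k" using sign_subset_subset card_sign_subset \<alpha>(2) by auto
  have fin: "finite ?x" by simp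
  have nx: "Suc n \<notin> ?x" using x by auto
  let ?I = "insert (Suc n) ?x"
  have I: "?I \<subseteq> {1..Suc n}" "card ?I = Suc k" using x fin nx by auto
  have Px: "P ?x > 0" using x by (intro P_pos) auto
  have PI: "P (?I - {i}) > 0" if "i \<in> ?x" for i
    using I x fin nx that by (intro P_pos) (auto simp: card_Diff_singleton_if)
  define s where "s z = (\<Sum>i\<in>?x. real_of_int (\<alpha> i) * coord z i * P (?I - {i})) / P ?x" for z
  have c0: "c\<^sub>0 \<bullet> v = - s v" if v: "v \<in> V" for v
  proof -
    let ?t = "\<lambda>j. (-1) ^ card {l \<in> ?I. l < j} * ext v j * P (?I - {j})"
    have "0 = (\<Sum>j\<in>?I. ?t j)" using rel_V[OF v I] by simp
    also have "\<dots> = ?t (Suc n) + (\<Sum>j\<in>?x. ?t j)" using nx fin by simp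
    also have "(\<Sum>j\<in>?x. ?t j) = (\<Sum>i\<in>?x. real_of_int (\<alpha> i) * coord v i * P (?I - {i}))"
    proof (rule sum.cong[OF refl])
      fix j assume j: "j \<in> ?x"
      then have j1: "j \<in> {1..n}" using x by auto
      then have "{l \<in> ?I. l < j} = {l \<in> ?x. l < j}" by auto
      then show "?t j = real_of_int (\<alpha> j) * coord v j * P (?I - {j})"
        using j1 unfolding sign_formula[OF \<alpha> j1] by auto
    qed
    also have "{l \<in> ?I. l < Suc n} = ?x" using x by auto
    then have "?t (Suc n) = c\<^sub>0 \<bullet> v * P ?x" using x nx by (simp add: power_add[symmetric] mult_2[symmetric])
    finally show ?thesis using Px by (simp add: s_def field_simps)
  qed
  obtain z0 where z0: "z0 \<in> \<eta>" using \<eta>_nonempty by blast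
  have "c\<^sub>0 \<bullet> z \<le> c\<^sub>0 \<bullet> z0 + s z0" if z: "z \<in> chamber n \<eta> \<alpha>" for z
  proof -
    have zc: "z \<in> \<eta>" "z \<in> carrier_vec n" "z0 \<in> carrier_vec n" "c\<^sub>0 \<in> carrier_vec n"
      using z z0 \<eta>_carrier \<xi>_carrier c\<^sub>0_in by (auto simp: chamber_def)
    have cd: "coord (z - z0) i = coord z i - coord z0 i" if "i \<in> {1..n}" for i
      using that zc by (auto simp: coord_def)
    have "s (z - z0) = s z - s z0"
    proof -
      have "(\<Sum>i\<in>?x. real_of_int (\<alpha> i) * coord (z - z0) i * P (?I - {i})) =
          (\<Sum>i\<in>?x. real_of_int (\<alpha> i) * coord z i * P (?I - {i})) -
          (\<Sum>i\<in>?x. real_of_int (\<alpha> i) * coord z0 i * P (?I - {i}))"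
        unfolding sum_subtractf[symmetric]
      proof (rule sum.cong[OF refl])
        fix i assume "i \<in> ?x"
        then have "i \<in> {1..n}" using x by blast
        from cd[OF this] show "real_of_int (\<alpha> i) * coord (z - z0) i * P (?I - {i}) =
            real_of_int (\<alpha> i) * coord z i * P (?I - {i}) - real_of_int (\<alpha> i) * coord z0 i * P (?I - {i})"
          by (simp only: left_diff_distrib right_diff_distrib)
      qed
      then show ?thesis by (simp add: s_def diff_divide_distrib)
    qed
    moreover have "c\<^sub>0 \<bullet> (z - z0) = c\<^sub>0 \<bullet> z - c\<^sub>0 \<bullet> z0" using zc by (simp add: scalar_prod_minus_distrib[of _ n])
    moreover have "s z \<ge> 0"
      unfolding s_def
    proof (intro divide_nonneg_pos sum_nonneg Px)
      fix i assume i: "i \<in> ?x"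
      then have "i \<in> {1..n}" using x by blast
      then have "real_of_int (\<alpha> i) * coord z i \<ge> 0" using z by (simp add: chamber_def)
      then show "real_of_int (\<alpha> i) * coord z i * P (?I - {i}) \<ge> 0"
        using mult_nonneg_nonneg[OF _ less_imp_le[OF PI[OF i]]] by blast
    qed
    ultimately show ?thesis using c0[OF \<eta>_diff[OF zc(1) z0]] by simp
  qed
  then show ?thesis unfolding bounded_sign_def bdd_above_def using c\<^sub>0_in by blast
qed

text \<open>Feasibility is the special case of two equal chambers and no hyperplane: the empty set
  of edges covers no gap.\<close>

lemma bounded_feasible_eq: "bounded_feasible n \<eta> \<xi> = {\<alpha> \<in> sign_vectors n. var_r n k \<alpha> = k}"
proof -
  have "feasible n \<eta> \<alpha>" if "\<alpha> \<in> sign_vectors n" "var_r n k \<alpha> = k" for \<alpha>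
  proof -
    have "live n (sign_subset n k \<alpha>) ({} \<union> {i \<in> {1..n}. \<alpha> i \<noteq> \<alpha> i})"
      by (auto simp: live_def)
    from chambers_meet[OF that that(1) _ this] show ?thesis by (auto simp: feasible_def)
  qed
  then show ?thesis
    using feasible_var_r_le bounded_var_r_ge var_r_eq_bounded
    by (auto simp: bounded_feasible_def intro: le_antisym)
qed

lemma chambers_empty_iff:
  assumes "\<alpha> \<in> bounded_feasible n \<eta> \<xi>" "\<beta> \<in> bounded_feasible n \<eta> \<xi>" "S \<subseteq> {1..n}"
  shows "chamber n \<eta> \<alpha> \<inter> chamber n \<eta> \<beta> \<inter> hyperplane_int \<eta> S = {} \<longleftrightarrow>
    \<not> live n (sign_subset n k \<alpha>) (S \<union> {i \<in> {1..n}. \<alpha> i \<noteq> \<beta> i})"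
  using assms chambers_meet[of \<alpha> \<beta> S] chambers_disjoint[of \<alpha> \<beta> S] unfolding bounded_feasible_eq by blast

end

section \<open>Maximal minors, and the sign fixed by the projection of \<eta>\<close>

section \<open>Minors of right cyclic arrangements\<close>

definition minor :: "real mat \<Rightarrow> nat set \<Rightarrow> real" where
  "minor M J = det (submatrix M UNIV J)"

definition laplace_sum :: "real mat \<Rightarrow> (nat \<Rightarrow> real) \<Rightarrow> nat set \<Rightarrow> real" where
  "laplace_sum M z I = (\<Sum>i\<in>I. (-1) ^ card {j \<in> I. j < i} * z i * minor M (I - {i}))"

definition bordered :: "real mat \<Rightarrow> (nat \<Rightarrow> real) \<Rightarrow> nat set \<Rightarrow> real mat" where
  "bordered M z I = mat (card I) (card I)
     (\<lambda>(i, c). if i = 0 then z (pick I c) else M $$ (i - 1, pick I c))"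

lemma pick_bij:
  assumes "finite I"
  shows "bij_betw (pick I) {..<card I} I"
proof (rule bij_betw_byWitness[where f' = "\<lambda>i. card {a \<in> I. a < i}"])
  show "\<forall>c\<in>{..<card I}. card {a \<in> I. a < pick I c} = c"
    using card_pick by auto
  show "\<forall>i\<in>I. pick I (card {a \<in> I. a < i}) = i" using pick_card_in_set by auto
  show "pick I ` {..<card I} \<subseteq> I" using pick_in_set_le by auto
  have "card {a \<in> I. a < i} < card I" if "i \<in> I" for i
    using assms that by (intro psubset_card_mono) auto
  then show "(\<lambda>i. card {a \<in> I. a < i}) ` I \<subseteq> {..<card I}" by auto
qed

lemma pick_remove:
  assumes "finite I" "j < card I" "c < card I - 1"
  shows "pick (I - {pick I j}) c = pick I (if c < j then c else Suc c)"
proof -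
  let ?c = "if c < j then c else Suc c"
  have c: "?c < card I" "?c \<noteq> j" using assms by auto
  have inj: "pick I a = pick I b \<longleftrightarrow> a = b" if "a < card I" "b < card I" for a b
    using bij_betw_imp_inj_on[OF pick_bij[OF assms(1)]] that by (auto simp: inj_on_def)
  have mem: "pick I ?c \<in> I - {pick I j}" using pick_in_set_le[OF c(1)] inj c assms(2) by auto
  have less: "pick I j < pick I ?c \<longleftrightarrow> j < ?c"
  proof -
    have "pick I a < pick I b" if "a < b" "b < card I" for a b using pick_mono_le[of b I a] that by simp
    then show ?thesis using c assms(2) by (metis less_asym' linorder_neqE_nat)
  qed
  have "card {a \<in> I - {pick I j}. a < pick I ?c} = c"
  proof (cases "c < j")
    case True
    then have "{a \<in> I - {pick I j}. a < pick I ?c} = {a \<in> I. a < pick I ?c}" using less by auto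
    then show ?thesis using card_pick[OF disjI1[OF c(1)]] True by simp
  next
    case False
    then have "{a \<in> I - {pick I j}. a < pick I ?c} = {a \<in> I. a < pick I ?c} - {pick I j}"
      "pick I j \<in> {a \<in> I. a < pick I ?c}"
      using less pick_in_set_le[OF assms(2)] by auto
    then have "card {a \<in> I - {pick I j}. a < pick I ?c} = card {a \<in> I. a < pick I ?c} - 1"
      using assms(1) by simp
    then show ?thesis using card_pick[OF disjI1[OF c(1)]] False by simp
  qed
  then show ?thesis using pick_card_in_set[OF mem] by simp
qed

lemma submatrix_UNIV_carrier:
  assumes "M \<in> carrier_mat r m" "J \<subseteq> {0..<m}"
  shows "submatrix M UNIV J \<in> carrier_mat r (card J)"
    and "i < r \<Longrightarrow> c < card J \<Longrightarrow> submatrix M UNIV J $$ (i, c) = M $$ (i, pick J c)"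
proof -
  have "{j. j < m \<and> j \<in> J} = J" using assms(2) by auto
  then show "submatrix M UNIV J \<in> carrier_mat r (card J)"
    "i < r \<Longrightarrow> c < card J \<Longrightarrow> submatrix M UNIV J $$ (i, c) = M $$ (i, pick J c)"
    using assms(1) by (auto simp: submatrix_def pick_UNIV)
qed

text \<open>Expansion along the added top row. The column at position j belongs to the element of
  \<open>I\<close> with exactly j smaller ones, so the cofactor sign is the counting sign.\<close>

lemma det_bordered:
  assumes M: "M \<in> carrier_mat r m" and I: "I \<subseteq> {0..<m}" "card I = Suc r"
  shows "det (bordered M z I) = laplace_sum M z I"
proof -
  have fin: "finite I" using I(1) finite_subset by blast
  let ?B = "bordered M z I"
  have B: "?B \<in> carrier_mat (Suc r) (Suc r)" by (simp add: bordered_def I(2))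
  have "det ?B = (\<Sum>j<Suc r. ?B $$ (0, j) * cofactor ?B 0 j)" by (rule laplace_expansion_row[OF B]) simp
  also have "\<dots> = (\<Sum>j<card I. (-1) ^ card {a \<in> I. a < pick I j} * z (pick I j) * minor M (I - {pick I j}))"
    unfolding I(2)
  proof (rule sum.cong[OF refl])
    fix j assume "j \<in> {..<Suc r}"
    then have j: "j < Suc r" "j < card I" using I(2) by auto
    have p: "pick I j \<in> I" by (rule pick_in_set_le[OF j(2)])
    have J: "I - {pick I j} \<subseteq> {0..<m}" "card (I - {pick I j}) = r" using I p fin by auto
    have "mat_delete ?B 0 j = submatrix M UNIV (I - {pick I j})"
    proof (rule eq_matI)
      fix a c assume "a < dim_row (submatrix M UNIV (I - {pick I j}))"
        "c < dim_col (submatrix M UNIV (I - {pick I j}))"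
      then have ac: "a < r" "c < r" using submatrix_UNIV_carrier(1)[OF M J(1)] J(2) by auto
      have "mat_delete ?B 0 j $$ (a, c) = M $$ (a, pick I (if c < j then c else Suc c))"
        using ac B I(2) by (simp add: mat_delete_def bordered_def)
      also have "\<dots> = M $$ (a, pick (I - {pick I j}) c)"
        using pick_remove[OF fin j(2), of c] ac I(2) by simp
      finally show "mat_delete ?B 0 j $$ (a, c) = submatrix M UNIV (I - {pick I j}) $$ (a, c)"
        using submatrix_UNIV_carrier(2)[OF M J(1)] ac J(2) by simp
    qed (use B submatrix_UNIV_carrier(1)[OF M J(1)] J(2) in \<open>auto simp: mat_delete_def\<close>)
    then have "cofactor ?B 0 j = (-1) ^ j * minor M (I - {pick I j})"
      by (simp add: cofactor_def minor_def)
    moreover have "?B $$ (0, j) = z (pick I j)" using j by (simp add: bordered_def)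
    moreover have "card {a \<in> I. a < pick I j} = j" by (rule card_pick[OF disjI1[OF j(2)]])
    ultimately show "?B $$ (0, j) * cofactor ?B 0 j =
        (-1) ^ card {a \<in> I. a < pick I j} * z (pick I j) * minor M (I - {pick I j})" by simp
  qed
  also have "\<dots> = laplace_sum M z I"
    unfolding laplace_sum_def by (rule sum.reindex_bij_betw[OF pick_bij[OF fin]])
  finally show ?thesis .
qed

lemma laplace_sum_row:
  assumes M: "M \<in> carrier_mat r m" and I: "I \<subseteq> {0..<m}" "card I = Suc r" and s: "s < r"
  shows "laplace_sum M (\<lambda>i. M $$ (s, i)) I = 0"
proof -
  let ?B = "bordered M (\<lambda>i. M $$ (s, i)) I"
  have "det ?B = 0"
  proof (rule det_identical_rows[of _ "Suc r" 0 "Suc s"])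
    show "?B \<in> carrier_mat (Suc r) (Suc r)" by (simp add: bordered_def I(2))
    show "row ?B 0 = row ?B (Suc s)" using s I(2) by (intro eq_vecI) (auto simp: bordered_def)
  qed (use s in auto)
  then show ?thesis using det_bordered[OF M I] by simp
qed

lemma laplace_sum_comb:
  assumes M: "M \<in> carrier_mat r m" and I: "I \<subseteq> {0..<m}" "card I = Suc r"
    and z: "\<And>i. i \<in> I \<Longrightarrow> z i = (\<Sum>s<r. y s * M $$ (s, i))"
  shows "laplace_sum M z I = 0"
proof -
  have "laplace_sum M z I = (\<Sum>i\<in>I. \<Sum>s<r. y s * ((-1) ^ card {j \<in> I. j < i} * M $$ (s, i) * minor M (I - {i})))"
    unfolding laplace_sum_def
    by (rule sum.cong[OF refl]) (simp add: z sum_distrib_left sum_distrib_right algebra_simps)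
  also have "\<dots> = (\<Sum>s<r. y s * laplace_sum M (\<lambda>i. M $$ (s, i)) I)"
    unfolding laplace_sum_def sum_distrib_left by (rule sum.swap)
  also have "\<dots> = 0" by (rule sum.neutral) (use laplace_sum_row[OF M I] in auto)
  finally show ?thesis .
qed

text \<open>The columns \<open>I\<close> of N factor as a fixed square matrix times the bordered
  matrix, so all maximal minors of N are the same multiple of the Laplace sums of h. This links the
  minors of the two spaces.\<close>

lemma minor_of_combinations:
  assumes M: "M \<in> carrier_mat r m" and N: "N \<in> carrier_mat (Suc r) n" and "n \<le> m"
    and A: "A \<in> carrier_mat (Suc r) (Suc r)"
    and eq: "\<And>a i. a < Suc r \<Longrightarrow> i < n \<Longrightarrow>
      N $$ (a, i) = A $$ (a, 0) * h i + (\<Sum>s<r. A $$ (a, Suc s) * M $$ (s, i))"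
    and I: "I \<subseteq> {0..<n}" "card I = Suc r"
  shows "minor N I = det A * laplace_sum M h I"
proof -
  let ?B = "bordered M h I"
  have B: "?B \<in> carrier_mat (Suc r) (Suc r)" by (simp add: bordered_def I(2))
  have "submatrix N UNIV I = A * ?B"
  proof (rule eq_matI)
    fix a c assume "a < dim_row (A * ?B)" "c < dim_col (A * ?B)"
    then have ac: "a < Suc r" "c < Suc r" using A B by auto
    have p: "pick I c < n" using pick_in_set_le[of c I] ac I by auto
    have "(A * ?B) $$ (a, c) = (\<Sum>b<Suc r. A $$ (a, b) * ?B $$ (b, c))"
      using A B ac by (simp add: scalar_prod_def atLeast0LessThan)
    also have "\<dots> = A $$ (a, 0) * h (pick I c) + (\<Sum>s<r. A $$ (a, Suc s) * M $$ (s, pick I c))"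
      unfolding sum.lessThan_Suc_shift using ac I(2) by (simp add: bordered_def)
    also have "\<dots> = N $$ (a, pick I c)" using eq[OF ac(1) p] by simp
    also have "\<dots> = submatrix N UNIV I $$ (a, c)"
      using submatrix_UNIV_carrier(2)[OF N I(1)] ac I(2) by simp
    finally show "submatrix N UNIV I $$ (a, c) = (A * ?B) $$ (a, c)" by simp
  qed (use submatrix_UNIV_carrier(1)[OF N I(1)] A B I(2) in auto)
  then have "minor N I = det A * det ?B" unfolding minor_def using det_mult[OF A B] by simp
  moreover have "I \<subseteq> {0..<m}" using I(1) \<open>n \<le> m\<close> by fastforce
  ultimately show ?thesis using det_bordered[OF M _ I(2)] by simp
qed

lemma prescribe_coords:
  assumes M: "M \<in> carrier_mat r m" and K: "K \<subseteq> {0..<m}" "card K = r" and nz: "minor M K \<noteq> 0"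
  shows "\<exists>y. \<forall>i\<in>K. (\<Sum>s<r. y s * M $$ (s, i)) = g i"
proof -
  have fin: "finite K" using K(1) finite_subset by blast
  let ?S = "submatrix M UNIV K"
  have S: "?S \<in> carrier_mat r r" using submatrix_UNIV_carrier(1)[OF M K(1)] K(2) by simp
  then have St: "?S\<^sup>T \<in> carrier_mat r r" by simp
  have "det ?S\<^sup>T \<noteq> 0" using nz det_transpose[OF S] by (simp add: minor_def)
  from det_non_zero_imp_unit[OF St this, of "()"]
  obtain B where B: "B \<in> carrier_mat r r" "?S\<^sup>T * B = 1\<^sub>m r" by (auto simp: Units_def ring_mat_def)
  define b where "b = vec r (\<lambda>c. g (pick K c))"
  define y where "y = B *\<^sub>v b"
  have yc: "y \<in> carrier_vec r" using B by (simp add: y_def b_def)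
  have "?S\<^sup>T *\<^sub>v y = b"
    unfolding y_def using assoc_mult_mat_vec[OF St B(1), of b] B(2) by (simp add: b_def)
  have "(\<Sum>s<r. y $ s * M $$ (s, i)) = g i" if i: "i \<in> K" for i
  proof -
    obtain c where c: "c < r" "i = pick K c" using pick_bij[OF fin] i K(2) by (auto simp: bij_betw_def)
    have "g i = (?S\<^sup>T *\<^sub>v y) $ c" unfolding \<open>?S\<^sup>T *\<^sub>v y = b\<close> using c by (simp add: b_def)
    also have "\<dots> = (\<Sum>s<r. ?S $$ (s, c) * y $ s)"
      using S yc c(1) by (simp add: scalar_prod_def atLeast0LessThan)
    also have "\<dots> = (\<Sum>s<r. y $ s * M $$ (s, i))"
      using submatrix_UNIV_carrier(2)[OF M K(1)] c K(2) by (intro sum.cong) auto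
    finally show ?thesis by simp
  qed
  then show ?thesis by blast
qed

lemma row_space_iff:
  assumes "(M :: real mat) \<in> carrier_mat r n"
  shows "w \<in> vec_space.row_space n M \<longleftrightarrow>
    w \<in> carrier_vec n \<and> (\<exists>y. \<forall>i<n. w $ i = (\<Sum>s<r. y s * M $$ (s, i)))"
proof -
  have e: "(M\<^sup>T *\<^sub>v y) $ i = (\<Sum>s<r. y $ s * M $$ (s, i))" if "y \<in> carrier_vec r" "i < n" for y i
    using assms that by (simp add: scalar_prod_def atLeast0LessThan mult.commute)
  have *: "w \<in> vec_space.row_space n M \<longleftrightarrow> w \<in> carrier_vec n \<and> (\<exists>y\<in>carrier_vec r. M\<^sup>T *\<^sub>v y = w)"
    using vec_space.row_space_eq[OF assms] assms by auto
  show ?thesis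
  proof
    assume "w \<in> vec_space.row_space n M"
    then obtain y where "w \<in> carrier_vec n" "y \<in> carrier_vec r" "M\<^sup>T *\<^sub>v y = w" using * by blast
    then show "w \<in> carrier_vec n \<and> (\<exists>y. \<forall>i<n. w $ i = (\<Sum>s<r. y s * M $$ (s, i)))"
      using e[of y] by auto
  next
    assume "w \<in> carrier_vec n \<and> (\<exists>y. \<forall>i<n. w $ i = (\<Sum>s<r. y s * M $$ (s, i)))"
    then obtain y where y: "w \<in> carrier_vec n" "\<And>i. i < n \<Longrightarrow> w $ i = (\<Sum>s<r. y s * M $$ (s, i))" by blast
    have "M\<^sup>T *\<^sub>v vec r y = w"
      using y assms e[of "vec r y"] by (intro eq_vecI) auto
    then show "w \<in> vec_space.row_space n M" using * y(1) by (metis vec_carrier)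
  qed
qed

lemma linear_subspaceD:
  assumes "linear_subspace n k V"
  shows "V \<subseteq> carrier_vec n" "0\<^sub>v n \<in> V" "v \<in> V \<Longrightarrow> w \<in> V \<Longrightarrow> v + w \<in> V" "v \<in> V \<Longrightarrow> t \<cdot>\<^sub>v v \<in> V"
proof -
  have "submodule class_ring V (module_vec TYPE(real) n)"
    using assms by (simp add: linear_subspace_def VectorSpace.subspace_def)
  then interpret submodule class_ring V "module_vec TYPE(real) n" .
  show "V \<subseteq> carrier_vec n" "0\<^sub>v n \<in> V" "v \<in> V \<Longrightarrow> w \<in> V \<Longrightarrow> v + w \<in> V" "v \<in> V \<Longrightarrow> t \<cdot>\<^sub>v v \<in> V"
    using subset zero_closed m_closed[of v w] smult_closed[of t v]
    by (auto simp: module_vec_def)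
qed

text \<open>Positivity of minors says nothing when there are too few columns to form one; it is the
  dimension that excludes this and yields k < n.\<close>

lemma dim_row_space_le:
  assumes "linear_subspace n r (vec_space.row_space n M)" "(M :: real mat) \<in> carrier_mat q n"
  shows "r \<le> n"
proof -
  interpret vec_space "TYPE(real)" n .
  let ?W = "row_space M"
  have sub: "VectorSpace.subspace class_ring ?W V" using assms(1) by (simp add: linear_subspace_def)
  then have subm: "submodule class_ring ?W V" by (simp add: VectorSpace.subspace_def)
  interpret W: vectorspace class_ring "vs ?W" by (rule subspace_is_vs[OF sub])
  have "W.fin_dim" using fin_dim_span_rows[OF assms(2)] by (simp add: row_space_def)
  then obtain \<beta> where \<beta>: "finite \<beta>" "W.basis \<beta>" using W.finite_basis_exists by blast
  have "r = card \<beta>" using W.dim_basis[OF \<beta>] assms(1) by (simp add: linear_subspace_def)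
  moreover have "lin_indpt \<beta>" "\<beta> \<subseteq> ?W"
    using \<beta>(2) span_li_not_depend(2)[OF _ subm, of \<beta>] by (auto simp: W.basis_def)
  moreover have "?W \<subseteq> carrier V" using submodule.subset[OF subm] .
  ultimately show ?thesis using li_le_dim(2)[of \<beta>] fin_dim dim_is_n by auto
qed

text \<open>Applied to the projection \<open>w\<close> of \<open>\<eta>\<close> to the orthogonal complement of \<open>V\<close>: if the minors
  involving \<open>\<eta>\<close> had the wrong sign, some \<open>v \<in> V\<close> would have the signs of \<open>w\<close>, contradicting
  \<open>v \<bullet> w = 0\<close>.\<close>

lemma weak_signs:
  fixes w :: "nat \<Rightarrow> real"
  assumes "1 \<le> m" "w 1 > 0"
  shows "\<exists>K\<subseteq>{2..m}. (\<forall>i\<in>{1..m} - K. (-1) ^ card {j \<in> K. j < i} * w i > 0) \<and>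
    (\<forall>i\<in>K. (-1) ^ card {j \<in> K. j < i} * w i \<le> 0)"
  using assms(1)
proof (induction m rule: dec_induct)
  case base
  have "{1..1 :: nat} = {1}" by auto
  then show ?case using assms(2) by (intro exI[of _ "{}"]) simp
next
  case (step m)
  then obtain K where K: "K \<subseteq> {2..m}"
    "\<And>i. i \<in> {1..m} - K \<Longrightarrow> (-1) ^ card {j \<in> K. j < i} * w i > 0"
    "\<And>i. i \<in> K \<Longrightarrow> (-1) ^ card {j \<in> K. j < i} * w i \<le> 0" by blast
  show ?case
  proof (cases "(-1) ^ card {j \<in> K. j < Suc m} * w (Suc m) > 0")
    case True
    have "(-1) ^ card {j \<in> K. j < i} * w i > 0" if "i \<in> {1..Suc m} - K" for i
      using that True K(2)[of i] by (cases "i = Suc m") auto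
    moreover have "K \<subseteq> {2..Suc m}" using K(1) by auto
    ultimately show ?thesis using K(3) by blast
  next
    case False
    let ?K = "insert (Suc m) K"
    have e: "{j \<in> ?K. j < i} = {j \<in> K. j < i}" if "i \<le> Suc m" for i using that by auto
    have "(-1) ^ card {j \<in> ?K. j < i} * w i > 0" if "i \<in> {1..Suc m} - ?K" for i
    proof -
      have "i \<in> {1..m} - K" "i \<le> Suc m" using that by auto
      then show ?thesis using K(2)[of i] e[of i] by simp
    qed
    moreover have "(-1) ^ card {j \<in> ?K. j < i} * w i \<le> 0" if "i \<in> ?K" for i
    proof (cases "i = Suc m")
      case True
      then show ?thesis using False e[of i] by simp
    next
      case False
      then have "i \<in> K" "i \<le> Suc m" using that K(1) by auto
      then show ?thesis using K(3)[of i] e[of i] by simp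
    qed
    moreover have "?K \<subseteq> {2..Suc m}" using K(1) step by auto
    ultimately show ?thesis by blast
  qed
qed

text \<open>\<open>K\<close> collects the indices at which w departs from the sign pattern built up
  so far. Together with 1 they form a set on which w alternates weakly, starting with plus, so
  negativity of the sums leaves room for at most k - 1 of them. A vector with first entry 1 and
  zeros on k - 1 indices including these has strictly the signs of w elsewhere.\<close>

lemma not_all_negative:
  fixes P :: "nat set \<Rightarrow> real" and w :: "nat \<Rightarrow> real"
  assumes k: "k < n" and w1: "w 1 > 0"
    and P: "\<And>J. J \<subseteq> {1..n} \<Longrightarrow> card J = k \<Longrightarrow> P J > 0"
    and rel: "\<And>v I. v \<in> L \<Longrightarrow> I \<subseteq> {1..n} \<Longrightarrow> card I = Suc k \<Longrightarrow>
      (\<Sum>i\<in>I. (-1) ^ card {j \<in> I. j < i} * v i * P (I - {i})) = 0"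
    and pre: "\<And>K g. K \<subseteq> {1..n} \<Longrightarrow> card K = k \<Longrightarrow> \<exists>v\<in>L. \<forall>i\<in>K. v i = g i"
    and orth: "\<And>v. v \<in> L \<Longrightarrow> (\<Sum>i\<in>{1..n}. v i * w i) = 0"
    and neg: "\<And>I. I \<subseteq> {1..n} \<Longrightarrow> card I = Suc k \<Longrightarrow>
      (\<Sum>i\<in>I. (-1) ^ card {j \<in> I. j < i} * w i * P (I - {i})) < 0"
  shows False
proof -
  obtain K where K: "K \<subseteq> {2..n}"
    "\<And>i. i \<in> {1..n} - K \<Longrightarrow> (-1) ^ card {j \<in> K. j < i} * w i > 0"
    "\<And>i. i \<in> K \<Longrightarrow> (-1) ^ card {j \<in> K. j < i} * w i \<le> 0"
  proof -
    have "1 \<le> n" using k by simp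
    from weak_signs[of n w, OF this w1] show thesis using that by blast
  qed
  have fin: "finite K" using K(1) finite_subset by blast
  have K1: "1 \<notin> K" using K(1) by auto
  let ?I = "insert 1 K"
  have cI: "card ?I = Suc (card K)" using fin K1 by simp
  have small: "Suc (card K) \<le> k"
  proof (rule ccontr)
    assume "\<not> ?thesis"
    then have "Suc k \<le> card ?I" using cI by simp
    then obtain J where J: "J \<subseteq> ?I" "card J = Suc k" "\<And>i. i \<in> J \<Longrightarrow> {j \<in> J. j < i} = {j \<in> ?I. j < i}"
      using initial_segment[of ?I "Suc k"] fin by blast
    have Jn: "J \<subseteq> {1..n}" using J(1) K(1) k by fastforce
    have "(\<Sum>i\<in>J. (-1) ^ card {j \<in> J. j < i} * w i * P (J - {i})) \<ge> 0"
    proof (rule sum_nonneg)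
      fix i assume i: "i \<in> J"
      have "P (J - {i}) > 0"
        using Jn J(2) i by (intro P) (auto simp: card_Diff_singleton_if)
      moreover have "(-1) ^ card {j \<in> J. j < i} * w i \<ge> 0"
      proof (cases "i = 1")
        case True
        then have "{j \<in> ?I. j < i} = {}" using K(1) by auto
        then show ?thesis unfolding J(3)[OF i] using True w1 by (simp only: card.empty) simp
      next
        case False
        then have iK: "i \<in> K" "1 < i" using i J(1) K(1) by auto
        then have "card {j \<in> ?I. j < i} = Suc (card {j \<in> K. j < i})"
          using card_less_insert[OF fin K1, of i] by simp
        then show ?thesis unfolding J(3)[OF i] using K(3)[OF iK(1)] by simp
      qed
      ultimately show "(-1) ^ card {j \<in> J. j < i} * w i * P (J - {i}) \<ge> 0" by simp
    qed
    then show False using neg[OF Jn J(2)] by simp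
  qed
  \<comment> \<open>Filling up from the top does not disturb the signs at the indices that remain
    outside.\<close>
  obtain K' where K': "K' \<subseteq> {2..n}" "card K' = k - 1"
    "\<And>i. i \<le> n \<Longrightarrow> i \<notin> K' \<Longrightarrow> i \<notin> K \<and> {j \<in> K'. j < i} = {j \<in> K. j < i}"
    by (rule enlarge_high[OF K(1), of "k - 1"]) (use small k in auto)
  have fin': "finite K'" using K'(1) finite_subset by blast
  have K1': "1 \<notin> K'" using K'(1) by auto
  let ?L = "insert 1 K'"
  have L: "?L \<subseteq> {1..n}" "card ?L = k" using K' fin' K1' k small by auto
  obtain v where v: "v \<in> L" "\<And>i. i \<in> ?L \<Longrightarrow> v i = (if i = 1 then 1 else 0)"
    using pre[OF L, of "\<lambda>i. if i = 1 then 1 else 0"] by blast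
  have pos: "v i * w i > 0" if i: "i \<in> {1..n} - ?L" for i
  proof -
    let ?J = "insert i ?L"
    have J: "?J \<subseteq> {1..n}" "card ?J = Suc k" using L i fin' by auto
    let ?t = "\<lambda>j. (-1) ^ card {l \<in> ?J. l < j} * v j * P (?J - {j})"
    have "0 = (\<Sum>j\<in>?J. ?t j)" using rel[OF v(1) J] by simp
    also have "\<dots> = ?t i + (?t 1 + (\<Sum>j\<in>K'. ?t j))" using i K1' fin' by simp
    also have "(\<Sum>j\<in>K'. ?t j) = 0" using v(2) K1' by (intro sum.neutral) auto
    finally have 0: "?t i + ?t 1 = 0" by simp
    have "{l \<in> ?J. l < 1} = {}" using J(1) by auto
    then have "card {l \<in> ?J. l < 1} = 0" by (simp only: card.empty)
    moreover have "v 1 = 1" using v(2)[of 1] by simp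
    ultimately have t1: "?t 1 = P (?J - {1})" by (simp only: power_0 mult_1_left)
    have "{l \<in> ?J. l < i} = insert 1 {l \<in> K'. l < i}" using i by auto
    then have "card {l \<in> ?J. l < i} = Suc (card {l \<in> K'. l < i})" using fin' K1' by simp
    then have ti: "?t i = - ((-1) ^ card {l \<in> K'. l < i} * v i) * P (?J - {i})" by simp
    have P1: "P (?J - {1}) > 0" "P (?J - {i}) > 0"
      using J i fin' by (auto intro!: P simp: card_Diff_singleton_if)
    define a :: real where "a = (-1) ^ card {l \<in> K'. l < i}"
    have "a * v i * P (?J - {i}) = P (?J - {1})" using 0 unfolding t1 ti a_def by simp
    then have "a * v i > 0" using P1 by (metis zero_less_mult_pos2)
    moreover have "a * w i > 0"
    proof -
      have iK: "i \<le> n" "i \<notin> K'" "i \<in> {1..n}" using i by auto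
      have "i \<in> {1..n} - K" using K'(3)[OF iK(1,2)] iK(3) by blast
      then show ?thesis using K(2)[of i] K'(3)[OF iK(1,2)] by (simp add: a_def)
    qed
    moreover have "a * a = 1" by (simp add: a_def power_add[symmetric] mult_2[symmetric])
    ultimately have "(a * v i) * (a * w i) > 0" by simp
    also have "(a * v i) * (a * w i) = (a * a) * (v i * w i)" by (simp add: algebra_simps)
    finally show ?thesis using \<open>a * a = 1\<close> by simp
  qed
  have "(\<Sum>i\<in>{1..n}. v i * w i) > 0"
  proof (rule sum_pos2[of _ 1])
    show "1 \<in> {1..n}" using k by simp
    show "v 1 * w 1 > 0" using v(2)[of 1] w1 by simp
    show "v i * w i \<ge> 0" if "i \<in> {1..n}" for i
      using that pos[of i] v(2)[of i] w1 by (cases "i \<in> ?L") (auto split: if_splits)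
  qed simp
  then show False using orth[OF v(1)] by simp
qed

lemma laplace_sum_shift:
  assumes "P = (\<lambda>J. \<epsilon> * minor M ((\<lambda>j. j - 1) ` J))"
  shows "(\<Sum>i\<in>Suc ` I. (-1) ^ card {j \<in> Suc ` I. j < i} * g i * P (Suc ` I - {i})) =
    \<epsilon> * laplace_sum M (\<lambda>i. g (Suc i)) I"
proof -
  have c: "card {j \<in> Suc ` I. j < Suc i} = card {j \<in> I. j < i}" for i
  proof -
    have "{j \<in> Suc ` I. j < Suc i} = Suc ` {j \<in> I. j < i}" by auto
    then show ?thesis by (simp add: card_image)
  qed
  have d: "(\<lambda>j. j - 1) ` (Suc ` I - {Suc i}) = I - {i}" for i by force
  show ?thesis
    unfolding sum.reindex[OF inj_Suc[THEN inj_on_subset[OF _ subset_UNIV]]] laplace_sum_def sum_distrib_left comp_def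
      assms c d
    by (rule sum.cong[OF refl]) (simp only: mult_ac)
qed

lemma Suc_image_ex:
  assumes "I \<subseteq> {1..m}"
  obtains I' where "I = Suc ` I'" "I' \<subseteq> {0..<m}" "card I' = card I"
proof -
  have "I = Suc ` ((\<lambda>j. j - 1) ` I)" using assms by force
  moreover have "(\<lambda>j. j - 1) ` I \<subseteq> {0..<m}" using assms by fastforce
  ultimately show thesis using that by (metis card_image inj_Suc inj_on_subset subset_UNIV)
qed

text \<open>All conditions are expressed in the minors of one matrix, that of the extended space.
  Since differences of points of \<eta> lie in V, the sums in question are the same for all points
  of \<eta>, and it suffices to find their sign at the projection \<open>w\<close>, which itself
  lies in \<eta>.\<close>

theorem right_cyclic_coords:
  assumes rc: "right_cyclic n k V \<eta> \<xi>"
  shows "\<exists>c\<^sub>0 P. cyclic_coords n k V \<eta> \<xi> c\<^sub>0 P"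
proof -
  have pa: "linear_subspace n k V" "is_coset n V \<eta>" "is_coset n (perp n V) \<xi>"
    using rc by (auto simp: right_cyclic_def polarized_arrangement_def)
  note V = linear_subspaceD[OF pa(1)]
  obtain h where h: "h \<in> carrier_vec n" "\<eta> = (\<lambda>w. h + w) ` V" using pa(2) by (auto simp: is_coset_def)
  have h\<eta>: "h \<in> \<eta>" using h V(2) by (force intro!: image_eqI[of _ _ "0\<^sub>v n"])
  have perp: "perp n V = {x \<in> carrier_vec n. \<forall>y\<in>V. x \<bullet> y = 0}"
    by (auto simp: vec_module.orthogonal_complement_def)
  obtain c\<^sub>0 where c0: "c\<^sub>0 \<in> carrier_vec n" "\<xi> = (\<lambda>w. c\<^sub>0 + w) ` perp n V" using pa(3) by (auto simp: is_coset_def)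
  have "0\<^sub>v n \<in> perp n V" using V(1) by (auto simp: perp)
  then have c0\<xi>: "c\<^sub>0 \<in> \<xi>" using c0 by (force intro!: image_eqI[of _ _ "0\<^sub>v n"])
  have \<xi>c: "\<xi> \<subseteq> carrier_vec n" using c0 by (auto simp: perp)
  have \<xi>eq: "c \<bullet> v = c\<^sub>0 \<bullet> v" if "c \<in> \<xi>" "v \<in> V" for c v
  proof -
    have "c \<in> (\<lambda>w. c\<^sub>0 + w) ` perp n V" using that(1) c0(2) by simp
    then obtain w where w: "c = c\<^sub>0 + w" "w \<in> perp n V" by (rule imageE)
    then have "w \<bullet> v = 0" "w \<in> carrier_vec n" "v \<in> carrier_vec n" using that V(1) by (auto simp: perp)
    then show ?thesis using w c0(1) by (simp add: add_scalar_prod_distrib[of _ n])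
  qed
  have \<eta>c: "\<eta> \<subseteq> carrier_vec n" using h V(1) by auto
  have \<eta>add: "z + v \<in> \<eta>" if z: "z \<in> \<eta>" and v: "v \<in> V" for z v
  proof -
    have "z \<in> (\<lambda>w. h + w) ` V" using z h(2) by simp
    then obtain u where u: "z = h + u" "u \<in> V" by (rule imageE)
    have "z + v = h + (u + v)" using u v V(1) h(1) by (simp add: subset_iff assoc_add_vec[of _ n])
    then show ?thesis using h(2) V(3)[OF u(2) v] by blast
  qed
  have \<eta>diff: "z - z' \<in> V" if z: "z \<in> \<eta>" and z': "z' \<in> \<eta>" for z z'
  proof -
    have "z \<in> (\<lambda>w. h + w) ` V" "z' \<in> (\<lambda>w. h + w) ` V" using z z' h(2) by simp_all
    then obtain u u' where u: "z = h + u" "u \<in> V" "z' = h + u'" "u' \<in> V" by (elim imageE)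
    have "z - z' = u + (-1) \<cdot>\<^sub>v u'" 
    proof -
      have "u \<in> carrier_vec n" "u' \<in> carrier_vec n" using u V(1) by auto
      then show ?thesis unfolding u(1,3) using h(1) by (intro eq_vecI) auto
    qed
    then show ?thesis using V(3)[OF u(2) V(4)[OF u(4)]] by simp
  qed
  let ?ext = "\<lambda>v i. if i = Suc n then (-1) ^ k * (c\<^sub>0 \<bullet> v) else coord v i"
  obtain M where M: "M \<in> carrier_mat k (n + 1)"
    and rs: "vec_space.row_space (n + 1) M =
      {v @\<^sub>v vec 1 (\<lambda>_. (-1) ^ k * (c \<bullet> v)) | v c. v \<in> V \<and> c \<in> \<xi>}"
    and minors: "(\<forall>J\<subseteq>{0..<n + 1}. card J = k \<longrightarrow> minor M J > 0) \<or>
      (\<forall>J\<subseteq>{0..<n + 1}. card J = k \<longrightarrow> minor M J < 0)"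
    using rc unfolding right_cyclic_def gr_pos_def minor_def by auto
  \<comment> \<open>The matrix is determined by its row space only up to a change of basis, so its
    minors may all be negative.\<close>
  define \<epsilon> :: real where "\<epsilon> = (if \<forall>J\<subseteq>{0..<n + 1}. card J = k \<longrightarrow> minor M J > 0 then 1 else -1)"
  have \<epsilon>: "\<epsilon> * minor M J > 0" if "J \<subseteq> {0..<n + 1}" "card J = k" for J
    using minors that by (auto simp: \<epsilon>_def)
  define P where "P = (\<lambda>J. \<epsilon> * minor M ((\<lambda>j. j - 1) ` J))"
  have comb: "\<exists>y. \<forall>i<n + 1. ?ext v (Suc i) = (\<Sum>s<k. y s * M $$ (s, i))" if v: "v \<in> V" for v
  proof -
    let ?v = "v @\<^sub>v vec 1 (\<lambda>_. (-1) ^ k * (c\<^sub>0 \<bullet> v))"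
    have "?v \<in> vec_space.row_space (n + 1) M" unfolding rs using v c0\<xi> by blast
    then obtain y where y: "\<And>i. i < n + 1 \<Longrightarrow> ?v $ i = (\<Sum>s<k. y s * M $$ (s, i))"
      using row_space_iff[OF M] by blast
    have "v \<in> carrier_vec n" using v V(1) by blast
    then have "?v $ i = ?ext v (Suc i)" if "i < n + 1" for i
      using that by (auto simp: coord_def less_Suc_eq)
    then show ?thesis using y by (intro exI[of _ y]) simp
  qed
  have comb': "\<exists>v\<in>V. \<forall>i<n + 1. ?ext v (Suc i) = (\<Sum>s<k. y s * M $$ (s, i))" for y
  proof -
    let ?w = "vec (n + 1) (\<lambda>i. \<Sum>s<k. y s * M $$ (s, i))"
    have "?w \<in> vec_space.row_space (n + 1) M" unfolding row_space_iff[OF M] by auto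
    then obtain v c where vc: "?w = v @\<^sub>v vec 1 (\<lambda>_. (-1) ^ k * (c \<bullet> v))" "v \<in> V" "c \<in> \<xi>"
      unfolding rs by blast
    have v: "v \<in> carrier_vec n" using vc(2) V(1) by blast
    have "?ext v (Suc i) = ?w $ i" if "i < n + 1" for i
      unfolding vc(1) using that v \<xi>eq[OF vc(3,2)] by (auto simp: coord_def less_Suc_eq)
    then show ?thesis using vc(2) by (intro bexI[of _ v]) auto
  qed
  obtain N where N: "N \<in> carrier_mat (k + 1) n"
    and rsN: "vec_space.row_space n N = {v + t \<cdot>\<^sub>v h | v t h. v \<in> V \<and> h \<in> \<eta>}"
    and minorsN: "(\<forall>J\<subseteq>{0..<n}. card J = k + 1 \<longrightarrow> minor N J > 0) \<or>
      (\<forall>J\<subseteq>{0..<n}. card J = k + 1 \<longrightarrow> minor N J < 0)"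
    and "linear_subspace n (k + 1) (vec_space.row_space n N)"
    using rc unfolding right_cyclic_def gr_pos_def minor_def by auto
  then have kn: "k < n" using dim_row_space_le[OF _ N] by fastforce
  obtain h' w where w: "h' \<in> \<eta>" "w \<in> perp n V" "h' - w \<in> V" "coord w 1 > 0"
    using rc by (auto simp: right_cyclic_def)
  have wc: "w \<in> carrier_vec n" using w(2) by (auto simp: perp)
  have w\<eta>: "w \<in> \<eta>"
  proof -
    have "w = h' + (-1) \<cdot>\<^sub>v (h' - w)" using w(1) wc \<eta>c by (intro eq_vecI) auto
    then show ?thesis using \<eta>add[OF w(1) V(4)[OF w(3)], of "-1"] by simp
  qed
  have P_pos: "P J > 0" if J: "J \<subseteq> {1..Suc n}" "card J = k" for J
  proof -
    obtain J' where "J = Suc ` J'" "J' \<subseteq> {0..<Suc n}" "card J' = card J" using Suc_image_ex[OF J(1)] .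
    moreover from this have "(\<lambda>j. j - 1) ` J = J'" by force
    ultimately show ?thesis using \<epsilon>[of J'] J(2) by (simp add: P_def)
  qed
  have rel_V: "(\<Sum>i\<in>I. (-1) ^ card {j \<in> I. j < i} * ?ext v i * P (I - {i})) = 0"
    if v: "v \<in> V" and I: "I \<subseteq> {1..Suc n}" "card I = Suc k" for v I
  proof -
    obtain I' where I': "I = Suc ` I'" "I' \<subseteq> {0..<Suc n}" "card I' = card I" using Suc_image_ex[OF I(1)] .
    obtain y where y: "\<And>i. i < n + 1 \<Longrightarrow> ?ext v (Suc i) = (\<Sum>s<k. y s * M $$ (s, i))" using comb[OF v] by blast
    have "laplace_sum M (\<lambda>i. ?ext v (Suc i)) I' = 0"
    proof (rule laplace_sum_comb[OF M, of _ _ y])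
      show "I' \<subseteq> {0..<n + 1}" "card I' = Suc k" using I' I by simp_all
      show "?ext v (Suc i) = (\<Sum>s<k. y s * M $$ (s, i))" if "i \<in> I'" for i
        using that I'(2) by (intro y) auto
    qed
    then show ?thesis unfolding I'(1) laplace_sum_shift[OF P_def] by simp
  qed
  have prescribe: "\<exists>v\<in>V. \<forall>i\<in>K. ?ext v i = g i" if K: "K \<subseteq> {1..Suc n}" "card K = k" for K g
  proof -
    obtain K' where K': "K = Suc ` K'" "K' \<subseteq> {0..<n + 1}" "card K' = card K"
      using Suc_image_ex[OF K(1)] by auto
    have "minor M K' \<noteq> 0" using \<epsilon>[of K'] K' K by auto
    then obtain y where y: "\<And>i. i \<in> K' \<Longrightarrow> (\<Sum>s<k. y s * M $$ (s, i)) = g (Suc i)"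
      using prescribe_coords[OF M, of K' "\<lambda>i. g (Suc i)"] K' K by auto
    obtain v where v: "v \<in> V" "\<And>i. i < n + 1 \<Longrightarrow> ?ext v (Suc i) = (\<Sum>s<k. y s * M $$ (s, i))"
      using comb'[of y] by blast
    have "?ext v i = g i" if "i \<in> K" for i
    proof -
      obtain j where j: "i = Suc j" "j \<in> K'" "j < n + 1" using \<open>i \<in> K\<close> K' by auto
      show ?thesis using v(2)[OF j(3)] y[OF j(2)] unfolding j(1) by simp
    qed
    then show ?thesis using v(1) by blast
  qed
  define F where "F z I = (\<Sum>i\<in>I. (-1) ^ card {j \<in> I. j < i} * coord z i * P (I - {i}))" for z I
  have F_const: "F z I = F w I" if z: "z \<in> \<eta>" and I: "I \<subseteq> {1..n}" "card I = Suc k" for z I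
  proof -
    have "F z I - F w I = (\<Sum>i\<in>I. (-1) ^ card {j \<in> I. j < i} * ?ext (z - w) i * P (I - {i}))"
      unfolding F_def sum_subtractf[symmetric]
    proof (rule sum.cong[OF refl])
      fix i assume i: "i \<in> I"
      then have i1: "1 \<le> i" "i \<le> n" using I(1) by auto
      have "z \<in> carrier_vec n" using z \<eta>c by blast
      then have "i \<noteq> Suc n" "coord (z - w) i = coord z i - coord w i"
        using i1 wc by (auto simp: coord_def)
      then show "(-1) ^ card {j \<in> I. j < i} * coord z i * P (I - {i}) -
          (-1) ^ card {j \<in> I. j < i} * coord w i * P (I - {i}) =
          (-1) ^ card {j \<in> I. j < i} * ?ext (z - w) i * P (I - {i})"
        by (simp add: left_diff_distrib right_diff_distrib)
    qed
    also have "\<dots> = 0" using I by (intro rel_V[OF \<eta>diff[OF z w\<eta>]]) auto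
    finally show ?thesis by simp
  qed
  \<comment> \<open>Each row of N is a multiple of \<open>w\<close> plus a vector of V, and the
    latter is a combination of the rows of M. The factor d is the determinant of these coefficients,
    up to the sign chosen above.\<close>
  have "\<exists>d. \<forall>I\<subseteq>{1..n}. card I = Suc k \<longrightarrow> minor N ((\<lambda>j. j - 1) ` I) = d * F w I"
  proof -
    have "\<exists>t y. \<forall>i<n. N $$ (a, i) = t * coord w (Suc i) + (\<Sum>s<k. y s * M $$ (s, i))" if a: "a < Suc k" for a
    proof -
      have "row N a \<in> vec_space.row_space n N"
        unfolding row_space_iff[OF N]
      proof (intro conjI exI allI impI)
        show "row N a \<in> carrier_vec n" using N row_carrier[of N a] by auto
        fix i assume "i < n"
        have "(\<Sum>s<k + 1. of_bool (s = a) * N $$ (s, i)) = (\<Sum>s<k + 1. if s = a then N $$ (s, i) else 0)"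
          by (rule sum.cong) auto
        then show "row N a $ i = (\<Sum>s<k + 1. of_bool (s = a) * N $$ (s, i))"
          using a N \<open>i < n\<close> by (simp add: sum.delta)
      qed
      then obtain v t z where r: "row N a = v + t \<cdot>\<^sub>v z" "v \<in> V" "z \<in> \<eta>" unfolding rsN by blast
      let ?u = "v + t \<cdot>\<^sub>v (z - w)"
      have u: "?u \<in> V" using V(3,4) r \<eta>diff[OF r(3) w\<eta>] by blast
      obtain y where y: "\<And>i. i < n + 1 \<Longrightarrow> ?ext ?u (Suc i) = (\<Sum>s<k. y s * M $$ (s, i))" using comb[OF u] by blast
      have "N $$ (a, i) = t * coord w (Suc i) + (\<Sum>s<k. y s * M $$ (s, i))" if i: "i < n" for i
      proof -
        have vz: "v \<in> carrier_vec n" "z \<in> carrier_vec n" using r V(1) \<eta>c by auto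
        have "N $$ (a, i) = row N a $ i" using a N i by simp
        also have "\<dots> = t * coord w (Suc i) + ?ext ?u (Suc i)"
          unfolding r(1) using i vz wc by (simp add: coord_def algebra_simps)
        finally show ?thesis using y[of i] i by simp
      qed
      then show ?thesis by blast
    qed
    then obtain t y where ty: "\<And>a i. a < Suc k \<Longrightarrow> i < n \<Longrightarrow>
        N $$ (a, i) = t a * coord w (Suc i) + (\<Sum>s<k. y a s * M $$ (s, i))" by metis
    define A where "A = mat (Suc k) (Suc k) (\<lambda>(a, b). if b = 0 then t a else y a (b - 1))"
    have Ac: "A \<in> carrier_mat (Suc k) (Suc k)" by (simp add: A_def)
    have mN: "minor N I = det A * laplace_sum M (\<lambda>i. coord w (Suc i)) I" if "I \<subseteq> {0..<n}" "card I = Suc k" for I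
    proof (rule minor_of_combinations[OF M _ _ Ac _ that])
      show "N \<in> carrier_mat (Suc k) n" using N by simp
      fix a i assume "a < Suc k" "i < n"
      then show "N $$ (a, i) = A $$ (a, 0) * coord w (Suc i) + (\<Sum>s<k. A $$ (a, Suc s) * M $$ (s, i))"
        using ty by (simp add: A_def)
    qed simp
    have "\<epsilon> * \<epsilon> = 1" by (simp add: \<epsilon>_def)
    then have "minor N ((\<lambda>j. j - 1) ` I) = (det A * \<epsilon>) * F w I" if I: "I \<subseteq> {1..n}" "card I = Suc k" for I
    proof -
      obtain I' where I': "I = Suc ` I'" "I' \<subseteq> {0..<n}" "card I' = card I" using Suc_image_ex[OF I(1)] .
      have "(\<lambda>j. j - 1) ` I = I'" unfolding I'(1) by force
      moreover have "F w I = \<epsilon> * laplace_sum M (\<lambda>i. coord w (Suc i)) I'"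
        unfolding F_def I'(1) by (rule laplace_sum_shift[OF P_def])
      ultimately show ?thesis using mN[of I'] I' I \<open>\<epsilon> * \<epsilon> = 1\<close> by simp
    qed
    then show ?thesis by blast
  qed
  then obtain d where d: "\<And>I. I \<subseteq> {1..n} \<Longrightarrow> card I = Suc k \<Longrightarrow> minor N ((\<lambda>j. j - 1) ` I) = d * F w I"
    by blast
  have sub: "(\<lambda>j. j - 1) ` I \<subseteq> {0..<n} \<and> card ((\<lambda>j. j - 1) ` I) = k + 1"
    if I: "I \<subseteq> {1..n}" "card I = Suc k" for I
  proof -
    obtain I' where I': "I = Suc ` I'" "I' \<subseteq> {0..<n}" "card I' = card I" using Suc_image_ex[OF I(1)] .
    have "(\<lambda>j. j - 1) ` I = I'" unfolding I'(1) by force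
    then show ?thesis using I' I by simp
  qed
  \<comment> \<open>Only a common sign results, because the sign of d is unknown.\<close>
  have dich: "(\<forall>I\<subseteq>{1..n}. card I = Suc k \<longrightarrow> F w I > 0) \<or> (\<forall>I\<subseteq>{1..n}. card I = Suc k \<longrightarrow> F w I < 0)"
    using minorsN
  proof
    assume a: "\<forall>J\<subseteq>{0..<n}. card J = k + 1 \<longrightarrow> minor N J > 0"
    have "d * F w I > 0" if "I \<subseteq> {1..n}" "card I = Suc k" for I
      using a sub[OF that] d[OF that] by metis
    then show ?thesis by (cases "d > 0") (auto simp: zero_less_mult_iff)
  next
    assume a: "\<forall>J\<subseteq>{0..<n}. card J = k + 1 \<longrightarrow> minor N J < 0"
    have "d * F w I < 0" if "I \<subseteq> {1..n}" "card I = Suc k" for I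
      using a sub[OF that] d[OF that] by metis
    then show ?thesis by (cases "d > 0") (auto simp: mult_less_0_iff)
  qed
  have pos: "\<forall>I\<subseteq>{1..n}. card I = Suc k \<longrightarrow> F w I > 0"
  proof (rule ccontr)
    assume "\<not> ?thesis"
    then have neg: "F w I < 0" if "I \<subseteq> {1..n}" "card I = Suc k" for I using dich that by blast
    show False
    proof (rule not_all_negative[of k n "coord w" P "?ext ` V"])
      fix v I assume v: "v \<in> ?ext ` V" and I: "I \<subseteq> {1..n}" "card I = Suc k"
      then have "I \<subseteq> {1..Suc n}" by auto
      then show "(\<Sum>i\<in>I. (-1) ^ card {j \<in> I. j < i} * v i * P (I - {i})) = 0"
        using v rel_V I(2) by blast
    next
      fix K g assume "K \<subseteq> {1..n}" "card K = k"
      then show "\<exists>v\<in>?ext ` V. \<forall>i\<in>K. v i = g i" using prescribe[of K g] by fastforce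
    next
      fix v assume "v \<in> ?ext ` V"
      then obtain u where u: "u \<in> V" "v = ?ext u" by blast
      have uc: "u \<in> carrier_vec n" using u V(1) by blast
      have "0 = w \<bullet> u" using w(2) u by (simp add: perp)
      also have "\<dots> = (\<Sum>i\<in>{0..<n}. w $ i * u $ i)" using uc by (simp add: scalar_prod_def)
      also have "\<dots> = (\<Sum>i\<in>{1..n}. v i * coord w i)"
        by (rule sum.reindex_bij_witness[of _ "\<lambda>i. i - 1" Suc]) (auto simp: u(2) coord_def)
      finally show "(\<Sum>i\<in>{1..n}. v i * coord w i) = 0" by simp
    next
      fix I assume "I \<subseteq> {1..n}" "card I = Suc k"
      from neg[OF this] show "(\<Sum>i\<in>I. (-1) ^ card {j \<in> I. j < i} * coord w i * P (I - {i})) < 0"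
        by (simp add: F_def)
    next
      fix J assume "J \<subseteq> {1..n}" "card J = k"
      then show "P J > 0" by (intro P_pos) auto
    qed (use kn w(4) in auto)
  qed
  have pos': "(\<Sum>i\<in>I. (-1) ^ card {j \<in> I. j < i} * coord z i * P (I - {i})) > 0"
    if "z \<in> \<eta>" "I \<subseteq> {1..n}" "card I = Suc k" for z I
  proof -
    have "F z I > 0" using pos F_const[OF that] that(2,3) by simp
    then show ?thesis by (simp only: F_def)
  qed
  have ne: "\<eta> \<noteq> {}" using h\<eta> by blast
  show ?thesis
    by (intro exI cyclic_coords.intro)
      (fact kn V(1) \<eta>c ne V(3) V(4) \<eta>add \<eta>diff \<xi>c c0\<xi> \<xi>eq P_pos rel_V pos' prescribe)+
qed

section \<open>Monomial ideals and the summands of the convolution algebra\<close>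

section \<open>Monomial ideals\<close>

lemma upoly_ring_simps [simp]:
  "p \<otimes>\<^bsub>upoly_ring n\<^esub> q = p * q" "p \<oplus>\<^bsub>upoly_ring n\<^esub> q = p + q"
  "\<one>\<^bsub>upoly_ring n\<^esub> = 1" "\<zero>\<^bsub>upoly_ring n\<^esub> = 0"
  by (simp_all add: upoly_ring_def)

abbreviation vars :: "(nat \<Rightarrow>\<^sub>0 nat) \<Rightarrow> nat set" where
  "vars \<equiv> Poly_Mapping.keys"

definition polys :: "nat \<Rightarrow> upoly set" where
  "polys n = {p. \<forall>m \<in> Poly_Mapping.keys p. vars m \<subseteq> {1..n}}"

lemma carrier_upoly_ring [simp]: "carrier (upoly_ring n) = polys n"
  by (simp add: upoly_ring_def polys_def)

lemma vars_add: "vars (m + m') = vars m \<union> vars m'"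
  by (auto simp: in_keys_iff lookup_add)

lemma polys_add: "p \<in> polys n \<Longrightarrow> q \<in> polys n \<Longrightarrow> p + q \<in> polys n"
  using Poly_Mapping.keys_add[of p q] by (auto simp: polys_def subset_iff)

lemma polys_mult: "p \<in> polys n \<Longrightarrow> q \<in> polys n \<Longrightarrow> p * q \<in> polys n"
  using keys_mult[of p q] by (fastforce simp: polys_def vars_add subset_iff)

lemma polys_uminus: "p \<in> polys n \<Longrightarrow> - p \<in> polys n"
  by (simp add: polys_def)

lemma polys_diff: "p \<in> polys n \<Longrightarrow> q \<in> polys n \<Longrightarrow> p - q \<in> polys n"
  using polys_add[of p n "- q"] polys_uminus[of q n] by simp

lemma polys_zero [simp]: "0 \<in> polys n" and polys_one [simp]: "1 \<in> polys n"
  by (simp_all add: polys_def)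

lemma polys_sum: "(\<And>a. a \<in> A \<Longrightarrow> f a \<in> polys n) \<Longrightarrow> sum f A \<in> polys n"
  by (induction A rule: infinite_finite_induct) (auto intro: polys_add)

lemma cring_upoly_ring: "cring (upoly_ring n)"
proof (rule cringI)
  show "abelian_group (upoly_ring n)"
  proof (rule abelian_groupI)
    show "\<exists>y\<in>carrier (upoly_ring n). y \<oplus>\<^bsub>upoly_ring n\<^esub> p = \<zero>\<^bsub>upoly_ring n\<^esub>"
      if "p \<in> carrier (upoly_ring n)" for p
      using that polys_uminus[of p n] by (intro bexI[of _ "- p"]) auto
  qed (auto intro: polys_add)
  show "comm_monoid (upoly_ring n)"
    by (rule comm_monoidI) (auto intro: polys_mult simp: mult_ac)
qed (auto simp: algebra_simps)

lemma ring_upoly_ring: "ring (upoly_ring n)"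
  using cring_upoly_ring by (rule cring.axioms)

lemma upoly_ring_uminus: "p \<in> polys n \<Longrightarrow> \<ominus>\<^bsub>upoly_ring n\<^esub> p = - p"
proof -
  interpret ring "upoly_ring n" by (rule ring_upoly_ring)
  assume "p \<in> polys n"
  then show ?thesis by (intro minus_equality) (auto intro: polys_uminus)
qed

lemma upoly_ring_minus: "p \<in> polys n \<Longrightarrow> q \<in> polys n \<Longrightarrow> p \<ominus>\<^bsub>upoly_ring n\<^esub> q = p - q"
  by (simp add: a_minus_def upoly_ring_uminus)

text \<open>Membership is decided for each monomial separately and depends only on its set of
  variables; this is an ideal when \<open>E\<close> is closed under supersets.\<close>

definition monomial_ideal :: "nat \<Rightarrow> (nat set \<Rightarrow> bool) \<Rightarrow> upoly set" where
  "monomial_ideal n E = {p \<in> polys n. \<forall>m \<in> Poly_Mapping.keys p. E (vars m)}"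

definition mon :: "nat set \<Rightarrow> (nat \<Rightarrow>\<^sub>0 nat)" where
  "mon S = (\<Sum>i\<in>S. Poly_Mapping.single i 1)"

lemma umon_eq_single:
  assumes "finite S"
  shows "umon S = Poly_Mapping.single (mon S) 1"
  using assms
proof (induction S rule: finite_induct)
  case (insert i S)
  then show ?case by (simp add: umon_def uvar_def mon_def mult_single)
qed (simp add: umon_def mon_def)

lemma lookup_mon:
  assumes "finite S"
  shows "Poly_Mapping.lookup (mon S) j = of_bool (j \<in> S)"
proof -
  have "(\<Sum>i\<in>S. Poly_Mapping.lookup (Poly_Mapping.single i (1::nat)) j) = (\<Sum>i\<in>S. if i = j then 1 else 0)"
    by (rule sum.cong) (auto simp: lookup_single when_def)
  then show ?thesis using assms by (simp add: mon_def lookup_sum sum.delta)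
qed

lemma vars_mon: "finite S \<Longrightarrow> vars (mon S) = S"
  by (auto simp: in_keys_iff lookup_mon)

lemma umon_in_polys: "S \<subseteq> {1..n} \<Longrightarrow> umon S \<in> polys n"
  by (simp add: umon_eq_single finite_subset polys_def vars_mon)

lemma monomial_ideal_ideal:
  assumes mono: "\<And>S T. E S \<Longrightarrow> S \<subseteq> T \<Longrightarrow> E T"
  shows "ideal (monomial_ideal n E) (upoly_ring n)"
proof (rule idealI[OF ring_upoly_ring])
  interpret ring "upoly_ring n" by (rule ring_upoly_ring)
  show "subgroup (monomial_ideal n E) (add_monoid (upoly_ring n))"
  proof (rule add.subgroupI)
    show "monomial_ideal n E \<noteq> {}" by (auto simp: monomial_ideal_def intro!: exI[of _ 0])
    show "\<ominus>\<^bsub>upoly_ring n\<^esub> p \<in> monomial_ideal n E" if "p \<in> monomial_ideal n E" for p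
      using that by (auto simp: monomial_ideal_def upoly_ring_uminus polys_uminus)
    show "p \<oplus>\<^bsub>upoly_ring n\<^esub> q \<in> monomial_ideal n E"
      if "p \<in> monomial_ideal n E" "q \<in> monomial_ideal n E" for p q
      using that Poly_Mapping.keys_add[of p q] by (auto simp: monomial_ideal_def polys_add)
  qed (auto simp: monomial_ideal_def)
  have mult: "p * q \<in> monomial_ideal n E" if p: "p \<in> monomial_ideal n E" and q: "q \<in> polys n" for p q
  proof -
    have "E (vars m)" if m: "m \<in> Poly_Mapping.keys (p * q)" for m
    proof -
      obtain a b where "m = a + b" "a \<in> Poly_Mapping.keys p" using keys_mult[of p q] m by blast
      then show ?thesis using p mono[of "vars a" "vars m"] by (auto simp: monomial_ideal_def vars_add)
    qed
    then show ?thesis using p q by (auto simp: monomial_ideal_def polys_mult)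
  qed
  fix p q assume "p \<in> monomial_ideal n E" "q \<in> carrier (upoly_ring n)"
  then show "q \<otimes>\<^bsub>upoly_ring n\<^esub> p \<in> monomial_ideal n E" "p \<otimes>\<^bsub>upoly_ring n\<^esub> q \<in> monomial_ideal n E"
    using mult[of p q] by (simp_all add: mult.commute)
qed

lemma sum_single_lookup: "(\<Sum>m\<in>Poly_Mapping.keys p. Poly_Mapping.single m (Poly_Mapping.lookup p m)) = p"
proof (rule poly_mapping_eqI)
  fix m
  have "(\<Sum>l\<in>Poly_Mapping.keys p. Poly_Mapping.lookup (Poly_Mapping.single l (Poly_Mapping.lookup p l)) m) =
      (\<Sum>l\<in>Poly_Mapping.keys p. if l = m then Poly_Mapping.lookup p l else 0)"
    by (rule sum.cong) (auto simp: lookup_single when_def)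
  also have "\<dots> = Poly_Mapping.lookup p m" by (simp add: sum.delta in_keys_iff)
  finally show "Poly_Mapping.lookup (\<Sum>m\<in>Poly_Mapping.keys p.
      Poly_Mapping.single m (Poly_Mapping.lookup p m)) m = Poly_Mapping.lookup p m"
    by (simp add: lookup_sum)
qed

lemma genideal_monomials:
  assumes mono: "\<And>S T. E S \<Longrightarrow> S \<subseteq> T \<Longrightarrow> E T"
  shows "genideal (upoly_ring n) {umon S | S. S \<subseteq> {1..n} \<and> E S} = monomial_ideal n E"
proof
  interpret ring "upoly_ring n" by (rule ring_upoly_ring)
  let ?G = "{umon S | S. S \<subseteq> {1..n} \<and> E S}"
  have sub: "?G \<subseteq> monomial_ideal n E"
  proof clarify
    fix S assume S: "S \<subseteq> {1..n}" "E S"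
    then have "finite S" using finite_subset by blast
    then show "umon S \<in> monomial_ideal n E"
      using S umon_in_polys[OF S(1)] by (simp add: monomial_ideal_def umon_eq_single vars_mon)
  qed
  have ideal: "ideal (monomial_ideal n E) (upoly_ring n)"
  proof (rule monomial_ideal_ideal)
    fix S T assume "E S" "S \<subseteq> T"
    then show "E T" by (rule mono)
  qed
  show "genideal (upoly_ring n) ?G \<subseteq> monomial_ideal n E"
    by (rule genideal_minimal[OF ideal sub])
  have G: "?G \<subseteq> carrier (upoly_ring n)"
  proof clarify
    fix S assume "S \<subseteq> {1..n}"
    then show "umon S \<in> carrier (upoly_ring n)" unfolding carrier_upoly_ring by (rule umon_in_polys)
  qed
  interpret I: ideal "genideal (upoly_ring n) ?G" "upoly_ring n" by (rule genideal_ideal[OF G])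
  show "monomial_ideal n E \<subseteq> genideal (upoly_ring n) ?G"
  proof
    fix p assume p: "p \<in> monomial_ideal n E"
    have single: "Poly_Mapping.single m c \<in> genideal (upoly_ring n) ?G"
      if m: "m \<in> Poly_Mapping.keys p" for m c
    proof -
      define m1 where "m1 = mon (vars m)"
      have v: "vars m \<subseteq> {1..n}" "E (vars m)" using p m by (auto simp: monomial_ideal_def polys_def)
      \<comment> \<open>Subtraction of exponents is truncated; it is exact here because
        \<open>m1\<close> has exponent 1 just at the variables of m. So the monomial is a multiple
        of a squarefree generator.\<close>
      have "m = (m - m1) + m1"
      proof (rule poly_mapping_eqI)
        fix i
        have "Poly_Mapping.lookup m1 i \<le> Poly_Mapping.lookup m i"
          unfolding m1_def by (auto simp: lookup_mon in_keys_iff)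
        then show "Poly_Mapping.lookup m i = Poly_Mapping.lookup (m - m1 + m1) i"
          by (simp add: lookup_add lookup_minus)
      qed
      then have "Poly_Mapping.single m c = Poly_Mapping.single (m - m1) c * umon (vars m)"
        by (simp add: umon_eq_single mult_single m1_def)
      moreover have "Poly_Mapping.single (m - m1) c \<in> polys n"
      proof -
        have "vars (m - m1) \<subseteq> vars m" by (auto simp: in_keys_iff lookup_minus)
        then show ?thesis using v by (auto simp: polys_def)
      qed
      moreover have "umon (vars m) \<in> genideal (upoly_ring n) ?G"
        using genideal_self[OF G] v by auto
      ultimately show ?thesis using I.I_l_closed[of "umon (vars m)" "Poly_Mapping.single (m - m1) c"] by simp
    qed
    have "(\<Sum>m\<in>A. Poly_Mapping.single m (Poly_Mapping.lookup p m)) \<in> genideal (upoly_ring n) ?G"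
      if "A \<subseteq> Poly_Mapping.keys p" for A
    proof -
      have "finite A" using that by (rule finite_subset) simp
      then show ?thesis using that
      proof (induction A rule: finite_induct)
        case empty
        then show ?case using additive_subgroup.zero_closed[OF I.is_additive_subgroup] by simp
      next
        case (insert m A)
        then show ?case
          using additive_subgroup.a_closed[OF I.is_additive_subgroup single[of m "Poly_Mapping.lookup p m"]] by simp
      qed
    qed
    from this[of "Poly_Mapping.keys p"] show "p \<in> genideal (upoly_ring n) ?G"
      by (simp add: sum_single_lookup)
  qed
qed

definition face_empty :: "nat \<Rightarrow> real vec set \<Rightarrow> (nat \<Rightarrow> int) \<Rightarrow> (nat \<Rightarrow> int) \<Rightarrow> nat set \<Rightarrow> bool" where
  "face_empty n \<eta> \<alpha> \<beta> S \<longleftrightarrow> chamber n \<eta> \<alpha> \<inter> chamber n \<eta> \<beta> \<inter> hyperplane_int \<eta> S = {}"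

lemma face_empty_mono: "face_empty n \<eta> \<alpha> \<beta> S \<Longrightarrow> S \<subseteq> T \<Longrightarrow> face_empty n \<eta> \<alpha> \<beta> T"
  unfolding face_empty_def hyperplane_int_def by blast

lemma face_empty_sym: "face_empty n \<eta> \<alpha> \<beta> S = face_empty n \<eta> \<beta> \<alpha> S"
  unfolding face_empty_def by (simp add: Int_commute)

lemma R_ideal_eq: "R_ideal n \<eta> \<alpha> \<beta> = monomial_ideal n (face_empty n \<eta> \<alpha> \<beta>)"
proof -
  have "R_ideal n \<eta> \<alpha> \<beta> =
      genideal (upoly_ring n) {umon S | S. S \<subseteq> {1..n} \<and> face_empty n \<eta> \<alpha> \<beta> S}"
    by (simp only: R_ideal_def face_empty_def)
  also have "\<dots> = monomial_ideal n (face_empty n \<eta> \<alpha> \<beta>)"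
  proof (rule genideal_monomials)
    fix S T assume "face_empty n \<eta> \<alpha> \<beta> S" "S \<subseteq> T"
    then show "face_empty n \<eta> \<alpha> \<beta> T" by (rule face_empty_mono)
  qed
  finally show ?thesis .
qed

lemma ideal_R_ideal: "ideal (R_ideal n \<eta> \<alpha> \<beta>) (upoly_ring n)"
  unfolding R_ideal_eq
proof (rule monomial_ideal_ideal)
  fix S T assume "face_empty n \<eta> \<alpha> \<beta> S" "S \<subseteq> T"
  then show "face_empty n \<eta> \<alpha> \<beta> T" by (rule face_empty_mono)
qed

lemma R_ideal_sym: "R_ideal n \<eta> \<alpha> \<beta> = R_ideal n \<eta> \<beta> \<alpha>"
proof -
  have "face_empty n \<eta> \<alpha> \<beta> = face_empty n \<eta> \<beta> \<alpha>" using face_empty_sym by blast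
  then show ?thesis by (simp add: R_ideal_eq)
qed

lemma R_class_sym: "R_class n \<eta> \<alpha> \<beta> = R_class n \<eta> \<beta> \<alpha>"
  by (rule ext) (simp only: R_class_def R_ideal_sym[of n \<eta> \<alpha> \<beta>])

lemma R_class_eq_iff:
  "p \<in> polys n \<Longrightarrow> q \<in> polys n \<Longrightarrow> R_class n \<eta> \<alpha> \<beta> p = R_class n \<eta> \<alpha> \<beta> q \<longleftrightarrow> p - q \<in> R_ideal n \<eta> \<alpha> \<beta>"
  using ring.quotient_eq_iff_same_a_r_cos[OF ring_upoly_ring ideal_R_ideal, of p n q]
  by (simp add: R_class_def upoly_ring_minus)

lemma R_class_eq_image: "R_class n \<eta> \<alpha> \<beta> p = (\<lambda>r. r + p) ` R_ideal n \<eta> \<alpha> \<beta>"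
  by (auto simp: R_class_def a_r_coset_def')

lemma carrier_R_ring: "carrier (R_ring n \<eta> \<alpha> \<beta>) = R_class n \<eta> \<alpha> \<beta> ` polys n"
  by (auto simp: R_ring_def FactRing_def A_RCOSETS_def' R_class_def)

lemma ring_R_ring: "ring (R_ring n \<eta> \<alpha> \<beta>)"
  unfolding R_ring_def by (rule ideal.quotient_is_ring[OF ideal_R_ideal])

lemma R_class_hom: "R_class n \<eta> \<alpha> \<beta> \<in> Ring.ring_hom (upoly_ring n) (R_ring n \<eta> \<alpha> \<beta>)"
proof -
  have "R_class n \<eta> \<alpha> \<beta> = (+>\<^bsub>upoly_ring n\<^esub>) (R_ideal n \<eta> \<alpha> \<beta>)" by (auto simp: R_class_def)
  then show ?thesis unfolding R_ring_def using ideal.rcos_ring_hom[OF ideal_R_ideal] by simp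
qed

lemma R_class_add: "p \<in> polys n \<Longrightarrow> q \<in> polys n \<Longrightarrow>
    R_class n \<eta> \<alpha> \<beta> p \<oplus>\<^bsub>R_ring n \<eta> \<alpha> \<beta>\<^esub> R_class n \<eta> \<alpha> \<beta> q = R_class n \<eta> \<alpha> \<beta> (p + q)"
  using ring_hom_add[OF R_class_hom, of p n q \<eta> \<alpha> \<beta>] by simp

lemma R_class_zero: "\<zero>\<^bsub>R_ring n \<eta> \<alpha> \<beta>\<^esub> = R_class n \<eta> \<alpha> \<beta> 0"
  using ring_hom_zero[OF R_class_hom ring_upoly_ring ring_R_ring, of n \<eta> \<alpha> \<beta>] by simp

lemma R_class_finsum:
  assumes "finite A" "\<And>a. a \<in> A \<Longrightarrow> f a \<in> polys n"
  shows "(\<Oplus>\<^bsub>R_ring n \<eta> \<alpha> \<beta>\<^esub> a \<in> A. R_class n \<eta> \<alpha> \<beta> (f a)) = R_class n \<eta> \<alpha> \<beta> (\<Sum>a\<in>A. f a)"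
proof -
  interpret ring "R_ring n \<eta> \<alpha> \<beta>" by (rule ring_R_ring)
  show ?thesis using assms
  proof (induction A rule: finite_induct)
    case empty
    then show ?case by (simp add: R_class_zero)
  next
    case (insert a A)
    have "(\<lambda>a. R_class n \<eta> \<alpha> \<beta> (f a)) \<in> insert a A \<rightarrow> carrier (R_ring n \<eta> \<alpha> \<beta>)"
      using insert.prems by (auto simp: carrier_R_ring)
    then show ?case using insert by (simp add: R_class_add polys_sum Pi_iff)
  qed
qed

text \<open>Where \<beta> differs from both \<alpha> and \<gamma>, these two agree, so the index
  belongs to \<open>S_set\<close>. A point of the chambers of \<alpha> and \<gamma> that vanishes on
  this set lies in the chamber of \<beta> as well. This is why the factor in the product makes it
  well defined on classes.\<close>

lemma face_empty_triangle:
  assumes "\<alpha> \<in> sign_vectors n" "\<beta> \<in> sign_vectors n" "\<gamma> \<in> sign_vectors n" "face_empty n \<eta> \<alpha> \<beta> S"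
  shows "face_empty n \<eta> \<alpha> \<gamma> (S \<union> S_set n \<alpha> \<beta> \<gamma>)"
  unfolding face_empty_def
proof (rule ccontr)
  assume "chamber n \<eta> \<alpha> \<inter> chamber n \<eta> \<gamma> \<inter> hyperplane_int \<eta> (S \<union> S_set n \<alpha> \<beta> \<gamma>) \<noteq> {}"
  then obtain z where z: "z \<in> chamber n \<eta> \<alpha>" "z \<in> chamber n \<eta> \<gamma>" "z \<in> hyperplane_int \<eta> (S \<union> S_set n \<alpha> \<beta> \<gamma>)"
    by blast
  have "real_of_int (\<beta> i) * coord z i \<ge> 0" if i: "i \<in> {1..n}" for i
  proof -
    have "\<beta> i = \<alpha> i \<or> \<beta> i = \<gamma> i \<or> i \<in> S_set n \<alpha> \<beta> \<gamma>"
      using assms(1-3)[THEN sign_vector_cases, OF i] i by (auto simp: S_set_def)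
    then show ?thesis using z i by (auto simp: chamber_def hyperplane_int_def)
  qed
  then have "z \<in> chamber n \<eta> \<beta>" using z(1) by (auto simp: chamber_def)
  moreover have "z \<in> hyperplane_int \<eta> S" using z(3) by (auto simp: hyperplane_int_def)
  ultimately show False using z(1) assms(4) by (auto simp: face_empty_def)
qed

lemma S_set_subset: "S_set n \<alpha> \<beta> \<gamma> \<subseteq> {1..n}"
  by (auto simp: S_set_def)

lemma S_set_swap: "S_set n \<alpha> \<beta> \<gamma> = S_set n \<gamma> \<beta> \<alpha>"
  by (auto simp: S_set_def)

lemma R_ideal_absorb:
  assumes "\<alpha> \<in> sign_vectors n" "\<beta> \<in> sign_vectors n" "\<gamma> \<in> sign_vectors n"
    and p: "p \<in> R_ideal n \<eta> \<alpha> \<beta>" and q: "q \<in> polys n"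
  shows "p * q * umon (S_set n \<alpha> \<beta> \<gamma>) \<in> R_ideal n \<eta> \<alpha> \<gamma>"
proof -
  let ?S = "S_set n \<alpha> \<beta> \<gamma>"
  have fin: "finite ?S" by (rule finite_subset[OF S_set_subset]) simp
  have pn: "p \<in> polys n" using p by (simp add: R_ideal_eq monomial_ideal_def)
  have "face_empty n \<eta> \<alpha> \<gamma> (vars m)" if m: "m \<in> Poly_Mapping.keys (p * q * umon ?S)" for m
  proof -
    obtain a b where ab: "m = a + b" "a \<in> Poly_Mapping.keys (p * q)" "b \<in> Poly_Mapping.keys (umon ?S)"
      using keys_mult[of "p * q" "umon ?S"] m by blast
    obtain c d where cd: "a = c + d" "c \<in> Poly_Mapping.keys p" using keys_mult[of p q] ab(2) by blast
    have "vars b = ?S" using ab(3) fin by (simp add: umon_eq_single vars_mon)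
    then have "vars c \<union> ?S \<subseteq> vars m" using ab cd by (auto simp: vars_add)
    moreover have "face_empty n \<eta> \<alpha> \<beta> (vars c)" using p cd by (auto simp: R_ideal_eq monomial_ideal_def)
    ultimately show ?thesis using face_empty_triangle[OF assms(1-3)] face_empty_mono by blast
  qed
  then show ?thesis using pn q umon_in_polys[OF S_set_subset] by (simp add: R_ideal_eq monomial_ideal_def polys_mult)
qed

text \<open>The union runs over all representatives, but all cosets in it coincide: a change of
  either representative changes the product by an element of the ideal. The second factor reduces to
  the first by exchanging \<alpha> and \<gamma>.\<close>

lemma R_conv_class:
  assumes "\<alpha> \<in> sign_vectors n" "\<beta> \<in> sign_vectors n" "\<gamma> \<in> sign_vectors n"
    and p: "p \<in> polys n" and q: "q \<in> polys n"
  shows "R_conv n \<eta> \<alpha> \<beta> \<gamma> (R_class n \<eta> \<alpha> \<beta> p) (R_class n \<eta> \<beta> \<gamma> q) =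
    R_class n \<eta> \<alpha> \<gamma> (p * q * umon (S_set n \<alpha> \<beta> \<gamma>))"
proof -
  let ?u = "umon (S_set n \<alpha> \<beta> \<gamma>)"
  have u: "?u \<in> polys n" by (rule umon_in_polys[OF S_set_subset])
  have *: "R_class n \<eta> \<alpha> \<gamma> (p' * q' * ?u) = R_class n \<eta> \<alpha> \<gamma> (p * q * ?u)"
    if p': "p' \<in> R_class n \<eta> \<alpha> \<beta> p" and q': "q' \<in> R_class n \<eta> \<beta> \<gamma> q" for p' q'
  proof -
    obtain r where r: "p' = r + p" "r \<in> R_ideal n \<eta> \<alpha> \<beta>" using p' by (auto simp: R_class_eq_image)
    obtain s where s: "q' = s + q" "s \<in> R_ideal n \<eta> \<beta> \<gamma>" using q' by (auto simp: R_class_eq_image)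
    have rs: "r \<in> polys n" "s \<in> polys n" using r s by (simp_all add: R_ideal_eq monomial_ideal_def)
    have 1: "r * q' * ?u \<in> R_ideal n \<eta> \<alpha> \<gamma>"
      using s rs q by (intro R_ideal_absorb[OF assms(1-3) r(2)]) (simp add: polys_add)
    have "s \<in> R_ideal n \<eta> \<gamma> \<beta>" using s(2) R_ideal_sym by blast
    from R_ideal_absorb[OF assms(3,2,1) this p] have 2: "p * s * ?u \<in> R_ideal n \<eta> \<alpha> \<gamma>"
      using R_ideal_sym[of n \<eta> \<alpha> \<gamma>] S_set_swap[of n \<alpha> \<beta> \<gamma>] by (simp add: mult.commute)
    have "p' * q' * ?u - p * q * ?u = r * q' * ?u + p * s * ?u"
      unfolding r(1) s(1) by (simp add: algebra_simps)
    also have "\<dots> \<in> R_ideal n \<eta> \<alpha> \<gamma>"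
      using additive_subgroup.a_closed[OF ideal.axioms(1)[OF ideal_R_ideal] 1 2] by simp
    finally show ?thesis
      using p q u r s rs by (subst R_class_eq_iff) (auto intro!: polys_mult polys_add)
  qed
  have 0: "0 \<in> R_ideal n \<eta> \<delta> \<epsilon>" for \<delta> \<epsilon> by (simp add: R_ideal_eq monomial_ideal_def)
  then have "p \<in> R_class n \<eta> \<alpha> \<beta> p" "q \<in> R_class n \<eta> \<beta> \<gamma> q"
    by (force simp: R_class_eq_image intro!: image_eqI[of _ _ 0])+
  then show ?thesis unfolding R_conv_def using * by blast
qed


section \<open>Elements of the convolution algebra as families of polynomials\<close>

section \<open>Elements of the convolution algebra\<close>

text \<open>Computations take place on representatives; only \<open>bt_of_eq_iff\<close> passes to
  classes.\<close>

definition bt_of :: "nat \<Rightarrow> real vec set \<Rightarrow> real vec set \<Rightarrow>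
    ((nat \<Rightarrow> int) \<Rightarrow> (nat \<Rightarrow> int) \<Rightarrow> upoly) \<Rightarrow> bt_elem" where
  "bt_of n \<eta> \<xi> g = (\<lambda>(\<alpha>, \<beta>) \<in> bounded_feasible n \<eta> \<xi> \<times> bounded_feasible n \<eta> \<xi>. R_class n \<eta> \<alpha> \<beta> (g \<alpha> \<beta>))"

context
  fixes n :: nat and \<eta> \<xi> :: "real vec set"
begin

abbreviation (input) "BF \<equiv> bounded_feasible n \<eta> \<xi>"

lemma BF_sign: "\<alpha> \<in> BF \<Longrightarrow> \<alpha> \<in> sign_vectors n"
  by (simp add: bounded_feasible_def)

lemma finite_BF: "finite BF"
proof (rule finite_subset)
  show "BF \<subseteq> sign_vectors n" by (auto simp: bounded_feasible_def)
  show "finite (sign_vectors n)" unfolding sign_vectors_def by (intro finite_PiE) auto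
qed

lemma bt_of_apply: "\<alpha> \<in> BF \<Longrightarrow> \<beta> \<in> BF \<Longrightarrow> bt_of n \<eta> \<xi> g (\<alpha>, \<beta>) = R_class n \<eta> \<alpha> \<beta> (g \<alpha> \<beta>)"
  by (simp add: bt_of_def)

lemma bt_of_closed:
  assumes "\<And>\<alpha> \<beta>. \<alpha> \<in> BF \<Longrightarrow> \<beta> \<in> BF \<Longrightarrow> g \<alpha> \<beta> \<in> polys n"
  shows "bt_of n \<eta> \<xi> g \<in> carrier (B_tilde n \<eta> \<xi>)"
  using assms by (auto simp: B_tilde_def Let_def bt_of_def carrier_R_ring intro!: restrict_PiE_iff[THEN iffD2])

lemma bt_elem_ex:
  assumes F: "F \<in> carrier (B_tilde n \<eta> \<xi>)"
  obtains g where "\<And>\<alpha> \<beta>. \<alpha> \<in> BF \<Longrightarrow> \<beta> \<in> BF \<Longrightarrow> g \<alpha> \<beta> \<in> polys n" "F = bt_of n \<eta> \<xi> g"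
proof -
  have FP: "F \<in> (\<Pi>\<^sub>E (\<alpha>, \<beta>) \<in> BF \<times> BF. carrier (R_ring n \<eta> \<alpha> \<beta>))"
    using F by (simp add: B_tilde_def Let_def)
  have "\<exists>p\<in>polys n. F (\<alpha>, \<beta>) = R_class n \<eta> \<alpha> \<beta> p" if "\<alpha> \<in> BF" "\<beta> \<in> BF" for \<alpha> \<beta>
    using PiE_mem[OF FP, of "(\<alpha>, \<beta>)"] that by (auto simp: carrier_R_ring)
  then obtain g where g: "\<And>\<alpha> \<beta>. \<alpha> \<in> BF \<Longrightarrow> \<beta> \<in> BF \<Longrightarrow> g \<alpha> \<beta> \<in> polys n \<and> F (\<alpha>, \<beta>) = R_class n \<eta> \<alpha> \<beta> (g \<alpha> \<beta>)"
    by metis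
  have "F r = bt_of n \<eta> \<xi> g r" for r
  proof (cases "r \<in> BF \<times> BF")
    case True
    then show ?thesis using g by (auto simp: bt_of_def)
  next
    case False
    then show ?thesis using PiE_arb[OF FP False] by (auto simp: bt_of_def restrict_def)
  qed
  then show thesis using that[of g] g by blast
qed

lemma bt_of_eq_iff:
  assumes "\<And>\<alpha> \<beta>. \<alpha> \<in> BF \<Longrightarrow> \<beta> \<in> BF \<Longrightarrow> g \<alpha> \<beta> \<in> polys n" "\<And>\<alpha> \<beta>. \<alpha> \<in> BF \<Longrightarrow> \<beta> \<in> BF \<Longrightarrow> h \<alpha> \<beta> \<in> polys n"
  shows "bt_of n \<eta> \<xi> g = bt_of n \<eta> \<xi> h \<longleftrightarrow> (\<forall>\<alpha>\<in>BF. \<forall>\<beta>\<in>BF. g \<alpha> \<beta> - h \<alpha> \<beta> \<in> R_ideal n \<eta> \<alpha> \<beta>)"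
proof -
  have "bt_of n \<eta> \<xi> g = bt_of n \<eta> \<xi> h \<longleftrightarrow> (\<forall>\<alpha>\<in>BF. \<forall>\<beta>\<in>BF. R_class n \<eta> \<alpha> \<beta> (g \<alpha> \<beta>) = R_class n \<eta> \<alpha> \<beta> (h \<alpha> \<beta>))"
    (is "?l \<longleftrightarrow> ?r")
  proof
    assume l: ?l
    show ?r
    proof (intro ballI)
      fix \<alpha> \<beta> assume "\<alpha> \<in> BF" "\<beta> \<in> BF"
      then show "R_class n \<eta> \<alpha> \<beta> (g \<alpha> \<beta>) = R_class n \<eta> \<alpha> \<beta> (h \<alpha> \<beta>)"
        using fun_cong[OF l, of "(\<alpha>, \<beta>)"] by (simp add: bt_of_def)
    qed
  qed (auto simp: bt_of_def intro!: restrict_ext)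
  then show ?thesis using assms by (simp add: R_class_eq_iff)
qed

lemma bt_of_add:
  assumes "\<And>\<alpha> \<beta>. \<alpha> \<in> BF \<Longrightarrow> \<beta> \<in> BF \<Longrightarrow> g \<alpha> \<beta> \<in> polys n" "\<And>\<alpha> \<beta>. \<alpha> \<in> BF \<Longrightarrow> \<beta> \<in> BF \<Longrightarrow> h \<alpha> \<beta> \<in> polys n"
  shows "bt_of n \<eta> \<xi> g \<oplus>\<^bsub>B_tilde n \<eta> \<xi>\<^esub> bt_of n \<eta> \<xi> h = bt_of n \<eta> \<xi> (\<lambda>\<alpha> \<beta>. g \<alpha> \<beta> + h \<alpha> \<beta>)"
  using assms by (auto simp: B_tilde_def Let_def bt_of_def R_class_add intro!: restrict_ext)

lemma bt_of_mult:
  assumes "\<And>\<alpha> \<beta>. \<alpha> \<in> BF \<Longrightarrow> \<beta> \<in> BF \<Longrightarrow> g \<alpha> \<beta> \<in> polys n" "\<And>\<alpha> \<beta>. \<alpha> \<in> BF \<Longrightarrow> \<beta> \<in> BF \<Longrightarrow> h \<alpha> \<beta> \<in> polys n"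
  shows "bt_of n \<eta> \<xi> g \<otimes>\<^bsub>B_tilde n \<eta> \<xi>\<^esub> bt_of n \<eta> \<xi> h =
    bt_of n \<eta> \<xi> (\<lambda>\<alpha> \<gamma>. \<Sum>\<beta>\<in>BF. g \<alpha> \<beta> * h \<beta> \<gamma> * umon (S_set n \<alpha> \<beta> \<gamma>))"
proof -
  have "(\<Oplus>\<^bsub>R_ring n \<eta> \<alpha> \<gamma>\<^esub> \<beta> \<in> BF. R_conv n \<eta> \<alpha> \<beta> \<gamma> (bt_of n \<eta> \<xi> g (\<alpha>, \<beta>)) (bt_of n \<eta> \<xi> h (\<beta>, \<gamma>))) =
      R_class n \<eta> \<alpha> \<gamma> (\<Sum>\<beta>\<in>BF. g \<alpha> \<beta> * h \<beta> \<gamma> * umon (S_set n \<alpha> \<beta> \<gamma>))"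
    if \<alpha>\<gamma>: "\<alpha> \<in> BF" "\<gamma> \<in> BF" for \<alpha> \<gamma>
  proof -
    interpret R: ring "R_ring n \<eta> \<alpha> \<gamma>" by (rule ring_R_ring)
    have c: "g \<alpha> \<beta> * h \<beta> \<gamma> * umon (S_set n \<alpha> \<beta> \<gamma>) \<in> polys n" if "\<beta> \<in> BF" for \<beta>
      using assms that \<alpha>\<gamma> by (intro polys_mult umon_in_polys S_set_subset) auto
    have "(\<Oplus>\<^bsub>R_ring n \<eta> \<alpha> \<gamma>\<^esub> \<beta> \<in> BF. R_conv n \<eta> \<alpha> \<beta> \<gamma> (bt_of n \<eta> \<xi> g (\<alpha>, \<beta>)) (bt_of n \<eta> \<xi> h (\<beta>, \<gamma>))) =
        (\<Oplus>\<^bsub>R_ring n \<eta> \<alpha> \<gamma>\<^esub> \<beta> \<in> BF. R_class n \<eta> \<alpha> \<gamma> (g \<alpha> \<beta> * h \<beta> \<gamma> * umon (S_set n \<alpha> \<beta> \<gamma>)))"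
      using c \<alpha>\<gamma> assms
      by (intro R.finsum_cong') (auto simp: carrier_R_ring bt_of_apply R_conv_class BF_sign)
    then show ?thesis using R_class_finsum[OF finite_BF c] by simp
  qed
  then show ?thesis
    unfolding bt_of_def[of n \<eta> \<xi> "\<lambda>\<alpha> \<gamma>. \<Sum>\<beta>\<in>BF. g \<alpha> \<beta> * h \<beta> \<gamma> * umon (S_set n \<alpha> \<beta> \<gamma>)"]
    by (auto simp: B_tilde_def Let_def intro!: restrict_ext)
qed

lemma bt_zero_eq: "\<zero>\<^bsub>B_tilde n \<eta> \<xi>\<^esub> = bt_of n \<eta> \<xi> (\<lambda>_ _. 0)"
  by (simp add: B_tilde_def Let_def bt_of_def)

lemma bt_one_eq: "\<one>\<^bsub>B_tilde n \<eta> \<xi>\<^esub> = bt_of n \<eta> \<xi> (\<lambda>\<alpha> \<beta>. of_bool (\<alpha> = \<beta>))"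
  by (auto simp: B_tilde_def Let_def bt_of_def intro!: restrict_ext)

lemma bt_f_eq: "bt_f n \<eta> \<xi> \<alpha> \<beta> = bt_of n \<eta> \<xi> (\<lambda>\<gamma> \<delta>. of_bool (\<gamma> = \<alpha> \<and> \<delta> = \<beta>))"
  by (auto simp: bt_f_def bt_of_def intro!: restrict_ext)

lemma bt_u_eq: "bt_u n \<eta> \<xi> i = bt_of n \<eta> \<xi> (\<lambda>\<gamma> \<delta>. of_bool (\<gamma> = \<delta>) * uvar i)"
  by (auto simp: bt_u_def bt_of_def intro!: restrict_ext)

lemma bt_psi_bt_of: "bt_psi n \<eta> \<xi> (bt_of n \<eta> \<xi> g) = bt_of n \<eta> \<xi> (\<lambda>\<alpha> \<beta>. g \<beta> \<alpha>)"
  by (auto simp: bt_psi_def bt_of_def R_class_sym[of n \<eta>] intro!: restrict_ext)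

end

section \<open>The truncated algebra: paths whose ends avoid 0, while inner states may contain
  it\<close>

definition PA_r :: "nat \<Rightarrow> nat \<Rightarrow> ((nat set, osz_arrow) qpath \<Rightarrow> int) set" where
  "PA_r n k = {f \<in> carrier (osz_PA n k). \<forall>x p y. (x, p, y) \<in> supp f \<longrightarrow> x \<in> osz_Vr n k \<and> y \<in> osz_Vr n k}"

definition unit_r :: "nat \<Rightarrow> nat \<Rightarrow> (nat set, osz_arrow) qpath \<Rightarrow> int" where
  "unit_r n k = (\<lambda>s. \<Sum>x\<in>osz_Vr n k. path_elem (x, [], x) s)"

lemma osz_Vr_subset: "osz_Vr n k \<subseteq> osz_V n k"
  by (auto simp: osz_Vr_def osz_V_def)

lemma finite_osz_Vr [simp]: "finite (osz_Vr n k)"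
  by (rule finite_subset[OF osz_Vr_subset]) simp

lemma PA_r_carrier: "f \<in> PA_r n k \<Longrightarrow> f \<in> carrier (osz_PA n k)"
  by (simp add: PA_r_def)

lemma PA_r_supp: "f \<in> PA_r n k \<Longrightarrow> (x, p, y) \<in> supp f \<Longrightarrow> x \<in> osz_Vr n k \<and> y \<in> osz_Vr n k"
  by (simp add: PA_r_def)

lemma PA_r_zero: "(\<lambda>_. 0) \<in> PA_r n k"
  using osz.PA_zero_closed by (simp add: PA_r_def supp_def)

lemma PA_r_add: "f \<in> PA_r n k \<Longrightarrow> g \<in> PA_r n k \<Longrightarrow> (\<lambda>s. f s + g s) \<in> PA_r n k"
proof -
  assume f: "f \<in> PA_r n k" and g: "g \<in> PA_r n k"
  have "(x, p, y) \<in> supp f \<or> (x, p, y) \<in> supp g" if "(x, p, y) \<in> supp (\<lambda>s. f s + g s)" for x p y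
    using that by (auto simp: supp_def)
  then have "x \<in> osz_Vr n k \<and> y \<in> osz_Vr n k" if "(x, p, y) \<in> supp (\<lambda>s. f s + g s)" for x p y
    using that PA_r_supp[OF f, of x p y] PA_r_supp[OF g, of x p y] by blast
  then show ?thesis
    using osz.PA_add_closed[OF PA_r_carrier[OF f] PA_r_carrier[OF g]] by (simp add: PA_r_def)
qed

lemma PA_r_uminus: "f \<in> PA_r n k \<Longrightarrow> (\<lambda>s. - f s) \<in> PA_r n k"
  using osz.PA_uminus_closed by (simp add: PA_r_def supp_def)

lemma PA_r_mult:
  assumes f: "f \<in> PA_r n k" and g: "g \<in> PA_r n k"
  shows "f \<otimes>\<^bsub>osz_PA n k\<^esub> g \<in> PA_r n k"
proof -
  have fg: "f \<in> carrier (osz_PA n k)" "g \<in> carrier (osz_PA n k)" using f g by (simp_all add: PA_r_carrier)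
  have "x \<in> osz_Vr n k \<and> y \<in> osz_Vr n k" if s: "(x, p, y) \<in> supp (f \<otimes>\<^bsub>osz_PA n k\<^esub> g)" for x p y
  proof -
    obtain r1 r2 where r: "r1 \<in> supp f" "r2 \<in> supp g" "composable r1 r2" "(x, p, y) = pcomp r1 r2"
      using osz.supp_PA_mult[OF fg] s by blast
    obtain u p1 v where r1: "r1 = (u, p1, v)" by (cases r1) auto
    obtain v' p2 w where r2: "r2 = (v', p2, w)" by (cases r2) auto
    show ?thesis using PA_r_supp[OF f, of u p1 v] PA_r_supp[OF g, of v' p2 w] r by (simp add: r1 r2)
  qed
  then show ?thesis using osz.PA_mult_closed(1)[OF fg] by (simp add: PA_r_def)
qed

lemma path_elem_PA_r:
  "osz.awalk n k x p y \<Longrightarrow> x \<in> osz_Vr n k \<Longrightarrow> y \<in> osz_Vr n k \<Longrightarrow> path_elem (x, p, y) \<in> PA_r n k"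
  by (simp add: PA_r_def path_elem_closed)

lemma awalk_triv: "x \<in> osz_V n k \<Longrightarrow> osz.awalk n k x [] x"
  by (simp add: osz.awalk_Nil_iff)

lemma PA_r_sum:
  assumes "finite A" "\<And>a. a \<in> A \<Longrightarrow> g a \<in> PA_r n k"
  shows "(\<lambda>s. \<Sum>a\<in>A. g a s) \<in> PA_r n k"
proof -
  have "(\<lambda>s. \<Sum>a\<in>A. 1 * g a s) \<in> PA_r n k"
    by (rule int_combination_closed) (fact PA_r_zero PA_r_add PA_r_uminus assms)+
  then show ?thesis by simp
qed

lemma unit_r_PA_r: "unit_r n k \<in> PA_r n k"
  unfolding unit_r_def using osz_Vr_subset by (intro PA_r_sum path_elem_PA_r awalk_triv) auto

lemma lin_sum:
  assumes "finite A" "\<And>a. a \<in> A \<Longrightarrow> finite (supp (g a))"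
  shows "lin \<Theta> (\<lambda>s. \<Sum>a\<in>A. g a s) = (\<Sum>a\<in>A. lin \<Theta> (g a))"
  using assms
proof (induction A rule: finite_induct)
  case (insert a A)
  have "supp (\<lambda>s. \<Sum>a\<in>A. g a s) \<subseteq> (\<Union>a\<in>A. supp (g a))"
    by (auto simp: supp_def intro: ccontr sum.neutral)
  then have "finite (supp (\<lambda>s. \<Sum>a\<in>A. g a s))" using insert finite_subset[of _ "\<Union>a\<in>A. supp (g a)"] by auto
  then show ?case using insert lin_add[of "g a" "\<lambda>s. \<Sum>a\<in>A. g a s" \<Theta>] by simp
qed simp

lemma lin_unit_r: "lin \<Theta> (unit_r n k) = (\<Sum>x\<in>osz_Vr n k. \<Theta> (x, [], x))"
  unfolding unit_r_def by (subst lin_sum) auto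

lemma unit_r_mult:
  assumes f: "f \<in> PA_r n k"
  shows "unit_r n k \<otimes>\<^bsub>osz_PA n k\<^esub> f = f" "f \<otimes>\<^bsub>osz_PA n k\<^esub> unit_r n k = f"
proof -
  have c: "f \<in> carrier (osz_PA n k)" "unit_r n k \<in> carrier (osz_PA n k)"
    using f unit_r_PA_r by (simp_all add: PA_r_carrier)
  show "unit_r n k \<otimes>\<^bsub>osz_PA n k\<^esub> f = f"
  proof (rule osz.PA_eqI[OF osz.PA_mult_closed(1)[OF c(2,1)] c(1)])
    fix \<Theta> :: "(nat set, osz_arrow) qpath \<Rightarrow> int"
    show "lin \<Theta> (unit_r n k \<otimes>\<^bsub>osz_PA n k\<^esub> f) = lin \<Theta> f"
      unfolding osz.lin_PA_mult_right[OF c(2,1)]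
    proof (rule lin_cong)
      fix r assume r: "r \<in> supp f"
      obtain u p v where [simp]: "r = (u, p, v)" by (cases r) auto
      have "u \<in> osz_Vr n k" using PA_r_supp[OF f] r by simp
      moreover have "(\<Sum>x\<in>osz_Vr n k. if composable (x, [], x) r then \<Theta> (pcomp (x, [], x) r) else 0) =
          (\<Sum>x\<in>osz_Vr n k. if x = u then \<Theta> r else 0)" by (rule sum.cong) auto
      ultimately show "lin (\<lambda>r1. if composable r1 r then \<Theta> (pcomp r1 r) else 0) (unit_r n k) = \<Theta> r"
        unfolding lin_unit_r by (simp add: sum.delta)
    qed
  qed
  show "f \<otimes>\<^bsub>osz_PA n k\<^esub> unit_r n k = f"
  proof (rule osz.PA_eqI[OF osz.PA_mult_closed(1)[OF c(1,2)] c(1)])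
    fix \<Theta> :: "(nat set, osz_arrow) qpath \<Rightarrow> int"
    show "lin \<Theta> (f \<otimes>\<^bsub>osz_PA n k\<^esub> unit_r n k) = lin \<Theta> f"
      unfolding osz.lin_PA_mult_left[OF c(1,2)]
    proof (rule lin_cong)
      fix r assume r: "r \<in> supp f"
      obtain u p v where [simp]: "r = (u, p, v)" by (cases r) auto
      have "v \<in> osz_Vr n k" using PA_r_supp[OF f] r by simp
      moreover have "(\<Sum>x\<in>osz_Vr n k. if composable r (x, [], x) then \<Theta> (pcomp r (x, [], x)) else 0) =
          (\<Sum>x\<in>osz_Vr n k. if x = v then \<Theta> r else 0)" by (rule sum.cong) auto
      ultimately show "lin (\<lambda>r2. if composable r r2 then \<Theta> (pcomp r r2) else 0) (unit_r n k) = \<Theta> r"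
        unfolding lin_unit_r by (simp add: sum.delta)
    qed
  qed
qed

lemma cut_mult:
  assumes g: "g \<in> carrier (osz_PA n k)" and xy: "x \<in> osz_V n k" "y \<in> osz_V n k"
  shows "path_elem (x, [], x) \<otimes>\<^bsub>osz_PA n k\<^esub> g \<otimes>\<^bsub>osz_PA n k\<^esub> path_elem (y, [], y) =
    (\<lambda>(u, p, v). if u = x \<and> v = y then g (u, p, v) else 0)" (is "?l = ?r")
proof -
  have c: "path_elem (x, [], x) \<in> carrier (osz_PA n k)" "path_elem (y, [], y) \<in> carrier (osz_PA n k)"
    using xy by (auto intro!: path_elem_closed awalk_triv)
  have c1: "path_elem (x, [], x) \<otimes>\<^bsub>osz_PA n k\<^esub> g \<in> carrier (osz_PA n k)"
    using osz.PA_mult_closed(1)[OF c(1) g] .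
  have c2: "?l \<in> carrier (osz_PA n k)" using osz.PA_mult_closed(1)[OF c1 c(2)] .
  have "?l s = ?r s" for s
  proof -
    obtain u p v where s: "s = (u, p, v)" by (cases s) auto
    have "?l s = lin (\<lambda>r. of_bool (r = s)) ?l" by (rule lin_delta[symmetric]) (rule supp_PA(1)[OF c2])
    also have "\<dots> = lin (\<lambda>r. if composable r (y, [], y) then of_bool (pcomp r (y, [], y) = s) else 0)
        (path_elem (x, [], x) \<otimes>\<^bsub>osz_PA n k\<^esub> g)"
      unfolding osz.lin_PA_mult_right[OF c1 c(2)] by simp
    also have "\<dots> = lin (\<lambda>r. if composable (x, [], x) r then (if composable (pcomp (x, [], x) r) (y, [], y)
        then of_bool (pcomp (pcomp (x, [], x) r) (y, [], y) = s) else 0) else 0) g"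
      unfolding osz.lin_PA_mult_left[OF c(1) g] by simp
    also have "\<dots> = (if u = x \<and> v = y then lin (\<lambda>r. of_bool (r = s)) g else 0)"
    proof (cases "u = x \<and> v = y")
      case True
      then show ?thesis by (auto simp: s intro!: lin_cong split: if_splits)
    next
      case False
      then show ?thesis by (auto simp: s intro!: lin_eq_0I split: if_splits)
    qed
    also have "\<dots> = ?r s" unfolding lin_delta[OF supp_PA(1)[OF g]] by (simp add: s)
    finally show ?thesis .
  qed
  then show ?thesis by blast
qed

text \<open>Applied twice: to the full algebra with C the whole path algebra, and to the truncated
  algebra with C the combinations of paths between states without 0.\<close>

lemma osz_class_finsum:
  fixes R :: "osz_elem ring"
  assumes "abelian_monoid R" "finite A" "\<And>a. a \<in> A \<Longrightarrow> g a \<in> C"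
    and C: "(\<lambda>_. 0) \<in> C" "\<And>f h. f \<in> C \<Longrightarrow> h \<in> C \<Longrightarrow> (\<lambda>s. f s + h s) \<in> C"
    "\<And>f. f \<in> C \<Longrightarrow> osz_class n k f \<in> carrier R"
    "\<And>f h. f \<in> C \<Longrightarrow> h \<in> C \<Longrightarrow> osz_class n k f \<oplus>\<^bsub>R\<^esub> osz_class n k h = osz_class n k (\<lambda>s. f s + h s)"
    "osz_class n k (\<lambda>_. 0) = \<zero>\<^bsub>R\<^esub>"
  shows "(\<Oplus>\<^bsub>R\<^esub> a \<in> A. osz_class n k (g a)) = osz_class n k (\<lambda>s. \<Sum>a\<in>A. g a s)
    \<and> (\<lambda>s. \<Sum>a\<in>A. g a s) \<in> C"
proof -
  interpret abelian_monoid R by fact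
  show ?thesis using assms(2,3)
  proof (induction A rule: finite_induct)
    case empty
    then show ?case using C by simp
  next
    case (insert a A)
    have "(\<lambda>a. osz_class n k (g a)) \<in> insert a A \<rightarrow> carrier R" using insert.prems C(3) by auto
    then show ?case using insert C by (simp add: Pi_iff)
  qed
qed

lemma osz_Br_simps:
  "b \<otimes>\<^bsub>osz_Br n k\<^esub> c = b \<otimes>\<^bsub>osz_B n k\<^esub> c" "b \<oplus>\<^bsub>osz_Br n k\<^esub> c = b \<oplus>\<^bsub>osz_B n k\<^esub> c"
  "\<zero>\<^bsub>osz_Br n k\<^esub> = \<zero>\<^bsub>osz_B n k\<^esub>"
  by (simp_all add: osz_Br_def)

lemma osz_B_finsum:
  assumes "finite A" "\<And>a. a \<in> A \<Longrightarrow> g a \<in> carrier (osz_PA n k)"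
  shows "(\<Oplus>\<^bsub>osz_B n k\<^esub> a \<in> A. osz_class n k (g a)) = osz_class n k (\<lambda>s. \<Sum>a\<in>A. g a s)"
    and "(\<lambda>s. \<Sum>a\<in>A. g a s) \<in> carrier (osz_PA n k)"
proof -
  interpret ring "osz_B n k" by (rule ring_osz_B)
  have "(\<Oplus>\<^bsub>osz_B n k\<^esub> a \<in> A. osz_class n k (g a)) = osz_class n k (\<lambda>s. \<Sum>a\<in>A. g a s) \<and>
      (\<lambda>s. \<Sum>a\<in>A. g a s) \<in> carrier (osz_PA n k)"
    by (rule osz_class_finsum[OF abelian_monoid_axioms assms])
      (auto simp: osz.PA_zero_closed osz.PA_add_closed osz_class_closed osz_class_add osz_class_zero)
  then show "(\<Oplus>\<^bsub>osz_B n k\<^esub> a \<in> A. osz_class n k (g a)) = osz_class n k (\<lambda>s. \<Sum>a\<in>A. g a s)"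
    "(\<lambda>s. \<Sum>a\<in>A. g a s) \<in> carrier (osz_PA n k)" by auto
qed

lemma osz_I_cut:
  assumes "g \<in> carrier (osz_PA n k)" "x \<in> osz_Vr n k" "y \<in> osz_Vr n k"
  shows "osz_I n k x \<otimes>\<^bsub>osz_B n k\<^esub> osz_class n k g \<otimes>\<^bsub>osz_B n k\<^esub> osz_I n k y =
    osz_class n k (\<lambda>(u, p, v). if u = x \<and> v = y then g (u, p, v) else 0)"
proof -
  have xy: "x \<in> osz_V n k" "y \<in> osz_V n k" using assms osz_Vr_subset by auto
  have c: "path_elem (x, [], x) \<in> carrier (osz_PA n k)" "path_elem (y, [], y) \<in> carrier (osz_PA n k)"
    using xy by (auto intro!: path_elem_closed awalk_triv)
  show ?thesis unfolding osz_I_def cut_mult[OF assms(1) xy, symmetric]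
    using c assms(1) osz.PA_mult_closed(1)[OF c(1) assms(1)] by (simp add: osz_class_mult)
qed

text \<open>Multiplying by two trivial paths keeps the part supported on paths from x to y. Thus
  each summand is the class of such a part, and conversely a combination of paths between admissible
  states is the sum of its parts.\<close>

lemma carrier_osz_Br: "carrier (osz_Br n k) = osz_class n k ` PA_r n k"
proof -
  let ?cut = "\<lambda>x y g (u, p, v). if u = x \<and> v = y then g (u, p, v) else (0::int)"
  have cutc: "?cut x y g \<in> PA_r n k" if "g \<in> carrier (osz_PA n k)" "x \<in> osz_Vr n k" "y \<in> osz_Vr n k"
    for x y and g :: "(nat set, osz_arrow) qpath \<Rightarrow> int"
  proof -
    have s: "supp (?cut x y g) \<subseteq> supp g" by (auto simp: supp_def split: if_splits)
    then have "finite (supp (?cut x y g))" using supp_PA(1)[OF that(1)] finite_subset by blast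
    then have "?cut x y g \<in> carrier (osz_PA n k)"
      using s supp_PA(2)[OF that(1)] by (simp add: carrier_path_algebra subset_iff)
    then show ?thesis using that by (auto simp: PA_r_def supp_def split: if_splits)
  qed
  have eq: "(\<Oplus>\<^bsub>osz_B n k\<^esub> x \<in> osz_Vr n k. \<Oplus>\<^bsub>osz_B n k\<^esub> y \<in> osz_Vr n k.
      osz_I n k x \<otimes>\<^bsub>osz_B n k\<^esub> osz_class n k (g x y) \<otimes>\<^bsub>osz_B n k\<^esub> osz_I n k y) =
      osz_class n k (\<lambda>s. \<Sum>x\<in>osz_Vr n k. \<Sum>y\<in>osz_Vr n k. ?cut x y (g x y) s)" (is "?l = _")
    if g: "\<And>x y. x \<in> osz_Vr n k \<Longrightarrow> y \<in> osz_Vr n k \<Longrightarrow> g x y \<in> carrier (osz_PA n k)" for g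
  proof -
    interpret ring "osz_B n k" by (rule ring_osz_B)
    have cc: "?cut x y (g x y) \<in> carrier (osz_PA n k)" if "x \<in> osz_Vr n k" "y \<in> osz_Vr n k" for x y
      using cutc[OF g] that PA_r_carrier by blast
    have inner: "(\<Oplus>\<^bsub>osz_B n k\<^esub> y \<in> osz_Vr n k.
        osz_I n k x \<otimes>\<^bsub>osz_B n k\<^esub> osz_class n k (g x y) \<otimes>\<^bsub>osz_B n k\<^esub> osz_I n k y) =
        osz_class n k (\<lambda>s. \<Sum>y\<in>osz_Vr n k. ?cut x y (g x y) s)" if x: "x \<in> osz_Vr n k" for x
    proof -
      have "(\<Oplus>\<^bsub>osz_B n k\<^esub> y \<in> osz_Vr n k.
          osz_I n k x \<otimes>\<^bsub>osz_B n k\<^esub> osz_class n k (g x y) \<otimes>\<^bsub>osz_B n k\<^esub> osz_I n k y) =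
          (\<Oplus>\<^bsub>osz_B n k\<^esub> y \<in> osz_Vr n k. osz_class n k (?cut x y (g x y)))"
        by (intro finsum_cong') (use x g cc in \<open>auto simp: osz_I_cut intro!: osz_class_closed\<close>)
      then show ?thesis using osz_B_finsum(1)[of "osz_Vr n k" "\<lambda>y. ?cut x y (g x y)"] cc x by simp
    qed
    have "?l = (\<Oplus>\<^bsub>osz_B n k\<^esub> x \<in> osz_Vr n k. osz_class n k (\<lambda>s. \<Sum>y\<in>osz_Vr n k. ?cut x y (g x y) s))"
      by (intro finsum_cong') (auto simp: inner intro!: osz_class_closed osz_B_finsum(2) cc)
    also have "\<dots> = osz_class n k (\<lambda>s. \<Sum>x\<in>osz_Vr n k. \<Sum>y\<in>osz_Vr n k. ?cut x y (g x y) s)"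
      by (intro osz_B_finsum finite_osz_Vr cc)
    finally show ?thesis .
  qed
  show ?thesis
  proof
    show "carrier (osz_Br n k) \<subseteq> osz_class n k ` PA_r n k"
    proof
      fix c assume "c \<in> carrier (osz_Br n k)"
      then obtain b where c: "c = (\<Oplus>\<^bsub>osz_B n k\<^esub> x \<in> osz_Vr n k. \<Oplus>\<^bsub>osz_B n k\<^esub> y \<in> osz_Vr n k.
          osz_I n k x \<otimes>\<^bsub>osz_B n k\<^esub> b x y \<otimes>\<^bsub>osz_B n k\<^esub> osz_I n k y)"
        and b: "\<And>x y. x \<in> osz_Vr n k \<Longrightarrow> y \<in> osz_Vr n k \<Longrightarrow> b x y \<in> carrier (osz_B n k)"
        by (auto simp: osz_Br_def)
      interpret ring "osz_B n k" by (rule ring_osz_B)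
      have "\<exists>f. f \<in> carrier (osz_PA n k) \<and> (x \<in> osz_Vr n k \<and> y \<in> osz_Vr n k \<longrightarrow> b x y = osz_class n k f)" for x y
        using b[of x y] osz_B_elem osz.PA_zero_closed by metis
      then obtain g where g: "\<And>x y. g x y \<in> carrier (osz_PA n k)"
        "\<And>x y. x \<in> osz_Vr n k \<Longrightarrow> y \<in> osz_Vr n k \<Longrightarrow> b x y = osz_class n k (g x y)" by metis
      have I: "osz_I n k x \<in> carrier (osz_B n k)" if "x \<in> osz_Vr n k" for x
        unfolding osz_I_def using that osz_Vr_subset by (auto intro!: osz_class_closed path_elem_closed awalk_triv)
      have "c = (\<Oplus>\<^bsub>osz_B n k\<^esub> x \<in> osz_Vr n k. \<Oplus>\<^bsub>osz_B n k\<^esub> y \<in> osz_Vr n k.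
          osz_I n k x \<otimes>\<^bsub>osz_B n k\<^esub> osz_class n k (g x y) \<otimes>\<^bsub>osz_B n k\<^esub> osz_I n k y)"
        unfolding c by (intro finsum_cong' refl finsum_closed) (use g I in \<open>auto simp: osz_class_closed\<close>)
      also have "\<dots> = osz_class n k (\<lambda>s. \<Sum>x\<in>osz_Vr n k. \<Sum>y\<in>osz_Vr n k. ?cut x y (g x y) s)"
        by (rule eq[OF g(1)])
      also have "\<dots> \<in> osz_class n k ` PA_r n k"
        by (intro imageI PA_r_sum cutc g) auto
      finally show "c \<in> osz_class n k ` PA_r n k" .
    qed
    show "osz_class n k ` PA_r n k \<subseteq> carrier (osz_Br n k)"
    proof clarify
      fix f assume f: "f \<in> PA_r n k"
      have "f s = (\<Sum>x\<in>osz_Vr n k. \<Sum>y\<in>osz_Vr n k. ?cut x y f s)" for s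
      proof -
        obtain u p v where s: "s = (u, p, v)" by (cases s) auto
        have "(\<Sum>x\<in>osz_Vr n k. \<Sum>y\<in>osz_Vr n k. ?cut x y f s) =
            (\<Sum>x\<in>osz_Vr n k. if x = u then (\<Sum>y\<in>osz_Vr n k. if y = v then f s else 0) else 0)"
          by (intro sum.cong refl) (auto simp: s intro!: sum.cong)
        also have "\<dots> = (if u \<in> osz_Vr n k \<and> v \<in> osz_Vr n k then f s else 0)" by (simp add: sum.delta)
        also have "\<dots> = f s" using PA_r_supp[OF f, of u p v] by (auto simp: s supp_def)
        finally show ?thesis by simp
      qed
      then have "osz_class n k f = osz_class n k (\<lambda>s. \<Sum>x\<in>osz_Vr n k. \<Sum>y\<in>osz_Vr n k. ?cut x y f s)"
        by (intro arg_cong[of _ _ "osz_class n k"] ext)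
      also have "\<dots> = (\<Oplus>\<^bsub>osz_B n k\<^esub> x \<in> osz_Vr n k. \<Oplus>\<^bsub>osz_B n k\<^esub> y \<in> osz_Vr n k.
          osz_I n k x \<otimes>\<^bsub>osz_B n k\<^esub> osz_class n k f \<otimes>\<^bsub>osz_B n k\<^esub> osz_I n k y)"
        by (rule eq[symmetric]) (rule PA_r_carrier[OF f])
      finally have "\<exists>b. osz_class n k f = (\<Oplus>\<^bsub>osz_B n k\<^esub> x \<in> osz_Vr n k. \<Oplus>\<^bsub>osz_B n k\<^esub> y \<in> osz_Vr n k.
          osz_I n k x \<otimes>\<^bsub>osz_B n k\<^esub> b x y \<otimes>\<^bsub>osz_B n k\<^esub> osz_I n k y) \<and>
          (\<forall>x\<in>osz_Vr n k. \<forall>y\<in>osz_Vr n k. b x y \<in> carrier (osz_B n k))"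
        using osz_class_closed[OF PA_r_carrier[OF f]] by (intro exI[of _ "\<lambda>_ _. osz_class n k f"]) simp
      then show "osz_class n k f \<in> carrier (osz_Br n k)" by (simp add: osz_Br_def)
    qed
  qed
qed

lemma osz_Br_one: "\<one>\<^bsub>osz_Br n k\<^esub> = osz_class n k (unit_r n k)"
proof -
  have "\<one>\<^bsub>osz_Br n k\<^esub> = (\<Oplus>\<^bsub>osz_B n k\<^esub> x \<in> osz_Vr n k. osz_class n k (path_elem (x, [], x)))"
    by (simp add: osz_Br_def osz_I_def)
  also have "\<dots> = osz_class n k (unit_r n k)"
    unfolding unit_r_def using osz_Vr_subset
    by (intro osz_B_finsum(1)) (auto intro!: path_elem_closed awalk_triv)
  finally show ?thesis .
qed

lemma osz_Br_mult: "f \<in> PA_r n k \<Longrightarrow> g \<in> PA_r n k \<Longrightarrow>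
    osz_class n k f \<otimes>\<^bsub>osz_Br n k\<^esub> osz_class n k g = osz_class n k (f \<otimes>\<^bsub>osz_PA n k\<^esub> g)"
  by (simp add: osz_Br_simps osz_class_mult PA_r_carrier)

lemma osz_Br_add: "f \<in> PA_r n k \<Longrightarrow> g \<in> PA_r n k \<Longrightarrow>
    osz_class n k f \<oplus>\<^bsub>osz_Br n k\<^esub> osz_class n k g = osz_class n k (\<lambda>s. f s + g s)"
  by (simp add: osz_Br_simps osz_class_add PA_r_carrier)

lemma osz_Br_zero: "\<zero>\<^bsub>osz_Br n k\<^esub> = osz_class n k (\<lambda>_. 0)"
  by (simp add: osz_Br_simps osz_class_zero)

text \<open>The unit is in general not that of the full algebra, so only associativity,
  distributivity and the laws of addition are inherited.\<close>

lemma ring_osz_Br: "ring (osz_Br n k)"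
proof (rule ringI)
  interpret B: ring "osz_B n k" by (rule ring_osz_B)
  have sub: "b \<in> carrier (osz_B n k)" if "b \<in> carrier (osz_Br n k)" for b
    using that osz_class_closed PA_r_carrier by (auto simp: carrier_osz_Br)
  have closed: "b \<otimes>\<^bsub>osz_Br n k\<^esub> c \<in> carrier (osz_Br n k)" "b \<oplus>\<^bsub>osz_Br n k\<^esub> c \<in> carrier (osz_Br n k)"
    if "b \<in> carrier (osz_Br n k)" "c \<in> carrier (osz_Br n k)" for b c
    using that by (auto simp: carrier_osz_Br osz_Br_mult osz_Br_add intro!: imageI PA_r_mult PA_r_add)
  show "abelian_group (osz_Br n k)"
  proof (rule abelian_groupI)
    show "\<zero>\<^bsub>osz_Br n k\<^esub> \<in> carrier (osz_Br n k)"
      unfolding carrier_osz_Br osz_Br_zero by (intro imageI PA_r_zero)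
    fix b assume "b \<in> carrier (osz_Br n k)"
    then obtain f where f: "b = osz_class n k f" "f \<in> PA_r n k" by (auto simp: carrier_osz_Br)
    have "osz_class n k (\<lambda>s. - f s) \<in> carrier (osz_Br n k)"
      unfolding carrier_osz_Br by (intro imageI PA_r_uminus f)
    moreover have "osz_class n k (\<lambda>s. - f s) \<oplus>\<^bsub>osz_Br n k\<^esub> b = \<zero>\<^bsub>osz_Br n k\<^esub>"
      unfolding f(1) using f(2) by (simp add: osz_Br_add PA_r_uminus osz_Br_zero)
    ultimately show "\<exists>c\<in>carrier (osz_Br n k). c \<oplus>\<^bsub>osz_Br n k\<^esub> b = \<zero>\<^bsub>osz_Br n k\<^esub>" by blast
  qed (auto simp: closed sub osz_Br_simps B.a_ac closed(2)[unfolded osz_Br_simps])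
  show "monoid (osz_Br n k)"
  proof (rule monoidI)
    show "\<one>\<^bsub>osz_Br n k\<^esub> \<in> carrier (osz_Br n k)"
      unfolding carrier_osz_Br osz_Br_one by (intro imageI unit_r_PA_r)
    fix b assume "b \<in> carrier (osz_Br n k)"
    then obtain f where f: "b = osz_class n k f" "f \<in> PA_r n k" by (auto simp: carrier_osz_Br)
    show "\<one>\<^bsub>osz_Br n k\<^esub> \<otimes>\<^bsub>osz_Br n k\<^esub> b = b" "b \<otimes>\<^bsub>osz_Br n k\<^esub> \<one>\<^bsub>osz_Br n k\<^esub> = b"
      unfolding f(1) osz_Br_one using f(2) by (simp_all add: osz_Br_mult unit_r_PA_r unit_r_mult)
  next
    fix b c d assume "b \<in> carrier (osz_Br n k)" "c \<in> carrier (osz_Br n k)" "d \<in> carrier (osz_Br n k)"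
    then show "b \<otimes>\<^bsub>osz_Br n k\<^esub> c \<otimes>\<^bsub>osz_Br n k\<^esub> d = b \<otimes>\<^bsub>osz_Br n k\<^esub> (c \<otimes>\<^bsub>osz_Br n k\<^esub> d)"
      by (simp add: osz_Br_simps sub B.m_assoc)
  qed (rule closed(1))
  fix b c d assume "b \<in> carrier (osz_Br n k)" "c \<in> carrier (osz_Br n k)" "d \<in> carrier (osz_Br n k)"
  then show "(b \<oplus>\<^bsub>osz_Br n k\<^esub> c) \<otimes>\<^bsub>osz_Br n k\<^esub> d = b \<otimes>\<^bsub>osz_Br n k\<^esub> d \<oplus>\<^bsub>osz_Br n k\<^esub> c \<otimes>\<^bsub>osz_Br n k\<^esub> d"
    and "d \<otimes>\<^bsub>osz_Br n k\<^esub> (b \<oplus>\<^bsub>osz_Br n k\<^esub> c) = d \<otimes>\<^bsub>osz_Br n k\<^esub> b \<oplus>\<^bsub>osz_Br n k\<^esub> d \<otimes>\<^bsub>osz_Br n k\<^esub> c"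
    by (simp_all add: osz_Br_simps sub B.l_distr B.r_distr)
qed

lemma osz_Br_finsum:
  assumes "finite A" "\<And>a. a \<in> A \<Longrightarrow> g a \<in> PA_r n k"
  shows "(\<Oplus>\<^bsub>osz_Br n k\<^esub> a \<in> A. osz_class n k (g a)) = osz_class n k (\<lambda>s. \<Sum>a\<in>A. g a s)"
proof -
  interpret ring "osz_Br n k" by (rule ring_osz_Br)
  have "(\<Oplus>\<^bsub>osz_Br n k\<^esub> a \<in> A. osz_class n k (g a)) = osz_class n k (\<lambda>s. \<Sum>a\<in>A. g a s) \<and>
      (\<lambda>s. \<Sum>a\<in>A. g a s) \<in> PA_r n k"
    by (rule osz_class_finsum[OF abelian_monoid_axioms assms])
      (auto simp: PA_r_zero PA_r_add carrier_osz_Br osz_Br_add osz_Br_zero)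
  then show ?thesis ..
qed

lemma osz_class_elem_append:
  assumes "word n k x (u @ w)" "x \<in> osz_Vr n k" "run x u \<in> osz_Vr n k" "run x (u @ w) \<in> osz_Vr n k"
  shows "osz_class n k (elem x (u @ w)) = osz_class n k (elem x u) \<otimes>\<^bsub>osz_Br n k\<^esub> osz_class n k (elem (run x u) w)"
  using assms elem_closed[of n k] by (simp add: osz_Br_simps osz_class_mult elem_append word_append)

lemma elem_PA_r:
  assumes "word n k x w" "x \<in> osz_Vr n k" "run x w \<in> osz_Vr n k"
  shows "elem x w \<in> PA_r n k"
  using assms awalk_wpath[of x n k w] by (auto simp: elem_def wpath_def word_def intro!: path_elem_PA_r)

text \<open>Paths between states without \<open>0\<close> may leave this set of states, but their normal forms do not.\<close>

lemma osz_Br_hom_eqI: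
  assumes R: "ring R" and h: "h \<in> Ring.ring_hom (osz_Br n k) R" and h': "h' \<in> Ring.ring_hom (osz_Br n k) R"
    and I: "\<And>x. x \<in> osz_Vr n k \<Longrightarrow> h (osz_I n k x) = h' (osz_I n k x)"
    and RL: "\<And>i l x y. x \<in> osz_Vr n k \<Longrightarrow> y \<in> osz_Vr n k \<Longrightarrow> l \<in> {OR i, OL i} \<Longrightarrow>
      (l, x, y) \<in> arcs (osz_quiver n k) \<Longrightarrow> h (osz_arr n k l x y) = h' (osz_arr n k l x y)"
    and U: "\<And>i x. i \<in> {1..n} \<Longrightarrow> x \<in> osz_Vr n k \<Longrightarrow> h (osz_arr n k (OU i) x x) = h' (osz_arr n k (OU i) x x)"
    and b: "b \<in> carrier (osz_Br n k)"
  shows "h b = h' b"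
proof -
  interpret h: ring_hom_ring "osz_Br n k" R h using ring_osz_Br R h by (rule ring_hom_ringI2)
  interpret h': ring_hom_ring "osz_Br n k" R h' using ring_osz_Br R h' by (rule ring_hom_ringI2)
  let ?c = "osz_class n k"
  have cl: "?c f \<in> carrier (osz_Br n k)" if "f \<in> PA_r n k" for f using that by (simp add: carrier_osz_Br)
  have letter: "h (?c (elem x [l])) = h' (?c (elem x [l]))"
    if "word n k x [l]" "x \<in> osz_Vr n k" "step x l \<in> osz_Vr n k" for x l
  proof -
    obtain c i where l: "l = (c, i)" by fastforce
    have i: "i \<in> {1..n}" using that(1) by (auto simp: l word_def)
    have arc: "arrow x l \<in> arcs (osz_quiver n k)" using that(1) by (intro arrow_in_arcs) (auto simp: word_def)
    show ?thesis
    proof (cases c)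
      case False
      then show ?thesis using U[OF i that(2)] by (simp add: elem_def wpath_def l osz_arr_def)
    next
      case True
      then show ?thesis using RL[OF that(2,3), of "fst (arrow x l)" i] arc
        by (simp add: elem_def wpath_def l osz_arr_def)
    qed
  qed
  \<comment> \<open>The factorization into letters stays within the truncated algebra only if every
    intermediate state avoids 0, hence the condition on all prefixes.\<close>
  have word: "h (?c (elem x w)) = h' (?c (elem x w))"
    if "word n k x w" "x \<in> osz_Vr n k" "\<And>u v. w = u @ v \<Longrightarrow> run x u \<in> osz_Vr n k" for x w
    using that
  proof (induction w arbitrary: x)
    case Nil
    then show ?case using I[of x] by (simp add: elem_def wpath_def osz_I_def)
  next
    case (Cons l w)
    have s: "step x l \<in> osz_Vr n k" using Cons.prems(3)[of "[l]" w] by simp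
    have w: "word n k x [l]" "word n k (step x l) w"
      using Cons.prems(1) word_Cons[of n k x l w] by simp_all
    have e: "run x (l # w) \<in> osz_Vr n k" using Cons.prems(3)[of "l # w" "[]"] by simp
    have IH: "h (?c (elem (step x l) w)) = h' (?c (elem (step x l) w))"
      using Cons.prems(3)[of "l # _"] by (intro Cons.IH w s) fastforce
    have "?c (elem x ([l] @ w)) = ?c (elem x [l]) \<otimes>\<^bsub>osz_Br n k\<^esub> ?c (elem (step x l) w)"
      using osz_class_elem_append[of n k x "[l]" w] Cons.prems(1,2) s e by simp
    moreover have "elem x [l] \<in> PA_r n k" "elem (step x l) w \<in> PA_r n k"
      using w s e Cons.prems(2) by (auto intro!: elem_PA_r)
    ultimately show ?case using letter[OF w(1) Cons.prems(2) s] IH cl by simp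
  qed
  have path: "h (?c (path_elem (x, p, y))) = h' (?c (path_elem (x, p, y)))"
    if asm: "osz.awalk n k x p y" "x \<in> osz_Vr n k" "y \<in> osz_Vr n k" for x p y
  proof -
    obtain w where w: "x \<in> osz_V n k" "word_ok n x w" "(x, p, y) = wpath x w"
      using awalk_is_wpath[OF asm(1)] by metis
    have ww: "word n k x w" using w by (simp add: word_def)
    have e: "path_elem (x, p, y) = elem x w" using w(3) by (simp add: elem_def)
    have y: "y = run x w" using w(3) by (simp add: wpath_def)
    from normal_form[OF ww] show ?thesis
    proof (elim disjE exE conjE)
      assume "wnul n k x w"
      then have "elem x w \<in> osz_ideal n k" by (simp add: wnul_def)
      then have "?c (elem x w) = ?c (\<lambda>_. 0)"
        using elem_closed[OF ww] osz.PA_zero_closed[of n k]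
        by (simp add: osz_class_eq_iff osz_ideal_eq_kernel kernel_def class_sum_def)
      then show ?thesis unfolding e using osz_Br_zero[of n k] h.hom_zero h'.hom_zero by metis
    next
      fix r us assume r: "distinct r" "weq n k x w (Cs r @ Us us)"
      let ?w = "Cs r @ Us us"
      note w2 = weq_word[OF r(2)]
      have cw: "?c (elem x w) = ?c (elem x ?w)"
        using r(2) elem_closed[OF w2(1)] elem_closed[OF w2(2)]
          ring.quotient_eq_iff_same_a_r_cos[OF ring_osz_PA ideal_osz]
        unfolding weq_def osz_class_def by blast
      have wr: "word n k x (Cs r)" using w2(2) by (simp only: word_append)
      have nz: "0 \<notin> set r" by (rule word_Cs_nz[OF wr])
      have yr: "run x (Cs r) = y" using w2(3) y by simp
      \<comment> \<open>The edge 1 is the only one that changes whether 0 is occupied, the normal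
        form crosses it at most once, and neither end contains 0.\<close>
      have 1: "1 \<notin> set r"
        using in_run_Cs_iff[OF r(1) nz, of 0 x] nz asm(2,3) unfolding yr by (auto simp: osz_Vr_def)
      have inV: "run x u \<in> osz_Vr n k" if "?w = u @ v" for u v
      proof -
        have "word n k x u" using w2(2) that word_append[of n k x u v] by simp
        then have V: "run x u \<in> osz_V n k" by (auto simp: word_def run_osz_V)
        have "set u \<subseteq> set ?w" unfolding that by simp
        moreover have "(True, 1) \<notin> set ?w" using 1 by auto
        ultimately have s: "(True, 1) \<notin> set u" by blast
        have "0 \<notin> run z u" if "0 \<notin> z" "word_ok n z u" for z
          using s that
        proof (induction u arbitrary: z)
          case (Cons l u)
          obtain c i where l: "l = (c, i)" by fastforce
          have "c \<Longrightarrow> i \<noteq> 0 \<and> i - 1 \<noteq> 0" using Cons.prems by (auto simp: l)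
          then have "0 \<notin> step z l" using Cons.prems(2) by (cases c) (auto simp: l in_toggle_iff)
          then show ?case using Cons by simp
        qed simp
        moreover have "0 \<notin> x" "word_ok n x u"
          using asm(2) \<open>word n k x u\<close> by (auto simp: osz_Vr_def word_def)
        ultimately have "0 \<notin> run x u" by blast
        then show ?thesis using V
          unfolding osz_V_def osz_Vr_def by (auto simp: subset_iff) (metis Suc_leI gr0I One_nat_def)
      qed
      show ?thesis unfolding e cw by (rule word[OF w2(2) asm(2) inV])
    qed
  qed
  let ?Q = "{f \<in> PA_r n k. h (?c f) = h' (?c f)}"
  obtain f where f: "b = ?c f" "f \<in> PA_r n k" using b by (auto simp: carrier_osz_Br)
  have neg: "?c (\<lambda>s. - f s) = \<ominus>\<^bsub>osz_Br n k\<^esub> ?c f" if "f \<in> PA_r n k" for f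
    using that osz_Br_add[OF PA_r_uminus[OF that] that] osz_Br_zero[of n k]
    by (intro h.R.minus_equality[symmetric]) (auto intro!: cl PA_r_uminus)
  have "(\<lambda>s. \<Sum>r\<in>supp f. f r * path_elem r s) \<in> ?Q"
  proof (rule int_combination_closed)
    show "(\<lambda>_. 0) \<in> ?Q" using PA_r_zero osz_Br_zero[of n k] h.hom_zero h'.hom_zero by simp
    show "(\<lambda>s. f s + g s) \<in> ?Q" if "f \<in> ?Q" "g \<in> ?Q" for f g
      using that by (simp add: PA_r_add osz_Br_add[symmetric] cl)
    show "(\<lambda>s. - f s) \<in> ?Q" if "f \<in> ?Q" for f
      using that by (simp add: PA_r_uminus neg cl)
    show "finite (supp f)" by (rule supp_PA(1)[OF PA_r_carrier[OF f(2)]])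
    fix r assume r: "r \<in> supp f"
    obtain x p y where [simp]: "r = (x, p, y)" by (cases r) auto
    show "path_elem r \<in> ?Q"
      using r supp_PA(2)[OF PA_r_carrier[OF f(2)], of x p y] PA_r_supp[OF f(2), of x p y]
      by (auto intro!: path_elem_PA_r path)
  qed
  moreover have "(\<lambda>s. \<Sum>r\<in>supp f. f r * path_elem r s) = f"
  proof
    fix s
    have "(\<Sum>r\<in>supp f. f r * path_elem r s) = (\<Sum>r\<in>supp f. if s = r then f r else 0)"
      by (rule sum.cong) (auto simp: path_elem_def)
    also have "\<dots> = f s" using supp_PA(1)[OF PA_r_carrier[OF f(2)]] by (simp add: supp_def)
    finally show "(\<Sum>r\<in>supp f. f r * path_elem r s) = f s" .
  qed
  ultimately show ?thesis by (simp add: f(1))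
qed

section \<open>From paths to monomials: parities of degrees and differing signs\<close>

section \<open>Paths and monomials\<close>

text \<open>A path \<open>p\<close> from \<open>X \<alpha>\<close> to \<open>X \<beta>\<close> corresponds to \<open>u\<^sup>m f\<^sub>\<alpha>\<^sub>\<beta>\<close> with \<open>m = half_degree p\<close>: the
  parities of its degrees are carried by \<open>f\<^sub>\<alpha>\<^sub>\<beta>\<close>.\<close>

definition half_degree :: "osz_arrow list \<Rightarrow> (nat \<Rightarrow>\<^sub>0 nat)" where
  "half_degree p = Abs_poly_mapping (\<lambda>i. nat (osz_degree p i div 2))"

lemma lookup_half_degree: "Poly_Mapping.lookup (half_degree p) i = nat (osz_degree p i div 2)"
proof -
  have "finite {i. osz_degree p i \<noteq> 0}"
  proof (induction p)
    case Nil
    then show ?case by (simp add: osz_degree_def)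
  next
    case (Cons a p)
    have l: "\<exists>j. {i. osz_label_degree l i \<noteq> 0} \<subseteq> {j}" for l by (cases l) auto
    obtain j where "{i. osz_label_degree (fst a) i \<noteq> 0} \<subseteq> {j}" using l by blast
    then have "{i. osz_degree (a # p) i \<noteq> 0} \<subseteq> insert j {i. osz_degree p i \<noteq> 0}"
      by (auto simp: osz_degree_def)
    then show ?case using Cons finite_subset[of _ "insert j {i. osz_degree p i \<noteq> 0}"] by simp
  qed
  then have "finite {i. nat (osz_degree p i div 2) \<noteq> 0}" by (rule rev_finite_subset) auto
  then have "Poly_Mapping.lookup (half_degree p) = (\<lambda>i. nat (osz_degree p i div 2))"
    unfolding half_degree_def by (intro Abs_poly_mapping_inverse CollectI)
  then show ?thesis by (rule fun_cong)
qed

text \<open>Among the two ends of the edge e, the number lying below i is odd only for i =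
  e.\<close>

lemma parity_toggle:
  assumes "finite x" "1 \<le> e"
  shows "even (card {j \<in> toggle e x. j < i}) \<longleftrightarrow> (even (card {j \<in> x. j < i}) \<longleftrightarrow> i \<noteq> e)"
proof -
  define A where "A = {j \<in> x. j < i}"
  define D where "D = {j \<in> {e - 1, e}. j < i}"
  have fin: "finite A" "finite D" using assms by (auto simp: A_def D_def)
  have e: "e - 1 < e" using assms by simp
  have "{j \<in> toggle e x. j < i} = (A - D) \<union> (D - A)" by (auto simp: A_def D_def in_toggle_iff)
  then have "card {j \<in> toggle e x. j < i} = card (A - D) + card (D - A)"
    using fin by (simp add: card_Un_disjoint disjoint_iff)
  moreover have "card A = card (A - D) + card (A \<inter> D)" using fin by (metis card_Diff_subset_Int Int_lower1 card_mono finite_Int le_add_diff_inverse2)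
  moreover have "card D = card (D - A) + card (A \<inter> D)"
    using fin by (metis card_Diff_subset_Int Int_lower1 Int_commute card_mono finite_Int le_add_diff_inverse2)
  moreover have "even (card D) \<longleftrightarrow> i \<noteq> e"
  proof -
    consider "i < e" | "i = e" | "e < i" by linarith
    then show ?thesis
    proof cases
      case 1
      then have "D = {}" by (auto simp: D_def)
      then show ?thesis using 1 by simp
    next
      case 2
      then have "D = {e - 1}" using e by (auto simp: D_def)
      then show ?thesis using 2 by simp
    next
      case 3
      then have "D = {e - 1, e}" by (auto simp: D_def)
      then show ?thesis using 3 e by simp
    qed
  qed
  ultimately show ?thesis unfolding A_def[symmetric] by presburger
qed

text \<open>The sign of a sign vector at i is the parity of the number of elements of its state
  below i, so this compares degrees with changes of sign.\<close>

lemma parity_walk: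
  assumes "osz.awalk n k x p y"
  shows "even (osz_degree p i) \<longleftrightarrow> (even (card {j \<in> y. j < i}) \<longleftrightarrow> even (card {j \<in> x. j < i}))"
proof -
  obtain w where w: "x \<in> osz_V n k" "word_ok n x w" "(x, p, y) = wpath x w"
    using awalk_is_wpath[OF assms] by metis
  have "finite x" using w(1) finite_subset[of x "{0..n}"] by (simp add: osz_V_def)
  then have "even (word_degree w i) \<longleftrightarrow> (even (card {j \<in> run x w. j < i}) \<longleftrightarrow> even (card {j \<in> x. j < i}))"
    using w(2)
  proof (induction w arbitrary: x)
    case (Cons l w)
    obtain c e where l: "l = (c, e)" by fastforce
    have fin: "finite (step x l)" using Cons.prems(1) by (auto simp: l toggle_def)
    have IH: "even (word_degree w i) \<longleftrightarrow>
        (even (card {j \<in> run (step x l) w. j < i}) \<longleftrightarrow> even (card {j \<in> step x l. j < i}))"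
      using Cons.prems(2) by (intro Cons.IH fin) simp
    have "1 \<le> e" using Cons.prems(2) by (simp add: l)
    then show ?case using IH parity_toggle[OF Cons.prems(1), of e i] by (cases c) (auto simp: l)
  qed simp
  then show ?thesis using w(3) by (simp add: wpath_def)
qed

lemma osz_degree_range:
  assumes "osz.awalk n k x p y" "i \<notin> {1..n}"
  shows "osz_degree p i = 0"
proof -
  obtain w where w: "word_ok n x w" "(x, p, y) = wpath x w"
    using awalk_is_wpath[OF assms(1)] by metis
  have "word_ok n x w \<Longrightarrow> word_degree w i = 0" for x
    by (induction w arbitrary: x) (use assms(2) in auto)
  then show ?thesis using w by (simp add: wpath_def)
qed

definition path_mon :: "nat set \<Rightarrow> nat set \<Rightarrow> (nat set, osz_arrow) qpath \<Rightarrow> upoly" where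
  "path_mon x y r = (case r of (x', p, y') \<Rightarrow>
     if x' = x \<and> y' = y then Poly_Mapping.single (half_degree p) 1 else 0)"

abbreviation path_poly :: "nat set \<Rightarrow> nat set \<Rightarrow> ((nat set, osz_arrow) qpath \<Rightarrow> int) \<Rightarrow> upoly" where
  "path_poly x y f \<equiv> lin (path_mon x y) f"

lemma of_int_upoly: "(of_int c :: upoly) = Poly_Mapping.single 0 c"
  by (metis of_int_eq_id id_apply single_of_int)

lemma lookup_path_poly:
  "Poly_Mapping.lookup (path_poly x y f) m =
    lin (\<lambda>(x', p, y'). of_bool (x' = x \<and> y' = y \<and> half_degree p = m)) f"
proof -
  have "Poly_Mapping.lookup (of_int c * path_mon x y r) m =
      of_int c * (case r of (x', p, y') \<Rightarrow> of_bool (x' = x \<and> y' = y \<and> half_degree p = m))" for c r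
  proof -
    show ?thesis by (auto simp: of_int_upoly path_mon_def mult_single lookup_single when_def split: prod.splits)
  qed
  then show ?thesis by (simp add: lin_def lookup_sum)
qed

text \<open>All of the geometry that enters the algebra: which sign vectors are bounded and
  feasible, and which faces common to two chambers are empty.\<close>

locale cyclic_combinatorics =
  fixes n k :: nat and \<eta> \<xi> :: "real vec set"
  assumes BF_eq: "bounded_feasible n \<eta> \<xi> = {\<alpha> \<in> sign_vectors n. var_r n k \<alpha> = k}"
    and face_empty_iff: "\<alpha> \<in> bounded_feasible n \<eta> \<xi> \<Longrightarrow> \<beta> \<in> bounded_feasible n \<eta> \<xi> \<Longrightarrow> S \<subseteq> {1..n} \<Longrightarrow>
      face_empty n \<eta> \<alpha> \<beta> S \<longleftrightarrow> \<not> live n (sign_subset n k \<alpha>) (S \<union> {i \<in> {1..n}. \<alpha> i \<noteq> \<beta> i})"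
begin

abbreviation X :: "(nat \<Rightarrow> int) \<Rightarrow> nat set" where "X \<equiv> sign_subset n k"
abbreviation A :: "nat set \<Rightarrow> nat \<Rightarrow> int" where "A \<equiv> sign_of_subset n k \<eta> \<xi>"
abbreviation BFs :: "(nat \<Rightarrow> int) set" where "BFs \<equiv> bounded_feasible n \<eta> \<xi>"
abbreviation Br where "Br \<equiv> osz_Br n k"
abbreviation Bt where "Bt \<equiv> B_tilde n \<eta> \<xi>"

lemma BF_signs: "\<alpha> \<in> BFs \<Longrightarrow> \<alpha> \<in> sign_vectors n" "\<alpha> \<in> BFs \<Longrightarrow> var_r n k \<alpha> = k"
  by (simp_all add: BF_eq)

lemma sign_eq: "\<alpha> \<in> BFs \<Longrightarrow> i \<in> {1..n} \<Longrightarrow> \<alpha> i = (-1) ^ card {j \<in> X \<alpha>. j < i}"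
  using sign_formula BF_signs by blast

lemma sign_eq_iff:
  "\<alpha> \<in> BFs \<Longrightarrow> \<beta> \<in> BFs \<Longrightarrow> i \<in> {1..n} \<Longrightarrow>
    \<alpha> i = \<beta> i \<longleftrightarrow> (even (card {j \<in> X \<alpha>. j < i}) \<longleftrightarrow> even (card {j \<in> X \<beta>. j < i}))"
  by (cases "even (card {j \<in> X \<alpha>. j < i})"; cases "even (card {j \<in> X \<beta>. j < i})") (auto simp: sign_eq)

lemma sign_outside: "\<alpha> \<in> BFs \<Longrightarrow> i \<notin> {1..n} \<Longrightarrow> \<alpha> i = undefined"
  using PiE_arb[of \<alpha> "{1..n}" "\<lambda>_. {-1, 1}" i] BF_signs(1)[of \<alpha>] unfolding sign_vectors_def by blast

lemma sign_eqI:
  assumes "\<alpha> \<in> BFs" "\<beta> \<in> BFs" "\<And>i. i \<in> {1..n} \<Longrightarrow> \<alpha> i = \<beta> i"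
  shows "\<alpha> = \<beta>"
proof
  fix i show "\<alpha> i = \<beta> i" using assms(3)[of i] sign_outside[OF assms(1), of i] sign_outside[OF assms(2), of i]
    by (cases "i \<in> {1..n}") simp_all
qed

lemma X_bij: "bij_betw X BFs (osz_Vr n k)"
proof (rule bij_betwI')
  fix \<alpha> \<beta> assume ab: "\<alpha> \<in> BFs" "\<beta> \<in> BFs"
  show "X \<alpha> = X \<beta> \<longleftrightarrow> \<alpha> = \<beta>" using sign_eqI[OF ab] ab by (auto simp: sign_eq)
next
  fix \<alpha> assume "\<alpha> \<in> BFs"
  then show "X \<alpha> \<in> osz_Vr n k"
    using sign_subset_subset[of n k \<alpha>] card_sign_subset[of n k \<alpha>] BF_signs by (simp add: osz_Vr_def)
next
  fix x assume x: "x \<in> osz_Vr n k"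
  then have xn: "x \<subseteq> {1..n}" "card x = k" "finite x" using finite_subset[of x "{1..n}"] by (simp_all add: osz_Vr_def)
  \<comment> \<open>The sequence starts with plus and changes sign after each element of x; with k
    elements it arrives at the appended sign (-1)^k.\<close>
  define \<alpha> where "\<alpha> = (\<lambda>i\<in>{1..n}. (-1 :: int) ^ card {j \<in> x. j < i})"
  have s: "\<alpha> \<in> sign_vectors n"
    unfolding sign_vectors_def \<alpha>_def
  proof (rule restrict_PiE_iff[THEN iffD2], rule ballI)
    fix i show "(-1 :: int) ^ card {j \<in> x. j < i} \<in> {-1, 1}" by (cases "even (card {j \<in> x. j < i})") auto
  qed
  have e: "extend_sign n k \<alpha> i = (-1) ^ card {j \<in> x. j < i}" if i: "i \<in> {1..Suc n}" for i
  proof (cases "i = Suc n")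
    case True
    have "{j \<in> x. j < Suc n} = x" using xn by auto
    then show ?thesis using True xn by (simp add: extend_sign_def)
  next
    case False
    then show ?thesis using i by (auto simp: extend_sign_def \<alpha>_def)
  qed
  have "X \<alpha> = x"
  proof (rule Set.set_eqI)
    fix i
    show "i \<in> X \<alpha> \<longleftrightarrow> i \<in> x"
    proof (cases "i \<in> {1..n}")
      case True
      have c: "card {j \<in> x. j < Suc i} = card {j \<in> x. j < i} + of_bool (i \<in> x)"
      proof (cases "i \<in> x")
        case True
        then have "{j \<in> x. j < Suc i} = insert i {j \<in> x. j < i}" by (auto simp: less_Suc_eq)
        then show ?thesis using True xn by simp
      next
        case False
        then have "{j \<in> x. j < Suc i} = {j \<in> x. j < i}" by (auto simp: less_Suc_eq)
        then show ?thesis using False by simp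
      qed
      have "i \<in> X \<alpha> \<longleftrightarrow> extend_sign n k \<alpha> i \<noteq> extend_sign n k \<alpha> (Suc i)"
        using True by (simp add: sign_subset_def)
      also have "\<dots> \<longleftrightarrow> i \<in> x" using e[of i] e[of "Suc i"] True unfolding c by (cases "i \<in> x") auto
      finally show ?thesis .
    next
      case False
      then show ?thesis using xn sign_subset_subset[of n k \<alpha>] by blast
    qed
  qed
  moreover from this have "\<alpha> \<in> BFs" using s xn card_sign_subset[of n k \<alpha>] by (simp add: BF_eq)
  ultimately show "\<exists>\<alpha>\<in>BFs. x = X \<alpha>" by blast
qed

lemma X_in: "\<alpha> \<in> BFs \<Longrightarrow> X \<alpha> \<in> osz_Vr n k"
  using X_bij by (rule bij_betw_apply)

lemma A_in: "x \<in> osz_Vr n k \<Longrightarrow> A x \<in> BFs"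
  unfolding sign_of_subset_def using X_bij by (metis bij_betw_def inv_into_into)

lemma X_A: "x \<in> osz_Vr n k \<Longrightarrow> X (A x) = x"
  unfolding sign_of_subset_def using X_bij by (rule bij_betw_inv_into_right)

lemma A_X: "\<alpha> \<in> BFs \<Longrightarrow> A (X \<alpha>) = \<alpha>"
  unfolding sign_of_subset_def using X_bij by (rule bij_betw_inv_into_left)

lemma X_eq_iff: "\<alpha> \<in> BFs \<Longrightarrow> x \<in> osz_Vr n k \<Longrightarrow> X \<alpha> = x \<longleftrightarrow> \<alpha> = A x"
  using X_A[of x] A_X[of \<alpha>] by auto

lemma walk_sign:
  assumes "\<alpha> \<in> BFs" "\<beta> \<in> BFs" "osz.awalk n k (X \<alpha>) p (X \<beta>)" "i \<in> {1..n}"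
  shows "even (osz_degree p i) \<longleftrightarrow> \<alpha> i = \<beta> i"
  unfolding sign_eq_iff[OF assms(1,2,4)] parity_walk[OF assms(3)] by blast

text \<open>A degree is twice its half plus its parity, and the parity is odd exactly where the two
  sign vectors differ.\<close>

lemma bt_degree_half_degree:
  assumes "\<alpha> \<in> BFs" "\<beta> \<in> BFs" "osz.awalk n k (X \<alpha>) p (X \<beta>)"
  shows "bt_degree \<alpha> \<beta> (half_degree p) = osz_degree p"
proof
  fix i
  show "bt_degree \<alpha> \<beta> (half_degree p) i = osz_degree p i"
  proof (cases "i \<in> {1..n}")
    case True
    have "0 \<le> osz_degree p i div 2" using osz_degree_nonneg[of p i] by simp
    then have "bt_degree \<alpha> \<beta> (half_degree p) i = 2 * (osz_degree p i div 2) + of_bool (odd (osz_degree p i))"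
      using walk_sign[OF assms True] by (simp add: bt_degree_def lookup_half_degree)
    also have "\<dots> = osz_degree p i" by (cases "even (osz_degree p i)") auto
    finally show ?thesis .
  next
    case False
    \<comment> \<open>Both sign vectors take the value \<open>undefined\<close> here, so they count
      as equal and contribute no degree.\<close>
    then show ?thesis using osz_degree_range[OF assms(3) False] sign_outside[OF assms(1) False]
      sign_outside[OF assms(2) False] by (simp add: bt_degree_def lookup_half_degree)
  qed
qed

lemma half_degree_eq_iff:
  assumes "\<alpha> \<in> BFs" "\<beta> \<in> BFs" "osz.awalk n k (X \<alpha>) p (X \<beta>)"
  shows "half_degree p = m \<longleftrightarrow> osz_degree p = bt_degree \<alpha> \<beta> m"
proof
  assume "osz_degree p = bt_degree \<alpha> \<beta> m"
  then have "bt_degree \<alpha> \<beta> (half_degree p) i = bt_degree \<alpha> \<beta> m i" for i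
    using bt_degree_half_degree[OF assms] by simp
  then show "half_degree p = m" by (intro poly_mapping_eqI) (simp add: bt_degree_def)
qed (use bt_degree_half_degree[OF assms] in auto)

lemma vars_half_degree: "osz.awalk n k x p y \<Longrightarrow> vars (half_degree p) \<subseteq> {1..n}"
  using osz_degree_range[of n k x p y] by (force simp: in_keys_iff lookup_half_degree)

lemma live_degree_bt_degree:
  assumes "\<alpha> \<in> BFs" "\<beta> \<in> BFs" "vars m \<subseteq> {1..n}"
  shows "live_degree n (X \<alpha>) (bt_degree \<alpha> \<beta> m) \<longleftrightarrow> \<not> face_empty n \<eta> \<alpha> \<beta> (vars m)"
proof -
  have "0 < bt_degree \<alpha> \<beta> m i \<longleftrightarrow> i \<in> vars m \<union> {i \<in> {1..n}. \<alpha> i \<noteq> \<beta> i}" for i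
    using sign_outside[of \<alpha> i] sign_outside[of \<beta> i] assms
    by (cases "i \<in> {1..n}") (auto simp: bt_degree_def in_keys_iff of_bool_def)
  then have "{i. 0 < bt_degree \<alpha> \<beta> m i} = vars m \<union> {i \<in> {1..n}. \<alpha> i \<noteq> \<beta> i}" by blast
  then show ?thesis using face_empty_iff[OF assms] by (simp add: live_degree_def)
qed

lemma lookup_path_poly_eq:
  assumes "\<alpha> \<in> BFs" "\<beta> \<in> BFs" "f \<in> carrier (osz_PA n k)"
  shows "Poly_Mapping.lookup (path_poly (X \<alpha>) (X \<beta>) f) m = class_sum (X \<alpha>) (X \<beta>) (bt_degree \<alpha> \<beta> m) f"
  unfolding lookup_path_poly class_sum_def
proof (rule lin_cong)
  fix s assume s: "s \<in> supp f"
  obtain x p y where [simp]: "s = (x, p, y)" by (cases s) auto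
  have w: "osz.awalk n k x p y" using supp_PA(2)[OF assms(3)] s by simp
  show "(case s of (x', p, y') \<Rightarrow> of_bool (x' = X \<alpha> \<and> y' = X \<beta> \<and> half_degree p = m)) =
      (case s of (x', p, y') \<Rightarrow> of_bool (x' = X \<alpha> \<and> y' = X \<beta> \<and> osz_degree p = bt_degree \<alpha> \<beta> m))"
    using half_degree_eq_iff[OF assms(1,2), of p m] w by auto
qed

lemma path_poly_polys:
  assumes "f \<in> carrier (osz_PA n k)"
  shows "path_poly x y f \<in> polys n"
  unfolding lin_def
proof (rule polys_sum)
  fix s assume s: "s \<in> supp f"
  obtain u p v where [simp]: "s = (u, p, v)" by (cases s) auto
  have w: "osz.awalk n k u p v" using supp_PA(2)[OF assms] s by simp
  have "of_int (f s) \<in> polys n" by (simp add: of_int_upoly polys_def)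
  moreover have "path_mon x y s \<in> polys n"
    using vars_half_degree[OF w] by (auto simp: path_mon_def polys_def)
  ultimately show "of_int (f s) * path_mon x y s \<in> polys n" by (rule polys_mult)
qed

section \<open>The map on the path algebra: its fibres, products and image\<close>

definition Phi0 :: "((nat set, osz_arrow) qpath \<Rightarrow> int) \<Rightarrow> bt_elem" where
  "Phi0 f = bt_of n \<eta> \<xi> (\<lambda>\<alpha> \<beta>. path_poly (X \<alpha>) (X \<beta>) f)"

lemma Phi0_closed: "f \<in> PA_r n k \<Longrightarrow> Phi0 f \<in> carrier Bt"
  unfolding Phi0_def by (intro bt_of_closed path_poly_polys PA_r_carrier)

text \<open>The coefficient of the monomial m in the component (\<alpha>, \<beta>) is the functional
  of degree \<open>bt_degree \<alpha> \<beta> m\<close>, and the monomials in the ideal are those of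
  dead degree.\<close>

lemma Phi0_eq_iff_class_sum:
  assumes c: "f \<in> carrier (osz_PA n k)" "g \<in> carrier (osz_PA n k)"
  shows "Phi0 f = Phi0 g \<longleftrightarrow> (\<forall>\<alpha>\<in>BFs. \<forall>\<beta>\<in>BFs. \<forall>m. vars m \<subseteq> {1..n} \<longrightarrow> live_degree n (X \<alpha>) (bt_degree \<alpha> \<beta> m) \<longrightarrow>
      class_sum (X \<alpha>) (X \<beta>) (bt_degree \<alpha> \<beta> m) f = class_sum (X \<alpha>) (X \<beta>) (bt_degree \<alpha> \<beta> m) g)"
proof -
  have "Phi0 f = Phi0 g \<longleftrightarrow>
      (\<forall>\<alpha>\<in>BFs. \<forall>\<beta>\<in>BFs. path_poly (X \<alpha>) (X \<beta>) f - path_poly (X \<alpha>) (X \<beta>) g \<in> R_ideal n \<eta> \<alpha> \<beta>)"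
    unfolding Phi0_def by (rule bt_of_eq_iff) (intro path_poly_polys c)+
  also have "\<dots> \<longleftrightarrow> (\<forall>\<alpha>\<in>BFs. \<forall>\<beta>\<in>BFs. \<forall>m. vars m \<subseteq> {1..n} \<longrightarrow> live_degree n (X \<alpha>) (bt_degree \<alpha> \<beta> m) \<longrightarrow>
      class_sum (X \<alpha>) (X \<beta>) (bt_degree \<alpha> \<beta> m) f = class_sum (X \<alpha>) (X \<beta>) (bt_degree \<alpha> \<beta> m) g)"
  proof (intro ball_cong refl)
    fix \<alpha> \<beta> assume ab: "\<alpha> \<in> BFs" "\<beta> \<in> BFs"
    let ?d = "path_poly (X \<alpha>) (X \<beta>) f - path_poly (X \<alpha>) (X \<beta>) g"
    have d: "?d \<in> polys n" by (intro polys_diff path_poly_polys c)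
    have l: "Poly_Mapping.lookup ?d m = class_sum (X \<alpha>) (X \<beta>) (bt_degree \<alpha> \<beta> m) f -
        class_sum (X \<alpha>) (X \<beta>) (bt_degree \<alpha> \<beta> m) g" for m
      by (simp add: lookup_minus lookup_path_poly_eq[OF ab] c)
    have "?d \<in> R_ideal n \<eta> \<alpha> \<beta> \<longleftrightarrow> (\<forall>m. Poly_Mapping.lookup ?d m \<noteq> 0 \<longrightarrow> face_empty n \<eta> \<alpha> \<beta> (vars m))"
      using d by (simp add: R_ideal_eq monomial_ideal_def in_keys_iff Ball_def)
    also have "\<dots> \<longleftrightarrow> (\<forall>m. vars m \<subseteq> {1..n} \<longrightarrow> live_degree n (X \<alpha>) (bt_degree \<alpha> \<beta> m) \<longrightarrow>
        Poly_Mapping.lookup ?d m = 0)"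
    proof -
      have "vars m \<subseteq> {1..n}" if "Poly_Mapping.lookup ?d m \<noteq> 0" for m
        using d that unfolding polys_def by (simp add: in_keys_iff)
      then show ?thesis using live_degree_bt_degree[OF ab] by metis
    qed
    finally show "?d \<in> R_ideal n \<eta> \<alpha> \<beta> \<longleftrightarrow>
      (\<forall>m. vars m \<subseteq> {1..n} \<longrightarrow> live_degree n (X \<alpha>) (bt_degree \<alpha> \<beta> m) \<longrightarrow>
      class_sum (X \<alpha>) (X \<beta>) (bt_degree \<alpha> \<beta> m) f = class_sum (X \<alpha>) (X \<beta>) (bt_degree \<alpha> \<beta> m) g)"
      unfolding l by simp
  qed
  finally show ?thesis .
qed

text \<open>Representatives are arbitrary here, not only combinations of paths between admissible
  states, because a homogeneous representative is only required to lie in the whole path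
  algebra.\<close>

lemma Phi0_cong:
  assumes "f \<in> carrier (osz_PA n k)" "g \<in> carrier (osz_PA n k)" "osz_class n k f = osz_class n k g"
  shows "Phi0 f = Phi0 g"
  using assms osz_class_eq_iff[OF assms(1,2)] Phi0_eq_iff_class_sum[OF assms(1,2)] by blast

text \<open>Triples of source, target and degree that are realized by a walk between admissible
  states come from some \<alpha>, \<beta> and m; on all others the functionals vanish on both
  elements.\<close>

lemma Phi0_eq_iff:
  assumes f: "f \<in> PA_r n k" and g: "g \<in> PA_r n k"
  shows "Phi0 f = Phi0 g \<longleftrightarrow> osz_class n k f = osz_class n k g"
proof -
  have c: "f \<in> carrier (osz_PA n k)" "g \<in> carrier (osz_PA n k)" using f g by (auto intro: PA_r_carrier)
  have "Phi0 f = Phi0 g \<longleftrightarrow> (\<forall>\<alpha>\<in>BFs. \<forall>\<beta>\<in>BFs. \<forall>m. vars m \<subseteq> {1..n} \<longrightarrow> live_degree n (X \<alpha>) (bt_degree \<alpha> \<beta> m) \<longrightarrow>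
      class_sum (X \<alpha>) (X \<beta>) (bt_degree \<alpha> \<beta> m) f = class_sum (X \<alpha>) (X \<beta>) (bt_degree \<alpha> \<beta> m) g)" by (rule Phi0_eq_iff_class_sum[OF c])
  also have "\<dots> \<longleftrightarrow> (\<forall>x y d. live_degree n x d \<longrightarrow> class_sum x y d f = class_sum x y d g)"
  proof (rule iffI)
    assume *: "\<forall>\<alpha>\<in>BFs. \<forall>\<beta>\<in>BFs. \<forall>m. vars m \<subseteq> {1..n} \<longrightarrow> live_degree n (X \<alpha>) (bt_degree \<alpha> \<beta> m) \<longrightarrow>
      class_sum (X \<alpha>) (X \<beta>) (bt_degree \<alpha> \<beta> m) f = class_sum (X \<alpha>) (X \<beta>) (bt_degree \<alpha> \<beta> m) g"
    show "\<forall>x y d. live_degree n x d \<longrightarrow> class_sum x y d f = class_sum x y d g"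
    proof (intro allI impI)
      fix x y d assume live: "live_degree n x d"
      show "class_sum x y d f = class_sum x y d g"
      proof (cases "\<exists>p. osz.awalk n k x p y \<and> x \<in> osz_Vr n k \<and> y \<in> osz_Vr n k \<and> osz_degree p = d")
        case True
        then obtain p where p: "osz.awalk n k x p y" "x \<in> osz_Vr n k" "y \<in> osz_Vr n k" "osz_degree p = d"
          by blast
        have ab: "A x \<in> BFs" "A y \<in> BFs" "X (A x) = x" "X (A y) = y" using p A_in X_A by auto
        have d: "d = bt_degree (A x) (A y) (half_degree p)"
          using bt_degree_half_degree[OF ab(1,2), of p] p ab by simp
        show ?thesis using *[rule_format, OF ab(1,2) vars_half_degree[OF p(1)]] live ab(3,4) d by simp
      next
        case False
        have "class_sum x y d f = 0" if "f \<in> PA_r n k" for f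
          unfolding class_sum_def
        proof (rule lin_eq_0I)
          fix s assume s: "s \<in> supp f"
          obtain x' p y' where [simp]: "s = (x', p, y')" by (cases s) auto
          show "(case s of (x', p, y') \<Rightarrow> of_bool (x' = x \<and> y' = y \<and> osz_degree p = d)) = (0 :: int)"
            using False s PA_r_supp[OF that, of x' p y'] supp_PA(2)[OF PA_r_carrier[OF that], of x' p y'] by auto
        qed
        then show ?thesis using f g by simp
      qed
    qed
  qed blast
  also have "\<dots> \<longleftrightarrow> osz_class n k f = osz_class n k g" using osz_class_eq_iff[OF c] by blast
  finally show ?thesis .
qed

lemma Phi0_add:
  assumes "f \<in> PA_r n k" "g \<in> PA_r n k"
  shows "Phi0 (\<lambda>s. f s + g s) = Phi0 f \<oplus>\<^bsub>Bt\<^esub> Phi0 g"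
  unfolding Phi0_def using assms
  by (subst bt_of_add) (auto intro!: path_poly_polys PA_r_carrier simp: lin_add supp_PA(1)[OF PA_r_carrier])

text \<open>Halving with rounding is additive except for a carry of 1 when both degrees are odd, and
  this happens exactly on \<open>S_set\<close>.\<close>

lemma half_degree_append:
  assumes ab: "\<alpha> \<in> BFs" "\<beta> \<in> BFs" "\<gamma> \<in> BFs"
    and p: "osz.awalk n k (X \<alpha>) p (X \<beta>)" and q: "osz.awalk n k (X \<beta>) q (X \<gamma>)"
  shows "half_degree (p @ q) = half_degree p + half_degree q + mon (S_set n \<alpha> \<beta> \<gamma>)"
proof (rule poly_mapping_eqI)
  fix i
  have fin: "finite (S_set n \<alpha> \<beta> \<gamma>)" by (rule finite_subset[OF S_set_subset]) simp
  have S: "i \<in> S_set n \<alpha> \<beta> \<gamma> \<longleftrightarrow> odd (osz_degree p i) \<and> odd (osz_degree q i)"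
  proof (cases "i \<in> {1..n}")
    case True
    have s: "\<alpha> i = 1 \<or> \<alpha> i = -1" "\<beta> i = 1 \<or> \<beta> i = -1" "\<gamma> i = 1 \<or> \<gamma> i = -1"
      using True ab BF_signs(1) sign_vector_cases by blast+
    show ?thesis using walk_sign[OF ab(1,2) p True] walk_sign[OF ab(2,3) q True] True s
      by (auto simp: S_set_def)
  next
    case False
    then show ?thesis using osz_degree_range[OF p False] by (auto simp: S_set_def)
  qed
  obtain a b where ab: "osz_degree p i = int a" "osz_degree q i = int b"
    using osz_degree_nonneg nonneg_int_cases by metis
  have "nat ((int a + int b) div 2) = nat (int a div 2) + nat (int b div 2) + of_bool (odd a \<and> odd b)"
    by (cases "even a"; cases "even b") (auto simp: nat_div_distrib nat_add_distrib elim!: evenE oddE)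
  then show "Poly_Mapping.lookup (half_degree (p @ q)) i =
      Poly_Mapping.lookup (half_degree p + half_degree q + mon (S_set n \<alpha> \<beta> \<gamma>)) i"
    using ab S by (simp add: lookup_add lookup_half_degree lookup_mon[OF fin] osz_degree_append)
qed

lemma Phi0_mult:
  assumes f: "f \<in> PA_r n k" and g: "g \<in> PA_r n k"
  shows "Phi0 (f \<otimes>\<^bsub>osz_PA n k\<^esub> g) = Phi0 f \<otimes>\<^bsub>Bt\<^esub> Phi0 g"
proof -
  have c: "f \<in> carrier (osz_PA n k)" "g \<in> carrier (osz_PA n k)" using f g by (auto intro: PA_r_carrier)
  have "path_poly (X \<alpha>) (X \<gamma>) (f \<otimes>\<^bsub>osz_PA n k\<^esub> g) =
      (\<Sum>\<beta>\<in>BFs. path_poly (X \<alpha>) (X \<beta>) f * path_poly (X \<beta>) (X \<gamma>) g * umon (S_set n \<alpha> \<beta> \<gamma>))"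
    if ag: "\<alpha> \<in> BFs" "\<gamma> \<in> BFs" for \<alpha> \<gamma>
  proof -
    have "(\<Sum>\<beta>\<in>BFs. path_poly (X \<alpha>) (X \<beta>) f * path_poly (X \<beta>) (X \<gamma>) g * umon (S_set n \<alpha> \<beta> \<gamma>)) =
        (\<Sum>\<beta>\<in>BFs. \<Sum>r1\<in>supp f. \<Sum>r2\<in>supp g. of_int (f r1 * g r2) *
          (path_mon (X \<alpha>) (X \<beta>) r1 * path_mon (X \<beta>) (X \<gamma>) r2 * umon (S_set n \<alpha> \<beta> \<gamma>)))"
      unfolding lin_def sum_product sum_distrib_right
      by (intro sum.cong refl) (simp add: sum_distrib_left mult_ac)
    also have "\<dots> = (\<Sum>r1\<in>supp f. \<Sum>r2\<in>supp g. \<Sum>\<beta>\<in>BFs. of_int (f r1 * g r2) *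
          (path_mon (X \<alpha>) (X \<beta>) r1 * path_mon (X \<beta>) (X \<gamma>) r2 * umon (S_set n \<alpha> \<beta> \<gamma>)))"
      by (subst sum.swap, rule sum.cong[OF refl], rule sum.swap)
    also have "\<dots> = (\<Sum>r1\<in>supp f. \<Sum>r2\<in>supp g.
        if composable r1 r2 then of_int (f r1 * g r2) * path_mon (X \<alpha>) (X \<gamma>) (pcomp r1 r2) else 0)"
    proof (intro sum.cong refl)
      fix r1 r2 assume r: "r1 \<in> supp f" "r2 \<in> supp g"
      obtain u p v where r1: "r1 = (u, p, v)" by (cases r1) auto
      obtain v' q w where r2: "r2 = (v', q, w)" by (cases r2) auto
      have p: "osz.awalk n k u p v" and q: "osz.awalk n k v' q w"
        using supp_PA(2)[OF c(1)] supp_PA(2)[OF c(2)] r by (auto simp: r1 r2)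
      have v: "v \<in> osz_Vr n k" using PA_r_supp[OF f] r(1) unfolding r1 by blast
      let ?t = "\<lambda>\<beta>. path_mon (X \<alpha>) (X \<beta>) r1 * path_mon (X \<beta>) (X \<gamma>) r2 * umon (S_set n \<alpha> \<beta> \<gamma>)"
      \<comment> \<open>In the sum over the middle sign vector only the one belonging to the end
        \<open>v\<close> of the first path contributes; it exists because \<open>v\<close> is an
        admissible state.\<close>
      have "?t \<beta> = (if \<beta> = A v then
          (if composable r1 r2 then path_mon (X \<alpha>) (X \<gamma>) (pcomp r1 r2) else 0) else 0)"
        if b: "\<beta> \<in> BFs" for \<beta>
      proof (cases "\<beta> = A v")
        case False
        then have "v \<noteq> X \<beta>" using X_eq_iff[OF b v] by auto
        then show ?thesis using False by (simp add: path_mon_def r1)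
      next
        case True
        then have Xv: "X \<beta> = v" using X_A[OF v] by simp
        show ?thesis
        proof (cases "v = v' \<and> u = X \<alpha> \<and> w = X \<gamma>")
          case False
          then show ?thesis using True Xv by (auto simp: path_mon_def r1 r2)
        next
          case vw: True
          have "half_degree (p @ q) = half_degree p + half_degree q + mon (S_set n \<alpha> \<beta> \<gamma>)"
            using p q vw Xv by (intro half_degree_append[OF ag(1) b ag(2)]) auto
          moreover have "finite (S_set n \<alpha> \<beta> \<gamma>)" by (rule finite_subset[OF S_set_subset]) simp
          ultimately show ?thesis using True Xv vw
            by (simp add: path_mon_def r1 r2 mult_single umon_eq_single)
        qed
      qed
      then have "(\<Sum>\<beta>\<in>BFs. ?t \<beta>) = (\<Sum>\<beta>\<in>BFs. if \<beta> = A v then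
          (if composable r1 r2 then path_mon (X \<alpha>) (X \<gamma>) (pcomp r1 r2) else 0) else 0)"
        by (intro sum.cong refl)
      also have "\<dots> = (if composable r1 r2 then path_mon (X \<alpha>) (X \<gamma>) (pcomp r1 r2) else 0)"
        using A_in[OF v] finite_BF[of n \<eta> \<xi>] by (simp add: sum.delta)
      finally show "(\<Sum>\<beta>\<in>BFs. of_int (f r1 * g r2) * ?t \<beta>) =
          (if composable r1 r2 then of_int (f r1 * g r2) * path_mon (X \<alpha>) (X \<gamma>) (pcomp r1 r2) else 0)"
        unfolding sum_distrib_left[symmetric] by simp
    qed
    also have "\<dots> = path_poly (X \<alpha>) (X \<gamma>) (f \<otimes>\<^bsub>osz_PA n k\<^esub> g)"
      by (rule osz.lin_PA_mult[OF c, symmetric])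
    finally show ?thesis ..
  qed
  moreover have "Phi0 f \<otimes>\<^bsub>Bt\<^esub> Phi0 g = bt_of n \<eta> \<xi>
      (\<lambda>\<alpha> \<gamma>. \<Sum>\<beta>\<in>BFs. path_poly (X \<alpha>) (X \<beta>) f * path_poly (X \<beta>) (X \<gamma>) g * umon (S_set n \<alpha> \<beta> \<gamma>))"
    unfolding Phi0_def by (rule bt_of_mult) (intro path_poly_polys c)+
  ultimately show ?thesis unfolding Phi0_def by (auto simp: bt_of_def intro!: restrict_ext)
qed

lemma Phi0_path_elem:
  "Phi0 (path_elem r) = bt_of n \<eta> \<xi> (\<lambda>\<gamma> \<delta>. path_mon (X \<gamma>) (X \<delta>) r)"
  by (simp add: Phi0_def)

lemma bt_of_cong: "(\<And>\<alpha> \<beta>. \<alpha> \<in> BFs \<Longrightarrow> \<beta> \<in> BFs \<Longrightarrow> g \<alpha> \<beta> = h \<alpha> \<beta>) \<Longrightarrow> bt_of n \<eta> \<xi> g = bt_of n \<eta> \<xi> h"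
  by (auto simp: bt_of_def intro!: restrict_ext)

lemma half_degree_Nil [simp]: "half_degree [] = 0"
  by (rule poly_mapping_eqI) (simp add: lookup_half_degree osz_degree_def)

lemma Phi0_one: "Phi0 (unit_r n k) = \<one>\<^bsub>Bt\<^esub>"
  unfolding Phi0_def bt_one_eq
proof (rule bt_of_cong)
  fix \<alpha> \<beta> assume ab: "\<alpha> \<in> BFs" "\<beta> \<in> BFs"
  have "path_poly (X \<alpha>) (X \<beta>) (unit_r n k) = (\<Sum>x\<in>osz_Vr n k. if x = X \<alpha> then of_bool (X \<alpha> = X \<beta>) else 0)"
    unfolding lin_unit_r by (rule sum.cong) (auto simp: path_mon_def)
  also have "\<dots> = of_bool (\<alpha> = \<beta>)" using X_in[OF ab(1)] A_X ab by (auto simp: sum.delta) (metis A_X)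
  finally show "path_poly (X \<alpha>) (X \<beta>) (unit_r n k) = of_bool (\<alpha> = \<beta>)" .
qed

lemma Phi0_triv:
  assumes "x \<in> osz_Vr n k"
  shows "Phi0 (path_elem (x, [], x)) = bt_e n \<eta> \<xi> (A x)"
  unfolding Phi0_path_elem bt_e_def bt_f_eq using A_in[OF assms]
  by (simp, intro bt_of_cong) (use X_eq_iff assms in \<open>auto simp: path_mon_def\<close>)

lemma Phi0_crossing:
  assumes "x \<in> osz_Vr n k" "y \<in> osz_Vr n k" "l \<in> {OR i, OL i}"
  shows "Phi0 (path_elem (x, [(l, x, y)], y)) = bt_p n \<eta> \<xi> (A x) (A y)"
proof -
  have "half_degree [(l, x, y)] = 0"
    by (rule poly_mapping_eqI) (use assms(3) in \<open>auto simp: lookup_half_degree osz_degree_def\<close>)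
  then show ?thesis
    unfolding Phi0_path_elem bt_p_def bt_f_eq using A_in assms
    by (simp, intro bt_of_cong) (use X_eq_iff assms in \<open>auto simp: path_mon_def\<close>)
qed

lemma half_degree_U: "half_degree [(OU i, x, y)] = Poly_Mapping.single i 1"
  by (rule poly_mapping_eqI) (auto simp: lookup_half_degree osz_degree_def lookup_single when_def)

lemma uvar_polys: "i \<in> {1..n} \<Longrightarrow> uvar i \<in> polys n"
  by (simp add: uvar_def polys_def)

lemma Phi0_U:
  assumes "x \<in> osz_Vr n k" "i \<in> {1..n}"
  shows "Phi0 (path_elem (x, [(OU i, x, x)], x)) = bt_u n \<eta> \<xi> i \<otimes>\<^bsub>Bt\<^esub> bt_e n \<eta> \<xi> (A x)"
proof -
  have Ax: "A x \<in> BFs" by (rule A_in[OF assms(1)])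
  have "bt_u n \<eta> \<xi> i \<otimes>\<^bsub>Bt\<^esub> bt_e n \<eta> \<xi> (A x) = bt_of n \<eta> \<xi> (\<lambda>\<alpha> \<gamma>. \<Sum>\<beta>\<in>BFs.
      of_bool (\<alpha> = \<beta>) * uvar i * of_bool (\<beta> = A x \<and> \<gamma> = A x) * umon (S_set n \<alpha> \<beta> \<gamma>))"
    using Ax uvar_polys[OF assms(2)] unfolding bt_e_def bt_u_eq bt_f_eq
    by (simp, subst bt_of_mult) (auto simp: of_bool_def)
  also have "\<dots> = bt_of n \<eta> \<xi> (\<lambda>\<gamma> \<delta>. path_mon (X \<gamma>) (X \<delta>) (x, [(OU i, x, x)], x))"
  proof (rule bt_of_cong)
    fix \<alpha> \<gamma> assume ag: "\<alpha> \<in> BFs" "\<gamma> \<in> BFs"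
    have "(\<Sum>\<beta>\<in>BFs. of_bool (\<alpha> = \<beta>) * uvar i * of_bool (\<beta> = A x \<and> \<gamma> = A x) * umon (S_set n \<alpha> \<beta> \<gamma>)) =
        (\<Sum>\<beta>\<in>BFs. if \<beta> = \<alpha> then of_bool (\<alpha> = A x \<and> \<gamma> = A x) * uvar i else 0)"
      by (rule sum.cong) (auto simp: S_set_def umon_def)
    also have "\<dots> = of_bool (\<alpha> = A x \<and> \<gamma> = A x) * uvar i" using ag finite_BF[of n \<eta> \<xi>] by (simp add: sum.delta)
    also have "\<dots> = path_mon (X \<alpha>) (X \<gamma>) (x, [(OU i, x, x)], x)"
      using X_eq_iff[OF ag(1) assms(1)] X_eq_iff[OF ag(2) assms(1)]
      by (auto simp: path_mon_def half_degree_U uvar_def)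
    finally show "(\<Sum>\<beta>\<in>BFs. of_bool (\<alpha> = \<beta>) * uvar i * of_bool (\<beta> = A x \<and> \<gamma> = A x) * umon (S_set n \<alpha> \<beta> \<gamma>)) =
        path_mon (X \<alpha>) (X \<gamma>) (x, [(OU i, x, x)], x)" .
  qed
  finally show ?thesis by (simp add: Phi0_path_elem)
qed

lemma list_with_counts: "finite B \<Longrightarrow> \<exists>us. set us \<subseteq> B \<and> (\<forall>i\<in>B. count (mset us) i = c i)"
proof (induction B rule: finite_induct)
  case (insert b B)
  then obtain us where us: "set us \<subseteq> B" "\<forall>i\<in>B. count (mset us) i = c i" by blast
  have "b \<notin> set us" using us insert by auto
  then have "count (mset us) b = 0" by (simp add: count_eq_zero_iff)
  moreover have "i \<noteq> b" if "i \<in> B" for i using that insert by auto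
  ultimately show ?case using us
    by (intro exI[of _ "replicate (c b) b @ us"]) auto
qed simp

text \<open>A nonempty face makes the set of differing signs live, so there is a path crossing
  exactly these edges once; the exponents of m are then realized by letters U at its end.\<close>

lemma walk_exists:
  assumes ab: "\<alpha> \<in> BFs" "\<beta> \<in> BFs" and m: "vars m \<subseteq> {1..n}" and ne: "\<not> face_empty n \<eta> \<alpha> \<beta> (vars m)"
  shows "\<exists>p. osz.awalk n k (X \<alpha>) p (X \<beta>) \<and> half_degree p = m"
proof -
  let ?D = "{i \<in> {1..n}. \<alpha> i \<noteq> \<beta> i}"
  have V: "X \<alpha> \<in> osz_V n k" "X \<beta> \<in> osz_V n k" using X_in ab osz_Vr_subset by auto
  have live: "live n (X \<alpha>) ?D"
    using face_empty_iff[OF ab m] ne by (auto intro: live_antimono)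
  \<comment> \<open>An index belongs to a state iff the adjacent signs differ, so its membership
    changes iff exactly one of them changes. The appended sign is common to all, and so is the sign
    at 1, which settles j = n and j = 0.\<close>
  have D: "j \<in> X \<beta> \<longleftrightarrow> (j \<in> X \<alpha>) \<noteq> ((j \<in> ?D) \<noteq> (Suc j \<in> ?D))" for j
  proof (cases "j \<in> {1..n}")
    case True
    have s: "\<alpha> i = 1 \<or> \<alpha> i = -1" "\<beta> i = 1 \<or> \<beta> i = -1" if "i \<in> {1..n}" for i
      using that ab BF_signs(1) sign_vector_cases by blast+
    show ?thesis
    proof (cases "j = n")
      case True
      have t: "(-1) ^ k = (1 :: int) \<or> (-1) ^ k = (-1 :: int)" by (cases "even k") auto
      show ?thesis using \<open>j \<in> {1..n}\<close> True s[of j] t by (auto simp: sign_subset_def extend_sign_def)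
    next
      case False
      then show ?thesis using \<open>j \<in> {1..n}\<close> s[of j] s[of "Suc j"] by (auto simp: sign_subset_def extend_sign_def)
    qed
  next
    case False
    have "\<alpha> 1 = \<beta> 1" if "1 \<le> n"
    proof -
      have "{j \<in> X \<delta>. j < 1} = {}" for \<delta> using sign_subset_subset[of n k \<delta>] by auto
      then have c: "card {j \<in> X \<delta>. j < 1} = 0" for \<delta> by (simp only: card.empty)
      have "1 \<in> {1..n}" using that by simp
      then show ?thesis using sign_eq[OF ab(1), of 1] sign_eq[OF ab(2), of 1] unfolding c by argo
    qed
    moreover have "j \<notin> X \<delta>" for \<delta> using False sign_subset_subset[of n k \<delta>] by blast
    moreover have "j = 0 \<or> n < j" using False by auto
    ultimately show ?thesis by auto
  qed
  have "?D \<subseteq> {1..n}" by blast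
  then obtain r where r: "distinct r" "set r = ?D" "word n k (X \<alpha>) (Cs r)" "run (X \<alpha>) (Cs r) = X \<beta>"
    using simple_path_exists[OF V _ live D] by blast
  obtain us where us: "set us \<subseteq> vars m" "\<And>i. i \<in> vars m \<Longrightarrow> count (mset us) i = Poly_Mapping.lookup m i"
    using list_with_counts[of "vars m" "Poly_Mapping.lookup m"] by auto
  have cnt: "count (mset us) i = Poly_Mapping.lookup m i" for i
    using us by (cases "i \<in> vars m") (auto simp: in_keys_iff count_eq_zero_iff)
  let ?w = "Cs r @ Us us"
  have w: "word n k (X \<alpha>) ?w" using r us(1) m by (auto simp: word_append word_def run_osz_V)
  then have walk: "osz.awalk n k (X \<alpha>) (arrows (X \<alpha>) ?w) (X \<beta>)"
    using awalk_wpath[of "X \<alpha>" n k ?w] r(4) by (simp add: word_def)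
  have "half_degree (arrows (X \<alpha>) ?w) = m"
  proof (rule poly_mapping_eqI)
    fix i
    have "osz_degree (arrows (X \<alpha>) ?w) i = of_bool (i \<in> set r) + 2 * int (Poly_Mapping.lookup m i)"
      unfolding osz_degree_arrows using r(1) by (simp add: word_degree_Cs word_degree_Us cnt)
    then show "Poly_Mapping.lookup (half_degree (arrows (X \<alpha>) ?w)) i = Poly_Mapping.lookup m i"
      unfolding lookup_half_degree by (simp add: of_bool_def)
  qed
  then show ?thesis using walk by blast
qed

text \<open>One walk is chosen for each realizable triple and carries the coefficient of its
  monomial; monomials without a walk lie in the ideal. The control of the support lets homogeneous
  elements be lifted to homogeneous ones.\<close>

lemma Phi0_surj:
  assumes g: "\<And>\<alpha> \<beta>. \<alpha> \<in> BFs \<Longrightarrow> \<beta> \<in> BFs \<Longrightarrow> g \<alpha> \<beta> \<in> polys n"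
  shows "\<exists>f\<in>PA_r n k. Phi0 f = bt_of n \<eta> \<xi> g \<and>
    (\<forall>x p y. (x, p, y) \<in> supp f \<longrightarrow> half_degree p \<in> Poly_Mapping.keys (g (A x) (A y)))"
proof -
  define c where "c x y m = (SOME p. osz.awalk n k x p y \<and> half_degree p = m)" for x y m
  define f where "f = (\<lambda>(x, p, y). if x \<in> osz_Vr n k \<and> y \<in> osz_Vr n k \<and> osz.awalk n k x p y \<and>
      p = c x y (half_degree p) then Poly_Mapping.lookup (g (A x) (A y)) (half_degree p) else 0)"
  have sf: "x \<in> osz_Vr n k \<and> y \<in> osz_Vr n k \<and> osz.awalk n k x p y \<and> p = c x y (half_degree p) \<and>
      half_degree p \<in> Poly_Mapping.keys (g (A x) (A y))" if "(x, p, y) \<in> supp f" for x p y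
    using that by (auto simp: f_def supp_def in_keys_iff split: if_splits)
  have "supp f \<subseteq> (\<Union>x\<in>osz_Vr n k. \<Union>y\<in>osz_Vr n k. (\<lambda>m. (x, c x y m, y)) ` Poly_Mapping.keys (g (A x) (A y)))"
  proof
    fix s assume s: "s \<in> supp f"
    obtain x p y where [simp]: "s = (x, p, y)" by (cases s) auto
    show "s \<in> (\<Union>x\<in>osz_Vr n k. \<Union>y\<in>osz_Vr n k. (\<lambda>m. (x, c x y m, y)) ` Poly_Mapping.keys (g (A x) (A y)))"
      using sf[of x p y] s by (intro UN_I[of x] UN_I[of y] image_eqI[of _ _ "half_degree p"]) auto
  qed
  then have fin: "finite (supp f)" by (rule finite_subset) simp
  have f: "f \<in> PA_r n k" using fin sf by (simp add: PA_r_def carrier_path_algebra)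
  have coeff: "Poly_Mapping.lookup (path_poly (X \<alpha>) (X \<beta>) f) m = Poly_Mapping.lookup (g \<alpha> \<beta>) m"
    if ab: "\<alpha> \<in> BFs" "\<beta> \<in> BFs" and ex: "\<exists>p. osz.awalk n k (X \<alpha>) p (X \<beta>) \<and> half_degree p = m" for \<alpha> \<beta> m
  proof -
    let ?p = "c (X \<alpha>) (X \<beta>) m"
    have p: "osz.awalk n k (X \<alpha>) ?p (X \<beta>)" "half_degree ?p = m"
      using someI_ex[OF ex] unfolding c_def by blast+
    have "Poly_Mapping.lookup (path_poly (X \<alpha>) (X \<beta>) f) m = lin (\<lambda>s. of_bool (s = (X \<alpha>, ?p, X \<beta>))) f"
      unfolding lookup_path_poly
    proof (rule lin_cong)
      fix s assume s: "s \<in> supp f"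
      obtain x q y where [simp]: "s = (x, q, y)" by (cases s) auto
      have "q = c x y (half_degree q)" using sf[of x q y] s by simp
      then have "x = X \<alpha> \<and> y = X \<beta> \<and> half_degree q = m \<longleftrightarrow> x = X \<alpha> \<and> q = ?p \<and> y = X \<beta>"
        using p by metis
      then show "(case s of (x', p, y') \<Rightarrow> of_bool (x' = X \<alpha> \<and> y' = X \<beta> \<and> half_degree p = m)) =
          (of_bool (s = (X \<alpha>, ?p, X \<beta>)) :: int)" by simp
    qed
    also have "\<dots> = f (X \<alpha>, ?p, X \<beta>)" by (rule lin_delta[OF fin])
    also have "\<dots> = Poly_Mapping.lookup (g \<alpha> \<beta>) m" using p ab by (simp add: f_def X_in A_X)
    finally show ?thesis .
  qed
  have "Phi0 f = bt_of n \<eta> \<xi> g"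
    unfolding Phi0_def
  proof (subst bt_of_eq_iff)
    show "\<forall>\<alpha>\<in>BFs. \<forall>\<beta>\<in>BFs. path_poly (X \<alpha>) (X \<beta>) f - g \<alpha> \<beta> \<in> R_ideal n \<eta> \<alpha> \<beta>"
    proof (intro ballI)
      fix \<alpha> \<beta> assume ab: "\<alpha> \<in> BFs" "\<beta> \<in> BFs"
      let ?d = "path_poly (X \<alpha>) (X \<beta>) f - g \<alpha> \<beta>"
      have d: "?d \<in> polys n" using ab f by (intro polys_diff path_poly_polys g PA_r_carrier)
      have "face_empty n \<eta> \<alpha> \<beta> (vars m)" if mk: "m \<in> Poly_Mapping.keys ?d" for m
      proof (rule ccontr)
        assume "\<not> face_empty n \<eta> \<alpha> \<beta> (vars m)"
        moreover have "vars m \<subseteq> {1..n}" using d mk by (simp add: polys_def)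
        ultimately have "Poly_Mapping.lookup ?d m = 0"
          using coeff[OF ab walk_exists[OF ab]] by (simp add: lookup_minus)
        then show False using mk by (simp add: in_keys_iff)
      qed
      then show "?d \<in> R_ideal n \<eta> \<alpha> \<beta>" using d by (simp add: R_ideal_eq monomial_ideal_def)
    qed
  qed (use f g in \<open>auto intro!: path_poly_polys PA_r_carrier\<close>)
  then show ?thesis using f sf by blast
qed

end

section \<open>Reversal of paths and its effect on the functionals\<close>

section \<open>Path reversal\<close>

lemma osz_label_degree_swap [simp]: "osz_label_degree (osz_swap l) = osz_label_degree l"
  by (cases l) (auto simp: fun_eq_iff)

lemma osz_swap_swap [simp]: "osz_swap (osz_swap l) = l"
  by (cases l) auto

lemma osz_rev_path_rev [simp]: "osz_rev_path (osz_rev_path r) = r"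
proof -
  have "map (\<lambda>(l, s, t). (osz_swap l, t, s)) (map (\<lambda>(l, s, t). (osz_swap l, t, s)) p) = p"
    for p :: "osz_arrow list" by (induction p) auto
  then show ?thesis by (cases r) (simp add: rev_map)
qed

lemma osz_degree_rev [simp]:
  "osz_degree (rev (map (\<lambda>(l, s, t). (osz_swap l, t, s)) p)) = osz_degree p"
proof
  fix j show "osz_degree (rev (map (\<lambda>(l, s, t). (osz_swap l, t, s)) p)) j = osz_degree p j"
    by (induction p) (auto simp: osz_degree_def)
qed

lemma tail_head_osz [simp]:
  "tail (osz_quiver n k) (l, x, y) = x" "head (osz_quiver n k) (l, x, y) = y"
  by (simp_all add: osz_quiver_def)

lemma awalk_arc: "(l, x, y) \<in> arcs (osz_quiver n k) \<Longrightarrow> osz.awalk n k x [(l, x, y)] y"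
  using osz.head_in_verts[of "(l, x, y)" n k]
  by (simp add: osz.awalk_Cons_iff osz.awalk_Nil_iff)

lemma awalk_rev:
  "osz.awalk n k x p y \<Longrightarrow> osz.awalk n k y (rev (map (\<lambda>(l, s, t). (osz_swap l, t, s)) p)) x"
proof (induction p arbitrary: x)
  case Nil
  then show ?case by (auto simp: osz.awalk_Nil_iff)
next
  case (Cons a p)
  obtain l s t where a: "a = (l, s, t)" by (cases a) auto
  have arc: "(l, s, t) \<in> arcs (osz_quiver n k)" and s: "s = x" and p: "osz.awalk n k t p y"
    using Cons.prems by (simp_all add: osz.awalk_Cons_iff a)
  have "(osz_swap l, t, s) \<in> arcs (osz_quiver n k)" using arc by (auto simp: osz_quiver_def)
  then have "osz.awalk n k t [(osz_swap l, t, s)] x" unfolding s by (rule awalk_arc)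
  from osz.awalk_appendI[OF Cons.IH[OF p] this] show ?case by (simp add: a)
qed

lemma supp_rev: "supp (f \<circ> osz_rev_path) = osz_rev_path ` supp f"
proof (rule Set.set_eqI)
  fix r show "r \<in> supp (f \<circ> osz_rev_path) \<longleftrightarrow> r \<in> osz_rev_path ` supp f"
  proof
    assume "r \<in> supp (f \<circ> osz_rev_path)"
    then have "osz_rev_path r \<in> supp f" by (simp add: supp_def)
    then have "osz_rev_path (osz_rev_path r) \<in> osz_rev_path ` supp f" by (rule imageI)
    then show "r \<in> osz_rev_path ` supp f" by simp
  qed (auto simp: supp_def simp del: osz_rev_path.simps)
qed

lemma lin_rev: "lin \<Theta> (f \<circ> osz_rev_path) = lin (\<lambda>r. \<Theta> (osz_rev_path r)) f"
  unfolding lin_def by (rule sum.reindex_bij_witness[of _ osz_rev_path osz_rev_path]) (auto simp: supp_def)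

lemma PA_rev: "f \<in> carrier (osz_PA n k) \<Longrightarrow> f \<circ> osz_rev_path \<in> carrier (osz_PA n k)"
  by (auto simp: carrier_path_algebra supp_rev awalk_rev)

lemma PA_r_rev: "f \<in> PA_r n k \<Longrightarrow> f \<circ> osz_rev_path \<in> PA_r n k"
  using PA_rev by (fastforce simp: PA_r_def supp_rev)

lemma class_sum_rev: "class_sum x y d (f \<circ> osz_rev_path) = class_sum y x d f"
  unfolding class_sum_def lin_rev by (rule lin_cong) auto

lemma class_sum_no_walk:
  assumes "f \<in> carrier (osz_PA n k)" "\<And>p. osz.awalk n k x p y \<Longrightarrow> osz_degree p \<noteq> d"
  shows "class_sum x y d f = 0"
  unfolding class_sum_def
proof (rule lin_eq_0I)
  fix s assume s: "s \<in> supp f"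
  obtain x' p y' where [simp]: "s = (x', p, y')" by (cases s) auto
  show "(case s of (x', p, y') \<Rightarrow> of_bool (x' = x \<and> y' = y \<and> osz_degree p = d)) = (0 :: int)"
    using assms(2)[of p] s supp_PA(2)[OF assms(1), of x' p y'] by auto
qed

text \<open>Reversal exchanges source and target in the functionals, and liveness agrees at both
  ends of any walk of the given degree. Without such a walk the functional is zero.\<close>

lemma osz_ideal_rev:
  assumes "f \<in> osz_ideal n k"
  shows "f \<circ> osz_rev_path \<in> osz_ideal n k"
proof -
  have f: "f \<in> carrier (osz_PA n k)" "\<And>x y d. live_degree n x d \<Longrightarrow> class_sum x y d f = 0"
    using assms by (auto simp: osz_ideal_eq_kernel kernel_def)
  have "class_sum y x d f = 0" if live: "live_degree n x d" for x y d
  proof (cases "\<exists>p. osz.awalk n k y p x \<and> osz_degree p = d")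
    case True
    then obtain p where "osz.awalk n k y p x" "osz_degree p = d" by blast
    then have "live_degree n y d" using live live_walk[of n k y p x "{i. d i > 0}"] by (auto simp: live_degree_def)
    then show ?thesis by (rule f(2))
  next
    case False
    then show ?thesis by (intro class_sum_no_walk[OF f(1)]) auto
  qed
  then show ?thesis using PA_rev[OF f(1)] by (simp add: osz_ideal_eq_kernel kernel_def class_sum_rev)
qed

lemma osz_class_eq: "osz_class n k f = {\<lambda>s. h s + f s | h. h \<in> osz_ideal n k}"
  by (auto simp: osz_class_def a_r_coset_def')

lemma osz_psi_class: "osz_psi (osz_class n k f) = osz_class n k (f \<circ> osz_rev_path)"
  unfolding osz_psi_def osz_class_eq
proof safe
  fix h assume h: "h \<in> osz_ideal n k"
  have "(\<lambda>s. h s + f s) \<circ> osz_rev_path = (\<lambda>s. (h \<circ> osz_rev_path) s + (f \<circ> osz_rev_path) s)" by auto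
  then show "\<exists>h'. (\<lambda>s. h s + f s) \<circ> osz_rev_path = (\<lambda>s. h' s + (f \<circ> osz_rev_path) s) \<and> h' \<in> osz_ideal n k"
    using osz_ideal_rev[OF h] by blast
  have "(\<lambda>s. h s + (f \<circ> osz_rev_path) s) = (\<lambda>s. (h \<circ> osz_rev_path) s + f s) \<circ> osz_rev_path"
    by (simp add: fun_eq_iff del: osz_rev_path.simps)
  then show "(\<lambda>s. h s + (f \<circ> osz_rev_path) s) \<in> (\<lambda>f. f \<circ> osz_rev_path) ` {\<lambda>s. h s + f s | h. h \<in> osz_ideal n k}"
    using osz_ideal_rev[OF h] by blast
qed

section \<open>Descent to the quotient, the inverse, gradings and involutions\<close>

section \<open>The isomorphism\<close>

text \<open>The set equation alone does not say that one end of the edge is occupied and the other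
  is not; this follows from equal cardinality and x \<noteq> y.\<close>

lemma crossing_arc:
  assumes V: "x \<in> osz_V n k" "y \<in> osz_V n k" and xy: "x \<noteq> y" and i: "i \<in> {1..n}"
  shows "y = insert i (x - {i - 1}) \<Longrightarrow> (OR i, x, y) \<in> arcs (osz_quiver n k)"
    and "y = insert (i - 1) (x - {i}) \<Longrightarrow> (OL i, x, y) \<in> arcs (osz_quiver n k)"
proof -
  have fin: "finite x" using V(1) finite_subset[of x "{0..n}"] by (simp add: osz_V_def)
  have i1: "i - 1 \<noteq> i" using i by auto
  have swap: "b \<in> x \<and> a \<notin> x" if e: "y = insert a (x - {b})" and "a \<noteq> b" for a b
  proof -
    have c: "card (insert a (x - {b})) = card x" using V e by (simp add: osz_V_def)
    have b: "b \<in> x"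
    proof (rule ccontr)
      assume b: "b \<notin> x"
      then have "a \<notin> x" using e xy by auto
      then show False using c b fin by simp
    qed
    moreover have "a \<notin> x"
    proof
      assume "a \<in> x"
      then have "insert a (x - {b}) = x - {b}" using that by auto
      then show False using c card_Diff1_less[OF fin b] by simp
    qed
    ultimately show ?thesis ..
  qed
  show "(OR i, x, y) \<in> arcs (osz_quiver n k)" if y: "y = insert i (x - {i - 1})"
  proof -
    have "x \<inter> {i - 1, i} = {i - 1}" using swap[OF y] i1 by auto
    then show ?thesis using V i y by (simp add: osz_quiver_def)
  qed
  show "(OL i, x, y) \<in> arcs (osz_quiver n k)" if y: "y = insert (i - 1) (x - {i})"
  proof -
    have s: "i \<in> x" "i - 1 \<notin> x" using swap[OF y i1] by auto
    then have "y \<inter> {i - 1, i} = {i - 1}" "x = insert i (y - {i - 1})" using y i1 by auto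
    then show ?thesis using V i unfolding osz_quiver_def pre_digraph.simps by blast
  qed
qed

context cyclic_combinatorics
begin

definition Phi :: "osz_elem \<Rightarrow> bt_elem" where
  "Phi = (\<lambda>b\<in>carrier Br. Phi0 (SOME f. f \<in> PA_r n k \<and> osz_class n k f = b))"

lemma Br_elem:
  assumes "b \<in> carrier Br" obtains f where "f \<in> PA_r n k" "b = osz_class n k f"
  using assms by (auto simp: carrier_osz_Br)

lemma osz_class_Br: "f \<in> PA_r n k \<Longrightarrow> osz_class n k f \<in> carrier Br"
  by (simp add: carrier_osz_Br)

lemma Phi_class:
  assumes "f \<in> PA_r n k"
  shows "Phi (osz_class n k f) = Phi0 f"
proof -
  let ?g = "SOME g. g \<in> PA_r n k \<and> osz_class n k g = osz_class n k f"
  have "?g \<in> PA_r n k \<and> osz_class n k ?g = osz_class n k f"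
    by (rule someI[of "\<lambda>g. g \<in> PA_r n k \<and> osz_class n k g = osz_class n k f" f]) (use assms in simp)
  then show ?thesis using Phi0_eq_iff[of ?g f] assms by (simp add: Phi_def osz_class_Br)
qed

lemma Phi_hom: "Phi \<in> Ring.ring_hom Br Bt"
proof (rule ring_hom_memI)
  fix b assume "b \<in> carrier Br"
  then obtain f where f: "f \<in> PA_r n k" "b = osz_class n k f" by (rule Br_elem)
  then show "Phi b \<in> carrier Bt" by (simp add: Phi_class Phi0_closed)
  fix c assume "c \<in> carrier Br"
  then obtain g where g: "g \<in> PA_r n k" "c = osz_class n k g" by (rule Br_elem)
  show "Phi (b \<otimes>\<^bsub>Br\<^esub> c) = Phi b \<otimes>\<^bsub>Bt\<^esub> Phi c"
    using f g by (simp add: osz_Br_mult Phi_class PA_r_mult Phi0_mult)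
  show "Phi (b \<oplus>\<^bsub>Br\<^esub> c) = Phi b \<oplus>\<^bsub>Bt\<^esub> Phi c"
    using f g by (simp add: osz_Br_add Phi_class PA_r_add Phi0_add)
next
  show "Phi \<one>\<^bsub>Br\<^esub> = \<one>\<^bsub>Bt\<^esub>" by (simp add: osz_Br_one Phi_class unit_r_PA_r Phi0_one)
qed

lemma Phi_bij: "bij_betw Phi (carrier Br) (carrier Bt)"
proof (rule bij_betwI')
  fix b c assume "b \<in> carrier Br" "c \<in> carrier Br"
  then obtain f g where "f \<in> PA_r n k" "b = osz_class n k f" "g \<in> PA_r n k" "c = osz_class n k g"
    by (metis Br_elem)
  then show "Phi b = Phi c \<longleftrightarrow> b = c" by (simp add: Phi_class Phi0_eq_iff)
next
  fix b assume "b \<in> carrier Br"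
  then show "Phi b \<in> carrier Bt" by (rule ring_hom_closed[OF Phi_hom])
next
  fix F assume "F \<in> carrier Bt"
  then obtain g where g: "\<And>\<alpha> \<beta>. \<alpha> \<in> BFs \<Longrightarrow> \<beta> \<in> BFs \<Longrightarrow> g \<alpha> \<beta> \<in> polys n" "F = bt_of n \<eta> \<xi> g"
    using bt_elem_ex by blast
  obtain f where "f \<in> PA_r n k" "Phi0 f = F" using Phi0_surj[of g, OF g(1)] g(2) by blast
  then show "\<exists>b\<in>carrier Br. F = Phi b" using osz_class_Br Phi_class by metis
qed

lemma Phi_iso: "Phi \<in> ring_iso Br Bt"
  using Phi_hom Phi_bij by (simp add: ring_iso_def)

lemma Phi_zero: "Phi \<zero>\<^bsub>Br\<^esub> = \<zero>\<^bsub>Bt\<^esub>"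
  by (simp add: osz_Br_zero Phi_class PA_r_zero Phi0_def bt_zero_eq)

text \<open>The axioms are transported along the bijection, so associativity of the product with its
  factors \<open>umon\<close> is never verified directly.\<close>

lemma ring_Bt: "ring Bt"
  using ring.ring_iso_imp_img_ring[OF ring_osz_Br Phi_iso] by (simp add: Phi_zero)

lemma Phi_homogeneous: "Phi ` osz_homogeneous n k d = bt_homogeneous n \<eta> \<xi> d"
proof (rule Set.set_eqI, rule iffI)
  fix F assume "F \<in> Phi ` osz_homogeneous n k d"
  then obtain b where b: "b \<in> carrier Br" "F = Phi b" "b \<in> osz_homogeneous n k d"
    by (auto simp: osz_homogeneous_def)
  then obtain f where f: "f \<in> carrier (osz_PA n k)" "b = osz_class n k f"
      "\<And>x p y. f (x, p, y) \<noteq> 0 \<Longrightarrow> osz_degree p = d"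
    unfolding osz_homogeneous_def by blast
  obtain g where g: "g \<in> PA_r n k" "b = osz_class n k g" using b(1) by (rule Br_elem)
  have "Phi0 g = Phi0 f" using f g by (intro Phi0_cong PA_r_carrier[OF g(1)]) auto
  then have F: "F = bt_of n \<eta> \<xi> (\<lambda>\<alpha> \<beta>. path_poly (X \<alpha>) (X \<beta>) f)"
    using b(2) g by (simp add: Phi_class) (simp add: Phi0_def)
  have deg: "bt_degree \<alpha> \<beta> m = d"
    if ab: "\<alpha> \<in> BFs" "\<beta> \<in> BFs" and m: "m \<in> Poly_Mapping.keys (path_poly (X \<alpha>) (X \<beta>) f)" for \<alpha> \<beta> m
  proof (rule ccontr)
    assume nd: "bt_degree \<alpha> \<beta> m \<noteq> d"
    have "class_sum (X \<alpha>) (X \<beta>) (bt_degree \<alpha> \<beta> m) f = 0"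
      unfolding class_sum_def by (rule lin_eq_0I) (use nd f(3) in \<open>auto simp: supp_def\<close>)
    then show False using m lookup_path_poly_eq[OF ab f(1)] by (simp add: in_keys_iff)
  qed
  show "F \<in> bt_homogeneous n \<eta> \<xi> d"
    unfolding bt_homogeneous_def
  proof (intro CollectI conjI ballI)
    show "F \<in> carrier Bt" unfolding F by (intro bt_of_closed path_poly_polys f(1))
    fix \<alpha> \<beta> assume ab: "\<alpha> \<in> BFs" "\<beta> \<in> BFs"
    show "\<exists>p\<in>carrier (upoly_ring n). F (\<alpha>, \<beta>) = R_class n \<eta> \<alpha> \<beta> p \<and> (\<forall>m\<in>Poly_Mapping.keys p. bt_degree \<alpha> \<beta> m = d)"
      using ab deg path_poly_polys[OF f(1)] unfolding F
      by (intro bexI[of _ "path_poly (X \<alpha>) (X \<beta>) f"]) (auto simp: bt_of_apply)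
  qed
next
  fix F assume F: "F \<in> bt_homogeneous n \<eta> \<xi> d"
  then have Fc: "F \<in> carrier Bt" by (simp add: bt_homogeneous_def)
  have "\<forall>\<alpha>\<in>BFs. \<forall>\<beta>\<in>BFs. \<exists>p. p \<in> polys n \<and> F (\<alpha>, \<beta>) = R_class n \<eta> \<alpha> \<beta> p \<and>
      (\<forall>m \<in> Poly_Mapping.keys p. bt_degree \<alpha> \<beta> m = d)"
    using F unfolding bt_homogeneous_def carrier_upoly_ring by blast
  then obtain g where g: "\<And>\<alpha> \<beta>. \<alpha> \<in> BFs \<Longrightarrow> \<beta> \<in> BFs \<Longrightarrow> g \<alpha> \<beta> \<in> polys n"
      "\<And>\<alpha> \<beta>. \<alpha> \<in> BFs \<Longrightarrow> \<beta> \<in> BFs \<Longrightarrow> F (\<alpha>, \<beta>) = R_class n \<eta> \<alpha> \<beta> (g \<alpha> \<beta>)"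
      "\<And>\<alpha> \<beta> m. \<alpha> \<in> BFs \<Longrightarrow> \<beta> \<in> BFs \<Longrightarrow> m \<in> Poly_Mapping.keys (g \<alpha> \<beta>) \<Longrightarrow> bt_degree \<alpha> \<beta> m = d"
    by metis
  have Fg: "F = bt_of n \<eta> \<xi> g"
  proof -
    obtain h where h: "F = bt_of n \<eta> \<xi> h" using Fc bt_elem_ex by blast
    show ?thesis using g(2) unfolding h by (auto simp: bt_of_def intro!: restrict_ext)
  qed
  obtain f where f: "f \<in> PA_r n k" "Phi0 f = F"
      "\<And>x p y. (x, p, y) \<in> supp f \<Longrightarrow> half_degree p \<in> Poly_Mapping.keys (g (A x) (A y))"
    using Phi0_surj[of g, OF g(1)] unfolding Fg by blast
  have "osz_degree p = d" if s: "(x, p, y) \<in> supp f" for x p y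
  proof -
    have V: "x \<in> osz_Vr n k" "y \<in> osz_Vr n k" using PA_r_supp[OF f(1) s] by auto
    have w: "osz.awalk n k (X (A x)) p (X (A y))"
      using supp_PA(2)[OF PA_r_carrier[OF f(1)] s] V by (simp add: X_A)
    have "bt_degree (A x) (A y) (half_degree p) = d" using g(3) f(3)[OF s] A_in V by blast
    then show ?thesis using bt_degree_half_degree[OF A_in A_in w] V by simp
  qed
  then have "osz_class n k f \<in> osz_homogeneous n k d"
    using f(1) PA_r_carrier[OF f(1)] by (auto simp: osz_homogeneous_def osz_class_Br supp_def)
  moreover have "F = Phi (osz_class n k f)" using f by (simp add: Phi_class)
  ultimately show "F \<in> Phi ` osz_homogeneous n k d" by blast
qed

lemma Phi_I: "x \<in> osz_Vr n k \<Longrightarrow> Phi (osz_I n k x) = bt_e n \<eta> \<xi> (A x)"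
  using osz_Vr_subset[of n k] unfolding osz_I_def
  by (subst Phi_class) (auto intro!: path_elem_PA_r awalk_triv simp: Phi0_triv)

lemma Phi_crossing:
  assumes "x \<in> osz_Vr n k" "y \<in> osz_Vr n k" "l \<in> {OR i, OL i}" "(l, x, y) \<in> arcs (osz_quiver n k)"
  shows "Phi (osz_arr n k l x y) = bt_p n \<eta> \<xi> (A x) (A y)"
  unfolding osz_arr_def using assms Phi0_crossing[OF assms(1-3)]
  by (subst Phi_class) (auto intro!: path_elem_PA_r awalk_arc)

lemma U_PA_r:
  assumes "x \<in> osz_Vr n k" "i \<in> {1..n}"
  shows "path_elem (x, [(OU i, x, x)], x) \<in> PA_r n k"
  using assms osz_Vr_subset[of n k] by (intro path_elem_PA_r awalk_arc) (auto simp: osz_quiver_def)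

lemma Phi_U:
  "x \<in> osz_Vr n k \<Longrightarrow> i \<in> {1..n} \<Longrightarrow>
    Phi (osz_arr n k (OU i) x x) = bt_u n \<eta> \<xi> i \<otimes>\<^bsub>Bt\<^esub> bt_e n \<eta> \<xi> (A x)"
  unfolding osz_arr_def by (simp add: Phi_class U_PA_r Phi0_U)

lemma is_Phi_Phi: "is_Phi n k \<eta> \<xi> Phi"
  unfolding is_Phi_def using Phi_hom Phi_I Phi_crossing Phi_U by (auto simp: Phi_def)

lemma is_Phi_unique:
  assumes "is_Phi n k \<eta> \<xi> \<Phi>"
  shows "\<Phi> = Phi"
proof (rule extensionalityI)
  show "\<Phi> \<in> extensional (carrier Br)" "Phi \<in> extensional (carrier Br)"
    using assms is_Phi_Phi unfolding is_Phi_def by blast+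
  have hom: "\<Phi> \<in> Ring.ring_hom Br Bt" using assms unfolding is_Phi_def by blast
  have I: "\<Phi> (osz_I n k x) = bt_e n \<eta> \<xi> (A x)" if "x \<in> osz_Vr n k" for x
    using assms that unfolding is_Phi_def by blast
  have RL: "\<Phi> (osz_arr n k l x y) = bt_p n \<eta> \<xi> (A x) (A y)"
    if "x \<in> osz_Vr n k" "y \<in> osz_Vr n k" "l \<in> {OR i, OL i}" "(l, x, y) \<in> arcs (osz_quiver n k)" for i l x y
    using assms that unfolding is_Phi_def by blast
  have U: "\<Phi> (osz_arr n k (OU i) x x) = bt_u n \<eta> \<xi> i \<otimes>\<^bsub>Bt\<^esub> bt_e n \<eta> \<xi> (A x)"
    if "i \<in> {1..n}" "x \<in> osz_Vr n k" for i x
    using assms that unfolding is_Phi_def by blast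
  fix b assume b: "b \<in> carrier Br"
  show "\<Phi> b = Phi b"
    by (rule osz_Br_hom_eqI[OF ring_Bt hom Phi_hom _ _ _ b]) (simp_all only: I RL U Phi_I Phi_crossing Phi_U)
qed

definition Psi :: "bt_elem \<Rightarrow> osz_elem" where
  "Psi = (\<lambda>F\<in>carrier Bt. inv_into (carrier Br) Phi F)"

lemma Psi_iso: "Psi \<in> ring_iso Bt Br"
  by (rule ring.ring_iso_restrict[OF ring_Bt ring_iso_set_sym[OF ring_osz_Br Phi_iso]]) (simp add: Psi_def)

lemma Psi_hom: "Psi \<in> Ring.ring_hom Bt Br"
  using Psi_iso by (simp add: ring_iso_def)

lemma Phi_closed: "b \<in> carrier Br \<Longrightarrow> Phi b \<in> carrier Bt"
  by (rule ring_hom_closed[OF Phi_hom])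

lemma Psi_closed: "F \<in> carrier Bt \<Longrightarrow> Psi F \<in> carrier Br"
  by (rule ring_hom_closed[OF Psi_hom])

lemma Psi_Phi: "b \<in> carrier Br \<Longrightarrow> Psi (Phi b) = b"
  using bij_betw_inv_into_left[OF Phi_bij] by (simp add: Psi_def Phi_closed)

lemma Phi_Psi: "F \<in> carrier Bt \<Longrightarrow> Phi (Psi F) = F"
  using bij_betw_inv_into_right[OF Phi_bij] by (simp add: Psi_def)

lemma osz_I_closed: "x \<in> osz_Vr n k \<Longrightarrow> osz_I n k x \<in> carrier Br"
  using osz_Vr_subset[of n k] unfolding osz_I_def by (intro osz_class_Br path_elem_PA_r awalk_triv) auto

lemma osz_arr_closed:
  "x \<in> osz_Vr n k \<Longrightarrow> y \<in> osz_Vr n k \<Longrightarrow> (l, x, y) \<in> arcs (osz_quiver n k) \<Longrightarrow> osz_arr n k l x y \<in> carrier Br"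
  unfolding osz_arr_def by (intro osz_class_Br path_elem_PA_r awalk_arc)

lemma quiver_verts_BF: "\<alpha> \<in> quiver_verts n k \<Longrightarrow> \<alpha> \<in> BFs \<longleftrightarrow> var_r n k \<alpha> = k"
  by (simp add: quiver_verts_def BF_eq)

lemma BF_quiver_verts: "\<alpha> \<in> BFs \<Longrightarrow> \<alpha> \<in> quiver_verts n k"
  by (simp add: quiver_verts_def BF_eq)

lemma finsum_U:
  assumes i: "i \<in> {1..n}"
  shows "(\<Oplus>\<^bsub>Br\<^esub> x \<in> osz_Vr n k. osz_arr n k (OU i) x x \<otimes>\<^bsub>Br\<^esub> osz_I n k x) =
    osz_class n k (\<lambda>s. \<Sum>x\<in>osz_Vr n k. path_elem (x, [(OU i, x, x)], x) s)"
proof -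
  interpret ring Br by (rule ring_osz_Br)
  have "osz_arr n k (OU i) x x \<otimes>\<^bsub>Br\<^esub> osz_I n k x = osz_class n k (path_elem (x, [(OU i, x, x)], x))"
    if x: "x \<in> osz_Vr n k" for x
  proof -
    have xV: "x \<in> osz_V n k" using x osz_Vr_subset by blast
    then have "(OU i, x, x) \<in> arcs (osz_quiver n k)" using i by (simp add: osz_quiver_def)
    then have "path_elem (x, [(OU i, x, x)], x) \<otimes>\<^bsub>osz_PA n k\<^esub> path_elem (x, [], x) =
        path_elem (x, [(OU i, x, x)] @ [], x)"
      by (intro osz.path_elem_mult awalk_arc awalk_triv xV)
    then show ?thesis
      unfolding osz_arr_def osz_I_def using x xV i
      by (subst osz_Br_mult) (auto intro: U_PA_r path_elem_PA_r awalk_triv)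
  qed
  then have "(\<Oplus>\<^bsub>Br\<^esub> x \<in> osz_Vr n k. osz_arr n k (OU i) x x \<otimes>\<^bsub>Br\<^esub> osz_I n k x) =
      (\<Oplus>\<^bsub>Br\<^esub> x \<in> osz_Vr n k. osz_class n k (path_elem (x, [(OU i, x, x)], x)))"
    by (intro finsum_cong') (auto intro!: osz_class_Br U_PA_r i)
  also have "\<dots> = osz_class n k (\<lambda>s. \<Sum>x\<in>osz_Vr n k. path_elem (x, [(OU i, x, x)], x) s)"
    by (rule osz_Br_finsum) (auto intro: U_PA_r i)
  finally show ?thesis .
qed

lemma finsum_U_closed:
  "i \<in> {1..n} \<Longrightarrow> (\<Oplus>\<^bsub>Br\<^esub> x \<in> osz_Vr n k. osz_arr n k (OU i) x x \<otimes>\<^bsub>Br\<^esub> osz_I n k x) \<in> carrier Br"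
  by (simp only: finsum_U) (intro osz_class_Br PA_r_sum U_PA_r, auto)

text \<open>The loops at the various states map to u_i times orthogonal idempotents that sum to the
  unit.\<close>

lemma Phi_finsum_U:
  assumes i: "i \<in> {1..n}"
  shows "Phi (\<Oplus>\<^bsub>Br\<^esub> x \<in> osz_Vr n k. osz_arr n k (OU i) x x \<otimes>\<^bsub>Br\<^esub> osz_I n k x) = bt_u n \<eta> \<xi> i"
proof -
  let ?f = "\<lambda>s. \<Sum>x\<in>osz_Vr n k. path_elem (x, [(OU i, x, x)], x) s"
  have "?f \<in> PA_r n k" by (intro PA_r_sum U_PA_r i) auto
  then have "Phi (\<Oplus>\<^bsub>Br\<^esub> x \<in> osz_Vr n k. osz_arr n k (OU i) x x \<otimes>\<^bsub>Br\<^esub> osz_I n k x) = Phi0 ?f"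
    by (simp only: finsum_U[OF i] Phi_class)
  also have "\<dots> = bt_u n \<eta> \<xi> i"
    unfolding Phi0_def bt_u_eq
  proof (rule bt_of_cong)
    fix \<alpha> \<beta> assume ab: "\<alpha> \<in> BFs" "\<beta> \<in> BFs"
    have "path_poly (X \<alpha>) (X \<beta>) ?f = (\<Sum>x\<in>osz_Vr n k. path_mon (X \<alpha>) (X \<beta>) (x, [(OU i, x, x)], x))"
      by (subst lin_sum) auto
    also have "\<dots> = (\<Sum>x\<in>osz_Vr n k. if x = X \<alpha> then of_bool (X \<alpha> = X \<beta>) * uvar i else 0)"
      by (rule sum.cong) (auto simp: path_mon_def half_degree_U uvar_def)
    also have "\<dots> = of_bool (X \<alpha> = X \<beta>) * uvar i" using X_in[OF ab(1)] by (simp add: sum.delta)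
    also have "X \<alpha> = X \<beta> \<longleftrightarrow> \<alpha> = \<beta>" using inj_on_eq_iff[OF bij_betw_imp_inj_on[OF X_bij] ab] .
    finally show "path_poly (X \<alpha>) (X \<beta>) ?f = of_bool (\<alpha> = \<beta>) * uvar i" .
  qed
  finally show ?thesis .
qed

lemma is_Psi_Psi: "is_Psi n k \<eta> \<xi> Psi"
  unfolding is_Psi_def
proof (intro conjI ballI impI)
  show "Psi \<in> extensional (carrier Bt)" by (simp add: Psi_def)
  show "Psi \<in> Ring.ring_hom Bt Br" by (rule Psi_hom)
  have zero: "Psi \<zero>\<^bsub>Bt\<^esub> = \<zero>\<^bsub>Br\<^esub>" by (rule ring_hom_zero[OF Psi_hom ring_Bt ring_osz_Br])
  show "Psi (bt_e n \<eta> \<xi> \<alpha>) = (if var_r n k \<alpha> = k then osz_I n k (X \<alpha>) else \<zero>\<^bsub>Br\<^esub>)"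
    if "\<alpha> \<in> quiver_verts n k" for \<alpha>
  proof (cases "\<alpha> \<in> BFs")
    case True
    have "Psi (Phi (osz_I n k (X \<alpha>))) = osz_I n k (X \<alpha>)" by (intro Psi_Phi osz_I_closed X_in True)
    then show ?thesis using True Phi_I[OF X_in[OF True]] quiver_verts_BF[OF that] by (simp add: A_X)
  next
    case False
    then show ?thesis using quiver_verts_BF[OF that] zero by (simp add: bt_e_def)
  qed
  fix i assume i: "i \<in> {1..n}"
  show "Psi (bt_u n \<eta> \<xi> i) = (\<Oplus>\<^bsub>Br\<^esub> x \<in> osz_Vr n k. osz_arr n k (OU i) x x \<otimes>\<^bsub>Br\<^esub> osz_I n k x)"
    unfolding Phi_finsum_U[OF i, symmetric] by (rule Psi_Phi[OF finsum_U_closed[OF i]])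
  fix \<alpha> \<beta> assume ab: "\<alpha> \<in> quiver_verts n k" "\<beta> \<in> quiver_verts n k" and flip: "\<beta> = flip_sign \<alpha> i"
  have arr: "Psi (bt_p n \<eta> \<xi> \<alpha> \<beta>) = osz_arr n k l (X \<alpha>) (X \<beta>)"
    if BF: "\<alpha> \<in> BFs" "\<beta> \<in> BFs" and l: "l \<in> {OR i, OL i}" "(l, X \<alpha>, X \<beta>) \<in> arcs (osz_quiver n k)" for l
  proof -
    have "Psi (Phi (osz_arr n k l (X \<alpha>) (X \<beta>))) = osz_arr n k l (X \<alpha>) (X \<beta>)"
      by (intro Psi_Phi osz_arr_closed X_in BF l)
    then show ?thesis using Phi_crossing[OF X_in[OF BF(1)] X_in[OF BF(2)] l] BF by (simp add: A_X)
  qed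
  have arcs: "y = insert i (x - {i - 1}) \<Longrightarrow> (OR i, x, y) \<in> arcs (osz_quiver n k)"
    "y = insert (i - 1) (x - {i}) \<Longrightarrow> (OL i, x, y) \<in> arcs (osz_quiver n k)"
    if BF: "\<alpha> \<in> BFs" "\<beta> \<in> BFs" and xy: "x = X \<alpha>" "y = X \<beta>" for x y
  proof -
    have "\<alpha> i = 1 \<or> \<alpha> i = -1" using BF_signs(1)[OF BF(1)] i by (rule sign_vector_cases)
    then have "\<beta> i \<noteq> \<alpha> i" by (auto simp: flip flip_sign_def)
    then have ne: "x \<noteq> y" using A_X[OF BF(1)] A_X[OF BF(2)] unfolding xy by metis
    have V: "x \<in> osz_V n k" "y \<in> osz_V n k" using X_in[OF BF(1)] X_in[OF BF(2)] osz_Vr_subset xy by auto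
    show "y = insert i (x - {i - 1}) \<Longrightarrow> (OR i, x, y) \<in> arcs (osz_quiver n k)"
      "y = insert (i - 1) (x - {i}) \<Longrightarrow> (OL i, x, y) \<in> arcs (osz_quiver n k)"
      using crossing_arc[OF V ne i] by blast+
  qed
  note BF = quiver_verts_BF[OF ab(1)] quiver_verts_BF[OF ab(2)]
  show "let x = X \<alpha>; y = X \<beta> in
      (var_r n k \<alpha> > k \<or> var_r n k \<beta> > k \<longrightarrow> Psi (bt_p n \<eta> \<xi> \<alpha> \<beta>) = \<zero>\<^bsub>Br\<^esub>) \<and>
      (var_r n k \<alpha> = k \<and> var_r n k \<beta> = k \<and> y = insert i (x - {i - 1}) \<longrightarrow>
        Psi (bt_p n \<eta> \<xi> \<alpha> \<beta>) = osz_arr n k (OR i) x y) \<and>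
      (var_r n k \<alpha> = k \<and> var_r n k \<beta> = k \<and> y = insert (i - 1) (x - {i}) \<longrightarrow>
        Psi (bt_p n \<eta> \<xi> \<alpha> \<beta>) = osz_arr n k (OL i) x y)"
    unfolding Let_def
  proof (intro conjI impI)
    assume "var_r n k \<alpha> > k \<or> var_r n k \<beta> > k"
    then have "\<not> (\<alpha> \<in> BFs \<and> \<beta> \<in> BFs)" using BF by auto
    then have "bt_p n \<eta> \<xi> \<alpha> \<beta> = \<zero>\<^bsub>Bt\<^esub>" unfolding bt_p_def by (rule if_not_P)
    then show "Psi (bt_p n \<eta> \<xi> \<alpha> \<beta>) = \<zero>\<^bsub>Br\<^esub>" using zero by simp
  next
    assume "var_r n k \<alpha> = k \<and> var_r n k \<beta> = k \<and> X \<beta> = insert i (X \<alpha> - {i - 1})"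
    then show "Psi (bt_p n \<eta> \<xi> \<alpha> \<beta>) = osz_arr n k (OR i) (X \<alpha>) (X \<beta>)"
      using BF arcs(1)[OF _ _ refl refl] by (intro arr) auto
  next
    assume "var_r n k \<alpha> = k \<and> var_r n k \<beta> = k \<and> X \<beta> = insert (i - 1) (X \<alpha> - {i})"
    then show "Psi (bt_p n \<eta> \<xi> \<alpha> \<beta>) = osz_arr n k (OL i) (X \<alpha>) (X \<beta>)"
      using BF arcs(2)[OF _ _ refl refl] by (intro arr) auto
  qed
qed

text \<open>The arrow has odd degree at i only, so its two sign vectors differ there and nowhere
  else. This makes the prescriptions for \<Psi>, stated with flipped signs, available at every
  arrow.\<close>

lemma arc_flip_sign:
  assumes V: "x \<in> osz_Vr n k" "y \<in> osz_Vr n k" and l: "l \<in> {OR i, OL i}" and arc: "(l, x, y) \<in> arcs (osz_quiver n k)"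
  shows "i \<in> {1..n}" "A y = flip_sign (A x) i"
    "l = OR i \<and> y = insert i (x - {i - 1}) \<or> l = OL i \<and> y = insert (i - 1) (x - {i})"
proof -
  show i: "i \<in> {1..n}" using arc l by (auto simp: osz_quiver_def)
  show "l = OR i \<and> y = insert i (x - {i - 1}) \<or> l = OL i \<and> y = insert (i - 1) (x - {i})"
    using arc l by (auto simp: osz_quiver_def)
  have BF: "A x \<in> BFs" "A y \<in> BFs" using V by (auto intro: A_in)
  have w: "osz.awalk n k (X (A x)) [(l, x, y)] (X (A y))" using awalk_arc[OF arc] V by (simp add: X_A)
  show "A y = flip_sign (A x) i"
  proof
    fix j
    show "A y j = flip_sign (A x) i j"
    proof (cases "j \<in> {1..n}")
      case True
      have "A x j = 1 \<or> A x j = -1" "A y j = 1 \<or> A y j = -1"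
        using BF[THEN BF_signs(1)] True sign_vector_cases by blast+
      moreover have "A x j = A y j \<longleftrightarrow> j \<noteq> i"
        using walk_sign[OF BF w True] l by (auto simp: osz_degree_def)
      ultimately show ?thesis by (auto simp: flip_sign_def)
    next
      case False
      then show ?thesis using sign_outside[OF BF(1) False] sign_outside[OF BF(2) False] i
        by (auto simp: flip_sign_def)
    qed
  qed
qed

text \<open>The composite of \<Psi> with \<open>Phi\<close> agrees with the identity on the
  generators of the truncated algebra, hence everywhere. So no generation statement for the
  convolution algebra enters.\<close>

lemma is_Psi_unique:
  assumes "is_Psi n k \<eta> \<xi> \<Psi>"
  shows "\<Psi> = Psi"
proof (rule extensionalityI)
  show "\<Psi> \<in> extensional (carrier Bt)" "Psi \<in> extensional (carrier Bt)"
    using assms is_Psi_Psi unfolding is_Psi_def by blast+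
  have hom: "\<Psi> \<in> Ring.ring_hom Bt Br" using assms unfolding is_Psi_def by blast
  have e: "\<Psi> (bt_e n \<eta> \<xi> (A x)) = osz_I n k x" if x: "x \<in> osz_Vr n k" for x
  proof -
    have "A x \<in> quiver_verts n k" "var_r n k (A x) = k" using BF_quiver_verts BF_signs(2) A_in[OF x] by auto
    moreover have "\<forall>\<alpha>\<in>quiver_verts n k. \<Psi> (bt_e n \<eta> \<xi> \<alpha>) =
        (if var_r n k \<alpha> = k then osz_I n k (X \<alpha>) else \<zero>\<^bsub>Br\<^esub>)"
      using assms unfolding is_Psi_def by (elim conjE)
    ultimately show ?thesis by (simp add: X_A x)
  qed
  have u: "\<Psi> (bt_u n \<eta> \<xi> i) = (\<Oplus>\<^bsub>Br\<^esub> x \<in> osz_Vr n k. osz_arr n k (OU i) x x \<otimes>\<^bsub>Br\<^esub> osz_I n k x)"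
    if "i \<in> {1..n}" for i
    using assms that unfolding is_Psi_def by blast
  have p: "\<Psi> (bt_p n \<eta> \<xi> (A x) (A y)) = osz_arr n k l x y"
    if V: "x \<in> osz_Vr n k" "y \<in> osz_Vr n k" and l: "l \<in> {OR i, OL i}" and arc: "(l, x, y) \<in> arcs (osz_quiver n k)"
    for l i x y
  proof -
    note flip = arc_flip_sign[OF V l arc]
    have q: "A x \<in> quiver_verts n k" "A y \<in> quiver_verts n k" "var_r n k (A x) = k" "var_r n k (A y) = k"
      using BF_quiver_verts BF_signs(2) A_in V by auto
    have "\<forall>\<alpha> \<in> quiver_verts n k. \<forall>\<beta> \<in> quiver_verts n k. \<forall>i \<in> {1..n}. \<beta> = flip_sign \<alpha> i \<longrightarrow>
        (let x = X \<alpha>; y = X \<beta> in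
           (var_r n k \<alpha> > k \<or> var_r n k \<beta> > k \<longrightarrow> \<Psi> (bt_p n \<eta> \<xi> \<alpha> \<beta>) = \<zero>\<^bsub>Br\<^esub>) \<and>
           (var_r n k \<alpha> = k \<and> var_r n k \<beta> = k \<and> y = insert i (x - {i - 1}) \<longrightarrow>
              \<Psi> (bt_p n \<eta> \<xi> \<alpha> \<beta>) = osz_arr n k (OR i) x y) \<and>
           (var_r n k \<alpha> = k \<and> var_r n k \<beta> = k \<and> y = insert (i - 1) (x - {i}) \<longrightarrow>
              \<Psi> (bt_p n \<eta> \<xi> \<alpha> \<beta>) = osz_arr n k (OL i) x y))"
      using assms unfolding is_Psi_def by (elim conjE)
    from this[rule_format, OF q(1,2) flip(1,2)] show ?thesis
      using flip(3) q(3,4) by (auto simp: X_A V)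
  qed
  have id: "\<Psi> (Phi b) = b" if b: "b \<in> carrier Br" for b
  proof -
    have "(\<Psi> \<circ> Phi) b = id b"
    proof (rule osz_Br_hom_eqI[OF ring_osz_Br ring_hom_trans[OF Phi_hom hom] id_ring_hom _ _ _ b])
      fix i x assume i: "i \<in> {1..n}" and x: "x \<in> osz_Vr n k"
      let ?s = "\<Oplus>\<^bsub>Br\<^esub> x \<in> osz_Vr n k. osz_arr n k (OU i) x x \<otimes>\<^bsub>Br\<^esub> osz_I n k x"
      interpret ring Br by (rule ring_osz_Br)
      have s: "?s \<in> carrier Br" "osz_I n k x \<in> carrier Br" using finsum_U_closed[OF i] osz_I_closed[OF x] by auto
      \<comment> \<open>\<Psi> is prescribed on u_i as a whole, so the loop at x is first written as
        the sum of all loops times the idempotent at x. This identity is read off through the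
        injective map \<open>Phi\<close>.\<close>
      have "Phi (osz_arr n k (OU i) x x) = Phi ?s \<otimes>\<^bsub>Bt\<^esub> Phi (osz_I n k x)"
        using x i by (simp only: Phi_U Phi_finsum_U Phi_I)
      also have "\<dots> = Phi (?s \<otimes>\<^bsub>Br\<^esub> osz_I n k x)" by (rule ring_hom_mult[OF Phi_hom s, symmetric])
      finally have "Psi (Phi (osz_arr n k (OU i) x x)) = Psi (Phi (?s \<otimes>\<^bsub>Br\<^esub> osz_I n k x))" by simp
      moreover have "osz_arr n k (OU i) x x \<in> carrier Br"
        unfolding osz_arr_def by (intro osz_class_Br U_PA_r x i)
      ultimately have arr: "osz_arr n k (OU i) x x = ?s \<otimes>\<^bsub>Br\<^esub> osz_I n k x"
        using m_closed[OF s] by (simp only: Psi_Phi)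
      have "bt_u n \<eta> \<xi> i \<in> carrier Bt" "bt_e n \<eta> \<xi> (A x) \<in> carrier Bt"
        using Phi_closed[OF s(1)] Phi_closed[OF s(2)] by (simp_all only: Phi_finsum_U[OF i] Phi_I[OF x])
      then have "\<Psi> (bt_u n \<eta> \<xi> i \<otimes>\<^bsub>Bt\<^esub> bt_e n \<eta> \<xi> (A x)) = ?s \<otimes>\<^bsub>Br\<^esub> osz_I n k x"
        using ring_hom_mult[OF hom] u[OF i] e[OF x] by simp
      then show "(\<Psi> \<circ> Phi) (osz_arr n k (OU i) x x) = id (osz_arr n k (OU i) x x)"
        unfolding o_apply id_apply Phi_U[OF x i] by (rule trans[OF _ arr[symmetric]])
    qed (simp_all only: o_apply id_apply Phi_I e Phi_crossing p)
    then show ?thesis by simp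
  qed
  fix F assume F: "F \<in> carrier Bt"
  show "\<Psi> F = Psi F" using id[OF Psi_closed[OF F]] by (simp add: Phi_Psi F)
qed

text \<open>Reversal exchanges the ends of a path and keeps its degrees, hence its monomial, while
  the ideals of (\<alpha>, \<beta>) and (\<beta>, \<alpha>) coincide.\<close>

lemma Phi_psi:
  assumes "b \<in> carrier Br"
  shows "osz_psi b \<in> carrier Br" "Phi (osz_psi b) = bt_psi n \<eta> \<xi> (Phi b)"
proof -
  obtain f where f: "f \<in> PA_r n k" "b = osz_class n k f" using assms by (rule Br_elem)
  have b: "osz_psi b = osz_class n k (f \<circ> osz_rev_path)" by (simp add: f(2) osz_psi_class)
  show "osz_psi b \<in> carrier Br" unfolding b by (intro osz_class_Br PA_r_rev f)
  have mon: "path_mon x y (osz_rev_path r) = path_mon y x r" for x y r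
    by (cases r) (auto simp: path_mon_def half_degree_def)
  have "Phi (osz_psi b) = Phi0 (f \<circ> osz_rev_path)" unfolding b by (rule Phi_class[OF PA_r_rev[OF f(1)]])
  also have "\<dots> = bt_of n \<eta> \<xi> (\<lambda>\<alpha> \<beta>. path_poly (X \<beta>) (X \<alpha>) f)" by (simp add: Phi0_def lin_rev mon)
  also have "\<dots> = bt_psi n \<eta> \<xi> (Phi0 f)" by (simp add: Phi0_def bt_psi_bt_of)
  finally show "Phi (osz_psi b) = bt_psi n \<eta> \<xi> (Phi b)" using f by (simp add: Phi_class)
qed

lemma graded_Phi: "graded_ring_iso Br (osz_homogeneous n k) Bt (bt_homogeneous n \<eta> \<xi>) Phi"
  using ring_osz_Br ring_Bt Phi_iso Phi_homogeneous by (simp add: graded_ring_iso_def)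

lemma graded_Psi: "graded_ring_iso Bt (bt_homogeneous n \<eta> \<xi>) Br (osz_homogeneous n k) Psi"
proof -
  have "Psi ` bt_homogeneous n \<eta> \<xi> d = osz_homogeneous n k d" for d
  proof -
    have "Psi ` bt_homogeneous n \<eta> \<xi> d = (\<lambda>b. Psi (Phi b)) ` osz_homogeneous n k d"
      by (simp add: Phi_homogeneous[symmetric] image_image)
    also have "\<dots> = (\<lambda>b. b) ` osz_homogeneous n k d"
      by (rule image_cong) (auto simp: osz_homogeneous_def Psi_Phi)
    finally show ?thesis by simp
  qed
  then show ?thesis using ring_osz_Br ring_Bt Psi_iso by (simp add: graded_ring_iso_def)
qed

end

theorem theorem4p13:
  fixes n k :: nat and V \<eta> \<xi> :: "real vec set"
  assumes "right_cyclic n k V \<eta> \<xi>"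
  shows "(\<exists>!\<Phi>. is_Phi n k \<eta> \<xi> \<Phi>) \<and>
    (\<exists>!\<Psi>. is_Psi n k \<eta> \<xi> \<Psi>) \<and>
    (\<forall>\<Phi> \<Psi>. is_Phi n k \<eta> \<xi> \<Phi> \<and> is_Psi n k \<eta> \<xi> \<Psi> \<longrightarrow>
       graded_ring_iso (osz_Br n k) (osz_homogeneous n k)
         (B_tilde n \<eta> \<xi>) (bt_homogeneous n \<eta> \<xi>) \<Phi> \<and>
       graded_ring_iso (B_tilde n \<eta> \<xi>) (bt_homogeneous n \<eta> \<xi>)
         (osz_Br n k) (osz_homogeneous n k) \<Psi> \<and>
       (\<forall>b \<in> carrier (osz_Br n k). \<Psi> (\<Phi> b) = b) \<and>
       (\<forall>F \<in> carrier (B_tilde n \<eta> \<xi>). \<Phi> (\<Psi> F) = F) \<and>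
       (\<forall>b \<in> carrier (osz_Br n k). \<Phi> (osz_psi b) = bt_psi n \<eta> \<xi> (\<Phi> b)) \<and>
       (\<forall>F \<in> carrier (B_tilde n \<eta> \<xi>). \<Psi> (bt_psi n \<eta> \<xi> F) = osz_psi (\<Psi> F)))"
proof -
  obtain c\<^sub>0 P where "cyclic_coords n k V \<eta> \<xi> c\<^sub>0 P" using right_cyclic_coords[OF assms] by blast
  then interpret cyclic_coords n k V \<eta> \<xi> c\<^sub>0 P .
  interpret cyclic_combinatorics n k \<eta> \<xi>
    by unfold_locales (simp_all only: bounded_feasible_eq face_empty_def chambers_empty_iff)
  have psi: "Psi (bt_psi n \<eta> \<xi> F) = osz_psi (Psi F)" if "F \<in> carrier (B_tilde n \<eta> \<xi>)" for F
    using Phi_psi[OF Psi_closed[OF that]] Psi_Phi by (metis Phi_Psi that)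
  have "\<exists>!\<Phi>. is_Phi n k \<eta> \<xi> \<Phi>" using is_Phi_Phi is_Phi_unique by blast
  moreover have "\<exists>!\<Psi>. is_Psi n k \<eta> \<xi> \<Psi>" using is_Psi_Psi is_Psi_unique by blast
  ultimately show ?thesis
    using graded_Phi graded_Psi Psi_Phi Phi_Psi Phi_psi(2) psi
    by (auto dest!: is_Phi_unique is_Psi_unique)
qed

end
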